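(* Let $p\ge 2$, $\mathbf{A}\in\mathbb{R}^{n\times m}$ with $m\ge n$, and $\mathbf{b}\in\mathbb{R}^n$. An $\varepsilon$-approximate solution to $\min_{\mathbf{x}\in\mathbb{R}^m:\ \mathbf{A}\mathbf{x}=\mathbf{b}}\|\mathbf{x}\|_p^p$ can be found in time $\tilde O_p\!\left((m+n)^{\omega+\frac{p-2}{3p-2}}\log^2\frac1\varepsilon\right)$, where $\omega$ is the matrix multiplication exponent.
   Context: A vector $\mathbf{x}$ is an $\varepsilon$-approximate solution if $\mathbf{A}\mathbf{x}=\mathbf{b}$ and $\|\mathbf{x}\|_p^p\le(1+\varepsilon)\min_{\mathbf{A}\mathbf{y}=\mathbf{b}}\|\mathbf{y}\|_p^p$. The notation $\tilde O_p(\cdot)$ hides constant factors depending only on $p$ (and on $\frac{p}{p-1}$) as well as factors polylogarithmic in $\frac{mn}{\varepsilon}$. *)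

theory Defs
  imports Complex_Main "Jordan_Normal_Form.Matrix"
begin

text \<open>
  Computation model: a uniform real RAM, given as a structured while language with exact real
  arithmetic at unit cost. The memory consists of named arrays of naturals and of reals (a scalar
  is cell 0 of its array). Naturals serve as loop counters and addresses. There is no conversion
  from reals to naturals (no floor), and the only literals are naturals, so no advice can
  be hidden in real constants.

  Expressions, tests and programs are parametrised by the type of real operations,
  so that \<open>ops c\<close>, the set of real operations occurring in a program \<open>c\<close>, comes with the datatype.
\<close>

datatype nexp =
    NConst nat
  | NGet string nexp
  | NAdd nexp nexp
  | NSub nexp nexp
  | NMul nexp nexp

datatype (rops: 'f) rexp =
    ROfNat nexp
  | RGet string nexp
  | ROp 'f "'f rexp" "'f rexp"

datatype (bops: 'f) bexp =
    NLess nexp nexp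
  | RLess "'f rexp" "'f rexp"
  | BNot "'f bexp"
  | BAnd "'f bexp" "'f bexp"

datatype (ops: 'f) com =
    Skip
  | NSet string nexp nexp
  | RSet string nexp "'f rexp"
  | Seq "'f com" "'f com"
  | If "'f bexp" "'f com" "'f com"
  | While "'f bexp" "'f com"

datatype rop = Plus | Minus | Times | Divide | Power

text \<open>Real powers \<open>\<bar>x\<bar>\<^sup>y\<close> are a primitive, since \<open>p\<close> may be an arbitrary real.\<close>

fun rop_val :: "rop \<Rightarrow> real \<Rightarrow> real \<Rightarrow> real" where
  "rop_val Plus x y = x + y"
| "rop_val Minus x y = x - y"
| "rop_val Times x y = x * y"
| "rop_val Divide x y = x / y"
| "rop_val Power x y = \<bar>x\<bar> powr y"

record state =
  nats :: "string \<Rightarrow> nat \<Rightarrow> nat"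
  reals :: "string \<Rightarrow> nat \<Rightarrow> real"

primrec nval :: "nexp \<Rightarrow> state \<Rightarrow> nat" where
  "nval (NConst k) s = k"
| "nval (NGet a i) s = nats s a (nval i s)"
| "nval (NAdd i j) s = nval i s + nval j s"
| "nval (NSub i j) s = nval i s - nval j s"
| "nval (NMul i j) s = nval i s * nval j s"

primrec rval :: "rop rexp \<Rightarrow> state \<Rightarrow> real" where
  "rval (ROfNat i) s = real (nval i s)"
| "rval (RGet a i) s = reals s a (nval i s)"
| "rval (ROp f x y) s = rop_val f (rval x s) (rval y s)"

primrec bval :: "rop bexp \<Rightarrow> state \<Rightarrow> bool" where
  "bval (NLess i j) s = (nval i s < nval j s)"
| "bval (RLess x y) s = (rval x s < rval y s)"
| "bval (BNot b) s = (\<not> bval b s)"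
| "bval (BAnd b1 b2) s = (bval b1 s \<and> bval b2 s)"

primrec ncost :: "nexp \<Rightarrow> nat" where
  "ncost (NConst k) = 1"
| "ncost (NGet a i) = 1 + ncost i"
| "ncost (NAdd i j) = 1 + ncost i + ncost j"
| "ncost (NSub i j) = 1 + ncost i + ncost j"
| "ncost (NMul i j) = 1 + ncost i + ncost j"

primrec rcost :: "'f rexp \<Rightarrow> nat" where
  "rcost (ROfNat i) = 1 + ncost i"
| "rcost (RGet a i) = 1 + ncost i"
| "rcost (ROp f x y) = 1 + rcost x + rcost y"

primrec bcost :: "'f bexp \<Rightarrow> nat" where
  "bcost (NLess i j) = 1 + ncost i + ncost j"
| "bcost (RLess x y) = 1 + rcost x + rcost y"
| "bcost (BNot b) = 1 + bcost b"
| "bcost (BAnd b1 b2) = 1 + bcost b1 + bcost b2"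

text \<open>\<open>run c s T t\<close>: started in \<open>s\<close>, program \<open>c\<close> terminates in \<open>t\<close> after time \<open>T\<close>.\<close>

inductive run :: "rop com \<Rightarrow> state \<Rightarrow> nat \<Rightarrow> state \<Rightarrow> bool" where
  Skip: "run Skip s 1 s"
| NSet: "run (NSet a i e) s (1 + ncost i + ncost e)
           (s\<lparr>nats := (nats s)(a := (nats s a)(nval i s := nval e s))\<rparr>)"
| RSet: "run (RSet a i e) s (1 + ncost i + rcost e)
           (s\<lparr>reals := (reals s)(a := (reals s a)(nval i s := rval e s))\<rparr>)"
| Seq: "run c1 s T1 s' \<Longrightarrow> run c2 s' T2 t \<Longrightarrow> run (Seq c1 c2) s (T1 + T2) t"
| IfTrue: "bval b s \<Longrightarrow> run c1 s T t \<Longrightarrow> run (If b c1 c2) s (bcost b + T) t"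
| IfFalse: "\<not> bval b s \<Longrightarrow> run c2 s T t \<Longrightarrow> run (If b c1 c2) s (bcost b + T) t"
| WhileFalse: "\<not> bval b s \<Longrightarrow> run (While b c) s (bcost b) s"
| WhileTrue: "bval b s \<Longrightarrow> run c s T1 s' \<Longrightarrow> run (While b c) s' T2 t \<Longrightarrow>
                run (While b c) s (bcost b + T1 + T2) t"

text \<open>
  Matrices are stored row by row, and inputs and outputs live in arrays with fixed names. All memory
  outside the inputs is arbitrary when a program starts, so programs must initialise what they use.
\<close>

definition holds_mat :: "state \<Rightarrow> string \<Rightarrow> real mat \<Rightarrow> bool" where
  "holds_mat s a A \<longleftrightarrow>
     (\<forall>i<dim_row A. \<forall>j<dim_col A. reals s a (i * dim_col A + j) = A $$ (i, j))"

definition holds_vec :: "state \<Rightarrow> string \<Rightarrow> real vec \<Rightarrow> bool" where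
  "holds_vec s a v \<longleftrightarrow> (\<forall>i<dim_vec v. reals s a i = v $ i)"

text \<open>
  \<open>\<tau>\<close> is admissible if \<open>N \<times> N\<close> real matrices can be multiplied in time \<open>O(N\<^sup>\<tau>)\<close> by a program whose
  real operations are the field operations only; \<open>\<omega>\<close> is the infimum, which need not be attained.
\<close>

definition matmul_exponent_admissible :: "real \<Rightarrow> bool" where
  "matmul_exponent_admissible \<tau> \<longleftrightarrow>
     (\<exists>c :: rop com. Power \<notin> ops c \<and>
       (\<exists>C :: real. \<forall>(N::nat) \<ge> 1. \<forall>A \<in> carrier_mat N N. \<forall>B \<in> carrier_mat N N. \<forall>s.
          nats s ''N'' 0 = N \<and> holds_mat s ''A'' A \<and> holds_mat s ''B'' B \<longrightarrow>
          (\<exists>T t. run c s T t \<and> holds_mat t ''C'' (A * B) \<and> real T \<le> C * real N powr \<tau>)))"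

definition matmul_omega :: real where
  "matmul_omega = Inf {\<tau>. matmul_exponent_admissible \<tau>}"

definition p_norm :: "real \<Rightarrow> real vec \<Rightarrow> real" where
  "p_norm p x = (\<Sum>i<dim_vec x. \<bar>x $ i\<bar> powr p) powr (1 / p)"

definition solutions :: "real mat \<Rightarrow> real vec \<Rightarrow> real vec set" where
  "solutions A b = {x \<in> carrier_vec (dim_col A). A *\<^sub>v x = b}"

text \<open>The minimum is written as an infimum; for nonempty \<open>solutions A b\<close> it is attained.\<close>

definition approx_solution ::
    "real \<Rightarrow> real \<Rightarrow> real mat \<Rightarrow> real vec \<Rightarrow> real vec \<Rightarrow> bool" where
  "approx_solution p \<epsilon> A b x \<longleftrightarrow> x \<in> solutions A b \<and>
     p_norm p x powr p \<le> (1 + \<epsilon>) * (INF y \<in> solutions A b. p_norm p y powr p)"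

text \<open>
  Logarithm in time bounds, truncated from below at 1: a factor \<open>log (1/\<epsilon>)\<close> is meant for \<open>\<epsilon>\<close> bounded
  away from 1. For \<open>x \<ge> 2\<close> it is the binary logarithm.
\<close>

definition lg :: "real \<Rightarrow> real" where
  "lg x = max 1 (log 2 x)"

end

theory Submission
  imports Defs "HOL-Library.Function_Algebras"
begin

text \<open>
  The program is width-reduced iteratively reweighted least squares. It keeps a solution \<open>x\<close> and an upper
  bound \<open>U\<close> for \<open>\<parallel>x\<parallel>\<^sub>p\<^sup>p - min\<close>. Starting from the solution of least Euclidean norm, \<open>U\<close> is a fraction of
  \<open>\<parallel>x\<parallel>\<^sub>p\<^sup>p\<close>, and it suffices to shrink it by a factor of order \<open>m powr ((p - 2) / 2) / \<epsilon>\<close>. Every outer step asks whether \<open>x\<close> can be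
  improved by \<open>\<nu> = U/2\<close> and either halves \<open>U\<close> or moves \<open>x\<close> so that \<open>U\<close> drops by a constant fraction.

  The inner loop answers that question with weighted least squares problems over the directions of slope \<open>-\<nu>\<close>.
  If their minimal energy is too large, no improvement by \<open>\<nu>\<close> exists. Otherwise the minimizer is either
  averaged into the step (\<open>T\<close> times, with \<open>T\<close> of order \<open>m powr ((p - 2) / (3 * p - 2))\<close>), or much of its energy sits on coordinates
  where it is large, and the weights of these coordinates are doubled. Doubling raises the minimal energy by
  a multiple of \<open>1/T\<close>, and the energy stays bounded, so this also happens only \<open>O(T)\<close> times.

  Each least squares problem costs \<open>O(m\<^sup>\<tau>)\<close>: a generalized inverse of the Gram matrix is computed by block
  recursion through Schur complements, which needs no rank assumption on \<open>A\<close>.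
\<close>

section \<open>Inequalities for powers\<close>

text \<open>The size of \<open>T\<close> comes from one balance. Weights never fall below m powr
  (-1/p), so coordinates whose heavy energy is below 1/T have squares summing to at most m powr
  ((p-2)/p) / T, hence p-th powers summing to at most the power p/2 of this. A flow step of length
  1/T is stable if that sum is at most T powr (p-1), that is, if m powr ((p-2)/2) \<le> T powr
  ((3p-2)/2). This is the condition T \<ge> m powr ((p-2)/(3p-2)). The machine model shapes the
  rest. One program serves all p, so p is read from memory and only constants depend on it. As
  \<omega> is an infimum, a multiplication program for some admissible exponent not above \<tau> is
  embedded as a black box. Reals cannot be rounded and naturals cannot be divided, so
  \<open>T\<close> and the powers of two are found by counting and doubling. The number of outer
  steps is of order ln m + |ln \<epsilon>|, which lg (m n / \<epsilon>) fails to dominate for large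
  \<epsilon>; there the exponent itself is changed.\<close>

type_synonym rvec = "nat \<Rightarrow> real"
type_synonym rmat = "nat \<Rightarrow> nat \<Rightarrow> real"

text \<open>Convexity of the power in tangent form. Scaling by \<open>x\<close> reduces it to
  Bernoulli's inequality, the difference \<open>g\<close> having its minimum at 1. The power mean
  inequality, the second-order bounds for |x + d| powr p and the growth of the weights all rest on
  it.\<close>

lemma powr_ge_tangent:
  fixes x z q :: real
  assumes "0 \<le> z" "0 < x" "1 \<le> q"
  shows "x powr q + q * x powr (q - 1) * (z - x) \<le> z powr q"
proof (cases "z = 0")
  case True
  have "x powr q = x * x powr (q - 1)"
    using assms(2) by (metis add_diff_cancel_left' diff_add_cancel powr_add powr_one less_imp_le)
  moreover have "1 * (x * x powr (q - 1)) \<le> q * (x * x powr (q - 1))"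
    using assms by (intro mult_right_mono) auto
  ultimately show ?thesis using True assms by (simp add: algebra_simps)
next
  case False
  then have z: "0 < z" using assms by simp
  define u where "u = z / x"
  have u: "0 < u" using z assms by (simp add: u_def)
  have bern: "1 + q * (u - 1) \<le> u powr q"
  proof -
    define g where "g = (\<lambda>t::real. t powr q - 1 - q * (t - 1))"
    have der: "(g has_real_derivative q * t powr (q - 1) - q) (at t)" if "0 < t" for t
      unfolding g_def using that by (auto intro!: derivative_eq_intros)
    have "g 1 \<le> g u"
    proof (cases "1 \<le> u")
      case True
      show ?thesis
      proof (rule DERIV_nonneg_imp_nondecreasing[OF True])
        fix t :: real assume t: "1 \<le> t" "t \<le> u"
        have "1 \<le> t powr (q - 1)" using t assms by (simp add: ge_one_powr_ge_zero)
        then show "\<exists>y. (g has_real_derivative y) (at t) \<and> 0 \<le> y"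
          using der[of t] t assms by (intro exI[of _ "q * t powr (q - 1) - q"]) auto
      qed
    next
      case False
      show ?thesis
      proof (rule DERIV_nonpos_imp_nonincreasing[of u 1])
        show "u \<le> 1" using False by simp
        fix t :: real assume t: "u \<le> t" "t \<le> 1"
        have "t powr (q - 1) \<le> 1" using t u assms by (simp add: powr_le1)
        then show "\<exists>y. (g has_real_derivative y) (at t) \<and> y \<le> 0"
          using der[of t] t u assms by (intro exI[of _ "q * t powr (q - 1) - q"]) auto
      qed
    qed
    then show ?thesis by (simp add: g_def)
  qed
  have zx: "z = x * u" using assms by (simp add: u_def)
  have "x powr q = x powr (q - 1) * x"
    using assms(2) by (metis diff_add_cancel powr_add powr_one less_imp_le)
  then have "x powr q + q * x powr (q - 1) * (z - x) = x powr q * (1 + q * (u - 1))"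
    by (simp add: zx algebra_simps)
  also have "\<dots> \<le> x powr q * u powr q" using bern by (simp add: mult_left_mono)
  also have "\<dots> = z powr q" using zx assms u by (simp add: powr_mult)
  finally show ?thesis .
qed

text \<open>One factor \<open>z i\<close> of each power is kept, and the remaining power q - 1 is
  enlarged to that of the total.\<close>

lemma sum_powr_le_powr_sum:
  fixes z :: "nat \<Rightarrow> real"
  assumes "finite I" "\<And>i. i \<in> I \<Longrightarrow> 0 \<le> z i" "1 \<le> q"
  shows "(\<Sum>i\<in>I. z i powr q) \<le> (\<Sum>i\<in>I. z i) powr q"
proof -
  let ?S = "\<Sum>i\<in>I. z i"
  have S: "0 \<le> ?S" by (intro sum_nonneg assms)
  have *: "y powr q = y * y powr (q - 1)" if "0 \<le> y" for y :: real
    using that by (cases "y = 0") (auto simp: powr_diff)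
  have "(\<Sum>i\<in>I. z i powr q) \<le> (\<Sum>i\<in>I. z i * ?S powr (q - 1))"
  proof (rule sum_mono)
    fix i assume i: "i \<in> I"
    have "z i \<le> ?S" using assms i by (intro member_le_sum) auto
    then have "z i powr (q - 1) \<le> ?S powr (q - 1)" using assms i by (intro powr_mono2) auto
    then show "z i powr q \<le> z i * ?S powr (q - 1)"
      unfolding *[OF assms(2)[OF i]] using assms(2)[OF i] by (rule mult_left_mono)
  qed
  also have "\<dots> = ?S powr q" using *[OF S] by (simp add: sum_distrib_right)
  finally show ?thesis .
qed

text \<open>Power mean inequality: the tangents at the mean \<open>?u\<close> are summed, and their
  linear terms cancel.\<close>

lemma powr_sum_le_sum_powr:
  fixes z :: "nat \<Rightarrow> real"
  assumes "\<And>i. i < m \<Longrightarrow> 0 \<le> z i" "1 \<le> q" "1 \<le> m"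
  shows "(\<Sum>i<m. z i) powr q \<le> real m powr (q - 1) * (\<Sum>i<m. z i powr q)"
proof (cases "(\<Sum>i<m. z i) = 0")
  case True
  then show ?thesis by (simp add: sum_nonneg)
next
  case False
  let ?S = "\<Sum>i<m. z i"
  let ?u = "?S / m"
  have S: "0 < ?S" using False assms(1) by (metis lessThan_iff less_le sum_nonneg)
  have u: "0 < ?u" using S assms by simp
  have "(\<Sum>i<m. ?u powr q + q * ?u powr (q - 1) * (z i - ?u)) \<le> (\<Sum>i<m. z i powr q)"
    by (intro sum_mono powr_ge_tangent) (use u assms in auto)
  moreover have "(\<Sum>i<m. ?u powr q + q * ?u powr (q - 1) * (z i - ?u)) = m * ?u powr q"
    using assms by (simp add: sum.distrib sum_distrib_left[symmetric] sum_subtractf)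
  ultimately have "m * ?u powr q \<le> (\<Sum>i<m. z i powr q)" by simp
  moreover have "?S powr q = real m powr (q - 1) * (m * ?u powr q)"
  proof -
    have "?S powr q = (m * ?u) powr q" using assms by simp
    also have "\<dots> = real m powr q * ?u powr q" using u by (intro powr_mult)
    also have "real m powr q = real m powr (q - 1) * m" using assms by (simp add: powr_diff)
    finally show ?thesis by simp
  qed
  ultimately show ?thesis by (simp add: mult_left_mono)
qed

section \<open>Second-order bounds for the p-th power of |x + d|\<close>

lemma powr_half_square: "(x\<^sup>2) powr (p / 2) = \<bar>x\<bar> powr p" for x p :: real
proof -
  have "(x\<^sup>2) = \<bar>x\<bar> powr 2" by simp
  then show ?thesis by (simp only: powr_powr) simp
qed

text \<open>The tangent inequality for the exponent p/2 \<ge> 1, taken at the square of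
  \<open>x\<close> and evaluated at the square of \<open>x + d\<close>. The difference of the
  squares, 2xd + d^2, yields the linear term and the quadratic gain at once.\<close>

lemma abs_powr_add_ge_quad:
  fixes x d p :: real
  assumes "2 \<le> p" "x \<noteq> 0"
  shows "\<bar>x\<bar> powr p + p * \<bar>x\<bar> powr (p - 2) * x * d + \<bar>x\<bar> powr (p - 2) * d\<^sup>2 \<le> \<bar>x + d\<bar> powr p"
proof -
  have "(x\<^sup>2) powr (p / 2) + (p / 2) * (x\<^sup>2) powr (p / 2 - 1) * ((x + d)\<^sup>2 - x\<^sup>2) \<le> ((x + d)\<^sup>2) powr (p / 2)"
    by (rule powr_ge_tangent) (use assms in auto)
  moreover have "(x\<^sup>2) powr (p / 2 - 1) = \<bar>x\<bar> powr (p - 2)"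
    using powr_half_square[of x "p - 2"] by (simp add: diff_divide_distrib)
  ultimately have "\<bar>x\<bar> powr p + (p / 2) * \<bar>x\<bar> powr (p - 2) * ((x + d)\<^sup>2 - x\<^sup>2) \<le> \<bar>x + d\<bar> powr p"
    by (simp add: powr_half_square)
  moreover have "(p / 2) * \<bar>x\<bar> powr (p - 2) * ((x + d)\<^sup>2 - x\<^sup>2)
     = p * \<bar>x\<bar> powr (p - 2) * x * d + (p / 2) * (\<bar>x\<bar> powr (p - 2) * d\<^sup>2)"
    by (simp add: power2_eq_square algebra_simps)
  moreover have "1 * (\<bar>x\<bar> powr (p - 2) * d\<^sup>2) \<le> (p / 2) * (\<bar>x\<bar> powr (p - 2) * d\<^sup>2)"
    using assms by (intro mult_right_mono) auto
  ultimately show ?thesis by linarith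
qed

text \<open>Clarkson's inequality from the parallelogram law. With exponent p/2 applied to squares,
  superadditivity of the power serves one side and the power mean inequality for two numbers the
  other.\<close>

lemma abs_powr_clarkson:
  fixes a b p :: real
  assumes "2 \<le> p"
  shows "2 * (\<bar>a\<bar> powr p + \<bar>b\<bar> powr p) \<le> \<bar>a + b\<bar> powr p + \<bar>a - b\<bar> powr p"
proof -
  let ?z = "\<lambda>i::nat. if i = 0 then (a + b)\<^sup>2 else (a - b)\<^sup>2"
  let ?y = "\<lambda>i::nat. if i = 0 then a\<^sup>2 else b\<^sup>2"
  have 2: "{..<2} = {0, 1::nat}" by auto
  have "\<bar>a\<bar> powr p + \<bar>b\<bar> powr p \<le> (a\<^sup>2 + b\<^sup>2) powr (p / 2)"
    using sum_powr_le_powr_sum[of "{..<2}" ?y "p / 2"] assms by (simp add: 2 powr_half_square)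
  moreover have "(2 * (a\<^sup>2 + b\<^sup>2)) powr (p / 2) \<le> 2 powr (p / 2 - 1) * (\<bar>a + b\<bar> powr p + \<bar>a - b\<bar> powr p)"
  proof -
    have "(\<Sum>i<2. ?z i) powr (p / 2) \<le> real 2 powr (p / 2 - 1) * (\<Sum>i<2. ?z i powr (p / 2))"
      by (rule powr_sum_le_sum_powr) (use assms in auto)
    moreover have "(\<Sum>i<2. ?z i) = 2 * (a\<^sup>2 + b\<^sup>2)" by (simp add: 2 power2_eq_square algebra_simps)
    ultimately show ?thesis by (simp add: 2 powr_half_square)
  qed
  moreover have "(2 * (a\<^sup>2 + b\<^sup>2)) powr (p / 2) = 2 powr (p / 2 - 1) * (2 * (a\<^sup>2 + b\<^sup>2) powr (p / 2))"
    by (subst powr_mult) (auto simp: powr_diff)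
  ultimately have "2 * (a\<^sup>2 + b\<^sup>2) powr (p / 2) \<le> \<bar>a + b\<bar> powr p + \<bar>a - b\<bar> powr p"
    by (simp add: mult_le_cancel_left_pos)
  moreover have "2 * (\<bar>a\<bar> powr p + \<bar>b\<bar> powr p) \<le> 2 * (a\<^sup>2 + b\<^sup>2) powr (p / 2)"
    using \<open>\<bar>a\<bar> powr p + \<bar>b\<bar> powr p \<le> (a\<^sup>2 + b\<^sup>2) powr (p / 2)\<close> by simp
  ultimately show ?thesis by (rule order.trans[rotated])
qed

text \<open>Two gains are averaged. The quadratic one is \<open>abs_powr_add_ge_quad\<close>; the
  term |d| powr p comes from Clarkson's inequality at \<open>x + d/2\<close> and \<open>d/2\<close>,
  the midpoint value being bounded below by its linearization.\<close>

lemma abs_powr_add_ge: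
  fixes x d p :: real
  assumes "2 < p"
  shows "\<bar>x\<bar> powr p + p * \<bar>x\<bar> powr (p - 2) * x * d
      + 2 powr (- p) * (\<bar>x\<bar> powr (p - 2) * d\<^sup>2 + \<bar>d\<bar> powr p) \<le> \<bar>x + d\<bar> powr p"
proof (cases "x = 0")
  case True
  have "2 powr (- p) \<le> 2 powr (0::real)" using assms by (intro powr_mono) auto
  then have "2 powr (- p) \<le> (1::real)" by simp
  then have "2 powr (- p) * \<bar>d\<bar> powr p \<le> 1 * \<bar>d\<bar> powr p" by (intro mult_right_mono) auto
  then show ?thesis using True by simp
next
  case False
  define lin where "lin = p * \<bar>x\<bar> powr (p - 2) * x * d"
  have q: "\<bar>x\<bar> powr p + lin + \<bar>x\<bar> powr (p - 2) * d\<^sup>2 \<le> \<bar>x + d\<bar> powr p"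
    unfolding lin_def by (rule abs_powr_add_ge_quad) (use assms False in auto)
  have h: "\<bar>x\<bar> powr p + lin / 2 \<le> \<bar>x + d / 2\<bar> powr p"
  proof -
    have "\<bar>x\<bar> powr p + p * \<bar>x\<bar> powr (p - 2) * x * (d/2) + \<bar>x\<bar> powr (p - 2) * (d/2)\<^sup>2 \<le> \<bar>x + d/2\<bar> powr p"
      by (rule abs_powr_add_ge_quad) (use assms False in auto)
    moreover have "0 \<le> \<bar>x\<bar> powr (p - 2) * (d/2)\<^sup>2" by simp
    moreover have "p * \<bar>x\<bar> powr (p - 2) * x * (d/2) = lin / 2" by (simp add: lin_def)
    ultimately show ?thesis by linarith
  qed
  have "2 * (\<bar>x + d/2\<bar> powr p + \<bar>d/2\<bar> powr p) \<le> \<bar>x + d/2 + d/2\<bar> powr p + \<bar>x + d/2 - d/2\<bar> powr p"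
    by (rule abs_powr_clarkson) (use assms in auto)
  then have "2 * \<bar>x + d/2\<bar> powr p + 2 * \<bar>d/2\<bar> powr p \<le> \<bar>x + d\<bar> powr p + \<bar>x\<bar> powr p" by (simp add: add.commute)
  moreover have "\<bar>d/2\<bar> powr p = 2 powr (- p) * \<bar>d\<bar> powr p"
    by (simp add: abs_divide powr_divide powr_minus divide_simps)
  ultimately have c: "\<bar>x\<bar> powr p + lin + 2 * (2 powr (- p) * \<bar>d\<bar> powr p) \<le> \<bar>x + d\<bar> powr p"
    using h by linarith
  have "(2::real) powr (- p) \<le> 2 powr (-1)" using assms by (intro powr_mono) auto
  then have "2 powr (- p) \<le> (1/2::real)" by (simp add: powr_minus)
  then have "2 powr (- p) * (\<bar>x\<bar> powr (p - 2) * d\<^sup>2) \<le> (1/2) * (\<bar>x\<bar> powr (p - 2) * d\<^sup>2)"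
    by (intro mult_right_mono) auto
  then have "\<bar>x\<bar> powr p + lin + 2 powr (- p) * (\<bar>x\<bar> powr (p - 2) * d\<^sup>2 + \<bar>d\<bar> powr p) \<le> \<bar>x + d\<bar> powr p"
    using q c by (simp add: distrib_left)
  then show ?thesis by (simp add: lin_def)
qed

text \<open>A crude common bound: it has to dominate 3 powr p + p * 2 powr (p - 1), which arises
  when \<open>d\<close> is large against \<open>x\<close>, and p * (p - 1) * 2 powr (p - 2), which
  arises when \<open>d\<close> is small.\<close>

definition upper_const :: "real \<Rightarrow> real" where
  "upper_const p = p\<^sup>2 * 4 powr p"

text \<open>If |d| is at least x/2, all terms are charged to |d| powr p. Otherwise
  \<open>x + d\<close> stays in (0, 2x], and tangent inequalities bound first the increment by the
  derivative at the new point and then the change of the derivative by a multiple of x powr (p - 2)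
  * |d|.\<close>

lemma abs_powr_add_le_pos:
  fixes x d p :: real
  assumes "2 < p" "0 < x"
  shows "\<bar>x + d\<bar> powr p \<le> x powr p + p * x powr (p - 2) * x * d
      + upper_const p * (x powr (p - 2) * d\<^sup>2 + \<bar>d\<bar> powr p)"
proof (cases "x \<le> 2 * \<bar>d\<bar>")
  case True
  have sp: "x powr (p - 2) * x = x powr (p - 1)"
    using assms powr_add[of x "p - 2" 1] by simp
  have "\<bar>x + d\<bar> powr p \<le> (3 * \<bar>d\<bar>) powr p" using True assms by (intro powr_mono2) auto
  also have "\<dots> = 3 powr p * \<bar>d\<bar> powr p" by (simp add: powr_mult)
  finally have 1: "\<bar>x + d\<bar> powr p \<le> 3 powr p * \<bar>d\<bar> powr p" .
  have "x powr (p - 1) \<le> (2 * \<bar>d\<bar>) powr (p - 1)" using True assms by (intro powr_mono2) auto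
  also have "\<dots> = 2 powr (p - 1) * \<bar>d\<bar> powr (p - 1)" by (simp add: powr_mult)
  finally have "x powr (p - 1) * \<bar>d\<bar> \<le> 2 powr (p - 1) * \<bar>d\<bar> powr (p - 1) * \<bar>d\<bar>"
    by (intro mult_right_mono) auto
  also have "2 powr (p - 1) * \<bar>d\<bar> powr (p - 1) * \<bar>d\<bar> = 2 powr (p - 1) * \<bar>d\<bar> powr p"
    using True assms by (simp add: powr_diff)
  finally have "p * (x powr (p - 1) * \<bar>d\<bar>) \<le> p * (2 powr (p - 1) * \<bar>d\<bar> powr p)"
    using assms by (intro mult_left_mono) (auto simp: mult.assoc)
  moreover have "- (p * x powr (p - 2) * x * d) \<le> p * (x powr (p - 1) * \<bar>d\<bar>)"
  proof -
    have "- (p * x powr (p - 2) * x * d) = p * x powr (p - 1) * (- d)"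
      unfolding sp[symmetric] by simp
    also have "\<dots> \<le> p * x powr (p - 1) * \<bar>d\<bar>"
      using assms by (intro mult_left_mono) auto
    finally show ?thesis by (simp only: mult.assoc)
  qed
  ultimately have 2: "- (p * x powr (p - 2) * x * d) \<le> p * 2 powr (p - 1) * \<bar>d\<bar> powr p"
    by (simp add: mult.assoc)
  have "3 powr p + p * 2 powr (p - 1) \<le> 4 powr p + p * 4 powr p"
    using assms by (intro add_mono mult_left_mono order.trans[OF powr_mono[of "p - 1" p 2] powr_mono2] powr_mono2) auto
  also have "\<dots> = (1 + p) * 4 powr p" by (simp add: algebra_simps)
  also have "\<dots> \<le> p\<^sup>2 * 4 powr p"
  proof (rule mult_right_mono)
    have "p * 2 \<le> p * p" using assms by (intro mult_left_mono) auto
    then show "1 + p \<le> p\<^sup>2" unfolding power2_eq_square using assms by linarith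
  qed simp
  finally have "(3 powr p + p * 2 powr (p - 1)) * \<bar>d\<bar> powr p \<le> upper_const p * \<bar>d\<bar> powr p"
    unfolding upper_const_def by (intro mult_right_mono) auto
  moreover have "0 \<le> upper_const p * (x powr (p - 2) * d\<^sup>2)" by (simp add: upper_const_def)
  moreover have "0 \<le> x powr p" by simp
  ultimately show ?thesis using 1 2 unfolding distrib_left distrib_right by linarith
next
  case False
  define z where "z = x + d"
  have z: "0 < z" "z \<le> 2 * x" "z - x = d" using False by (auto simp: z_def abs_if split: if_splits)
  have sp: "x powr (p - 2) * x = x powr (p - 1)"
    using assms powr_add[of x "p - 2" 1] by simp
  have "z powr p + p * z powr (p - 1) * (x - z) \<le> x powr p"
    by (rule powr_ge_tangent) (use assms z in auto)
  then have 1: "z powr p \<le> x powr p + p * z powr (p - 1) * d" using z by (simp add: algebra_simps)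
  have 2: "(z powr (p - 1) - x powr (p - 1)) * d \<le> (p - 1) * 2 powr (p - 2) * x powr (p - 2) * d\<^sup>2"
  proof (cases "0 \<le> d")
    case True
    have "z powr (p - 1) + (p - 1) * z powr (p - 1 - 1) * (x - z) \<le> x powr (p - 1)"
      by (rule powr_ge_tangent) (use assms z in auto)
    then have "z powr (p - 1) - x powr (p - 1) \<le> (p - 1) * z powr (p - 2) * d"
      using z by (simp add: algebra_simps)
    then have "(z powr (p - 1) - x powr (p - 1)) * d \<le> (p - 1) * z powr (p - 2) * d * d"
      using True by (rule mult_right_mono)
    also have "\<dots> = (p - 1) * d\<^sup>2 * z powr (p - 2)" by (simp add: power2_eq_square)
    also have "\<dots> \<le> (p - 1) * d\<^sup>2 * (2 * x) powr (p - 2)"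
      using assms z by (intro mult_left_mono powr_mono2) auto
    also have "\<dots> = (p - 1) * 2 powr (p - 2) * x powr (p - 2) * d\<^sup>2"
      using assms by (simp add: powr_mult)
    finally show ?thesis .
  next
    case False
    have "x powr (p - 1) + (p - 1) * x powr (p - 1 - 1) * (z - x) \<le> z powr (p - 1)"
      by (rule powr_ge_tangent) (use assms z in auto)
    then have "(p - 1) * x powr (p - 2) * d \<le> z powr (p - 1) - x powr (p - 1)"
      using z by (simp add: algebra_simps)
    then have "(z powr (p - 1) - x powr (p - 1)) * d \<le> (p - 1) * x powr (p - 2) * d * d"
      using False by (intro mult_right_mono_neg) auto
    also have "\<dots> = 1 * ((p - 1) * x powr (p - 2) * d\<^sup>2)" by (simp add: power2_eq_square)
    also have "\<dots> \<le> 2 powr (p - 2) * ((p - 1) * x powr (p - 2) * d\<^sup>2)"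
      using assms by (intro mult_right_mono) (auto simp: ge_one_powr_ge_zero)
    finally show ?thesis by (simp add: mult_ac)
  qed
  have "p * ((z powr (p - 1) - x powr (p - 1)) * d) \<le> p * ((p - 1) * 2 powr (p - 2) * x powr (p - 2) * d\<^sup>2)"
    using 2 assms by (intro mult_left_mono) auto
  moreover have "p * ((p - 1) * 2 powr (p - 2) * x powr (p - 2) * d\<^sup>2) \<le> upper_const p * (x powr (p - 2) * d\<^sup>2)"
  proof -
    have "p * ((p - 1) * 2 powr (p - 2)) \<le> p * (p * 4 powr p)"
      using assms by (intro mult_left_mono mult_mono order.trans[OF powr_mono[of "p - 2" p 2] powr_mono2]) auto
    then have "p * ((p - 1) * 2 powr (p - 2)) * (x powr (p - 2) * d\<^sup>2) \<le> upper_const p * (x powr (p - 2) * d\<^sup>2)"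
      unfolding upper_const_def power2_eq_square by (intro mult_right_mono) (auto simp: mult.assoc)
    then show ?thesis by (simp add: mult.assoc)
  qed
  moreover have "0 \<le> upper_const p * \<bar>d\<bar> powr p" by (simp add: upper_const_def)
  moreover have xd: "\<bar>x + d\<bar> = z" using z by (simp add: z_def)
  moreover have lin: "p * x powr (p - 2) * x * d = p * x powr (p - 1) * d" unfolding sp[symmetric] by simp
  ultimately show ?thesis using 1
    unfolding xd lin distrib_left left_diff_distrib right_diff_distrib mult.assoc by linarith
qed

lemma abs_powr_add_le:
  fixes x d p :: real
  assumes "2 < p"
  shows "\<bar>x + d\<bar> powr p \<le> \<bar>x\<bar> powr p + p * \<bar>x\<bar> powr (p - 2) * x * d
      + upper_const p * (\<bar>x\<bar> powr (p - 2) * d\<^sup>2 + \<bar>d\<bar> powr p)"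
proof -
  consider "x = 0" | "0 < x" | "x < 0" by linarith
  then show ?thesis
  proof cases
    case 1
    have "1 * 1 \<le> p\<^sup>2 * 4 powr p" using assms by (intro mult_mono) (auto simp: ge_one_powr_ge_zero)
    then have "1 * \<bar>d\<bar> powr p \<le> upper_const p * \<bar>d\<bar> powr p"
      unfolding upper_const_def by (intro mult_right_mono) auto
    with 1 show ?thesis by simp
  next
    case 2
    then show ?thesis using abs_powr_add_le_pos[OF assms 2, of d] by simp
  next
    case 3
    have "\<bar>- x + - d\<bar> = \<bar>x + d\<bar>" by linarith
    then show ?thesis using abs_powr_add_le_pos[OF assms, of "- x" "- d"] 3 by simp
  qed
qed

section \<open>Width reduction\<close>

definition psum :: "real \<Rightarrow> nat \<Rightarrow> rvec \<Rightarrow> real" where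
  "psum p m x = (\<Sum>i<m. \<bar>x i\<bar> powr p)"

definition grad :: "real \<Rightarrow> rvec \<Rightarrow> nat \<Rightarrow> real" where
  "grad p x i = p * \<bar>x i\<bar> powr (p - 2) * x i"

text \<open>Chosen such that scale p \<nu> powr p = \<nu> * 2 powr p, the bound that
  \<open>gap_witness\<close> obtains for the sum of p-th powers of the witness direction.\<close>

definition scale :: "real \<Rightarrow> real \<Rightarrow> real" where
  "scale p \<nu> = 2 * \<nu> powr (1 / p)"

text \<open>
  Normalized so that, if some solution is better than \<open>x\<close> by \<open>\<nu>\<close>, then a direction of slope \<open>-\<nu>\<close> has
  energy at most \<open>3 * psum p m w\<close>.
\<close>

definition weight :: "real \<Rightarrow> real \<Rightarrow> rvec \<Rightarrow> rvec \<Rightarrow> nat \<Rightarrow> real" where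
  "weight p \<nu> x w i = \<bar>x i\<bar> powr (p - 2) / (\<nu> * 2 powr p) + w i powr (p - 2) / (scale p \<nu>)\<^sup>2"

text \<open>The threshold for being heavy. Its square times (1 - 2 powr (2 - p)) / 12 is 2 powr p:
  doubling a heavy weight makes its p-th power 2 powr p times larger, and this is paid with a
  twelfth of the energy gained there.\<close>

definition rho :: "real \<Rightarrow> real" where
  "rho p = (12 * 2 powr p / (1 - 2 powr (2 - p))) powr (1 / 2)"

text \<open>Only the \<open>w\<close>-part of \<open>weight\<close> enters, in the units u =
  |\<Delta>| / scale p \<nu>. Doubling \<open>w\<close> acts on this part alone.\<close>

definition heavy_energy :: "real \<Rightarrow> nat \<Rightarrow> rvec \<Rightarrow> rvec \<Rightarrow> real" where
  "heavy_energy p m w u = (\<Sum>i<m. of_bool (rho p * w i < u i) * (w i powr (p - 2) * (u i)\<^sup>2))"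

text \<open>The relative growth rate of \<open>psum p m w\<close> under a flow step. The factor p *
  2 powr (p - 1) comes from a tangent and from splitting a power of a sum; the terms comparable with
  powers of \<open>w\<close> contribute 2 * (1 + rho p powr (p - 1)), the heavy remainder
  contributes 1.\<close>

definition growth :: "real \<Rightarrow> real" where
  "growth p = p * 2 powr (p - 1) * (2 * (1 + rho p powr (p - 1)) + 1)"

definition start :: "real \<Rightarrow> nat \<Rightarrow> real" where
  "start p m = real m powr (- 1 / p)"

definition width_exp :: "real \<Rightarrow> real" where
  "width_exp p = (p - 2) / (3 * p - 2)"

lemma scale_pos: "0 < \<nu> \<Longrightarrow> 0 < scale p \<nu>"
  by (simp add: scale_def)

lemma scale_powr: "0 < \<nu> \<Longrightarrow> 2 < p \<Longrightarrow> scale p \<nu> powr p = \<nu> * 2 powr p"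
  by (simp add: scale_def powr_mult powr_powr)

lemma rho_sq:
  assumes "2 < p" shows "(rho p)\<^sup>2 = 12 * 2 powr p / (1 - 2 powr (2 - p))" "0 < rho p"
proof -
  have "2 powr (2 - p) < 2 powr (0::real)" using assms by (intro powr_less_mono) auto
  then have *: "0 < 12 * 2 powr p / (1 - 2 powr (2 - p))" by simp
  show "(rho p)\<^sup>2 = 12 * 2 powr p / (1 - 2 powr (2 - p))" using less_imp_le[OF *]
    unfolding rho_def by (simp only: powr_half_sqrt real_sqrt_pow2)
  show "0 < rho p" using * unfolding rho_def by (simp only: powr_gt_zero)
qed

text \<open>A square is completed in each coordinate, around r * \<Delta> / r' instead of \<Delta>.
  The third hypothesis is the optimality condition of \<Delta> for the weights r, so r * \<Delta>
  acts as a dual certificate for any other weights r'; with r' = r the lemma gives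
  minimality.\<close>

lemma energy_increase:
  fixes r r' \<Delta> d :: "nat \<Rightarrow> real"
  assumes "\<And>i. i < m \<Longrightarrow> 0 < r i" "\<And>i. i < m \<Longrightarrow> 0 < r' i"
    and "(\<Sum>i<m. r i * \<Delta> i * d i) = (\<Sum>i<m. r i * (\<Delta> i)\<^sup>2)"
  shows "(\<Sum>i<m. r i * (\<Delta> i)\<^sup>2) + (\<Sum>i<m. r i * (\<Delta> i)\<^sup>2 * (1 - r i / r' i)) \<le> (\<Sum>i<m. r' i * (d i)\<^sup>2)"
proof -
  have "(\<Sum>i<m. 2 * (r i * \<Delta> i * d i) - r i * (\<Delta> i)\<^sup>2 * (r i / r' i)) \<le> (\<Sum>i<m. r' i * (d i)\<^sup>2)"
  proof (rule sum_mono)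
    fix i assume "i \<in> {..<m}"
    then have r: "0 < r i" "0 < r' i" using assms by auto
    have "0 \<le> r' i * (d i - r i * \<Delta> i / r' i)\<^sup>2" using r by simp
    also have "\<dots> = r' i * (d i)\<^sup>2 - 2 * (r i * \<Delta> i * d i) + r i * (\<Delta> i)\<^sup>2 * (r i / r' i)"
      using r by (simp add: power2_eq_square field_simps)
    finally show "2 * (r i * \<Delta> i * d i) - r i * (\<Delta> i)\<^sup>2 * (r i / r' i) \<le> r' i * (d i)\<^sup>2" by simp
  qed
  moreover have "(\<Sum>i<m. 2 * (r i * \<Delta> i * d i) - r i * (\<Delta> i)\<^sup>2 * (r i / r' i))
    = (\<Sum>i<m. r i * (\<Delta> i)\<^sup>2) + (\<Sum>i<m. r i * (\<Delta> i)\<^sup>2 * (1 - r i / r' i))"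
    using assms(3) by (simp add: sum_subtractf sum_distrib_left[symmetric] right_diff_distrib)
  ultimately show ?thesis by simp
qed

text \<open>A substitute for Hoelder's inequality: each term is at most the p-th power of the larger
  of \<open>w i\<close> and |v i|.\<close>

lemma weighted_le_psum_add:
  assumes "2 < p" "\<And>i. i < m \<Longrightarrow> 0 < w i"
  shows "(\<Sum>i<m. w i powr (p - 2) * (v i)\<^sup>2) \<le> psum p m w + psum p m v"
proof -
  have *: "w i powr (p - 2) * (v i)\<^sup>2 \<le> \<bar>w i\<bar> powr p + \<bar>v i\<bar> powr p" if "i < m" for i
  proof -
    have w: "0 < w i" using assms that by auto
    have sq: "a powr (p - 2) * a\<^sup>2 = a powr p" if "0 \<le> a" for a :: real
    proof (cases "a = 0")
      case False
      then have "a\<^sup>2 = a powr 2" using that by simp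
      then show ?thesis using False by (simp add: powr_add[symmetric] del: powr_numeral)
    qed simp
    show ?thesis
    proof (cases "\<bar>v i\<bar> \<le> w i")
      case True
      then have "(v i)\<^sup>2 \<le> (w i)\<^sup>2" by (simp add: abs_le_square_iff[symmetric])
      then have "w i powr (p - 2) * (v i)\<^sup>2 \<le> w i powr (p - 2) * (w i)\<^sup>2" by (intro mult_left_mono) auto
      also have "\<dots> = \<bar>w i\<bar> powr p" using sq[of "w i"] w by simp
      finally show ?thesis by (simp add: add_increasing2)
    next
      case False
      then have "w i powr (p - 2) * (v i)\<^sup>2 \<le> \<bar>v i\<bar> powr (p - 2) * (v i)\<^sup>2"
        using w assms by (intro mult_right_mono powr_mono2) auto
      also have "\<dots> = \<bar>v i\<bar> powr p" using sq[of "\<bar>v i\<bar>"] by simp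
      finally show ?thesis by (simp add: add_increasing)
    qed
  qed
  show ?thesis unfolding psum_def sum.distrib[symmetric]
    by (rule sum_mono) (use * in auto)
qed

text \<open>\<open>F\<close> stays abstract here and later becomes \<open>dirs\<close>, the kernel
  directions of slope -\<nu>. The lower bound on \<open>T\<close> enters the balance in
  \<open>flow_growth\<close> and yields 1 \<le> T.\<close>

locale width_reduction =
  fixes p \<nu> :: real and m :: nat and x :: "nat \<Rightarrow> real" and F :: "rvec set" and T :: nat
  assumes p: "2 < p" and \<nu>: "0 < \<nu>" and m: "1 \<le> m" and T: "real m powr width_exp p \<le> real T"
begin

abbreviation "wt \<equiv> weight p \<nu> x"

definition en :: "rvec \<Rightarrow> rvec \<Rightarrow> real" where
  "en w d = (\<Sum>i<m. wt w i * (d i)\<^sup>2)"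

text \<open>The optimality condition on the affine set \<open>F\<close> rather than minimality: this
  is what the linear solver delivers and what \<open>energy_increase\<close> consumes.
  \<open>minimizer_le\<close> recovers minimality.\<close>

definition minimizer :: "rvec \<Rightarrow> rvec \<Rightarrow> bool" where
  "minimizer w \<Delta> \<longleftrightarrow> \<Delta> \<in> F \<and> (\<forall>d\<in>F. (\<Sum>i<m. wt w i * \<Delta> i * d i) = en w \<Delta>)"

text \<open>
  After \<open>k\<close> flow steps, \<open>e\<close> is a certified lower bound for the energy of all directions. The last conjunct
  is the potential argument: growth of the weights in a width step is paid for by growth of \<open>e\<close>.
\<close>

definition invar :: "rvec \<Rightarrow> nat \<Rightarrow> real \<Rightarrow> bool" where
  "invar w k e \<longleftrightarrow> (\<forall>i<m. start p m \<le> w i) \<and> 0 \<le> e \<and> (\<forall>d\<in>F. e \<le> en w d) \<and>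
     e \<le> 6 * psum p m w \<and> psum p m w - e / 12 \<le> exp (2 * growth p * k / T)"

lemma T_pos: "1 \<le> real T"
proof -
  have "1 \<le> real m powr width_exp p" using m p
    by (intro ge_one_powr_ge_zero) (auto simp: width_exp_def)
  then show ?thesis using T by linarith
qed

lemma growth_pos: "0 < growth p"
  using p by (simp add: growth_def add_pos_nonneg)

lemma wt_pos: "0 < w i \<Longrightarrow> 0 < wt w i"
  using \<nu> scale_pos[OF \<nu>, of p] unfolding weight_def by (intro add_nonneg_pos) auto

lemma psum_init: "psum p m (\<lambda>_. start p m) = 1"
proof -
  have "start p m powr p = real m powr (- 1 / p * p)" unfolding start_def by (rule powr_powr)
  also have "- 1 / p * p = - 1" using p by simp
  finally have "start p m powr p = 1 / real m" using m by (simp add: powr_minus_divide)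
  then show ?thesis using m by (simp add: psum_def start_def)
qed

lemma start_pos: "0 < start p m"
  using m by (simp add: start_def)

lemma inv_pos: "invar w k e \<Longrightarrow> i < m \<Longrightarrow> 0 < w i"
  using start_pos unfolding invar_def by (blast intro: order.strict_trans2)

lemma psum_ge_1:
  assumes "\<And>i. i < m \<Longrightarrow> start p m \<le> w i" shows "1 \<le> psum p m w"
proof -
  have "psum p m (\<lambda>_. start p m) \<le> psum p m w"
    unfolding psum_def using assms p by (intro sum_mono powr_mono2) (auto simp: start_pos less_imp_le order_trans[OF _ abs_ge_self])
  then show ?thesis by (simp add: psum_init)
qed

lemma inv_psum_ge_1: "invar w k e \<Longrightarrow> 1 \<le> psum p m w"
  by (rule psum_ge_1) (auto simp: invar_def)

lemma inv_init: "invar (\<lambda>_. start p m) 0 0"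
proof -
  have "0 \<le> en (\<lambda>_. start p m) d" for d
    unfolding en_def using m by (intro sum_nonneg mult_nonneg_nonneg less_imp_le[OF wt_pos]) (auto simp: start_pos)
  then show ?thesis unfolding invar_def by (simp add: psum_init)
qed

text \<open>Since e \<le> 6 * psum p m w, subtracting e / 12 removes at most half of the sum, hence
  the factor 2. The bound depends neither on \<open>m\<close> nor on the number of width
  steps.\<close>

lemma inv_psum_le:
  assumes "invar w k e" "k \<le> T"
  shows "psum p m w \<le> 2 * exp (2 * growth p)"
proof -
  have "2 * growth p * k / T \<le> 2 * growth p * T / T"
    using growth_pos T_pos assms by (intro divide_right_mono mult_left_mono) auto
  also have "\<dots> = 2 * growth p" using T_pos by simp
  finally have "exp (2 * growth p * k / T) \<le> exp (2 * growth p)" by simp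
  then show ?thesis using assms(1) unfolding invar_def by linarith
qed

lemma minimizer_le:
  assumes "invar w k e" "minimizer w \<Delta>" "d \<in> F" shows "en w \<Delta> \<le> en w d"
proof -
  have "en w \<Delta> + (\<Sum>i<m. wt w i * (\<Delta> i)\<^sup>2 * (1 - wt w i / wt w i)) \<le> en w d"
    unfolding en_def
    by (rule energy_increase) (use assms inv_pos in \<open>auto simp: minimizer_def en_def intro!: wt_pos\<close>)
  moreover have "(\<Sum>i<m. wt w i * (\<Delta> i)\<^sup>2 * (1 - wt w i / wt w i)) = 0"
    using inv_pos[OF assms(1)] wt_pos by (intro sum.neutral) (auto simp: less_imp_neq[symmetric])
  ultimately show ?thesis by simp
qed

lemma en_split:
  "en w \<Delta> = (\<Sum>i<m. \<bar>x i\<bar> powr (p - 2) / (\<nu> * 2 powr p) * (\<Delta> i)\<^sup>2)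
     + (\<Sum>i<m. w i powr (p - 2) * (\<bar>\<Delta> i\<bar> / scale p \<nu>)\<^sup>2)"
  unfolding en_def weight_def sum.distrib[symmetric]
  by (intro sum.cong) (auto simp: field_simps)

lemma en_parts:
  "(\<Sum>i<m. \<bar>x i\<bar> powr (p - 2) / (\<nu> * 2 powr p) * (\<Delta> i)\<^sup>2) \<le> en w \<Delta>"
  "(\<Sum>i<m. w i powr (p - 2) * (\<bar>\<Delta> i\<bar> / scale p \<nu>)\<^sup>2) \<le> en w \<Delta>"
  unfolding en_split using \<nu> by (auto intro!: sum_nonneg)

lemma heavy_energy_le: "heavy_energy p m w u \<le> (\<Sum>i<m. w i powr (p - 2) * (u i)\<^sup>2)"
  unfolding heavy_energy_def by (intro sum_mono) (auto simp: of_bool_def)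

lemma heavy_energy_nonneg: "0 \<le> heavy_energy p m w u"
  unfolding heavy_energy_def by (intro sum_nonneg) auto

text \<open>Doubling the heavy weights has two effects that offset each other in the last conjunct
  of \<open>invar\<close>: by \<open>energy_increase\<close> the certified energy rises by (1 - 2
  powr (2 - p)) times the heavy energy, and by the choice of \<open>rho\<close> the sum of p-th
  powers rises by at most a twelfth of that.\<close>

lemma width_step:
  assumes invar: "invar w k e" and \<Delta>: "minimizer w \<Delta>" and E: "en w \<Delta> \<le> 3 * psum p m w"
    and u: "u = (\<lambda>i. \<bar>\<Delta> i\<bar> / scale p \<nu>)"
    and w': "\<And>i. i < m \<Longrightarrow> w' i = w i * (1 + of_bool (rho p * w i < u i))"
  shows "invar w' k (en w \<Delta> + (1 - 2 powr (2 - p)) * heavy_energy p m w u)"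
proof -
  define \<theta> where "\<theta> = 1 - 2 powr (2 - p)"
  define EH where "EH = heavy_energy p m w u"
  have "2 powr (2 - p) < 2 powr (0::real)" using p by (intro powr_less_mono) auto
  then have \<theta>: "0 < \<theta>" "\<theta> \<le> 1" by (auto simp: \<theta>_def)
  have wpos: "0 < w i" if "i < m" for i using inv_pos[OF invar that] .
  have w'ge: "w i \<le> w' i" if "i < m" for i using w'[OF that] wpos[OF that] by auto
  have w'pos: "0 < w' i" if "i < m" for i using w'ge[OF that] wpos[OF that] by linarith
  have EH0: "0 \<le> EH" unfolding EH_def by (rule heavy_energy_nonneg)
  have EHE: "EH \<le> en w \<Delta>"
    unfolding EH_def using heavy_energy_le[of w u] en_parts(2)[of w \<Delta>] by (simp add: u)
  have inc: "psum p m w \<le> psum p m w'"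
    unfolding psum_def using w'ge wpos p by (intro sum_mono powr_mono2) (auto simp: less_imp_le order_trans[OF _ abs_ge_self])
  have en': "en w \<Delta> + \<theta> * EH \<le> en w' d" if d: "d \<in> F" for d
  proof -
    have "en w \<Delta> + (\<Sum>i<m. wt w i * (\<Delta> i)\<^sup>2 * (1 - wt w i / wt w' i)) \<le> en w' d"
      unfolding en_def
      by (rule energy_increase) (use d \<Delta> wpos w'pos in \<open>auto simp: minimizer_def en_def intro!: wt_pos\<close>)
    moreover have "\<theta> * EH \<le> (\<Sum>i<m. wt w i * (\<Delta> i)\<^sup>2 * (1 - wt w i / wt w' i))"
      unfolding EH_def heavy_energy_def sum_distrib_left
    proof (rule sum_mono)
      fix i assume "i \<in> {..<m}"
      then have i: "i < m" by simp
      show "\<theta> * (of_bool (rho p * w i < u i) * (w i powr (p - 2) * (u i)\<^sup>2)) \<le> wt w i * (\<Delta> i)\<^sup>2 * (1 - wt w i / wt w' i)"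
      proof (cases "rho p * w i < u i")
        case False
        then have "w' i = w i" using w'[OF i] by simp
        then have "wt w' i = wt w i" by (simp add: weight_def)
        then show ?thesis using False wt_pos[of w i, OF wpos[OF i]] by simp
      next
        case True
        then have w2: "w' i = 2 * w i" using w'[OF i] by simp
        define a where "a = \<bar>x i\<bar> powr (p - 2) / (\<nu> * 2 powr p)"
        define s where "s = w i powr (p - 2) / (scale p \<nu>)\<^sup>2"
        define \<kappa> where "\<kappa> = 2 powr (p - 2)"
        have a: "0 \<le> a" using \<nu> by (simp add: a_def)
        have s: "0 < s" using wpos[OF i] scale_pos[OF \<nu>, of p] by (simp add: s_def)
        have \<kappa>: "1 \<le> \<kappa>" using p by (simp add: \<kappa>_def ge_one_powr_ge_zero)
        have th: "\<theta> = 1 - 1 / \<kappa>" by (simp add: \<theta>_def \<kappa>_def powr_diff)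
        have r: "wt w i = a + s" by (simp add: weight_def a_def s_def)
        have r': "wt w' i = a + \<kappa> * s" using wpos[OF i]
          by (simp add: weight_def a_def s_def w2 \<kappa>_def powr_mult)
        \<comment> \<open>With old weight r = a + s and new weight r' = a + \<kappa> * s this is
          \<theta> * s \<le> r * (1 - r / r') after clearing the denominator. Equality holds for a =
          0, and the unchanged part \<open>a\<close> only helps.\<close>
        have "\<theta> * s * (a + \<kappa> * s) \<le> (a + s) * ((\<kappa> - 1) * s)"
        proof -
          have "\<theta> * s * (a + \<kappa> * s) = (a / \<kappa> + s) * ((\<kappa> - 1) * s)" using \<kappa> by (simp add: th field_simps)
          also have "\<dots> \<le> (a + s) * ((\<kappa> - 1) * s)"
          proof (intro mult_right_mono add_right_mono)
            have "a * 1 \<le> a * \<kappa>" using a \<kappa> by (intro mult_left_mono) auto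
            then show "a / \<kappa> \<le> a" using \<kappa> by (simp add: divide_le_eq)
          qed (use \<kappa> s in auto)
          finally show ?thesis .
        qed
        then have "\<theta> * s \<le> (a + s) * ((\<kappa> - 1) * s) / (a + \<kappa> * s)"
          using a s \<kappa> by (subst pos_le_divide_eq) (auto intro!: add_nonneg_pos)
        also have "\<dots> = (a + s) * (1 - (a + s) / (a + \<kappa> * s))"
        proof -
          have "0 < \<kappa> * s" using s \<kappa> by simp
          then have "a + \<kappa> * s \<noteq> 0" using a by linarith
          then show ?thesis by (simp add: field_simps)
        qed
        finally have "\<theta> * s * (\<Delta> i)\<^sup>2 \<le> (a + s) * (1 - (a + s) / (a + \<kappa> * s)) * (\<Delta> i)\<^sup>2"
          by (rule mult_right_mono) simp
        moreover have "w i powr (p - 2) * (u i)\<^sup>2 = s * (\<Delta> i)\<^sup>2" by (simp add: u s_def power_divide)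
        ultimately show ?thesis using True by (simp add: r r' mult_ac)
      qed
    qed
    ultimately show ?thesis by linarith
  qed
  have grow: "psum p m w' \<le> psum p m w + \<theta> * EH / 12"
  proof -
    have "psum p m w' \<le> (\<Sum>i<m. \<bar>w i\<bar> powr p + \<theta> / 12 * (of_bool (rho p * w i < u i) * (w i powr (p - 2) * (u i)\<^sup>2)))"
      unfolding psum_def
    proof (rule sum_mono)
      fix i assume "i \<in> {..<m}"
      then have i: "i < m" by simp
      show "\<bar>w' i\<bar> powr p \<le> \<bar>w i\<bar> powr p + \<theta> / 12 * (of_bool (rho p * w i < u i) * (w i powr (p - 2) * (u i)\<^sup>2))"
      proof (cases "rho p * w i < u i")
        case False
        then show ?thesis using w'[OF i] by simp
      next
        case True
        then have w2: "w' i = 2 * w i" using w'[OF i] by simp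
        have "(rho p * w i)\<^sup>2 \<le> (u i)\<^sup>2" using True rho_sq(2)[OF p] wpos[OF i] by (intro power_mono) auto
        then have "\<theta> / 12 * (w i powr (p - 2) * (rho p * w i)\<^sup>2) \<le> \<theta> / 12 * (w i powr (p - 2) * (u i)\<^sup>2)"
          using \<theta> by (intro mult_left_mono) auto
        moreover have "\<theta> / 12 * (w i powr (p - 2) * (rho p * w i)\<^sup>2) = 2 powr p * w i powr p"
        proof -
          have "w i powr (p - 2) * (w i)\<^sup>2 = w i powr p"
            using wpos[OF i] by (simp add: powr_diff)
          moreover have "\<theta> / 12 * (rho p)\<^sup>2 = 2 powr p"
            using \<theta> unfolding rho_sq(1)[OF p] \<theta>_def[symmetric] by simp
          moreover have "\<theta> / 12 * (w i powr (p - 2) * (rho p * w i)\<^sup>2) = (\<theta> / 12 * (rho p)\<^sup>2) * (w i powr (p - 2) * (w i)\<^sup>2)"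
            by (simp add: power_mult_distrib)
          ultimately show ?thesis by simp
        qed
        moreover have "\<bar>w' i\<bar> powr p = 2 powr p * w i powr p"
          using wpos[OF i] by (simp add: w2 powr_mult)
        ultimately have "\<bar>w' i\<bar> powr p \<le> \<theta> / 12 * (w i powr (p - 2) * (u i)\<^sup>2)" by linarith
        then show ?thesis using True by (simp add: add_increasing)
      qed
    qed
    also have "\<dots> = psum p m w + \<theta> / 12 * EH"
      by (simp add: psum_def EH_def heavy_energy_def sum.distrib sum_distrib_left del: sum_of_bool_mult_eq)
    finally show ?thesis by simp
  qed
  have "\<theta> * EH \<le> 1 * EH" using \<theta> EH0 by (intro mult_right_mono) auto
  \<comment> \<open>Origin of the 6 in \<open>invar\<close>: the energy and its increase are each at
    most 3 times the old sum. The 12 is twice this, so that half of the sum survives the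
    subtraction.\<close>
  then have le6: "en w \<Delta> + \<theta> * EH \<le> 6 * psum p m w'" using EHE E inc by linarith
  have ge0: "0 \<le> en w \<Delta> + \<theta> * EH" using EHE EH0 \<theta> by (smt (verit) mult_nonneg_nonneg)
  have "e \<le> en w \<Delta>" using invar \<Delta> by (auto simp: invar_def minimizer_def)
  then have "psum p m w' - (en w \<Delta> + \<theta> * EH) / 12 \<le> psum p m w - e / 12"
    using grow by (simp add: add_divide_distrib)
  also have "\<dots> \<le> exp (2 * growth p * k / T)" using invar by (simp add: invar_def)
  finally show ?thesis using invar w'ge en' le6 ge0 unfolding invar_def \<theta>_def EH_def
    by (auto intro: order_trans)
qed

text \<open>To first order the p-th powers grow by terms u * w powr (p - 1), which the energy
  controls. The higher-order terms are comparable with these on light coordinates; on heavy ones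
  only their total is bounded, through the threshold 1 / T and the size of \<open>T\<close>.\<close>

lemma flow_growth:
  assumes invar: "invar w k e" and E: "en w \<Delta> \<le> 3 * psum p m w"
    and u: "u = (\<lambda>i. \<bar>\<Delta> i\<bar> / scale p \<nu>)"
    and EH: "heavy_energy p m w u < 1 / T"
    and w': "\<And>i. i < m \<Longrightarrow> w' i = w i + u i / T"
  shows "psum p m w' \<le> (1 + growth p / T) * psum p m w"
proof -
  define \<alpha> where "\<alpha> = 1 / real T"
  define H where "H i \<longleftrightarrow> rho p * w i < u i" for i
  define uH where "uH i = of_bool (H i) * u i" for i
  have \<alpha>: "0 < \<alpha>" "\<alpha> \<le> 1" using T_pos by (auto simp: \<alpha>_def)
  have wpos: "0 < w i" if "i < m" for i using inv_pos[OF invar that] .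
  have u0: "0 \<le> u i" for i using scale_pos[OF \<nu>, of p] by (simp add: u)
  have uH0: "0 \<le> uH i" for i using u0 by (simp add: uH_def)
  have \<rho>: "0 < rho p" using rho_sq[OF p] by simp
  \<comment> \<open>As \<open>w i\<close> is at least \<open>start p m\<close>, heavy energy bounds
    the plain sum of squares of \<open>uH\<close> up to the factor \<open>B\<close>. Passing to p-th
    powers leaves m powr ((p - 2) / 2) * \<alpha> powr ((3 * p - 2) / 2), which is at most 1 by the
    choice of \<open>width_exp\<close>.\<close>
  have heavy: "(\<Sum>i<m. uH i powr p) * \<alpha> powr (p - 1) \<le> 1"
  proof -
    define B where "B = real m powr ((p - 2) / p)"
    have sq: "(\<Sum>i<m. (uH i)\<^sup>2) \<le> B * \<alpha>"
    proof -
      have "(\<Sum>i<m. (uH i)\<^sup>2) \<le> (\<Sum>i<m. B * (of_bool (H i) * (w i powr (p - 2) * (u i)\<^sup>2)))"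
      proof (rule sum_mono)
        fix i assume "i \<in> {..<m}"
        then have i: "i < m" by simp
        have "start p m powr (p - 2) \<le> w i powr (p - 2)"
          using invar i p start_pos by (intro powr_mono2) (auto simp: invar_def)
        then have "B * (start p m powr (p - 2)) \<le> B * w i powr (p - 2)"
          by (intro mult_left_mono) (auto simp: B_def)
        moreover have "B * (start p m powr (p - 2)) = 1"
          using m p unfolding B_def start_def powr_powr powr_add[symmetric] by (simp add: diff_divide_distrib)
        ultimately have "1 * (u i)\<^sup>2 \<le> (B * w i powr (p - 2)) * (u i)\<^sup>2" by (intro mult_right_mono) auto
        then show "(uH i)\<^sup>2 \<le> B * (of_bool (H i) * (w i powr (p - 2) * (u i)\<^sup>2))"
          by (simp add: uH_def mult.assoc)
      qed
      also have "\<dots> = B * heavy_energy p m w u"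
        by (simp add: heavy_energy_def sum_distrib_left H_def del: sum_of_bool_mult_eq)
      also have "\<dots> \<le> B * \<alpha>" using EH by (intro mult_left_mono) (auto simp: B_def \<alpha>_def)
      finally show ?thesis .
    qed
    have "(\<Sum>i<m. uH i powr p) = (\<Sum>i<m. ((uH i)\<^sup>2) powr (p / 2))"
      using uH0 by (simp add: powr_half_square)
    also have "\<dots> \<le> (\<Sum>i<m. (uH i)\<^sup>2) powr (p / 2)"
      by (rule sum_powr_le_powr_sum) (use p in auto)
    also have "\<dots> \<le> (B * \<alpha>) powr (p / 2)"
      using sq p by (intro powr_mono2) (auto intro!: sum_nonneg)
    finally have "(\<Sum>i<m. uH i powr p) * \<alpha> powr (p - 1) \<le> (B * \<alpha>) powr (p / 2) * \<alpha> powr (p - 1)"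
      by (rule mult_right_mono) simp
    also have "\<dots> = real m powr ((p - 2) / 2) * \<alpha> powr ((3 * p - 2) / 2)"
    proof -
      have "(B * \<alpha>) powr (p / 2) = real m powr ((p - 2) / 2) * \<alpha> powr (p / 2)"
        using \<alpha> p by (simp add: B_def powr_mult powr_powr)
      moreover have "\<alpha> powr (p / 2) * \<alpha> powr (p - 1) = \<alpha> powr ((3 * p - 2) / 2)"
        by (simp add: powr_add[symmetric] field_simps)
      ultimately show ?thesis by (simp add: mult.assoc)
    qed
    also have "\<dots> \<le> 1"
    proof -
      have "\<alpha> \<le> real m powr (- width_exp p)"
        using T m unfolding \<alpha>_def powr_minus by (simp add: divide_inverse le_imp_inverse_le)
      then have "\<alpha> powr ((3 * p - 2) / 2) \<le> (real m powr (- width_exp p)) powr ((3 * p - 2) / 2)"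
        using \<alpha> p by (intro powr_mono2) auto
      also have "\<dots> = real m powr (- ((p - 2) / 2))"
      proof -
        have "- width_exp p * ((3 * p - 2) / 2) = - ((p - 2) / 2)"
          using p by (simp add: width_exp_def divide_simps)
        then show ?thesis by (simp only: powr_powr)
      qed
      finally have "real m powr ((p - 2) / 2) * \<alpha> powr ((3 * p - 2) / 2)
        \<le> real m powr ((p - 2) / 2) * real m powr (- ((p - 2) / 2))" by (intro mult_left_mono) auto
      also have "\<dots> = 1" using m by (simp add: powr_add[symmetric])
      finally show ?thesis .
    qed
    finally show ?thesis .
  qed
  define c where "c = p * 2 powr (p - 1)"
  have c: "0 < c" using p by (simp add: c_def)
  have "psum p m w' \<le> (\<Sum>i<m. \<bar>w i\<bar> powr p + c * \<alpha> * ((1 + rho p powr (p - 1)) * ((\<bar>w i\<bar> powr p + w i powr (p - 2) * (u i)\<^sup>2) / 2)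
       + uH i powr p * \<alpha> powr (p - 1)))"
    unfolding psum_def
  proof (rule sum_mono)
    fix i assume "i \<in> {..<m}"
    then have i: "i < m" by simp
    let ?z = "w i + \<alpha> * u i"
    have w: "0 < w i" by (rule wpos[OF i])
    have z: "0 < ?z" using w \<alpha> u0[of i] by (intro add_pos_nonneg) auto
    have w'z: "w' i = ?z" using w'[OF i] by (simp add: \<alpha>_def)
    have "?z powr p + p * ?z powr (p - 1) * (w i - ?z) \<le> w i powr p"
      by (rule powr_ge_tangent) (use w z p in auto)
    then have 1: "?z powr p \<le> w i powr p + p * \<alpha> * (u i * ?z powr (p - 1))" by (simp add: algebra_simps)
    have "?z \<le> 2 * max (w i) (\<alpha> * u i)" by simp
    then have "?z powr (p - 1) \<le> (2 * max (w i) (\<alpha> * u i)) powr (p - 1)"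
      using z p by (intro powr_mono2) auto
    also have "\<dots> = 2 powr (p - 1) * max (w i) (\<alpha> * u i) powr (p - 1)"
      using w by (intro powr_mult)
    also have "\<dots> \<le> 2 powr (p - 1) * (w i powr (p - 1) + (\<alpha> * u i) powr (p - 1))"
      by (intro mult_left_mono) (auto simp: max_def)
    finally have "p * \<alpha> * (u i * ?z powr (p - 1)) \<le> p * \<alpha> * (u i * (2 powr (p - 1) * (w i powr (p - 1) + (\<alpha> * u i) powr (p - 1))))"
      using p \<alpha> u0[of i] by (intro mult_left_mono) auto
    also have "\<dots> = c * \<alpha> * (u i * w i powr (p - 1) + u i * (\<alpha> * u i) powr (p - 1))"
      by (simp add: c_def algebra_simps)
    finally have 2: "p * \<alpha> * (u i * ?z powr (p - 1)) \<le> c * \<alpha> * (u i * w i powr (p - 1) + u i * (\<alpha> * u i) powr (p - 1))" .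
    \<comment> \<open>On a light coordinate \<alpha> * u i \<le> rho p * w i, so the term reduces to
      the first-order one; on a heavy coordinate it is kept as it is and left to
      \<open>heavy\<close>.\<close>
    have 3: "u i * (\<alpha> * u i) powr (p - 1) \<le> rho p powr (p - 1) * (u i * w i powr (p - 1)) + uH i powr p * \<alpha> powr (p - 1)"
    proof (cases "H i")
      case True
      then have ui: "uH i = u i" "0 < u i" using \<rho> w by (auto simp: uH_def H_def intro: order.strict_trans[of 0 "rho p * w i"])
      then have "u i * (\<alpha> * u i) powr (p - 1) = uH i powr p * \<alpha> powr (p - 1)"
        using \<alpha> by (simp add: powr_mult powr_diff)
      moreover have "0 \<le> rho p powr (p - 1) * (u i * w i powr (p - 1))" using u0[of i] by simp
      ultimately show ?thesis by linarith
    next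
      case False
      then have "u i \<le> rho p * w i" by (simp add: H_def)
      moreover have "\<alpha> * u i \<le> 1 * u i" using \<alpha> u0[of i] by (intro mult_right_mono) auto
      ultimately have "\<alpha> * u i \<le> rho p * w i" by linarith
      then have "(\<alpha> * u i) powr (p - 1) \<le> (rho p * w i) powr (p - 1)"
        using \<alpha> u0[of i] p by (intro powr_mono2) auto
      also have "\<dots> = rho p powr (p - 1) * w i powr (p - 1)" using \<rho> w by (simp add: powr_mult)
      finally have "u i * (\<alpha> * u i) powr (p - 1) \<le> u i * (rho p powr (p - 1) * w i powr (p - 1))"
        using u0[of i] by (intro mult_left_mono) auto
      moreover have "uH i powr p = 0" using False by (simp add: uH_def)
      ultimately show ?thesis by (simp add: mult_ac)
    qed
    \<comment> \<open>The arithmetic-geometric mean inequality, weighted by w powr (p - 2). Summed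
      up, the right side is at most (1 + 3) / 2 times psum p m w, the source of the inner factor 2
      in \<open>growth\<close>.\<close>
    have 4: "u i * w i powr (p - 1) \<le> (w i powr p + w i powr (p - 2) * (u i)\<^sup>2) / 2"
    proof -
      have "0 \<le> w i powr (p - 2) * (w i - u i)\<^sup>2" by simp
      also have "\<dots> = w i powr (p - 2) * (w i)\<^sup>2 + w i powr (p - 2) * (u i)\<^sup>2 - 2 * (u i * (w i powr (p - 2) * w i))"
        by (simp add: power2_eq_square algebra_simps)
      also have "w i powr (p - 2) * w i = w i powr (p - 1)" using w powr_add[of "w i" "p - 2" 1] by simp
      also have "w i powr (p - 2) * (w i)\<^sup>2 = w i powr p" using w by (simp add: powr_diff)
      finally show ?thesis by simp
    qed
    have "u i * w i powr (p - 1) + u i * (\<alpha> * u i) powr (p - 1)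
      \<le> (1 + rho p powr (p - 1)) * (u i * w i powr (p - 1)) + uH i powr p * \<alpha> powr (p - 1)"
      using 3 by (simp add: distrib_right)
    also have "\<dots> \<le> (1 + rho p powr (p - 1)) * ((w i powr p + w i powr (p - 2) * (u i)\<^sup>2) / 2) + uH i powr p * \<alpha> powr (p - 1)"
      using 4 by (intro add_right_mono mult_left_mono) auto
    finally have "c * \<alpha> * (u i * w i powr (p - 1) + u i * (\<alpha> * u i) powr (p - 1)) \<le> c * \<alpha> * \<dots>"
      using c \<alpha> by (intro mult_left_mono) auto
    then show "\<bar>w' i\<bar> powr p \<le> \<bar>w i\<bar> powr p + c * \<alpha> * ((1 + rho p powr (p - 1)) * ((\<bar>w i\<bar> powr p + w i powr (p - 2) * (u i)\<^sup>2) / 2)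
       + uH i powr p * \<alpha> powr (p - 1))"
      using 1 2 w z by (simp add: w'z)
  qed
  also have "\<dots> = psum p m w + c * \<alpha> * ((1 + rho p powr (p - 1)) * ((psum p m w + (\<Sum>i<m. w i powr (p - 2) * (u i)\<^sup>2)) / 2)
       + (\<Sum>i<m. uH i powr p) * \<alpha> powr (p - 1))"
    by (simp add: psum_def sum.distrib sum_distrib_left[symmetric] sum_divide_distrib[symmetric] sum_distrib_right)
  also have "\<dots> \<le> psum p m w + c * \<alpha> * ((1 + rho p powr (p - 1)) * ((psum p m w + 3 * psum p m w) / 2) + psum p m w)"
  proof (intro add_left_mono mult_left_mono add_mono divide_right_mono)
    show "(\<Sum>i<m. w i powr (p - 2) * (u i)\<^sup>2) \<le> 3 * psum p m w"
      using en_parts(2)[of w \<Delta>] E by (simp add: u)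
    show "(\<Sum>i<m. uH i powr p) * \<alpha> powr (p - 1) \<le> psum p m w"
      using heavy inv_psum_ge_1[OF invar] by linarith
  qed (use c \<alpha> in auto)
  also have "\<dots> = (1 + growth p / T) * psum p m w"
    by (simp add: growth_def c_def \<alpha>_def algebra_simps add_divide_distrib)
  finally show ?thesis .
qed

text \<open>Larger weights only raise energies, so the energy of \<Delta> becomes the new
  certificate. Because psum p m w is at most twice psum p m w - e / 12, the growth factor 1 + growth
  p / T of the sum costs the difference at most 1 + 2 * growth p / T, and \<open>T\<close> such
  factors stay below exp (2 * growth p).\<close>

lemma flow_step:
  assumes invar: "invar w k e" and \<Delta>: "minimizer w \<Delta>" and E: "en w \<Delta> \<le> 3 * psum p m w"
    and u: "u = (\<lambda>i. \<bar>\<Delta> i\<bar> / scale p \<nu>)"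
    and EH: "heavy_energy p m w u < 1 / T"
    and w': "\<And>i. i < m \<Longrightarrow> w' i = w i + u i / T"
  shows "invar w' (Suc k) (en w \<Delta>)" and "psum p m w \<le> psum p m w'"
proof -
  have wpos: "0 < w i" if "i < m" for i using inv_pos[OF invar that] .
  have u0: "0 \<le> u i" for i using scale_pos[OF \<nu>, of p] by (simp add: u)
  have w'ge: "w i \<le> w' i" if "i < m" for i using w'[OF that] u0[of i] by auto
  have w'pos: "0 < w' i" if "i < m" for i using w'ge[OF that] wpos[OF that] by linarith
  show inc: "psum p m w \<le> psum p m w'"
    unfolding psum_def using w'ge wpos p by (intro sum_mono powr_mono2) (auto simp: less_imp_le order_trans[OF _ abs_ge_self])
  have E0: "0 \<le> en w \<Delta>" unfolding en_def
    using wpos wt_pos by (intro sum_nonneg) (auto simp: less_imp_le)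
  have en': "en w \<Delta> \<le> en w' d" if d: "d \<in> F" for d
  proof -
    have "en w \<Delta> \<le> en w d" by (rule minimizer_le[OF invar \<Delta> d])
    also have "\<dots> \<le> en w' d" unfolding en_def weight_def
      using w'ge wpos p by (intro sum_mono mult_right_mono add_left_mono divide_right_mono powr_mono2) (auto simp: less_imp_le)
    finally show ?thesis .
  qed
  have e: "e \<le> en w \<Delta>" using invar \<Delta> by (auto simp: invar_def minimizer_def)
  define c where "c = growth p / T"
  have c: "0 < c" using growth_pos T_pos by (simp add: c_def)
  let ?Z = "psum p m w - e / 12"
  have Z: "psum p m w \<le> 2 * ?Z" using invar by (simp add: invar_def)
  have "psum p m w' - en w \<Delta> / 12 \<le> (1 + c) * psum p m w - e / 12"
    using flow_growth[OF invar E u EH w'] e by (simp add: c_def)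
  also have "\<dots> = ?Z + c * psum p m w" by (simp add: algebra_simps)
  also have "\<dots> \<le> ?Z + c * (2 * ?Z)" using Z c by (intro add_left_mono mult_left_mono) auto
  also have "\<dots> = (1 + 2 * c) * ?Z" by (simp add: algebra_simps)
  also have "\<dots> \<le> exp (2 * c) * exp (2 * growth p * k / T)"
    using invar c Z inv_psum_ge_1[OF invar] by (intro mult_mono) (auto simp: invar_def)
  also have "\<dots> = exp (2 * growth p * Suc k / T)"
    by (simp add: exp_add[symmetric] c_def algebra_simps add_divide_distrib)
  finally show "invar w' (Suc k) (en w \<Delta>)"
    using invar w'ge en' E inc E0 unfolding invar_def by (auto intro: order_trans)
qed

text \<open>The accumulated step \<open>a\<close> is the sum of the accepted directions divided by
  \<open>T\<close>. Its coordinates stay below scale p \<nu> * w because \<open>w\<close> receives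
  the same increments in absolute value and in units of the scale. Its quadratic part obeys a
  triangle inequality, hence the factor (k / T)^2.\<close>

definition routed :: "rvec \<Rightarrow> nat \<Rightarrow> rvec \<Rightarrow> bool" where
  "routed w k a \<longleftrightarrow> (\<forall>i<m. \<bar>a i\<bar> \<le> scale p \<nu> * w i) \<and>
     (\<Sum>i<m. \<bar>x i\<bar> powr (p - 2) / (\<nu> * 2 powr p) * (a i)\<^sup>2) \<le> (k / T)\<^sup>2 * (3 * psum p m w)"

lemma routed_init: "routed (\<lambda>_. start p m) 0 (\<lambda>_. 0)"
  using scale_pos[OF \<nu>, of p] start_pos by (simp add: routed_def less_imp_le)

lemma routed_width:
  assumes "routed w k a" "\<And>i. i < m \<Longrightarrow> 0 < w i" "\<And>i. i < m \<Longrightarrow> w i \<le> w' i"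
  shows "routed w' k a"
proof -
  have "psum p m w \<le> psum p m w'"
    unfolding psum_def using assms p by (intro sum_mono powr_mono2) (auto simp: less_imp_le order_trans[OF _ abs_ge_self])
  then have "(k / T)\<^sup>2 * (3 * psum p m w) \<le> (k / T)\<^sup>2 * (3 * psum p m w')" by (intro mult_left_mono) auto
  moreover have "scale p \<nu> * w i \<le> scale p \<nu> * w' i" if "i < m" for i
    using assms(3)[OF that] scale_pos[OF \<nu>, of p] by (intro mult_left_mono) auto
  ultimately show ?thesis using assms(1) unfolding routed_def by (auto intro: order_trans)
qed

text \<open>Cauchy-Schwarz for two terms with weights \<open>K\<close> and \<alpha>. It replaces the
  triangle inequality for the seminorm given by the quadratic part, without square roots.\<close>

lemma sq_add_le:
  fixes a b K \<alpha> :: real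
  assumes "0 < K" "0 < \<alpha>"
  shows "(a + \<alpha> * b)\<^sup>2 \<le> (K + \<alpha>) * (a\<^sup>2 / K + \<alpha> * b\<^sup>2)"
proof -
  have "0 \<le> \<alpha> / K * (a - K * b)\<^sup>2" using assms by simp
  also have "\<dots> = (K + \<alpha>) * (a\<^sup>2 / K + \<alpha> * b\<^sup>2) - (a + \<alpha> * b)\<^sup>2"
    using assms by (simp add: power2_eq_square field_simps)
  finally show ?thesis by simp
qed

lemma routed_flow:
  assumes invar: "invar w k e" and r: "routed w k a" and E: "en w \<Delta> \<le> 3 * psum p m w"
    and u: "u = (\<lambda>i. \<bar>\<Delta> i\<bar> / scale p \<nu>)"
    and w': "\<And>i. i < m \<Longrightarrow> w' i = w i + u i / T" and inc: "psum p m w \<le> psum p m w'"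
    and a': "\<And>i. i < m \<Longrightarrow> a' i = a i + \<Delta> i / T"
  shows "routed w' (Suc k) a'"
proof -
  define q where "q i = \<bar>x i\<bar> powr (p - 2) / (\<nu> * 2 powr p)" for i
  define \<alpha> where "\<alpha> = 1 / real T"
  define K where "K = k * \<alpha>"
  define M where "M = 3 * psum p m w"
  have \<alpha>: "0 < \<alpha>" using T_pos by (simp add: \<alpha>_def)
  have q: "0 \<le> q i" for i using \<nu> by (simp add: q_def)
  have a'': "a' i = a i + \<alpha> * \<Delta> i" if "i < m" for i using a'[OF that] by (simp add: \<alpha>_def)
  have Q\<Delta>: "(\<Sum>i<m. q i * (\<Delta> i)\<^sup>2) \<le> M" using en_parts(1)[of \<Delta> w] E by (simp add: q_def M_def)
  have Qa: "(\<Sum>i<m. q i * (a i)\<^sup>2) \<le> K\<^sup>2 * M" using r by (simp add: routed_def q_def M_def K_def \<alpha>_def)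
  have "(\<Sum>i<m. q i * (a' i)\<^sup>2) \<le> (K + \<alpha>)\<^sup>2 * M"
  \<comment> \<open>\<open>sq_add_le\<close> divides by K = k / T. For k = 0 the quadratic part of
    \<open>a\<close> vanishes, so in each coordinate either its coefficient or \<open>a i\<close> is
    zero.\<close>
  proof (cases "k = 0")
    case True
    have qa: "q i = 0 \<or> a i = 0" if "i < m" for i
    proof -
      have "(\<Sum>i<m. q i * (a i)\<^sup>2) = 0" using Qa True q by (simp add: K_def order_antisym sum_nonneg)
      then show ?thesis using q that by (subst (asm) sum_nonneg_eq_0_iff) auto
    qed
    have "q i * (a' i)\<^sup>2 = \<alpha>\<^sup>2 * (q i * (\<Delta> i)\<^sup>2)" if i: "i < m" for i
      using qa[OF i] by (elim disjE) (simp_all add: a''[OF i] power_mult_distrib)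
    then have "(\<Sum>i<m. q i * (a' i)\<^sup>2) = \<alpha>\<^sup>2 * (\<Sum>i<m. q i * (\<Delta> i)\<^sup>2)"
      unfolding sum_distrib_left by (intro sum.cong) (auto simp del: mult_cancel_left)
    also have "\<dots> \<le> \<alpha>\<^sup>2 * M" using Q\<Delta> by (intro mult_left_mono) auto
    finally show ?thesis using True by (simp add: K_def)
  next
    case False
    then have K: "0 < K" using \<alpha> by (simp add: K_def)
    have "(\<Sum>i<m. q i * (a' i)\<^sup>2) \<le> (\<Sum>i<m. q i * ((K + \<alpha>) * ((a i)\<^sup>2 / K + \<alpha> * (\<Delta> i)\<^sup>2)))"
      using q a'' sq_add_le[OF K \<alpha>] by (intro sum_mono mult_left_mono) auto
    also have "\<dots> = (K + \<alpha>) * ((\<Sum>i<m. q i * (a i)\<^sup>2) / K + \<alpha> * (\<Sum>i<m. q i * (\<Delta> i)\<^sup>2))"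
    proof -
      have "q i * ((K + \<alpha>) * ((a i)\<^sup>2 / K + \<alpha> * (\<Delta> i)\<^sup>2))
        = (K + \<alpha>) * (q i * (a i)\<^sup>2 / K) + (K + \<alpha>) * \<alpha> * (q i * (\<Delta> i)\<^sup>2)" for i
        by (simp add: algebra_simps)
      then have "(\<Sum>i<m. q i * ((K + \<alpha>) * ((a i)\<^sup>2 / K + \<alpha> * (\<Delta> i)\<^sup>2)))
        = (K + \<alpha>) * (\<Sum>i<m. q i * (a i)\<^sup>2 / K) + (K + \<alpha>) * \<alpha> * (\<Sum>i<m. q i * (\<Delta> i)\<^sup>2)"
        by (simp only: sum.distrib sum_distrib_left)
      then show ?thesis by (simp only: sum_divide_distrib[symmetric] distrib_left mult.assoc)
    qed
    also have "\<dots> \<le> (K + \<alpha>) * (K\<^sup>2 * M / K + \<alpha> * M)"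
      using K \<alpha> Qa Q\<Delta> by (intro mult_left_mono add_mono divide_right_mono) auto
    also have "\<dots> = (K + \<alpha>)\<^sup>2 * M" using K by (simp add: power2_eq_square algebra_simps)
    finally show ?thesis .
  qed
  also have "\<dots> = (Suc k / T)\<^sup>2 * M" by (simp add: K_def \<alpha>_def add_divide_distrib)
  also have "\<dots> \<le> (Suc k / T)\<^sup>2 * (3 * psum p m w')"
    using inc by (intro mult_left_mono) (auto simp: M_def)
  finally have 1: "(\<Sum>i<m. q i * (a' i)\<^sup>2) \<le> (Suc k / T)\<^sup>2 * (3 * psum p m w')" .
  have 2: "\<bar>a' i\<bar> \<le> scale p \<nu> * w' i" if i: "i < m" for i
  proof -
    have "\<bar>a' i\<bar> \<le> \<bar>a i\<bar> + \<bar>\<Delta> i / T\<bar>" unfolding a'[OF i] by (rule abs_triangle_ineq)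
    also have "\<bar>\<Delta> i / T\<bar> = \<bar>\<Delta> i\<bar> / T" by simp
    also have "\<bar>a i\<bar> + \<bar>\<Delta> i\<bar> / T \<le> scale p \<nu> * w i + \<bar>\<Delta> i\<bar> / T" using r i by (auto simp: routed_def)
    also have "\<dots> = scale p \<nu> * w' i"
      using scale_pos[OF \<nu>, of p] by (simp add: w'[OF i] u field_simps)
    finally show ?thesis .
  qed
  show ?thesis unfolding routed_def using 1 2 by (simp add: q_def)
qed

end

section \<open>Descent steps\<close>

lemma psum_nonneg: "0 \<le> psum p m x"
  by (simp add: psum_def sum_nonneg)

lemma psum_lower:
  assumes "2 < p"
  shows "psum p m x + (\<Sum>i<m. grad p x i * d i)
      + 2 powr (- p) * ((\<Sum>i<m. \<bar>x i\<bar> powr (p - 2) * (d i)\<^sup>2) + psum p m d) \<le> psum p m (\<lambda>i. x i + d i)"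
proof -
  have "(\<Sum>i<m. \<bar>x i\<bar> powr p + p * \<bar>x i\<bar> powr (p - 2) * x i * d i
      + 2 powr (- p) * (\<bar>x i\<bar> powr (p - 2) * (d i)\<^sup>2 + \<bar>d i\<bar> powr p)) \<le> psum p m (\<lambda>i. x i + d i)"
    unfolding psum_def by (intro sum_mono abs_powr_add_ge assms)
  then show ?thesis by (simp add: psum_def grad_def sum.distrib sum_distrib_left[symmetric])
qed

lemma psum_upper:
  assumes "2 < p"
  shows "psum p m (\<lambda>i. x i + d i) \<le> psum p m x + (\<Sum>i<m. grad p x i * d i)
      + upper_const p * ((\<Sum>i<m. \<bar>x i\<bar> powr (p - 2) * (d i)\<^sup>2) + psum p m d)"
proof -
  have "psum p m (\<lambda>i. x i + d i) \<le> (\<Sum>i<m. \<bar>x i\<bar> powr p + p * \<bar>x i\<bar> powr (p - 2) * x i * d i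
      + upper_const p * (\<bar>x i\<bar> powr (p - 2) * (d i)\<^sup>2 + \<bar>d i\<bar> powr p))"
    unfolding psum_def by (intro sum_mono abs_powr_add_le assms)
  then show ?thesis by (simp add: psum_def grad_def sum.distrib sum_distrib_left[symmetric])
qed

lemma psum_scaled: "psum p m (\<lambda>i. t * d i) = \<bar>t\<bar> powr p * psum p m d"
  by (simp add: psum_def abs_mult powr_mult sum_distrib_left)

text \<open>The direction y - x is scaled by t = \<nu> / h to slope -\<nu>. By
  \<open>psum_lower\<close>, \<open>h\<close> is at least \<nu> plus a multiple of both second-order
  parts \<open>Q\<close> and \<open>P\<close>; hence t \<le> 1, and t * Q and t * P are at most
  \<nu> * 2 powr p. The energy is then at most 1 for the \<open>x\<close>-part and psum p m w + 1
  for the \<open>w\<close>-part, which is where the 3 comes from.\<close>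

lemma gap_witness:
  assumes p: "2 < p" and \<nu>: "0 < \<nu>" and gap: "\<nu> \<le> psum p m x - psum p m y"
    and w: "\<And>i. i < m \<Longrightarrow> 0 < w i" and \<Phi>: "1 \<le> psum p m w"
  shows "\<exists>t. (\<Sum>i<m. grad p x i * (t * (y i - x i))) = - \<nu> \<and>
    (\<Sum>i<m. weight p \<nu> x w i * (t * (y i - x i))\<^sup>2) \<le> 3 * psum p m w"
proof -
  define d where "d i = y i - x i" for i
  define h where "h = - (\<Sum>i<m. grad p x i * d i)"
  define Q where "Q = (\<Sum>i<m. \<bar>x i\<bar> powr (p - 2) * (d i)\<^sup>2)"
  define P where "P = psum p m d"
  define t where "t = \<nu> / h"
  have Q: "0 \<le> Q" by (simp add: Q_def sum_nonneg)
  have P: "0 \<le> P" by (simp add: P_def psum_nonneg)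
  have "psum p m x - h + 2 powr (- p) * (Q + P) \<le> psum p m y"
    using psum_lower[OF p, of m x d] by (simp add: h_def Q_def P_def d_def)
  then have h: "\<nu> + 2 powr (- p) * (Q + P) \<le> h" using gap by linarith
  have "0 \<le> 2 powr (- p) * (Q + P)" using Q P by simp
  then have \<nu>h: "\<nu> \<le> h" using h by linarith
  then have t: "0 < t" "t \<le> 1" "t * h = \<nu>" using \<nu> by (auto simp: t_def)
  have "2 powr (- p) * (Q + P) \<le> h" using h \<nu> by linarith
  then have QP: "Q + P \<le> 2 powr p * h" by (simp add: powr_minus field_simps)
  have tQP: "t * Q \<le> \<nu> * 2 powr p" "t * P \<le> \<nu> * 2 powr p"
  proof -
    have "t * (Q + P) \<le> t * (2 powr p * h)" using QP t by (intro mult_left_mono) auto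
    also have "\<dots> = \<nu> * 2 powr p" using t(3) by (simp add: mult_ac)
    finally have "t * Q + t * P \<le> \<nu> * 2 powr p" by (simp add: distrib_left)
    moreover have "0 \<le> t * Q" "0 \<le> t * P" using t Q P by auto
    ultimately show "t * Q \<le> \<nu> * 2 powr p" "t * P \<le> \<nu> * 2 powr p" by linarith+
  qed
  have K: "0 < \<nu> * 2 powr p" using \<nu> by simp
  have lin: "(\<Sum>i<m. grad p x i * (t * d i)) = - \<nu>"
  proof -
    have "(\<Sum>i<m. grad p x i * (t * d i)) = t * (\<Sum>i<m. grad p x i * d i)"
      by (simp add: sum_distrib_left mult_ac)
    also have "\<dots> = - (t * h)" by (simp add: h_def)
    finally show ?thesis using t by simp
  qed
  have "(\<Sum>i<m. weight p \<nu> x w i * (t * d i)\<^sup>2)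
    = t\<^sup>2 * Q / (\<nu> * 2 powr p) + (\<Sum>i<m. w i powr (p - 2) * (t * d i / scale p \<nu>)\<^sup>2)"
    unfolding Q_def sum_distrib_left sum_divide_distrib sum.distrib[symmetric] weight_def
    by (intro sum.cong) (auto simp: power_mult_distrib power_divide algebra_simps)
  also have "t\<^sup>2 * Q / (\<nu> * 2 powr p) \<le> 1"
  proof -
    have "t * (t * Q) \<le> 1 * (\<nu> * 2 powr p)" using t tQP K Q by (intro mult_mono[of t 1 "t * Q"] mult_nonneg_nonneg) auto
    then show ?thesis using K by (simp add: power2_eq_square mult.assoc)
  qed
  also have "(\<Sum>i<m. w i powr (p - 2) * (t * d i / scale p \<nu>)\<^sup>2)
      \<le> psum p m w + psum p m (\<lambda>i. (t / scale p \<nu>) * d i)"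
    using weighted_le_psum_add[OF p, of m w "\<lambda>i. (t / scale p \<nu>) * d i"] w by simp
  also have "psum p m (\<lambda>i. (t / scale p \<nu>) * d i) \<le> 1"
  proof -
    have s: "0 < scale p \<nu>" using \<nu> by (rule scale_pos)
    have "psum p m (\<lambda>i. (t / scale p \<nu>) * d i) = t powr p * P / (\<nu> * 2 powr p)"
      unfolding psum_scaled P_def using t s \<nu> p by (simp add: powr_divide scale_powr)
    also have "\<dots> \<le> 1"
    proof -
      have "t powr p \<le> t powr 1" using t p by (intro powr_mono') auto
      then have "t powr p * P \<le> t * P" using P t by (intro mult_right_mono) auto
      then show ?thesis using tQP K by simp
    qed
    finally show ?thesis .
  qed
  finally have "(\<Sum>i<m. weight p \<nu> x w i * (t * d i)\<^sup>2) \<le> 3 * psum p m w" using \<Phi> by simp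
  then show ?thesis using lin by (auto simp: d_def)
qed

text \<open>For this step \<mu> the bound 4 * upper_const p * 2 powr p * \<Phi> * \<nu> * \<mu>^2 on
  the second-order loss is exactly half of the first-order gain \<mu> * \<nu>.\<close>

definition step_size :: "real \<Rightarrow> real \<Rightarrow> real" where
  "step_size p \<Phi> = 1 / (8 * upper_const p * 2 powr p * \<Phi>)"

lemma upper_const_ge_1: "2 < p \<Longrightarrow> 1 \<le> upper_const p"
proof -
  assume p: "2 < p"
  have "1 * 1 \<le> p\<^sup>2 * 4 powr p" using p by (intro mult_mono) (auto simp: ge_one_powr_ge_zero)
  then show ?thesis by (simp add: upper_const_def)
qed

context width_reduction begin

text \<open>The two bounds of \<open>routed\<close> control the second-order part in
  \<open>psum_upper\<close>. Since the step size is at most 1, the part with p-th powers shrinks at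
  least quadratically as well.\<close>

lemma routed_descent:
  assumes r: "routed w T a" and \<Phi>: "1 \<le> psum p m w" and w: "\<And>i. i < m \<Longrightarrow> 0 < w i"
    and lin: "(\<Sum>i<m. grad p x i * a i) = - \<nu>"
  shows "psum p m (\<lambda>i. x i + step_size p (psum p m w) * a i) \<le> psum p m x - step_size p (psum p m w) * \<nu> / 2"
proof -
  define \<Phi>' where "\<Phi>' = psum p m w"
  define \<mu> where "\<mu> = step_size p \<Phi>'"
  define C where "C = upper_const p"
  have C: "1 \<le> C" using upper_const_ge_1[OF p] by (simp add: C_def)
  have p2: "1 \<le> 2 powr p" using p by (simp add: ge_one_powr_ge_zero)
  have "1 * 1 * 1 \<le> 8 * C * 2 powr p * \<Phi>'"
    using C p2 \<Phi> by (intro mult_mono) (auto simp: \<Phi>'_def)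
  then have D: "1 \<le> 8 * C * 2 powr p * \<Phi>'" by simp
  have \<mu>: "0 < \<mu>" "\<mu> \<le> 1" "8 * C * 2 powr p * \<Phi>' * \<mu> = 1"
  proof -
    have "0 < 8 * C * 2 powr p * \<Phi>'" using D by linarith
    moreover have "\<mu> = 1 / (8 * C * 2 powr p * \<Phi>')" by (simp add: \<mu>_def step_size_def C_def)
    ultimately show "0 < \<mu>" "\<mu> \<le> 1" "8 * C * 2 powr p * \<Phi>' * \<mu> = 1"
      using D by (simp_all only: zero_less_divide_iff divide_le_eq_1_pos) auto
  qed
  have s: "0 < scale p \<nu>" using \<nu> by (rule scale_pos)
  have K: "0 < \<nu> * 2 powr p" using \<nu> by simp
  have Q: "(\<Sum>i<m. \<bar>x i\<bar> powr (p - 2) * (a i)\<^sup>2) \<le> 3 * \<Phi>' * (\<nu> * 2 powr p)"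
  proof -
    have "(\<Sum>i<m. \<bar>x i\<bar> powr (p - 2) / (\<nu> * 2 powr p) * (a i)\<^sup>2) \<le> 3 * \<Phi>'"
      using r T_pos by (simp add: routed_def \<Phi>'_def)
    moreover have "(\<Sum>i<m. \<bar>x i\<bar> powr (p - 2) / (\<nu> * 2 powr p) * (a i)\<^sup>2)
      = (\<Sum>i<m. \<bar>x i\<bar> powr (p - 2) * (a i)\<^sup>2) / (\<nu> * 2 powr p)"
      by (simp add: sum_divide_distrib)
    ultimately show ?thesis using K by (simp add: pos_divide_le_eq)
  qed
  have P: "psum p m a \<le> \<Phi>' * (\<nu> * 2 powr p)"
  proof -
    have "psum p m a \<le> psum p m (\<lambda>i. scale p \<nu> * w i)"
      unfolding psum_def using r p w s by (intro sum_mono powr_mono2) (auto simp: routed_def abs_mult less_imp_le)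
    also have "\<dots> = \<Phi>' * (\<nu> * 2 powr p)"
      unfolding psum_scaled using s by (simp add: \<Phi>'_def scale_powr[OF \<nu> p])
    finally show ?thesis .
  qed
  have "psum p m (\<lambda>i. x i + \<mu> * a i) \<le> psum p m x + (\<Sum>i<m. grad p x i * (\<mu> * a i))
      + C * ((\<Sum>i<m. \<bar>x i\<bar> powr (p - 2) * (\<mu> * a i)\<^sup>2) + psum p m (\<lambda>i. \<mu> * a i))"
    unfolding C_def by (rule psum_upper[OF p])
  also have "(\<Sum>i<m. grad p x i * (\<mu> * a i)) = - (\<mu> * \<nu>)"
  proof -
    have "(\<Sum>i<m. grad p x i * (\<mu> * a i)) = \<mu> * (\<Sum>i<m. grad p x i * a i)"
      by (simp add: sum_distrib_left mult_ac)
    then show ?thesis by (simp add: lin)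
  qed
  also have "(\<Sum>i<m. \<bar>x i\<bar> powr (p - 2) * (\<mu> * a i)\<^sup>2) = \<mu>\<^sup>2 * (\<Sum>i<m. \<bar>x i\<bar> powr (p - 2) * (a i)\<^sup>2)"
    by (simp add: sum_distrib_left power_mult_distrib mult_ac)
  also have "psum p m (\<lambda>i. \<mu> * a i) = \<mu> powr p * psum p m a" using \<mu> by (simp add: psum_scaled)
  also have "\<mu> powr p * psum p m a \<le> \<mu>\<^sup>2 * psum p m a"
  proof (rule mult_right_mono)
    have "\<mu> powr p \<le> \<mu> powr 2" using \<mu> p by (intro powr_mono') auto
    then show "\<mu> powr p \<le> \<mu>\<^sup>2" using \<mu> by simp
  qed (rule psum_nonneg)
  finally have "psum p m (\<lambda>i. x i + \<mu> * a i) \<le> psum p m x - \<mu> * \<nu>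
      + C * (\<mu>\<^sup>2 * (\<Sum>i<m. \<bar>x i\<bar> powr (p - 2) * (a i)\<^sup>2) + \<mu>\<^sup>2 * psum p m a)"
    using C by simp
  also have "\<dots> \<le> psum p m x - \<mu> * \<nu> + C * (\<mu>\<^sup>2 * (3 * \<Phi>' * (\<nu> * 2 powr p)) + \<mu>\<^sup>2 * (\<Phi>' * (\<nu> * 2 powr p)))"
    using Q P C by (intro add_left_mono mult_left_mono add_mono) auto
  also have "C * (\<mu>\<^sup>2 * (3 * \<Phi>' * (\<nu> * 2 powr p)) + \<mu>\<^sup>2 * (\<Phi>' * (\<nu> * 2 powr p)))
      = (8 * C * 2 powr p * \<Phi>' * \<mu>) * (\<mu> * \<nu> / 2)"
    by (simp add: power2_eq_square algebra_simps)
  also have "\<dots> = \<mu> * \<nu> / 2" using \<mu> by simp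
  finally show ?thesis by (simp add: \<mu>_def \<Phi>'_def mult.commute)
qed

text \<open>The slope constraint is kept out of the linear system: \<Delta> lies in the kernel and
  represents the negative gradient there, so its own slope is -E. Rescaling by \<nu> / E gives slope
  -\<nu> and energy \<nu>^2 / E, and \<open>ok\<close> says that this is at most 3 * psum p m w
  without dividing.\<close>

lemma lsq_minimizer:
  assumes F: "F = {d \<in> K. (\<Sum>i<m. grad p x i * d i) = - \<nu>}"
    and K: "\<And>t d. d \<in> K \<Longrightarrow> (\<lambda>i. t * d i) \<in> K" and \<Delta>: "\<Delta> \<in> K"
    and orth: "\<And>d. d \<in> K \<Longrightarrow> (\<Sum>i<m. wt w i * \<Delta> i * d i) = - (\<Sum>i<m. grad p x i * d i)"
    and E: "E = (\<Sum>i<m. wt w i * (\<Delta> i)\<^sup>2)" and ok: "\<nu>\<^sup>2 \<le> 3 * psum p m w * E"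
    and E0: "0 \<le> E"
  shows "minimizer w (\<lambda>i. \<nu> / E * \<Delta> i)" "en w (\<lambda>i. \<nu> / E * \<Delta> i) \<le> 3 * psum p m w"
proof -
  have "0 < \<nu>\<^sup>2" using \<nu> by simp
  then have E1: "E \<noteq> 0" using ok by auto
  then have Epos: "0 < E" using E0 by linarith
  have en: "en w (\<lambda>i. \<nu> / E * \<Delta> i) = \<nu>\<^sup>2 / E"
  proof -
    have "en w (\<lambda>i. \<nu> / E * \<Delta> i) = (\<nu> / E)\<^sup>2 * E"
      by (simp add: en_def E sum_distrib_left sum_divide_distrib power_mult_distrib power_divide mult_ac)
    then show ?thesis using E1 by (simp add: power2_eq_square)
  qed
  show "en w (\<lambda>i. \<nu> / E * \<Delta> i) \<le> 3 * psum p m w"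
    unfolding en using ok Epos by (simp add: pos_divide_le_eq)
  have "(\<Sum>i<m. grad p x i * \<Delta> i) = - E"
    using orth[OF \<Delta>] by (simp add: E power2_eq_square mult.assoc)
  then have "(\<Sum>i<m. grad p x i * (\<nu> / E * \<Delta> i)) = - \<nu>"
    using E1 by (simp only: mult.left_commute[of _ "\<nu> / E"] sum_distrib_left[symmetric]) simp
  then have "(\<lambda>i. \<nu> / E * \<Delta> i) \<in> F" using K[OF \<Delta>, of "\<nu> / E"] unfolding F by blast
  moreover have "(\<Sum>i<m. wt w i * (\<nu> / E * \<Delta> i) * d i) = \<nu>\<^sup>2 / E" if "d \<in> F" for d
  proof -
    have "(\<Sum>i<m. wt w i * (\<nu> / E * \<Delta> i) * d i) = \<nu> / E * (\<Sum>i<m. wt w i * \<Delta> i * d i)"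
      by (simp add: sum_distrib_left mult_ac)
    also have "\<dots> = \<nu> / E * \<nu>" using orth[of d] that F by simp
    finally show ?thesis by (simp add: power2_eq_square)
  qed
  ultimately show "minimizer w (\<lambda>i. \<nu> / E * \<Delta> i)" unfolding minimizer_def en by blast
qed

text \<open>The energy of d - t * \<Delta> is nonnegative for every \<open>t\<close>; the best
  choice of \<open>t\<close> bounds the energy of \<open>d\<close> from below by \<nu>^2 /
  E.\<close>

lemma lsq_infeasible:
  assumes F: "F = {d \<in> K. (\<Sum>i<m. grad p x i * d i) = - \<nu>}"
    and orth: "\<And>d. d \<in> K \<Longrightarrow> (\<Sum>i<m. wt w i * \<Delta> i * d i) = - (\<Sum>i<m. grad p x i * d i)"
    and E: "E = (\<Sum>i<m. wt w i * (\<Delta> i)\<^sup>2)" and bad: "3 * psum p m w * E < \<nu>\<^sup>2"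
    and d: "d \<in> F" and w: "\<And>i. i < m \<Longrightarrow> 0 < w i"
  shows "3 * psum p m w < en w d"
proof (rule ccontr)
  assume "\<not> ?thesis"
  then have le: "en w d \<le> 3 * psum p m w" by simp
  have E0: "0 \<le> E" unfolding E using wt_pos w by (intro sum_nonneg) (auto simp: less_imp_le)
  have quad: "2 * t * \<nu> \<le> en w d + t\<^sup>2 * E" for t
  proof -
    have "0 \<le> (\<Sum>i<m. wt w i * (d i - t * \<Delta> i)\<^sup>2)"
      using wt_pos w by (intro sum_nonneg) (auto simp: less_imp_le)
    also have "\<dots> = (\<Sum>i<m. wt w i * (d i)\<^sup>2 - 2 * t * (wt w i * \<Delta> i * d i) + t\<^sup>2 * (wt w i * (\<Delta> i)\<^sup>2))"
      by (intro sum.cong) (auto simp: power2_eq_square algebra_simps)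
    also have "\<dots> = en w d - 2 * t * (\<Sum>i<m. wt w i * \<Delta> i * d i) + t\<^sup>2 * E"
      by (simp add: sum.distrib sum_subtractf sum_distrib_left[symmetric] en_def E)
    also have "(\<Sum>i<m. wt w i * \<Delta> i * d i) = \<nu>" using orth[of d] d F by simp
    finally show ?thesis by simp
  qed
  show False
  proof (cases "E = 0")
    \<comment> \<open>For E = 0 the inequality is linear in \<open>t\<close> and fails for large
      \<open>t\<close>: there is no direction of slope -\<nu> at all.\<close>
    case True
    then show False using quad[of "(en w d + 1) / \<nu>"] quad[of 0] \<nu> by simp
  next
    case False
    then have "\<nu>\<^sup>2 / E \<le> en w d" using quad[of "\<nu> / E"] by (simp add: power2_eq_square)
    then have "\<nu>\<^sup>2 / E \<le> 3 * psum p m w" using le by linarith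
    then have "\<nu>\<^sup>2 \<le> 3 * psum p m w * E" using False E0 by (simp add: pos_divide_le_eq)
    then show False using bad by simp
  qed
qed

end

section \<open>Comparison of different exponents\<close>

lemma psum_le_powr:
  assumes "0 < q" "q \<le> p"
  shows "psum p m x \<le> psum q m x powr (p / q)"
proof -
  have "psum p m x = (\<Sum>i<m. (\<bar>x i\<bar> powr q) powr (p / q))"
    using assms by (simp add: psum_def powr_powr)
  also have "\<dots> \<le> psum q m x powr (p / q)"
    unfolding psum_def by (rule sum_powr_le_powr_sum) (use assms in auto)
  finally show ?thesis .
qed

lemma powr_le_psum:
  assumes "0 < q" "q \<le> p" "1 \<le> m"
  shows "psum q m x powr (p / q) \<le> real m powr (p / q - 1) * psum p m x"
proof -
  have "psum q m x powr (p / q) \<le> real m powr (p / q - 1) * (\<Sum>i<m. (\<bar>x i\<bar> powr q) powr (p / q))"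
    unfolding psum_def by (rule powr_sum_le_sum_powr) (use assms in auto)
  also have "(\<Sum>i<m. (\<bar>x i\<bar> powr q) powr (p / q)) = psum p m x"
    using assms by (simp add: psum_def powr_powr)
  finally show ?thesis .
qed

lemma psum_two: "psum 2 m x = (\<Sum>i<m. (x i)\<^sup>2)"
  by (simp add: psum_def)

text \<open>Passing from exponent \<open>p\<close> to 2 and back costs a power of \<open>m\<close>
  only once, because the p-norm is dominated by the 2-norm. This rates the least-norm solution as a
  starting point.\<close>

lemma psum_lsq_le:
  assumes "2 \<le> p" "1 \<le> m" "(\<Sum>i<m. (x i)\<^sup>2) \<le> (\<Sum>i<m. (y i)\<^sup>2)"
  shows "psum p m x \<le> real m powr ((p - 2) / 2) * psum p m y"
proof -
  have "psum p m x \<le> psum 2 m x powr (p / 2)" by (rule psum_le_powr) (use assms in auto)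
  also have "\<dots> \<le> psum 2 m y powr (p / 2)"
    using assms by (intro powr_mono2 psum_nonneg) (auto simp: psum_two)
  also have "\<dots> \<le> real m powr (p / 2 - 1) * psum p m y" by (rule powr_le_psum) (use assms in auto)
  finally show ?thesis by (simp add: diff_divide_distrib)
qed

text \<open>For \<epsilon> at least the square root of \<open>m\<close>, a factor 3/2 for a nearby
  exponent is good enough. The change of exponent costs m powr (1/4), (3/2) powr (5/4) is at most 2,
  and 2 * m powr (1/4) \<le> 1 + m powr (1/2) by completing a square.\<close>

lemma psum_approx_transfer:
  assumes "2 \<le> q" "q \<le> p" "p / q \<le> 5 / 4" "1 \<le> m" "psum q m x \<le> 3 / 2 * psum q m y"
    and \<epsilon>: "real m powr (1 / 2) \<le> \<epsilon>"
  shows "psum p m x \<le> (1 + \<epsilon>) * psum p m y"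
proof -
  have "psum p m x \<le> psum q m x powr (p / q)" by (rule psum_le_powr) (use assms in auto)
  also have "\<dots> \<le> (3 / 2 * psum q m y) powr (p / q)"
    using assms by (intro powr_mono2 psum_nonneg) auto
  also have "\<dots> = (3 / 2) powr (p / q) * psum q m y powr (p / q)" by (rule powr_mult)
  also have "\<dots> \<le> (3 / 2) powr (5 / 4) * (real m powr (1 / 4) * psum p m y)"
  proof (rule mult_mono)
    show "(3 / 2) powr (p / q) \<le> (3 / 2) powr (5 / 4 :: real)" using assms by (intro powr_mono) auto
    have "psum q m y powr (p / q) \<le> real m powr (p / q - 1) * psum p m y"
      by (rule powr_le_psum) (use assms in auto)
    also have "\<dots> \<le> real m powr (1 / 4) * psum p m y"
      using assms by (intro mult_right_mono powr_mono psum_nonneg) auto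
    finally show "psum q m y powr (p / q) \<le> real m powr (1 / 4) * psum p m y" .
  qed auto
  also have "\<dots> \<le> (1 + \<epsilon>) * psum p m y"
  proof -
    have "(3 / 2) powr (5 / 4 :: real) \<le> 2"
    proof -
      have "((3 / 2) powr (5 / 4 :: real)) ^ 4 = (3 / 2) powr 5"
        by (simp add: powr_powr flip: powr_realpow del: powr_numeral)
      also have "\<dots> \<le> 2 ^ 4" by (simp add: power_divide)
      finally show ?thesis by (rule power_mono_iff[THEN iffD1, rotated 3]) auto
    qed
    then have "(3 / 2) powr (5 / 4) * real m powr (1 / 4) \<le> 2 * real m powr (1 / 4)" by (intro mult_right_mono) auto
    also have "\<dots> \<le> 1 + real m powr (1 / 2)"
    proof -
      have "0 \<le> (real m powr (1 / 4) - 1)\<^sup>2" by simp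
      also have "\<dots> = real m powr (1 / 4) * real m powr (1 / 4) + 1 - 2 * real m powr (1 / 4)"
        by (simp add: power2_eq_square algebra_simps)
      also have "real m powr (1 / 4) * real m powr (1 / 4) = real m powr (1 / 2)"
        by (simp add: powr_add[symmetric])
      finally show ?thesis by simp
    qed
    also have "\<dots> \<le> 1 + \<epsilon>" using \<epsilon> by simp
    finally have "(3 / 2) powr (5 / 4) * real m powr (1 / 4) * psum p m y \<le> (1 + \<epsilon>) * psum p m y"
      by (intro mult_right_mono psum_nonneg)
    then show ?thesis by (simp add: mult.assoc)
  qed
  finally show ?thesis .
qed

section \<open>Generalized inverses and Schur complements\<close>

text \<open>Matrix identities are derived from associativity, distributivity and the rules of
  transposition, free of indices and dimensions. There is no unit in this structure, so projections
  1 - X are written out as differences.\<close>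

locale star_algebra =
  fixes mul :: "'a :: ab_group_add \<Rightarrow> 'a \<Rightarrow> 'a" (infixl "\<odot>" 70) and tr :: "'a \<Rightarrow> 'a"
  assumes assoc: "a \<odot> b \<odot> c = a \<odot> (b \<odot> c)"
    and distl: "a \<odot> (b + c) = a \<odot> b + a \<odot> c" and distr: "(a + b) \<odot> c = a \<odot> c + b \<odot> c"
    and tr_add: "tr (a + b) = tr a + tr b" and tr_mul: "tr (a \<odot> b) = tr b \<odot> tr a" and tr_tr: "tr (tr a) = a"
begin

lemma zero_l: "0 \<odot> a = 0" using distr[of 0 0 a] by simp
lemma zero_r: "a \<odot> 0 = 0" using distl[of a 0 0] by simp
lemma neg_l: "(- a) \<odot> b = - (a \<odot> b)" using distr[of a "- a" b] by (simp add: zero_l minus_unique)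
lemma neg_r: "a \<odot> (- b) = - (a \<odot> b)" using distl[of a b "- b"] by (simp add: zero_r minus_unique)
lemma diff_l: "(a - b) \<odot> c = a \<odot> c - b \<odot> c" using distr[of a "- b" c] by (simp add: neg_l)
lemma diff_r: "a \<odot> (b - c) = a \<odot> b - a \<odot> c" using distl[of a b "- c"] by (simp add: neg_r)
lemma tr_zero: "tr 0 = 0" using tr_add[of 0 0] by simp
lemma tr_neg: "tr (- a) = - tr a" using tr_add[of a "- a"] by (simp add: tr_zero minus_unique)
lemma tr_diff: "tr (a - b) = tr a - tr b" using tr_add[of a "- b"] by (simp add: tr_neg)

lemmas expand = distl distr diff_l diff_r neg_l neg_r zero_l zero_r tr_add tr_diff tr_neg tr_mul tr_tr tr_zero assoc

text \<open>A symmetric \<open>H\<close> that inverts the Gram matrix B \<odot> tr B on the column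
  space of \<open>B\<close>, whatever the rank. Mentioning \<open>B\<close> and not only its Gram
  matrix keeps the notion stable under passing to Schur complements.\<close>

definition ginv :: "'a \<Rightarrow> 'a \<Rightarrow> bool" where
  "ginv B H \<longleftrightarrow> tr H = H \<and> B \<odot> tr B \<odot> H \<odot> B = B"

text \<open>
  With \<open>X\<close> the projection onto the row space of \<open>B1\<close>, the Schur complement is the Gram matrix
  of \<open>B2 - B2 \<odot> X\<close>, and \<open>tr B \<odot> H \<odot> B = X + (1 - X) \<odot> C \<odot> (1 - X)\<close> for \<open>C = tr B2 \<odot> H2 \<odot> B2\<close>.
\<close>

lemma schur_gram:
  assumes "ginv B1 H1" and B': "B' = B2 - B2 \<odot> (tr B1 \<odot> H1 \<odot> B1)"
  shows "B' \<odot> tr B' = B2 \<odot> tr B2 - tr (B1 \<odot> tr B2) \<odot> H1 \<odot> (B1 \<odot> tr B2)"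
proof -
  have H: "tr H1 = H1" "B1 \<odot> (tr B1 \<odot> (H1 \<odot> B1)) = B1" using assms by (auto simp: ginv_def assoc)
  have "B1 \<odot> (tr B1 \<odot> (H1 \<odot> (B1 \<odot> c))) = B1 \<odot> c" for c using H(2) by (metis assoc)
  then show ?thesis by (simp add: B' expand H)
qed

text \<open>The usual block formula for the inverse of a symmetric matrix, with generalized inverses
  in place of inverses. The hypotheses \<open>o\<close> reflect that the two blocks occupy disjoint
  row indices; they make the mixed products vanish. \<open>B1\<close> and \<open>B2\<close> are then
  reproduced separately.\<close>

lemma block_ginv:
  assumes g1: "ginv B1 H1" and g2: "ginv B' H2" and B': "B' = B2 - B2 \<odot> (tr B1 \<odot> H1 \<odot> B1)"
    and o: "tr B1 \<odot> B2 = 0" "H1 \<odot> B2 = 0" "H2 \<odot> B1 = 0"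
    and U: "U = H1 \<odot> (B1 \<odot> tr B2)" and V: "V = U \<odot> H2"
  shows "ginv (B1 + B2) (H1 + V \<odot> tr U - V - tr V + H2)"
proof -
  have H1: "tr H1 = H1" "B1 \<odot> (tr B1 \<odot> (H1 \<odot> B1)) = B1" using g1 by (auto simp: ginv_def assoc)
  have H2: "tr H2 = H2" using g2 by (simp add: ginv_def)
  define X where "X = tr B1 \<odot> H1 \<odot> B1"
  define C where "C = tr B2 \<odot> H2 \<odot> B2"
  have trX: "tr X = X" by (simp add: X_def expand H1)
  have B1X: "B1 \<odot> X = B1" by (simp add: X_def assoc H1)
  have XX: "X \<odot> X = X" using B1X by (simp add: X_def assoc)
  have B'X: "B' = B2 - B2 \<odot> X" by (simp add: B' X_def)
  have o': "tr B2 \<odot> B1 = 0" using arg_cong[OF o(1), of tr] by (simp add: expand)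
  have o2: "tr B2 \<odot> H1 = 0" using arg_cong[OF o(2), of tr] by (simp add: expand H1)
  have o3: "tr B1 \<odot> H2 = 0" using arg_cong[OF o(3), of tr] by (simp add: expand H2)
  have z: "tr B1 \<odot> (B2 \<odot> c) = 0" "H1 \<odot> (B2 \<odot> c) = 0" "H2 \<odot> (B1 \<odot> c) = 0"
     "tr B2 \<odot> (B1 \<odot> c) = 0" "tr B2 \<odot> (H1 \<odot> c) = 0" "tr B1 \<odot> (H2 \<odot> c) = 0" for c
    using o o' o2 o3 by (simp_all add: assoc[symmetric] zero_l)
  let ?H = "H1 + V \<odot> tr U - V - tr V + H2"
  have M: "tr (B1 + B2) \<odot> ?H \<odot> (B1 + B2) = X + X \<odot> C \<odot> X - X \<odot> C - C \<odot> X + C"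
    by (simp add: expand V U H1 H2 z o o' o2 o3 X_def C_def)
  have 1: "B1 \<odot> (tr (B1 + B2) \<odot> ?H \<odot> (B1 + B2)) = B1"
  proof -
    have "B1 \<odot> (X \<odot> c) = B1 \<odot> c" for c using B1X by (metis assoc)
    then show ?thesis unfolding M by (simp add: distl diff_r assoc B1X)
  qed
  \<comment> \<open>\<open>B'\<close> is orthogonal to the row space of \<open>B1\<close>, so its
    second copy may be replaced by \<open>B2\<close>, the matrix that occurs in
    \<open>C\<close>.\<close>
  have S: "B' \<odot> tr B' = B' \<odot> tr B2"
  proof -
    have "B' \<odot> X = 0" by (simp add: B'X diff_l assoc XX)
    then have "B' \<odot> (X \<odot> c) = 0" for c by (metis assoc zero_l)
    then show ?thesis by (simp add: B'X[THEN arg_cong, of tr] expand trX)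
  qed
  have 2: "B2 \<odot> (tr (B1 + B2) \<odot> ?H \<odot> (B1 + B2)) = B2"
  proof -
    have "B' \<odot> tr B' \<odot> H2 \<odot> B' = B'" using g2 by (simp add: ginv_def)
    then have *: "B' \<odot> tr B2 \<odot> H2 \<odot> B' = B'" by (simp only: S)
    have "B2 \<odot> (X + X \<odot> C \<odot> X - X \<odot> C - C \<odot> X + C) = B2 \<odot> X + B' \<odot> tr B2 \<odot> H2 \<odot> B'"
      by (simp add: B'X C_def expand)
    also have "\<dots> = B2" by (simp add: *) (simp add: B'X)
    finally show ?thesis unfolding M .
  qed
  have "tr ?H = ?H" by (simp add: expand H1 H2 V)
  moreover have "(B1 + B2) \<odot> tr (B1 + B2) \<odot> ?H \<odot> (B1 + B2) = B1 + B2"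
    using 1 2 by (simp add: assoc distr)
  ultimately show ?thesis by (simp add: ginv_def)
qed

end

section \<open>Real matrices over a common index range\<close>

definition mm :: "nat \<Rightarrow> rmat \<Rightarrow> rmat \<Rightarrow> nat \<Rightarrow> nat \<Rightarrow> real" where
  "mm N A B = (\<lambda>i k. \<Sum>j<N. A i j * B j k)"

definition mtr :: "rmat \<Rightarrow> nat \<Rightarrow> nat \<Rightarrow> real" where
  "mtr A = (\<lambda>i j. A j i)"

definition rows :: "nat \<Rightarrow> nat set \<Rightarrow> rmat \<Rightarrow> nat \<Rightarrow> nat \<Rightarrow> real" where
  "rows N I A = (\<lambda>i j. if i \<in> I \<and> j < N then A i j else 0)"

definition block :: "nat set \<Rightarrow> nat set \<Rightarrow> rmat \<Rightarrow> nat \<Rightarrow> nat \<Rightarrow> real" where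
  "block I J A = (\<lambda>i j. if i \<in> I \<and> j \<in> J then A i j else 0)"

text \<open>Matrices are total functions and only the summation index is bounded by
  \<open>N\<close>, so the laws hold without side conditions on dimensions.\<close>

interpretation mm: star_algebra "mm N" mtr for N
proof
  fix a b c :: "nat \<Rightarrow> nat \<Rightarrow> real"
  show "mm N (mm N a b) c = mm N a (mm N b c)"
    unfolding mm_def sum_distrib_left sum_distrib_right
    by (intro ext, subst sum.swap) (simp add: mult.assoc)
qed (auto simp: mm_def mtr_def fun_eq_iff plus_fun_def algebra_simps sum.distrib)

text \<open>Blocks are addressed by index sets in their original positions and padded with zeros.
  This matches the program, which works in place in one array.\<close>

definition solves :: "nat \<Rightarrow> nat set \<Rightarrow> rmat \<Rightarrow> rmat \<Rightarrow> bool" where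
  "solves N I B H \<longleftrightarrow> mm.ginv N (rows N I B) (block I I H)"

lemma block_cong:
  "(\<And>i j. i \<in> I \<Longrightarrow> j \<in> J \<Longrightarrow> A i j = C i j) \<Longrightarrow> block I J A = block I J C"
  by (auto simp: block_def fun_eq_iff)

lemma mm_block:
  assumes "J \<subseteq> {..<N}"
  shows "mm N (block I J A) (block J K C) = block I K (\<lambda>i k. \<Sum>j\<in>J. A i j * C j k)"
proof (intro ext)
  fix i k
  have "mm N (block I J A) (block J K C) i k = (\<Sum>j\<in>J. block I J A i j * block J K C j k)"
    unfolding mm_def by (rule sum.mono_neutral_right) (use assms in \<open>auto simp: block_def\<close>)
  also have "\<dots> = block I K (\<lambda>i k. \<Sum>j\<in>J. A i j * C j k) i k"
    by (auto simp: block_def intro!: sum.cong)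
  finally show "mm N (block I J A) (block J K C) i k = \<dots>" .
qed

lemma mtr_block: "mtr (block I J A) = block J I (mtr A)"
  by (auto simp: mtr_def block_def fun_eq_iff)

lemma rows_block: "rows N I A = block I {..<N} A"
  by (simp add: rows_def block_def)

text \<open>Base case of the recursion. If the diagonal entry is zero, then so is the row, and any
  value of 1 / G satisfies the equation; hence the program divides without testing the
  pivot.\<close>

lemma solves_singleton:
  assumes "i < N" and G: "G = (\<Sum>k<N. B i k * B i k)" and H: "H i i = 1 / G"
  shows "solves N {i} B H"
proof -
  have "B i k = 0" if "G = 0" "k < N" for k
  proof -
    have "\<forall>k\<in>{..<N}. B i k * B i k = 0" using that unfolding G by (subst (asm) sum_nonneg_eq_0_iff) auto
    then show ?thesis using that by simp
  qed
  then have *: "G * (H i i * B i k) = B i k" if "k < N" for k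
    using that by (cases "G = 0") (simp_all add: H)
  have "mm N (block {i} {..<N} B) (mtr (block {i} {..<N} B)) = block {i} {i} (\<lambda>_ _. G)"
    unfolding mtr_block by (subst mm_block) (auto simp: G mtr_def intro!: block_cong)
  moreover have "mm N (block {i} {i} (\<lambda>_ _. G)) (mm N (block {i} {i} H) (block {i} {..<N} B)) = block {i} {..<N} B"
    using assms(1) by (simp add: mm_block) (intro block_cong, auto simp: *)
  moreover have "mtr (block {i} {i} H) = block {i} {i} H"
    unfolding mtr_block by (rule block_cong) (auto simp: mtr_def)
  ultimately show ?thesis
    unfolding solves_def rows_block mm.ginv_def by (simp add: mm.assoc)
qed

text \<open>The rows in \<open>I2\<close> minus their projections onto the span of the rows in
  \<open>I1\<close>. They are never computed: they witness that the Schur complement is again a Gram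
  matrix, which is what the second recursive call presupposes.\<close>

definition schur_rows :: "nat \<Rightarrow> nat set \<Rightarrow> rmat \<Rightarrow> rmat \<Rightarrow> nat set \<Rightarrow> nat \<Rightarrow> nat \<Rightarrow> real" where
  "schur_rows N I1 B G I2 = rows N I2 B - mm N (rows N I2 B) (mm N (mm N (mtr (rows N I1 B)) (block I1 I1 G)) (rows N I1 B))"

lemma rows_schur_rows: "rows N I2 (schur_rows N I1 B G I2) = schur_rows N I1 B G I2"
  by (auto simp: schur_rows_def rows_def mm_def fun_eq_iff sum.neutral)

lemma gram_block:
  assumes "\<And>i j. i \<in> I \<Longrightarrow> j \<in> J \<Longrightarrow> G i j = (\<Sum>k<N. B i k * B j k)"
  shows "mm N (rows N I B) (mtr (rows N J B)) = block I J G"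
  unfolding rows_block mtr_block
  by (subst mm_block) (auto simp: assms mtr_def intro!: block_cong)

text \<open>\<open>G\<close> plays two roles, as the array does between the two recursive calls: on
  \<open>I1\<close> x \<open>I1\<close> it already is the generalized inverse, while the blocks with
  columns in \<open>I2\<close> still hold Gram entries.\<close>

lemma schur_rows_gram:
  assumes s: "solves N I1 B G" and I: "I1 \<subseteq> {..<N}"
    and Q: "\<And>i j. i \<in> I1 \<Longrightarrow> j \<in> I2 \<Longrightarrow> G i j = (\<Sum>k<N. B i k * B j k)"
    and S: "\<And>i j. i \<in> I2 \<Longrightarrow> j \<in> I2 \<Longrightarrow> G i j = (\<Sum>k<N. B i k * B j k)"
    and ij: "i \<in> I2" "j \<in> I2"
  shows "G i j - (\<Sum>a\<in>I1. G a i * (\<Sum>b\<in>I1. G a b * G b j))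
    = (\<Sum>k<N. schur_rows N I1 B G I2 i k * schur_rows N I1 B G I2 j k)"
proof -
  let ?B1 = "rows N I1 B" and ?B2 = "rows N I2 B" and ?H = "block I1 I1 G" and ?B' = "schur_rows N I1 B G I2"
  have "mm N ?B' (mtr ?B') = mm N ?B2 (mtr ?B2)
     - mm N (mm N (mtr (mm N ?B1 (mtr ?B2))) ?H) (mm N ?B1 (mtr ?B2))"
    using s unfolding solves_def schur_rows_def by (intro mm.schur_gram) auto
  also have "mm N ?B1 (mtr ?B2) = block I1 I2 G" by (rule gram_block) (rule Q)
  also have "mm N ?B2 (mtr ?B2) = block I2 I2 G" by (rule gram_block) (rule S)
  also have "mm N (mm N (mtr (block I1 I2 G)) ?H) (block I1 I2 G)
    = block I2 I2 (\<lambda>i j. \<Sum>a\<in>I1. G a i * (\<Sum>b\<in>I1. G a b * G b j))"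
    unfolding mm.assoc mtr_block by (simp add: mm_block[OF I]) (simp add: mtr_def)
  finally have "mm N ?B' (mtr ?B') i j = (block I2 I2 G - block I2 I2 (\<lambda>i j. \<Sum>a\<in>I1. G a i * (\<Sum>b\<in>I1. G a b * G b j))) i j"
    by simp
  then show ?thesis using ij by (simp add: block_def mm_def mtr_def)
qed

text \<open>\<open>block_ginv\<close> in coordinates, for the moment when both recursive calls are
  finished: disjointness of \<open>I1\<close> and \<open>I2\<close> supplies the vanishing products,
  and \<open>U\<close>, \<open>V\<close> are the matrices named so there.\<close>

lemma solves_combine:
  assumes s1: "solves N I1 B G" and s2: "solves N I2 (schur_rows N I1 B G I2) H2"
    and I: "I1 \<subseteq> {..<N}" "I2 \<subseteq> {..<N}" "I1 \<inter> I2 = {}"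
    and Q: "\<And>i j. i \<in> I1 \<Longrightarrow> j \<in> I2 \<Longrightarrow> G i j = (\<Sum>k<N. B i k * B j k)"
    and U: "\<And>i j. i \<in> I1 \<Longrightarrow> j \<in> I2 \<Longrightarrow> U i j = (\<Sum>b\<in>I1. G i b * G b j)"
    and V: "\<And>i j. i \<in> I1 \<Longrightarrow> j \<in> I2 \<Longrightarrow> V i j = (\<Sum>c\<in>I2. U i c * H2 c j)"
    and H11: "\<And>i j. i \<in> I1 \<Longrightarrow> j \<in> I1 \<Longrightarrow> H i j = G i j + (\<Sum>c\<in>I2. V i c * U j c)"
    and H12: "\<And>i j. i \<in> I1 \<Longrightarrow> j \<in> I2 \<Longrightarrow> H i j = - V i j"
    and H21: "\<And>i j. i \<in> I2 \<Longrightarrow> j \<in> I1 \<Longrightarrow> H i j = - V j i"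
    and H22: "\<And>i j. i \<in> I2 \<Longrightarrow> j \<in> I2 \<Longrightarrow> H i j = H2 i j"
  shows "solves N (I1 \<union> I2) B H"
proof -
  let ?B1 = "rows N I1 B" and ?B2 = "rows N I2 B" and ?H1 = "block I1 I1 G" and ?H2 = "block I2 I2 H2"
  have o: "mm N (mtr ?B1) ?B2 = 0" "mm N ?H1 ?B2 = 0" "mm N ?H2 ?B1 = 0"
    using I(3) by (auto simp: mm_def mtr_def rows_def block_def fun_eq_iff zero_fun_def intro!: sum.neutral)
  have Um: "mm N ?H1 (mm N ?B1 (mtr ?B2)) = block I1 I2 U"
  proof -
    have "mm N ?B1 (mtr ?B2) = block I1 I2 G" by (rule gram_block) (rule Q)
    then show ?thesis by (simp add: mm_block[OF I(1)]) (rule block_cong, simp add: U)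
  qed
  have Vm: "mm N (block I1 I2 U) ?H2 = block I1 I2 V"
    unfolding mm_block[OF I(2)] by (rule block_cong) (simp add: V)
  have VU: "mm N (block I1 I2 V) (mtr (block I1 I2 U)) = block I1 I1 (\<lambda>i j. \<Sum>c\<in>I2. V i c * U j c)"
    unfolding mtr_block mm_block[OF I(2)] by (rule block_cong) (simp add: mtr_def)
  have "mm.ginv N (?B1 + ?B2) (?H1 + mm N (block I1 I2 V) (mtr (block I1 I2 U)) - block I1 I2 V
      - mtr (block I1 I2 V) + ?H2)"
  proof (rule mm.block_ginv)
    show "mm.ginv N ?B1 ?H1" using s1 by (simp add: solves_def)
    show "mm.ginv N (schur_rows N I1 B G I2) ?H2" using s2 by (simp add: solves_def rows_schur_rows)
  qed (simp_all add: o Um Vm schur_rows_def)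
  moreover have "?B1 + ?B2 = rows N (I1 \<union> I2) B"
    using I(3) by (auto simp: rows_def fun_eq_iff)
  moreover have "?H1 + mm N (block I1 I2 V) (mtr (block I1 I2 U)) - block I1 I2 V
      - mtr (block I1 I2 V) + ?H2 = block (I1 \<union> I2) (I1 \<union> I2) H"
    unfolding VU unfolding mtr_block using I(3)
    by (auto simp: block_def fun_eq_iff mtr_def H11 H12 H21 H22)
  ultimately show ?thesis by (simp add: solves_def)
qed

text \<open>With \<open>B\<close> the matrix \<open>A\<close> whose columns are scaled by square
  roots of \<open>W\<close>, the equation B B^T H B = B turns into A W A^T H A = A, and
  \<open>v\<close> lies in the range of \<open>A\<close>. The square roots belong to the argument
  only; the program forms the Gram matrix from \<open>W\<close> directly.\<close>

lemma lsq_consistent: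
  fixes A H :: "nat \<Rightarrow> nat \<Rightarrow> real" and W z v y :: "nat \<Rightarrow> real"
  assumes s: "solves N {..<N} (\<lambda>i k. if i < n \<and> k < m then A i k * sqrt (W k) else 0) H"
    and N: "n \<le> N" "m \<le> N" and W: "\<And>k. k < m \<Longrightarrow> 0 < W k" and i: "i < n"
    and v: "\<And>i. i < n \<Longrightarrow> v i = (\<Sum>k<m. A i k * z k)"
    and y: "\<And>j. j < n \<Longrightarrow> y j = (\<Sum>l<n. H j l * v l)"
  shows "(\<Sum>l<m. A i l * (W l * (\<Sum>j<n. A j l * y j))) = v i"
proof -
  define B where "B i k = (if i < n \<and> k < m then A i k * sqrt (W k) else 0)" for i k
  have B0: "B i k = 0" if "n \<le> i \<or> m \<le> k" for i k using that by (auto simp: B_def)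
  have rB: "rows N {..<N} B = B" using B0 N by (auto simp: rows_def fun_eq_iff)
  have "mm N (mm N (mm N B (mtr B)) (block {..<N} {..<N} H)) B = B"
    using s by (simp add: solves_def mm.ginv_def rB flip: B_def)
  then have eq: "mm N B (mm N (mtr B) (mm N (block {..<N} {..<N} H) B)) i k = B i k" for k
    by (simp only: mm.assoc)
  have sumn: "(\<Sum>j<N. f j) = (\<Sum>j<n. f j)" if "\<And>j. n \<le> j \<Longrightarrow> f j = 0" for f :: "nat \<Rightarrow> real"
    by (rule sum.mono_neutral_right) (use N that in auto)
  have summ: "(\<Sum>j<N. f j) = (\<Sum>j<m. f j)" if "\<And>j. m \<le> j \<Longrightarrow> f j = 0" for f :: "nat \<Rightarrow> real"
    by (rule sum.mono_neutral_right) (use N that in auto)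
  have A: "(\<Sum>l<m. A i l * (W l * (\<Sum>j<n. A j l * (\<Sum>j'<n. H j j' * A j' k)))) = A i k" if k: "k < m" for k
  proof -
    have sq: "sqrt (W l) * sqrt (W l) = W l" if "l < m" for l using W[OF that] by simp
    have "B i k = (\<Sum>l<N. B i l * (\<Sum>j<N. B j l * (\<Sum>j'<N. block {..<N} {..<N} H j j' * B j' k)))"
      unfolding eq[of k, symmetric] by (simp add: mm_def mtr_def)
    also have "\<dots> = (\<Sum>l<m. B i l * (\<Sum>j<n. B j l * (\<Sum>j'<n. block {..<N} {..<N} H j j' * B j' k)))"
      by (simp add: summ sumn B0)
    also have "\<dots> = (\<Sum>l<m. (A i l * (W l * (\<Sum>j<n. A j l * (\<Sum>j'<n. H j j' * A j' k)))) * sqrt (W k))"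
    proof (rule sum.cong[OF refl])
      fix l assume "l \<in> {..<m}"
      then have l: "l < m" by simp
      have "(\<Sum>j<n. B j l * (\<Sum>j'<n. block {..<N} {..<N} H j j' * B j' k))
        = (\<Sum>j<n. sqrt (W l) * sqrt (W k) * (A j l * (\<Sum>j'<n. H j j' * A j' k)))"
        using l k N by (intro sum.cong) (auto simp: B_def block_def sum_distrib_left mult_ac intro!: sum.cong)
      then have "B i l * (\<Sum>j<n. B j l * (\<Sum>j'<n. block {..<N} {..<N} H j j' * B j' k))
        = A i l * sqrt (W l) * (sqrt (W l) * sqrt (W k) * (\<Sum>j<n. A j l * (\<Sum>j'<n. H j j' * A j' k)))"
        using l i by (simp add: B_def sum_distrib_left)
      also have "\<dots> = (A i l * ((sqrt (W l) * sqrt (W l)) * (\<Sum>j<n. A j l * (\<Sum>j'<n. H j j' * A j' k)))) * sqrt (W k)"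
        by (simp only: mult_ac)
      also have "sqrt (W l) * sqrt (W l) = W l" by (rule sq[OF l])
      finally show "B i l * (\<Sum>j<n. B j l * (\<Sum>j'<n. block {..<N} {..<N} H j j' * B j' k))
        = (A i l * (W l * (\<Sum>j<n. A j l * (\<Sum>j'<n. H j j' * A j' k)))) * sqrt (W k)" .
    qed
    also have "\<dots> = (\<Sum>l<m. A i l * (W l * (\<Sum>j<n. A j l * (\<Sum>j'<n. H j j' * A j' k)))) * sqrt (W k)"
      by (simp add: sum_distrib_right)
    finally show ?thesis using W[OF k] i k by (simp add: B_def)
  qed
  define M where "M j k = (\<Sum>j'<n. H j j' * A j' k)" for j k
  have yz: "y j = (\<Sum>k<m. M j k * z k)" if "j < n" for j
    unfolding y[OF that] sum_distrib_right M_def by (subst sum.swap) (simp add: v sum_distrib_left mult.assoc)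
  define L where "L l k = (\<Sum>j<n. A j l * M j k)" for l k
  have "(\<Sum>j<n. A j l * y j) = (\<Sum>k<m. L l k * z k)" for l
    unfolding sum_distrib_right L_def by (subst sum.swap) (simp add: yz sum_distrib_left mult.assoc)
  then have "(\<Sum>l<m. A i l * (W l * (\<Sum>j<n. A j l * y j)))
    = (\<Sum>l<m. \<Sum>k<m. (A i l * (W l * L l k)) * z k)"
    by (simp add: sum_distrib_left mult.assoc)
  also have "\<dots> = (\<Sum>k<m. A i k * z k)"
    by (subst sum.swap) (simp add: sum_distrib_right[symmetric] A L_def M_def del: sum_distrib_left)
  finally show ?thesis using v[OF i] by simp
qed

section \<open>Program logic\<close>

abbreviation "nset a e \<equiv> NSet a (NConst 0) e"
abbreviation "rset a e \<equiv> RSet a (NConst 0) e"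

text \<open>Total correctness with a time budget. The budget is real, so that bounds such as C *
  real N powr \<tau> can be added along a program directly.\<close>

definition exec :: "rop com \<Rightarrow> state \<Rightarrow> real \<Rightarrow> (state \<Rightarrow> bool) \<Rightarrow> bool" where
  "exec c s B Q \<longleftrightarrow> (\<exists>T t. run c s T t \<and> real T \<le> B \<and> Q t)"

lemma exec_mono: "exec c s B Q \<Longrightarrow> B \<le> B' \<Longrightarrow> (\<And>t. Q t \<Longrightarrow> Q' t) \<Longrightarrow> exec c s B' Q'"
  unfolding exec_def by (blast intro: order_trans)

lemma exec_Seq:
  assumes "exec c1 s B1 Q1" "\<And>t. Q1 t \<Longrightarrow> exec c2 t B2 Q"
  shows "exec (Seq c1 c2) s (B1 + B2) Q"
proof -
  obtain T1 t where 1: "run c1 s T1 t" "real T1 \<le> B1" "Q1 t" using assms(1) by (auto simp: exec_def)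
  obtain T2 u where 2: "run c2 t T2 u" "real T2 \<le> B2" "Q u" using assms(2)[OF 1(3)] by (auto simp: exec_def)
  show ?thesis unfolding exec_def
    using run.Seq[OF 1(1) 2(1)] 1 2 by (intro exI[of _ "T1 + T2"] exI[of _ u]) auto
qed

lemma exec_Seq_eq: "exec c1 s B1 (\<lambda>t. t = s') \<Longrightarrow> exec c2 s' B2 Q \<Longrightarrow> exec (Seq c1 c2) s (B1 + B2) Q"
  by (erule exec_Seq) auto

lemma exec_eq: "exec c s B (\<lambda>t. t = s') \<Longrightarrow> Q s' \<Longrightarrow> exec c s B Q"
  by (erule exec_mono) auto

lemma exec_NSet:
  assumes "Q (s\<lparr>nats := (nats s)(a := (nats s a)(nval i s := nval e s))\<rparr>)" "real (1 + ncost i + ncost e) \<le> B"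
  shows "exec (NSet a i e) s B Q"
  unfolding exec_def using run.NSet[of a i e s] assms by blast

lemma exec_RSet:
  assumes "Q (s\<lparr>reals := (reals s)(a := (reals s a)(nval i s := rval e s))\<rparr>)" "real (1 + ncost i + rcost e) \<le> B"
  shows "exec (RSet a i e) s B Q"
  unfolding exec_def using run.RSet[of a i e s] assms by blast

lemma exec_If:
  fixes B :: real
  assumes "bval b s \<Longrightarrow> exec c1 s B Q" "\<not> bval b s \<Longrightarrow> exec c2 s B Q"
  shows "exec (If b c1 c2) s (bcost b + B) Q"
proof (cases "bval b s")
  case True
  then obtain T t where "run c1 s T t" "real T \<le> B" "Q t" using assms by (auto simp: exec_def)
  then show ?thesis unfolding exec_def
    using run.IfTrue[OF True] by (intro exI[of _ "bcost b + T"] exI[of _ t]) auto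
next
  case False
  then obtain T t where "run c2 s T t" "real T \<le> B" "Q t" using assms by (auto simp: exec_def)
  then show ?thesis unfolding exec_def
    using run.IfFalse[OF False] by (intro exI[of _ "bcost b + T"] exI[of _ t]) auto
qed

text \<open>The measure is real and falls by at least 1 in each round, because logarithms and
  energies serve as measures later; the induction runs over its floor. The summand 1 pays for the
  final test.\<close>

lemma exec_While:
  fixes \<mu> :: real
  assumes step: "\<And>s \<mu>. I \<mu> s \<Longrightarrow> bval b s \<Longrightarrow> exec c s B (\<lambda>t. \<exists>\<mu>'. \<mu>' \<le> \<mu> - 1 \<and> I \<mu>' t)"
    and nonneg: "\<And>s \<mu>. I \<mu> s \<Longrightarrow> 0 \<le> \<mu>" and B: "0 \<le> B" and I: "I \<mu> s"
  shows "exec (While b c) s ((B + bcost b) * (\<mu> + 1)) (\<lambda>t. (\<exists>\<mu>'. I \<mu>' t) \<and> \<not> bval b t)"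
  using I
proof (induction "nat \<lfloor>\<mu>\<rfloor>" arbitrary: \<mu> s rule: less_induct)
  case less
  have \<mu>: "0 \<le> \<mu>" using nonneg[OF less.prems] .
  show ?case
  proof (cases "bval b s")
    case False
    have "real (bcost b) * 1 \<le> (B + bcost b) * (\<mu> + 1)" using B \<mu> by (intro mult_mono) auto
    then show ?thesis unfolding exec_def using run.WhileFalse[OF False, of c] False less.prems
      by (intro exI[of _ "bcost b"] exI[of _ s]) auto
  next
    case True
    obtain T t \<mu>' where 1: "run c s T t" "real T \<le> B" "\<mu>' \<le> \<mu> - 1" "I \<mu>' t"
      using step[OF less.prems True] by (auto simp: exec_def)
    have "0 \<le> \<mu>'" using nonneg[OF 1(4)] .
    then have "nat \<lfloor>\<mu>'\<rfloor> < nat \<lfloor>\<mu>\<rfloor>" using 1(3) by linarith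
    from less.hyps[OF this 1(4)] obtain T2 u where 2: "run (While b c) t T2 u"
      "real T2 \<le> (B + bcost b) * (\<mu>' + 1)" "\<exists>\<mu>'. I \<mu>' u" "\<not> bval b u"
      by (auto simp: exec_def)
    have "(B + bcost b) * (\<mu>' + 1) \<le> (B + bcost b) * \<mu>" using 1(3) B by (intro mult_left_mono) auto
    then have "real (bcost b + T + T2) \<le> (B + bcost b) * (\<mu> + 1)"
      using 1 2 by (simp add: algebra_simps)
    then show ?thesis unfolding exec_def using run.WhileTrue[OF True 1(1) 2(1)] 2 by blast
  qed
qed

text \<open>Framing is tracked by array name, so that it reduces to comparing string
  literals.\<close>

definition same :: "string set \<Rightarrow> string set \<Rightarrow> state \<Rightarrow> state \<Rightarrow> bool" where
  "same X Y s t \<longleftrightarrow> (\<forall>a. a \<notin> X \<longrightarrow> nats t a = nats s a) \<and> (\<forall>a. a \<notin> Y \<longrightarrow> reals t a = reals s a)"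

lemma same_trans: "same X Y s t \<Longrightarrow> same X' Y' t u \<Longrightarrow> X \<subseteq> Z \<Longrightarrow> X' \<subseteq> Z \<Longrightarrow> Y \<subseteq> W \<Longrightarrow> Y' \<subseteq> W \<Longrightarrow> same Z W s u"
  unfolding same_def by (metis subsetD)

lemma same_refl: "same X Y s s"
  by (simp add: same_def)

lemma same_nats: "same X Y s t \<Longrightarrow> a \<notin> X \<Longrightarrow> nats t a = nats s a"
  and same_reals: "same X Y s t \<Longrightarrow> a \<notin> Y \<Longrightarrow> reals t a = reals s a"
  by (auto simp: same_def)

lemmas same_eqs = same_nats same_reals

definition For :: "string \<Rightarrow> nexp \<Rightarrow> rop com \<Rightarrow> rop com" where
  "For v e c = Seq (nset v (NConst 0))
     (While (NLess (NGet v (NConst 0)) e) (Seq c (nset v (NAdd (NGet v (NConst 0)) (NConst 1)))))"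

abbreviation set_counter :: "string \<Rightarrow> nat \<Rightarrow> state \<Rightarrow> state" where
  "set_counter v k s \<equiv> s\<lparr>nats := (nats s)(v := (nats s v)(0 := k))\<rparr>"

text \<open>The bound \<open>e\<close> is evaluated anew in each round, so the invariant has to fix
  its value. The body must leave the counter as it found it, and the invariant for
  \<open>Suc k\<close> is required only after the increment.\<close>

lemma exec_For:
  assumes e: "\<And>k s. I k s \<Longrightarrow> nval e s = n"
    and step: "\<And>k s. k < n \<Longrightarrow> I k s \<Longrightarrow> nats s v 0 = k \<Longrightarrow>
       exec c s B (\<lambda>t. nats t v 0 = k \<and> I (Suc k) (set_counter v (Suc k) t))"
    and B: "0 \<le> B" and I: "I 0 (set_counter v 0 s)"
  shows "exec (For v e c) s ((B + ncost e + 12) * (real n + 1)) (\<lambda>t. I n t)"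
proof -
  let ?b = "NLess (NGet v (NConst 0)) e :: rop bexp"
  let ?J = "\<lambda>\<mu> s. \<exists>k\<le>n. \<mu> = real (n - k) \<and> I k s \<and> nats s v 0 = k"
  have 1: "exec (nset v (NConst 0)) s 3 (\<lambda>t. ?J (real n) t)"
    by (rule exec_NSet) (use I in auto)
  have "exec (For v e c) s (3 + (B + 6 + bcost ?b) * (real n + 1)) (\<lambda>t. (\<exists>\<mu>'. ?J \<mu>' t) \<and> \<not> bval ?b t)"
    unfolding For_def
  proof (rule exec_Seq[OF 1])
    fix t assume t: "?J (real n) t"
    show "exec (While ?b (Seq c (nset v (NAdd (NGet v (NConst 0)) (NConst 1))))) t
       ((B + 6 + bcost ?b) * (real n + 1)) (\<lambda>t. (\<exists>\<mu>'. ?J \<mu>' t) \<and> \<not> bval ?b t)"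
    proof (rule exec_While[where I = ?J and B = "B + 6" and \<mu> = "real n"])
      fix s \<mu> assume J: "?J \<mu> s" and b: "bval ?b s"
      then obtain k where k: "k \<le> n" "\<mu> = real (n - k)" "I k s" "nats s v 0 = k" by auto
      have kn: "k < n" using b k e[OF k(3)] by simp
      show "exec (Seq c (nset v (NAdd (NGet v (NConst 0)) (NConst 1)))) s (B + 6)
        (\<lambda>t. \<exists>\<mu>'. \<mu>' \<le> \<mu> - 1 \<and> ?J \<mu>' t)"
      proof (rule exec_Seq[OF step[OF kn k(3,4)]])
        fix t assume t: "nats t v 0 = k \<and> I (Suc k) (set_counter v (Suc k) t)"
        then show "exec (nset v (NAdd (NGet v (NConst 0)) (NConst 1))) t 6
           (\<lambda>t. \<exists>\<mu>'. \<mu>' \<le> \<mu> - 1 \<and> ?J \<mu>' t)"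
          using kn k(2) by (intro exec_NSet exI[of _ "real (n - Suc k)"] conjI exI[of _ "Suc k"]) auto
      qed
    qed (use B t in auto)
  qed
  then show ?thesis
  proof (rule exec_mono)
    show "3 + (B + 6 + bcost ?b) * (real n + 1) \<le> (B + ncost e + 12) * (real n + 1)"
      by (simp add: algebra_simps)
  next
    fix t assume "(\<exists>\<mu>'. ?J \<mu>' t) \<and> \<not> bval ?b t"
    then obtain k where k: "k \<le> n" "I k t" "nats t v 0 = k" "\<not> bval ?b t" by auto
    then show "I n t" using e[OF k(2)] by simp
  qed
qed

text \<open>The one loop nest behind all linear algebra: entrywise maps have an empty inner loop,
  vectors and scalars have a single column, and products and sums use the inner loop.\<close>

definition Tensor :: "string \<Rightarrow> nexp \<Rightarrow> nexp \<Rightarrow> nexp \<Rightarrow> rop rexp \<Rightarrow> nexp \<Rightarrow> rop rexp \<Rightarrow> rop com" where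
  "Tensor d ix R S e0 K e = For ''i'' R (For ''j'' S (Seq (RSet d ix e0)
     (For ''k'' K (RSet d ix (ROp Plus (RGet d ix) e)))))"

definition tensor_cost :: "nexp \<Rightarrow> nexp \<Rightarrow> nexp \<Rightarrow> rop rexp \<Rightarrow> nexp \<Rightarrow> rop rexp \<Rightarrow> nat" where
  "tensor_cost ix R S e0 K e = 100 + ncost R + ncost S + ncost K + 3 * ncost ix + rcost e0 + rcost e"

text \<open>The premise for \<open>e0\<close> may use the old content of the target cell, which
  permits updates in place; the premise for \<open>e\<close> has to hold for any content of the
  target array, which is changing meanwhile. Injectivity of \<open>X\<close> keeps finished cells
  intact.\<close>

lemma exec_Tensor:
  fixes Z :: "nat \<Rightarrow> nat \<Rightarrow> real" and F :: "nat \<Rightarrow> nat \<Rightarrow> nat \<Rightarrow> real" and d :: string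
  defines "fr \<equiv> \<lambda>s t. same {''i'', ''j'', ''k''} {d} s t"
  assumes R: "\<And>s'. fr s s' \<Longrightarrow> nval R s' = r" and S: "\<And>s'. fr s s' \<Longrightarrow> nval S s' = q"
    and K: "\<And>s'. fr s s' \<Longrightarrow> nval K s' = \<kappa>"
    and ix: "\<And>s' i j. fr s s' \<Longrightarrow> i < r \<Longrightarrow> j < q \<Longrightarrow> nats s' ''i'' 0 = i \<Longrightarrow> nats s' ''j'' 0 = j \<Longrightarrow> nval ix s' = X i j"
    and e0: "\<And>s' i j. fr s s' \<Longrightarrow> i < r \<Longrightarrow> j < q \<Longrightarrow> nats s' ''i'' 0 = i \<Longrightarrow> nats s' ''j'' 0 = j \<Longrightarrow>
       reals s' d (X i j) = reals s d (X i j) \<Longrightarrow> rval e0 s' = Z i j"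
    and e: "\<And>s' i j k. fr s s' \<Longrightarrow> i < r \<Longrightarrow> j < q \<Longrightarrow> k < \<kappa> \<Longrightarrow> nats s' ''i'' 0 = i \<Longrightarrow> nats s' ''j'' 0 = j \<Longrightarrow> nats s' ''k'' 0 = k \<Longrightarrow>
       rval e s' = F i j k"
    and inj: "\<And>i j i' j'. i < r \<Longrightarrow> j < q \<Longrightarrow> i' < r \<Longrightarrow> j' < q \<Longrightarrow> X i j = X i' j' \<Longrightarrow> i = i' \<and> j = j'"
  shows "exec (Tensor d ix R S e0 K e) s (tensor_cost ix R S e0 K e * (real r + 1) * (real q + 1) * (real \<kappa> + 1))
    (\<lambda>t. fr s t \<and> (\<forall>i<r. \<forall>j<q. reals t d (X i j) = Z i j + (\<Sum>k<\<kappa>. F i j k)) \<and>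
      (\<forall>c. (\<forall>i<r. \<forall>j<q. c \<noteq> X i j) \<longrightarrow> reals t d c = reals s d c))"
proof -
  define D where "D f t \<longleftrightarrow> fr s t \<and> (\<forall>i<r. \<forall>j<q. reals t d (X i j) = f i j) \<and>
      (\<forall>c. (\<forall>i<r. \<forall>j<q. c \<noteq> X i j) \<longrightarrow> reals t d c = reals s d c)" for f t
  define V where "V i j = Z i j + (\<Sum>k<\<kappa>. F i j k)" for i j
  define O0 where "O0 i j = reals s d (X i j)" for i j
  have Dc: "D f (set_counter v k t) \<longleftrightarrow> D f t" if "v \<in> {''i'', ''j'', ''k''}" for f v k t
    using that by (auto simp: D_def fr_def same_def)
  have Dfr: "D f t \<Longrightarrow> fr s t" for f t by (simp add: D_def)
  have Dup: "D g (t\<lparr>reals := (reals t)(d := (reals t d)(X a b := v))\<rparr>)"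
    if "D f t" "a < r" "b < q" "\<And>i j. i < r \<Longrightarrow> j < q \<Longrightarrow> g i j = (if i = a \<and> j = b then v else f i j)" for f g t a b v
  proof -
    let ?t = "t\<lparr>reals := (reals t)(d := (reals t d)(X a b := v))\<rparr>"
    have "fr s ?t" using that(1) by (auto simp: D_def fr_def same_def)
    moreover have "reals ?t d (X i j) = g i j" if "i < r" "j < q" for i j
    proof (cases "i = a \<and> j = b")
      case False
      then have "X i j \<noteq> X a b" using inj[OF that \<open>a < r\<close> \<open>b < q\<close>] by blast
      then show ?thesis using \<open>D f t\<close> that False \<open>\<And>i j. i < r \<Longrightarrow> j < q \<Longrightarrow> g i j = _\<close>[OF that] by (auto simp: D_def)
    qed (use that \<open>\<And>i j. i < r \<Longrightarrow> j < q \<Longrightarrow> g i j = _\<close>[OF that] in auto)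
    moreover have "reals ?t d c = reals s d c" if "\<forall>i<r. \<forall>j<q. c \<noteq> X i j" for c
      using that \<open>D f t\<close> \<open>a < r\<close> \<open>b < q\<close> by (auto simp: D_def)
    ultimately show ?thesis by (auto simp: D_def)
  qed
  define I1 where "I1 a t \<longleftrightarrow> D (\<lambda>i j. if i < a then V i j else O0 i j) t" for a t
  define I2 where "I2 a b t \<longleftrightarrow> nats t ''i'' 0 = a \<and> D (\<lambda>i j. if i < a \<or> i = a \<and> j < b then V i j else O0 i j) t" for a b t
  define I3 where "I3 a b k t \<longleftrightarrow> nats t ''i'' 0 = a \<and> nats t ''j'' 0 = b \<and>
     D (\<lambda>i j. if i = a \<and> j = b then Z a b + (\<Sum>k'<k. F a b k') else if i < a \<or> i = a \<and> j < b then V i j else O0 i j) t" for a b k t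
  let ?B3 = "real (2 + 1 + ncost ix + ncost ix + rcost e)"
  let ?B3' = "(?B3 + ncost K + 12) * (real \<kappa> + 1)"
  let ?B2 = "real (1 + ncost ix + rcost e0) + ?B3'"
  let ?B2' = "(?B2 + ncost S + 12) * (real q + 1)"
  have inner: "exec (For ''k'' K (RSet d ix (ROp Plus (RGet d ix) e))) t ?B3' (\<lambda>t. I3 a b \<kappa> t)"
    if ab: "a < r" "b < q" and t: "I3 a b 0 t" for a b t
  proof (rule exec_For)
    show "nval K t = \<kappa>" if "I3 a b k t" for k t using that K Dfr by (auto simp: I3_def)
    show "I3 a b 0 (set_counter ''k'' 0 t)" using t by (simp add: I3_def Dc)
    fix k t assume k: "k < \<kappa>" and I: "I3 a b k t" and tk: "nats t ''k'' 0 = k"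
    have fr: "fr s t" using I Dfr by (auto simp: I3_def)
    have x: "nval ix t = X a b" using ix[OF fr ab] I by (simp add: I3_def)
    have v: "rval e t = F a b k" using e[OF fr ab k] I tk by (simp add: I3_def)
    have c: "reals t d (X a b) = Z a b + (\<Sum>k'<k. F a b k')" using I ab by (simp add: I3_def D_def)
    show "exec (RSet d ix (ROp Plus (RGet d ix) e)) t ?B3
       (\<lambda>t. nats t ''k'' 0 = k \<and> I3 a b (Suc k) (set_counter ''k'' (Suc k) t))"
    proof (rule exec_RSet)
      show "nats (t\<lparr>reals := (reals t)(d := (reals t d)(nval ix t := rval (ROp Plus (RGet d ix) e) t))\<rparr>) ''k'' 0 = k \<and>
        I3 a b (Suc k) (set_counter ''k'' (Suc k) (t\<lparr>reals := (reals t)(d := (reals t d)(nval ix t := rval (ROp Plus (RGet d ix) e) t))\<rparr>))"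
        using I tk ab unfolding I3_def by (subst Dc) (auto simp: x v c add.assoc intro!: Dup)
    qed auto
  qed auto
  have middle: "exec (For ''j'' S (Seq (RSet d ix e0) (For ''k'' K (RSet d ix (ROp Plus (RGet d ix) e))))) t ?B2' (\<lambda>t. I2 a q t)"
    if a: "a < r" and t: "I2 a 0 t" for a t
  proof (rule exec_For)
    show "nval S t = q" if "I2 a b t" for b t using that S Dfr by (auto simp: I2_def)
    show "I2 a 0 (set_counter ''j'' 0 t)" using t by (simp add: I2_def Dc)
    fix b t assume b: "b < q" and I: "I2 a b t" and tb: "nats t ''j'' 0 = b"
    have fr: "fr s t" using I Dfr by (auto simp: I2_def)
    have x: "nval ix t = X a b" using ix[OF fr a b] I tb by (simp add: I2_def)
    have c: "reals t d (X a b) = reals s d (X a b)" using I a b by (simp add: I2_def D_def O0_def)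
    have v: "rval e0 t = Z a b" using e0[OF fr a b _ tb c] I by (simp add: I2_def)
    show "exec (Seq (RSet d ix e0) (For ''k'' K (RSet d ix (ROp Plus (RGet d ix) e)))) t ?B2
       (\<lambda>t. nats t ''j'' 0 = b \<and> I2 a (Suc b) (set_counter ''j'' (Suc b) t))"
    proof (rule exec_Seq)
      show "exec (RSet d ix e0) t (real (1 + ncost ix + rcost e0)) (I3 a b 0)"
      proof (rule exec_RSet)
        show "I3 a b 0 (t\<lparr>reals := (reals t)(d := (reals t d)(nval ix t := rval e0 t))\<rparr>)"
          using I tb a b unfolding I3_def I2_def by (auto simp: x v intro!: Dup)
      qed auto
      fix t assume "I3 a b 0 t"
      from inner[OF a b this] show "exec (For ''k'' K (RSet d ix (ROp Plus (RGet d ix) e))) t ?B3'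
         (\<lambda>t. nats t ''j'' 0 = b \<and> I2 a (Suc b) (set_counter ''j'' (Suc b) t))"
      proof (rule exec_mono)
        fix t assume t: "I3 a b \<kappa> t"
        have "(\<lambda>i j. if i = a \<and> j = b then Z a b + (\<Sum>k'<\<kappa>. F a b k') else if i < a \<or> i = a \<and> j < b then V i j else O0 i j)
           = (\<lambda>i j. if i < a \<or> i = a \<and> j < Suc b then V i j else O0 i j)"
          by (auto simp: fun_eq_iff V_def)
        then show "nats t ''j'' 0 = b \<and> I2 a (Suc b) (set_counter ''j'' (Suc b) t)"
          using t by (simp add: I3_def I2_def Dc)
      qed simp
    qed
  qed auto
  have "exec (Tensor d ix R S e0 K e) s ((?B2' + ncost R + 12) * (real r + 1)) (\<lambda>t. I1 r t)"
    unfolding Tensor_def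
  proof (rule exec_For)
    show "nval R t = r" if "I1 a t" for a t using that R Dfr by (auto simp: I1_def)
    show "I1 0 (set_counter ''i'' 0 s)" by (simp add: I1_def Dc) (simp add: D_def fr_def same_refl O0_def)
    fix a t assume a: "a < r" and I: "I1 a t" and ta: "nats t ''i'' 0 = a"
    have "I2 a 0 t" using I ta by (simp add: I1_def I2_def)
    from middle[OF a this] show "exec (For ''j'' S (Seq (RSet d ix e0) (For ''k'' K (RSet d ix (ROp Plus (RGet d ix) e))))) t ?B2'
      (\<lambda>t. nats t ''i'' 0 = a \<and> I1 (Suc a) (set_counter ''i'' (Suc a) t))"
    proof (rule exec_mono)
      fix t assume t: "I2 a q t"
      then have D: "D (\<lambda>i j. if i < a \<or> i = a \<and> j < q then V i j else O0 i j) t" "nats t ''i'' 0 = a" by (auto simp: I2_def)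
      have "D (\<lambda>i j. if i < Suc a then V i j else O0 i j) t"
        using D(1) unfolding D_def by (auto simp: less_Suc_eq)
      then show "nats t ''i'' 0 = a \<and> I1 (Suc a) (set_counter ''i'' (Suc a) t)" using D by (simp add: I1_def Dc)
    qed simp
  qed auto
  then show ?thesis
  proof (rule exec_mono)
    let ?k = "real \<kappa> + 1" and ?q = "real q + 1" and ?r = "real r + 1"
    have le: "(x + y) * z \<le> (x' + y) * (z * w)" if "x \<le> x' * w" "1 \<le> w" "0 \<le> y" "0 \<le> z" for x y z w x' :: real
    proof -
      have "y * 1 \<le> y * w" using that by (intro mult_left_mono) auto
      then have "x + y \<le> (x' + y) * w" using that by (simp add: distrib_right)
      then have "(x + y) * z \<le> (x' + y) * w * z" using that by (intro mult_right_mono) auto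
      then show ?thesis by (simp add: mult_ac)
    qed
    have 2: "?B2' \<le> (real (15 + 1 + 12 + 3 * ncost ix + rcost e + rcost e0 + ncost K + ncost S)) * (?q * ?k)"
    proof -
      have "?B2 + ncost S + 12 = ?B3' + real (13 + ncost ix + rcost e0 + ncost S)" by simp
      moreover have "(?B3' + real (13 + ncost ix + rcost e0 + ncost S)) * ?q \<le> ((?B3 + ncost K + 12) + real (13 + ncost ix + rcost e0 + ncost S)) * (?q * ?k)"
        by (rule le) auto
      ultimately show ?thesis by (simp add: algebra_simps)
    qed
    have "(?B2' + ncost R + 12) * ?r = (?B2' + real (ncost R + 12)) * ?r" by simp
    also have "\<dots> \<le> (real (15 + 1 + 12 + 3 * ncost ix + rcost e + rcost e0 + ncost K + ncost S) + real (ncost R + 12)) * (?r * (?q * ?k))"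
    proof (rule le[OF 2])
      have "1 * 1 \<le> ?q * ?k" by (intro mult_mono) auto
      then show "1 \<le> ?q * ?k" by simp
    qed auto
    also have "\<dots> \<le> real (tensor_cost ix R S e0 K e) * (?r * (?q * ?k))"
      by (intro mult_right_mono) (auto simp: tensor_cost_def)
    finally show "(?B2' + ncost R + 12) * ?r \<le> real (tensor_cost ix R S e0 K e) * ?r * ?q * ?k" by (simp only: mult.assoc)
  next
    fix t assume "I1 r t"
    then show "fr s t \<and> (\<forall>i<r. \<forall>j<q. reals t d (X i j) = Z i j + (\<Sum>k<\<kappa>. F i j k)) \<and>
      (\<forall>c. (\<forall>i<r. \<forall>j<q. c \<noteq> X i j) \<longrightarrow> reals t d c = reals s d c)"
      by (auto simp: I1_def D_def V_def)
  qed
qed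

section \<open>Matrix multiplication programs\<close>

primrec rename_n :: "(string \<Rightarrow> string) \<Rightarrow> nexp \<Rightarrow> nexp" where
  "rename_n f (NConst k) = NConst k"
| "rename_n f (NGet a i) = NGet (f a) (rename_n f i)"
| "rename_n f (NAdd i j) = NAdd (rename_n f i) (rename_n f j)"
| "rename_n f (NSub i j) = NSub (rename_n f i) (rename_n f j)"
| "rename_n f (NMul i j) = NMul (rename_n f i) (rename_n f j)"

primrec rename_r :: "(string \<Rightarrow> string) \<Rightarrow> rop rexp \<Rightarrow> rop rexp" where
  "rename_r f (ROfNat i) = ROfNat (rename_n f i)"
| "rename_r f (RGet a i) = RGet (f a) (rename_n f i)"
| "rename_r f (ROp g x y) = ROp g (rename_r f x) (rename_r f y)"

primrec rename_b :: "(string \<Rightarrow> string) \<Rightarrow> rop bexp \<Rightarrow> rop bexp" where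
  "rename_b f (NLess i j) = NLess (rename_n f i) (rename_n f j)"
| "rename_b f (RLess x y) = RLess (rename_r f x) (rename_r f y)"
| "rename_b f (BNot b) = BNot (rename_b f b)"
| "rename_b f (BAnd b1 b2) = BAnd (rename_b f b1) (rename_b f b2)"

primrec rename_c :: "(string \<Rightarrow> string) \<Rightarrow> rop com \<Rightarrow> rop com" where
  "rename_c f Skip = Skip"
| "rename_c f (NSet a i e) = NSet (f a) (rename_n f i) (rename_n f e)"
| "rename_c f (RSet a i e) = RSet (f a) (rename_n f i) (rename_r f e)"
| "rename_c f (Seq c d) = Seq (rename_c f c) (rename_c f d)"
| "rename_c f (If b c d) = If (rename_b f b) (rename_c f c) (rename_c f d)"
| "rename_c f (While b c) = While (rename_b f b) (rename_c f c)"

text \<open>The state that the original program sees while its renamed copy runs in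
  \<open>s\<close>.\<close>

definition pull :: "(string \<Rightarrow> string) \<Rightarrow> state \<Rightarrow> state" where
  "pull f s = \<lparr>nats = (\<lambda>a. nats s (f a)), reals = (\<lambda>a. reals s (f a))\<rparr>"

lemma nval_rename [simp]: "nval (rename_n f e) s = nval e (pull f s)"
  by (induction e) (auto simp: pull_def)

lemma rval_rename [simp]: "rval (rename_r f e) s = rval e (pull f s)"
  by (induction e) (auto simp: pull_def)

lemma bval_rename [simp]: "bval (rename_b f e) s = bval e (pull f s)"
  by (induction e) auto

lemma ncost_rename [simp]: "ncost (rename_n f e) = ncost e"
  by (induction e) auto

lemma rcost_rename [simp]: "rcost (rename_r f e) = rcost e"
  by (induction e) auto

lemma bcost_rename [simp]: "bcost (rename_b f e) = bcost e"
  by (induction e) auto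

text \<open>A simulation with equal costs, by induction on the run. Injectivity of the renaming
  ensures that a write to one renamed array leaves the images of all others alone.\<close>

lemma run_rename:
  assumes "run c s T t" "inj f" "pull f s' = s"
  shows "\<exists>t'. run (rename_c f c) s' T t' \<and> pull f t' = t \<and> same (range f) (range f) s' t'"
  using assms
proof (induction arbitrary: s' rule: run.induct)
  case (Skip s)
  then show ?case using run.Skip by (auto intro!: exI[of _ s'] same_refl)
next
  case (NSet a i e s)
  let ?t = "s'\<lparr>nats := (nats s')(f a := (nats s' (f a))(nval i s := nval e s))\<rparr>"
  have "run (rename_c f (NSet a i e)) s' (1 + ncost i + ncost e) ?t"
    using run.NSet[of "f a" "rename_n f i" "rename_n f e" s'] NSet by simp
  moreover have "pull f ?t = s\<lparr>nats := (nats s)(a := (nats s a)(nval i s := nval e s))\<rparr>"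
    using NSet by (auto simp: pull_def fun_eq_iff inj_eq)
  ultimately show ?case by (auto simp: same_def intro!: exI[of _ ?t])
next
  case (RSet a i e s)
  let ?t = "s'\<lparr>reals := (reals s')(f a := (reals s' (f a))(nval i s := rval e s))\<rparr>"
  have "run (rename_c f (RSet a i e)) s' (1 + ncost i + rcost e) ?t"
    using run.RSet[of "f a" "rename_n f i" "rename_r f e" s'] RSet(2) by simp
  moreover have "pull f ?t = s\<lparr>reals := (reals s)(a := (reals s a)(nval i s := rval e s))\<rparr>"
    using RSet by (auto simp: pull_def fun_eq_iff inj_eq)
  ultimately show ?case by (auto simp: same_def intro!: exI[of _ ?t])
next
  case (Seq c1 s T1 u c2 T2 t)
  obtain u' where u: "run (rename_c f c1) s' T1 u'" "pull f u' = u" "same (range f) (range f) s' u'"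
    using Seq by blast
  obtain t' where t: "run (rename_c f c2) u' T2 t'" "pull f t' = t" "same (range f) (range f) u' t'"
    using Seq u by blast
  show ?case using run.Seq[OF u(1) t(1)] t(2) same_trans[OF u(3) t(3)] by auto
next
  case (IfTrue b s c1 T t c2)
  then obtain t' where t: "run (rename_c f c1) s' T t'" "pull f t' = t" "same (range f) (range f) s' t'" by blast
  show ?case using run.IfTrue[OF _ t(1), of "rename_b f b" "rename_c f c2"] IfTrue t by auto
next
  case (IfFalse b s c2 T t c1)
  then obtain t' where t: "run (rename_c f c2) s' T t'" "pull f t' = t" "same (range f) (range f) s' t'" by blast
  show ?case using run.IfFalse[OF _ t(1), of "rename_b f b" "rename_c f c1"] IfFalse t by auto
next
  case (WhileFalse b s c)
  then show ?case using run.WhileFalse[of "rename_b f b" s' "rename_c f c"] by (auto simp: same_refl)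
next
  case (WhileTrue b s c T1 u T2 t)
  obtain u' where u: "run (rename_c f c) s' T1 u'" "pull f u' = u" "same (range f) (range f) s' u'"
    using WhileTrue by blast
  obtain t' where t: "run (rename_c f (While b c)) u' T2 t'" "pull f t' = t" "same (range f) (range f) u' t'"
    using WhileTrue u by blast
  have "run (rename_c f (While b c)) s' (bcost b + T1 + T2) t'"
    using run.WhileTrue[of "rename_b f b" s' "rename_c f c" T1 u' T2 t'] WhileTrue u t by simp
  then show ?case using t(2) same_trans[OF u(3) t(3)] by auto
qed

text \<open>
  The given multiplication program may use arrays of any name. Renaming confines it to the names that
  start with \<open>z\<close>, which are used for nothing else.
\<close>

definition znames :: "string set" where
  "znames = range ((#) CHR ''z'')"

lemma znames_iff: "a \<in> znames \<longleftrightarrow> a \<noteq> [] \<and> hd a = CHR ''z''"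
  by (cases a) (auto simp: znames_def)

abbreviation "product_in N s t \<equiv>
  (\<forall>i<N. \<forall>j<N. reals t ''zC'' (i * N + j) = (\<Sum>k<N. reals s ''zA'' (i * N + k) * reals s ''zB'' (k * N + j)))"

text \<open>The matrices of the definition are read off the current contents of the arrays
  \<open>zA\<close> and \<open>zB\<close>, so that the specification speaks about states only. The
  absolute value makes the constant nonnegative.\<close>

lemma admissible_multiplier:
  assumes "matmul_exponent_admissible \<tau>"
  shows "\<exists>c. \<exists>C\<ge>0. \<forall>N\<ge>1. \<forall>s. nats s ''zN'' 0 = N \<longrightarrow>
    exec c s (C * real N powr \<tau>) (\<lambda>t. same znames znames s t \<and>
      product_in N s t)"
proof -
  obtain c C where c: "\<And>N A B s. N \<ge> 1 \<Longrightarrow> A \<in> carrier_mat N N \<Longrightarrow> B \<in> carrier_mat N N \<Longrightarrow>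
     nats s ''N'' 0 = N \<Longrightarrow> holds_mat s ''A'' A \<Longrightarrow> holds_mat s ''B'' B \<Longrightarrow>
          \<exists>T t. run c s T t \<and> holds_mat t ''C'' (A * B) \<and> real T \<le> C * real N powr \<tau>"
    using assms unfolding matmul_exponent_admissible_def by blast
  let ?f = "(#) CHR ''z''"
  show ?thesis
  proof (intro exI[of _ "rename_c ?f c"] exI[of _ "\<bar>C\<bar>"] conjI allI impI)
    fix N :: nat and s :: state assume N: "1 \<le> N" and sN: "nats s ''zN'' 0 = N"
    define A where "A = mat N N (\<lambda>(i, j). reals s ''zA'' (i * N + j))"
    define B where "B = mat N N (\<lambda>(i, j). reals s ''zB'' (i * N + j))"
    have "\<exists>T t. run c (pull ?f s) T t \<and> holds_mat t ''C'' (A * B) \<and> real T \<le> C * real N powr \<tau>"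
      by (rule c) (use N sN in \<open>auto simp: A_def B_def pull_def holds_mat_def\<close>)
    then obtain T t where t: "run c (pull ?f s) T t" "holds_mat t ''C'' (A * B)" "real T \<le> C * real N powr \<tau>" by blast
    from run_rename[OF t(1) _ refl] obtain t' where t': "run (rename_c ?f c) s T t'" "pull ?f t' = t" "same (range ?f) (range ?f) s t'"
      by auto
    have "reals t' ''zC'' (i * N + j) = (\<Sum>k<N. reals s ''zA'' (i * N + k) * reals s ''zB'' (k * N + j))"
      if "i < N" "j < N" for i j
    proof -
      have "reals t' ''zC'' (i * N + j) = (A * B) $$ (i, j)"
        using t(2) that unfolding t'(2)[symmetric] by (simp add: holds_mat_def A_def B_def pull_def)
      also have "\<dots> = (\<Sum>k<N. reals s ''zA'' (i * N + k) * reals s ''zB'' (k * N + j))"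
        using that by (simp add: A_def B_def scalar_prod_def atLeast0LessThan)
      finally show ?thesis .
    qed
    moreover have "real T \<le> \<bar>C\<bar> * real N powr \<tau>"
      using t(3) by (rule order_trans) (intro mult_right_mono, auto)
    ultimately show "exec (rename_c ?f c) s (\<bar>C\<bar> * real N powr \<tau>) (\<lambda>t. same znames znames s t \<and>
      product_in N s t)"
      unfolding exec_def using t' by (auto simp: znames_def)
  qed simp
qed

section \<open>Bounds for admissible exponents\<close>

lemma few_changes_trans:
  fixes f g h :: "nat \<Rightarrow> real"
  assumes "finite {i. g i \<noteq> f i} \<and> card {i. g i \<noteq> f i} \<le> T1" "finite {i. h i \<noteq> g i} \<and> card {i. h i \<noteq> g i} \<le> T2"
    and "T1 + T2 \<le> T"
  shows "finite {i. h i \<noteq> f i} \<and> card {i. h i \<noteq> f i} \<le> T"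
proof -
  have sub: "{i. h i \<noteq> f i} \<subseteq> {i. g i \<noteq> f i} \<union> {i. h i \<noteq> g i}" by auto
  have fin: "finite ({i. g i \<noteq> f i} \<union> {i. h i \<noteq> g i})" using assms by simp
  have "card {i. h i \<noteq> f i} \<le> card {i. g i \<noteq> f i} + card {i. h i \<noteq> g i}"
    using card_mono[OF fin sub] card_Un_le le_trans by blast
  then show ?thesis using assms finite_subset[OF sub fin] by linarith
qed

text \<open>Only assignments change cells, and each changes one cell for at least one unit of time.
  Counting changed output cells thus bounds the time from below.\<close>

lemma run_changes_few:
  "run c s T t \<Longrightarrow> finite {i. reals t a i \<noteq> reals s a i} \<and> card {i. reals t a i \<noteq> reals s a i} \<le> T"
proof (induction rule: run.induct)
  case (RSet b i e s)
  have sub: "{j. reals (s\<lparr>reals := (reals s)(b := (reals s b)(nval i s := rval e s))\<rparr>) a j \<noteq> reals s a j} \<subseteq> {nval i s}"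
    by auto
  show ?case using finite_subset[OF sub] card_mono[OF _ sub] by simp
next
  case (Seq c1 s T1 u c2 T2 t)
  show ?case by (rule few_changes_trans[OF Seq.IH]) simp
next
  case (WhileTrue b s c T1 u T2 t)
  show ?case by (rule few_changes_trans[OF WhileTrue.IH]) simp
qed auto

text \<open>A multiplication program has to overwrite every entry of an output array filled with ones.\<close>

lemma admissible_ge_2:
  assumes "matmul_exponent_admissible \<tau>"
  shows "2 \<le> \<tau>"
proof (rule ccontr)
  assume "\<not> 2 \<le> \<tau>"
  then have \<tau>: "0 < 2 - \<tau>" by simp
  obtain c C where c: "\<And>N A B s. N \<ge> 1 \<Longrightarrow> A \<in> carrier_mat N N \<Longrightarrow> B \<in> carrier_mat N N \<Longrightarrow>
     nats s ''N'' 0 = N \<Longrightarrow> holds_mat s ''A'' A \<Longrightarrow> holds_mat s ''B'' B \<Longrightarrow>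
          \<exists>T t. run c s T t \<and> holds_mat t ''C'' (A * B) \<and> real T \<le> C * real N powr \<tau>"
    using assms unfolding matmul_exponent_admissible_def by blast
  have bound: "real N powr (2 - \<tau>) \<le> C" if N: "1 \<le> N" for N :: nat
  proof -
    define s where "s = \<lparr>nats = (\<lambda>_ _. N), reals = (\<lambda>a _. if a = ''C'' then 1 else 0)\<rparr>"
    have "\<exists>T t. run c s T t \<and> holds_mat t ''C'' (0\<^sub>m N N * 0\<^sub>m N N) \<and> real T \<le> C * real N powr \<tau>"
      by (rule c) (use N in \<open>auto simp: s_def holds_mat_def\<close>)
    then obtain T t where t: "run c s T t" "holds_mat t ''C'' (0\<^sub>m N N * 0\<^sub>m N N)" "real T \<le> C * real N powr \<tau>" by blast
    have "{..<N * N} \<subseteq> {i. reals t ''C'' i \<noteq> reals s ''C'' i}"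
    proof
      fix i assume "i \<in> {..<N * N}"
      then have "i div N < N" "i mod N < N" using N by (auto simp: less_mult_imp_div_less)
      moreover have "reals t ''C'' (a * N + b) = 0" if "a < N" "b < N" for a b
        using t(2) that by (simp add: holds_mat_def)
      ultimately have "reals t ''C'' (i div N * N + i mod N) = 0" by blast
      then show "i \<in> {i. reals t ''C'' i \<noteq> reals s ''C'' i}" by (simp add: s_def)
    qed
    then have "card {..<N * N} \<le> T" using run_changes_few[OF t(1), of "''C''"] by (blast intro: card_mono le_trans)
    then have "N * N \<le> T" by simp
    then have "real (N * N) \<le> real T" by (rule of_nat_mono)
    then have "real N * real N \<le> C * real N powr \<tau>" using t(3) unfolding of_nat_mult by linarith
    moreover have "real N * real N = real N powr (2 - \<tau>) * real N powr \<tau>"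
      using N by (simp add: powr_add[symmetric] power2_eq_square)
    ultimately show ?thesis using N by simp
  qed
  have "1 \<le> C" using bound[of 1] by simp
  obtain N :: nat where N: "C powr (1 / (2 - \<tau>)) < real N" using reals_Archimedean2 by blast
  have "0 < real N" using N by (rule order.strict_trans1[rotated]) simp
  then have "1 \<le> N" by simp
  have "C = (C powr (1 / (2 - \<tau>))) powr (2 - \<tau>)" using \<tau> \<open>1 \<le> C\<close> by (simp add: powr_powr)
  also have "\<dots> < real N powr (2 - \<tau>)" using N \<tau> by (intro powr_less_mono2) auto
  finally show False using bound[OF \<open>1 \<le> N\<close>] by simp
qed

abbreviation "nv a \<equiv> NGet a (NConst 0)"

text \<open>The schoolbook product, as an instance of \<open>Tensor\<close>. It shows that the set
  whose infimum is \<open>matmul_omega\<close> is nonempty, so that this infimum can be approximated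
  from above.\<close>

lemma admissible_three: "matmul_exponent_admissible 3"
proof -
  let ?ix = "NAdd (NMul (nv ''i'') (nv ''N'')) (nv ''j'')"
  let ?e = "ROp Times (RGet ''A'' (NAdd (NMul (nv ''i'') (nv ''N'')) (nv ''k''))) (RGet ''B'' (NAdd (NMul (nv ''k'') (nv ''N'')) (nv ''j'')))"
  let ?z = "ROfNat (NConst 0) :: rop rexp"
  define c where "c = Tensor ''C'' ?ix (nv ''N'') (nv ''N'') ?z (nv ''N'') ?e"
  let ?K = "real (tensor_cost ?ix (nv ''N'') (nv ''N'') ?z (nv ''N'') ?e)"
  have "Power \<notin> ops c" by (simp add: c_def Tensor_def For_def)
  moreover have "\<exists>T t. run c s T t \<and> holds_mat t ''C'' (A * B) \<and> real T \<le> (?K * 8) * real N powr 3"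
    if N: "1 \<le> N" and A: "A \<in> carrier_mat N N" and B: "B \<in> carrier_mat N N"
      and sN: "nats s ''N'' 0 = N" and sA: "holds_mat s ''A'' A" and sB: "holds_mat s ''B'' B" for N A B s
  proof -
    have "exec c s (?K * (real N + 1) * (real N + 1) * (real N + 1))
      (\<lambda>t. same {''i'', ''j'', ''k''} {''C''} s t \<and> (\<forall>i<N. \<forall>j<N. reals t ''C'' (i * N + j) = 0 + (\<Sum>k<N. A $$ (i, k) * B $$ (k, j))) \<and>
      (\<forall>c. (\<forall>i<N. \<forall>j<N. c \<noteq> i * N + j) \<longrightarrow> reals t ''C'' c = reals s ''C'' c))"
      unfolding c_def
    proof (rule exec_Tensor[where F = "\<lambda>i j k. A $$ (i, k) * B $$ (k, j)" and Z = "\<lambda>_ _. 0" and X = "\<lambda>i j. i * N + j"])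
      fix i j i' j' assume "i < N" "j < N" "i' < N" "j' < N" and eq: "i * N + j = i' * N + j'"
      then have "(i * N + j) div N = (i' * N + j') div N" "(i * N + j) mod N = (i' * N + j') mod N" by simp_all
      then show "i = i' \<and> j = j'" using \<open>j < N\<close> \<open>j' < N\<close> by simp
    qed (use sN sA sB A B in \<open>auto simp: same_def holds_mat_def\<close>)
    then obtain T t where t: "run c s T t" "real T \<le> ?K * (real N + 1) * (real N + 1) * (real N + 1)"
      "\<forall>i<N. \<forall>j<N. reals t ''C'' (i * N + j) = (\<Sum>k<N. A $$ (i, k) * B $$ (k, j))" by (auto simp: exec_def)
    have "?K * (real N + 1) * (real N + 1) * (real N + 1) \<le> ?K * (2 * real N) * (2 * real N) * (2 * real N)"
      using N by (intro mult_mono mult_nonneg_nonneg) auto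
    also have "\<dots> = (?K * 8) * real N powr 3" using N by (simp add: power3_eq_cube)
    finally have "real T \<le> (?K * 8) * real N powr 3" using t by linarith
    moreover have "holds_mat t ''C'' (A * B)"
      using t(3) A B by (auto simp: holds_mat_def scalar_prod_def atLeast0LessThan)
    ultimately show ?thesis using t(1) by blast
  qed
  ultimately show ?thesis unfolding matmul_exponent_admissible_def by blast
qed

text \<open>An infimum that is not attained still leaves an admissible exponent below any larger
  \<tau>; the second alternative covers an attained one.\<close>

lemma admissible_below:
  assumes "\<tau> > matmul_omega \<or> (\<tau> = matmul_omega \<and> matmul_exponent_admissible matmul_omega)"
  shows "\<exists>\<tau>'\<le>\<tau>. matmul_exponent_admissible \<tau>'"
proof (cases "\<tau> > matmul_omega")
  case True
  have "{\<tau>. matmul_exponent_admissible \<tau>} \<noteq> {}" using admissible_three by blast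
  from cInf_lessD[OF this] True show ?thesis unfolding matmul_omega_def by (auto intro: less_imp_le)
qed (use assms in auto)

section \<open>Computing a generalized inverse\<close>

declare znames_iff [simp]

lemma same_mono: "same X Y s t \<Longrightarrow> X \<subseteq> X' \<Longrightarrow> Y \<subseteq> Y' \<Longrightarrow> same X' Y' s t"
  unfolding same_def by blast

definition Map :: "string \<Rightarrow> nexp \<Rightarrow> nexp \<Rightarrow> nexp \<Rightarrow> rop rexp \<Rightarrow> rop com" where
  "Map d ix R S e = Tensor d ix R S e (NConst 0) (ROfNat (NConst 0))"

definition map_cost :: "nexp \<Rightarrow> nexp \<Rightarrow> nexp \<Rightarrow> rop rexp \<Rightarrow> real" where
  "map_cost ix R S e = real (tensor_cost ix R S e (NConst 0) (ROfNat (NConst 0)))"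

lemma map_cost_nonneg: "0 \<le> map_cost ix R S e"
  by (simp add: map_cost_def)

abbreviation "ijk \<equiv> {''i'', ''j'', ''k''}"

lemma exec_Map:
  assumes R: "\<And>s'. same ijk {d} s s' \<Longrightarrow> nval R s' = r" and S: "\<And>s'. same ijk {d} s s' \<Longrightarrow> nval S s' = q"
    and ix: "\<And>s' i j. same ijk {d} s s' \<Longrightarrow> i < r \<Longrightarrow> j < q \<Longrightarrow> nats s' ''i'' 0 = i \<Longrightarrow> nats s' ''j'' 0 = j \<Longrightarrow> nval ix s' = X i j"
    and e: "\<And>s' i j. same ijk {d} s s' \<Longrightarrow> i < r \<Longrightarrow> j < q \<Longrightarrow> nats s' ''i'' 0 = i \<Longrightarrow> nats s' ''j'' 0 = j \<Longrightarrow>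
       reals s' d (X i j) = reals s d (X i j) \<Longrightarrow> rval e s' = Z i j"
    and inj: "\<And>i j i' j'. i < r \<Longrightarrow> j < q \<Longrightarrow> i' < r \<Longrightarrow> j' < q \<Longrightarrow> X i j = X i' j' \<Longrightarrow> i = i' \<and> j = j'"
  shows "exec (Map d ix R S e) s (map_cost ix R S e * (real r + 1) * (real q + 1))
    (\<lambda>t. same ijk {d} s t \<and> (\<forall>i<r. \<forall>j<q. reals t d (X i j) = Z i j) \<and>
      (\<forall>c. (\<forall>i<r. \<forall>j<q. c \<noteq> X i j) \<longrightarrow> reals t d c = reals s d c))"
proof -
  have "exec (Map d ix R S e) s (map_cost ix R S e * (real r + 1) * (real q + 1) * (real 0 + 1))
    (\<lambda>t. same ijk {d} s t \<and> (\<forall>i<r. \<forall>j<q. reals t d (X i j) = Z i j + (\<Sum>k<(0::nat). 0)) \<and>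
      (\<forall>c. (\<forall>i<r. \<forall>j<q. c \<noteq> X i j) \<longrightarrow> reals t d c = reals s d c))"
    unfolding Map_def map_cost_def
    by (rule exec_Tensor[where F = "\<lambda>_ _ _. 0"], erule R, erule S, simp, erule (4) ix, erule (5) e, simp, erule (4) inj)
  then show ?thesis by simp
qed

lemma index_inj:
  fixes N :: nat
  assumes "j < N" "j' < N" "i * N + j = i' * N + j'" shows "i = i' \<and> j = j'"
proof -
  have "(i * N + j) div N = (i' * N + j') div N" "(i * N + j) mod N = (i' * N + j') mod N" using assms(3) by simp_all
  then show ?thesis using assms(1,2) by simp
qed

text \<open>Here \<tau> \<ge> 2 pays off: every pass over the entries of a matrix can be charged to
  the cost of one multiplication.\<close>

lemma Suc_sq_le: "1 \<le> h \<Longrightarrow> 2 \<le> \<tau> \<Longrightarrow> (real h + 1) * (real h + 1) \<le> 4 * real h powr \<tau>"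
proof -
  assume h: "1 \<le> h" and \<tau>: "2 \<le> \<tau>"
  have "(real h + 1) * (real h + 1) \<le> (2 * real h) * (2 * real h)" using h by (intro mult_mono) auto
  also have "\<dots> = 4 * real h powr 2" using h by (simp add: power2_eq_square)
  also have "\<dots> \<le> 4 * real h powr \<tau>" using h \<tau> by (intro mult_left_mono powr_mono) auto
  finally show ?thesis .
qed

abbreviation "hix \<equiv> NAdd (NMul (nv ''i'') (nv ''h'')) (nv ''j'')"
abbreviation "hixT \<equiv> NAdd (NMul (nv ''j'') (nv ''h'')) (nv ''i'')"

lemma exec_Map_square:
  assumes h: "1 \<le> h" "nats s ''h'' 0 = h" and \<tau>: "2 \<le> \<tau>"
    and ix: "\<And>s' i j. same ijk {d} s s' \<Longrightarrow> i < h \<Longrightarrow> j < h \<Longrightarrow> nats s' ''i'' 0 = i \<Longrightarrow> nats s' ''j'' 0 = j \<Longrightarrow> nval ix s' = X i j"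
    and e: "\<And>s' i j. same ijk {d} s s' \<Longrightarrow> i < h \<Longrightarrow> j < h \<Longrightarrow> nats s' ''i'' 0 = i \<Longrightarrow> nats s' ''j'' 0 = j \<Longrightarrow>
       reals s' d (X i j) = reals s d (X i j) \<Longrightarrow> rval e s' = Z i j"
    and inj: "\<And>i j i' j'. i < h \<Longrightarrow> j < h \<Longrightarrow> i' < h \<Longrightarrow> j' < h \<Longrightarrow> X i j = X i' j' \<Longrightarrow> i = i' \<and> j = j'"
  shows "exec (Map d ix (nv ''h'') (nv ''h'') e) s (4 * map_cost ix (nv ''h'') (nv ''h'') e * real h powr \<tau>)
    (\<lambda>t. same ijk {d} s t \<and> (\<forall>i<h. \<forall>j<h. reals t d (X i j) = Z i j) \<and>
      (\<forall>c. (\<forall>i<h. \<forall>j<h. c \<noteq> X i j) \<longrightarrow> reals t d c = reals s d c))"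
proof -
  let ?c = "map_cost ix (nv ''h'') (nv ''h'') e"
  have "exec (Map d ix (nv ''h'') (nv ''h'') e) s (?c * (real h + 1) * (real h + 1))
    (\<lambda>t. same ijk {d} s t \<and> (\<forall>i<h. \<forall>j<h. reals t d (X i j) = Z i j) \<and>
      (\<forall>c. (\<forall>i<h. \<forall>j<h. c \<noteq> X i j) \<longrightarrow> reals t d c = reals s d c))"
    by (rule exec_Map, simp add: same_def h, simp add: same_def h, erule (4) ix, erule (5) e, erule (4) inj)
  moreover have "?c * (real h + 1) * (real h + 1) \<le> 4 * ?c * real h powr \<tau>"
    using mult_left_mono[OF Suc_sq_le[OF h(1) \<tau>] map_cost_nonneg[of ix "nv ''h''" "nv ''h''" e]] by (simp add: mult_ac)
  ultimately show ?thesis by (rule exec_mono)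
qed

lemma exec_Map_hix:
  assumes h: "1 \<le> h" "nats s ''h'' 0 = h" and \<tau>: "2 \<le> \<tau>"
    and e: "\<And>s' i j. same ijk {d} s s' \<Longrightarrow> i < h \<Longrightarrow> j < h \<Longrightarrow> nats s' ''i'' 0 = i \<Longrightarrow> nats s' ''j'' 0 = j \<Longrightarrow> rval e s' = Z i j"
  shows "exec (Map d hix (nv ''h'') (nv ''h'') e) s (4 * map_cost hix (nv ''h'') (nv ''h'') e * real h powr \<tau>)
    (\<lambda>t. same ijk {d} s t \<and> (\<forall>i<h. \<forall>j<h. reals t d (i * h + j) = Z i j))"
proof (rule exec_mono[OF exec_Map_square[OF h \<tau>, where X = "\<lambda>i j. i * h + j" and Z = Z] order_refl])
  fix s' i j assume "same ijk {d} s s'" "nats s' ''i'' 0 = i" "nats s' ''j'' 0 = j"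
  then show "nval hix s' = i * h + j" using h by (simp add: same_def)
next
  fix i j i' j' assume "j < h" "j' < h" "i * h + j = i' * h + j'"
  then show "i = i' \<and> j = j'" by (rule index_inj)
qed (erule (4) e, simp)

section \<open>Schur complement and assembly inside one array\<close>

abbreviation "Gat r c \<equiv> NAdd (NMul r (nv ''N'')) c"
abbreviation "qi \<equiv> NAdd (nv ''q'') (nv ''i'')"
abbreviation "qj \<equiv> NAdd (nv ''q'') (nv ''j'')"
abbreviation "qhi \<equiv> NAdd (NAdd (nv ''q'') (nv ''h'')) (nv ''i'')"
abbreviation "qhj \<equiv> NAdd (NAdd (nv ''q'') (nv ''h'')) (nv ''j'')"
abbreviation "rzero \<equiv> ROfNat (NConst 0) :: rop rexp"
abbreviation "ginv_nats \<equiv> ijk \<union> znames"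
abbreviation "ginv_reals \<equiv> {''U'', ''V'', ''X'', ''G''} \<union> znames"

text \<open>A fixed multiplication program as a black box. It touches only \<open>znames\<close>, so
  it can be called in the middle of any computation that keeps its data elsewhere.\<close>

locale multiplier =
  fixes mulc :: "rop com" and \<tau> Cm :: real
  assumes \<tau>: "2 \<le> \<tau>" and Cm: "0 \<le> Cm"
    and mulc: "\<And>N s. 1 \<le> N \<Longrightarrow> nats s ''zN'' 0 = N \<Longrightarrow> exec mulc s (Cm * real N powr \<tau>) (\<lambda>t. same znames znames s t \<and>
      product_in N s t)"
begin

abbreviation "mtime N \<equiv> real N powr \<tau>"

text \<open>Operands are given as expressions in the row and column counters, so blocks and
  transposes of stored matrices are formed while being copied into the input arrays of the
  multiplication program.\<close>

definition Prod :: "string \<Rightarrow> rop rexp \<Rightarrow> rop rexp \<Rightarrow> rop com" where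
  "Prod D ex ey = Seq (Map ''zA'' hix (nv ''h'') (nv ''h'') ex) (Seq (Map ''zB'' hix (nv ''h'') (nv ''h'') ey)
     (Seq (nset ''zN'' (nv ''h'')) (Seq mulc (Map D hix (nv ''h'') (nv ''h'') (RGet ''zC'' hix)))))"

definition prod_cost :: "rop rexp \<Rightarrow> rop rexp \<Rightarrow> real" where
  "prod_cost ex ey = 4 * map_cost hix (nv ''h'') (nv ''h'') ex + (4 * map_cost hix (nv ''h'') (nv ''h'') ey
     + (4 + (Cm + 4 * map_cost hix (nv ''h'') (nv ''h'') (RGet ''zC'' hix))))"

lemma prod_cost_nonneg: "0 \<le> prod_cost ex ey"
  using Cm by (simp add: prod_cost_def map_cost_nonneg)

lemma powr_ge_1: "1 \<le> h \<Longrightarrow> 1 \<le> mtime h"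
  using \<tau> by (intro ge_one_powr_ge_zero) auto

text \<open>The operands have to keep their values while the counters and \<open>znames\<close>
  change. The target is written last, so it may be an array that the operands read.\<close>

lemma exec_Prod:
  assumes h: "1 \<le> h" "nats s ''h'' 0 = h" and D: "D \<notin> znames"
    and ex: "\<And>s' i j. same (ijk \<union> znames) znames s s' \<Longrightarrow> i < h \<Longrightarrow> j < h \<Longrightarrow> nats s' ''i'' 0 = i \<Longrightarrow> nats s' ''j'' 0 = j \<Longrightarrow> rval ex s' = X i j"
    and ey: "\<And>s' i j. same (ijk \<union> znames) znames s s' \<Longrightarrow> i < h \<Longrightarrow> j < h \<Longrightarrow> nats s' ''i'' 0 = i \<Longrightarrow> nats s' ''j'' 0 = j \<Longrightarrow> rval ey s' = Y i j"
  shows "exec (Prod D ex ey) s (prod_cost ex ey * mtime h)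
    (\<lambda>t. same (ijk \<union> znames) ({D} \<union> znames) s t \<and> (\<forall>i<h. \<forall>j<h. reals t D (i * h + j) = (\<Sum>k<h. X i k * Y k j)))"
  unfolding Prod_def prod_cost_def distrib_right
proof (rule exec_Seq)
  let ?P = "mtime h"
  show "exec (Map ''zA'' hix (nv ''h'') (nv ''h'') ex) s (4 * map_cost hix (nv ''h'') (nv ''h'') ex * ?P)
    (\<lambda>t. same ijk {''zA''} s t \<and> (\<forall>i<h. \<forall>j<h. reals t ''zA'' (i * h + j) = X i j))" (is "exec _ _ _ ?Qa")
  proof (rule exec_Map_hix[OF h \<tau>])
    fix s' i j assume *: "same ijk {''zA''} s s'" "i < h" "j < h" "nats s' ''i'' 0 = i" "nats s' ''j'' 0 = j"
    show "rval ex s' = X i j" by (rule ex[OF same_mono[OF *(1)]]) (use * in auto)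
  qed
  fix t1 assume t1: "?Qa t1"
  show "exec (Seq (Map ''zB'' hix (nv ''h'') (nv ''h'') ey)
     (Seq (nset ''zN'' (nv ''h'')) (Seq mulc (Map D hix (nv ''h'') (nv ''h'') (RGet ''zC'' hix))))) t1
      (4 * map_cost hix (nv ''h'') (nv ''h'') ey * ?P + (4 * ?P + (Cm * ?P + 4 * map_cost hix (nv ''h'') (nv ''h'') (RGet ''zC'' hix) * ?P)))
     (\<lambda>t. same (ijk \<union> znames) ({D} \<union> znames) s t \<and> (\<forall>i<h. \<forall>j<h. reals t D (i * h + j) = (\<Sum>k<h. X i k * Y k j)))"
  proof (rule exec_Seq)
    have h1: "nats t1 ''h'' 0 = h" using t1 h by (simp add: same_def)
    show "exec (Map ''zB'' hix (nv ''h'') (nv ''h'') ey) t1 (4 * map_cost hix (nv ''h'') (nv ''h'') ey * ?P)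
      (\<lambda>t. same ijk {''zB''} t1 t \<and> (\<forall>i<h. \<forall>j<h. reals t ''zB'' (i * h + j) = Y i j))" (is "exec _ _ _ ?Qb")
    proof (rule exec_Map_hix[OF h(1) h1 \<tau>])
      fix s' i j assume *: "same ijk {''zB''} t1 s'" "i < h" "j < h" "nats s' ''i'' 0 = i" "nats s' ''j'' 0 = j"
      have "same (ijk \<union> znames) znames s s'"
        by (rule same_trans[OF conjunct1[OF t1] *(1)]) auto
      then show "rval ey s' = Y i j" by (rule ey) (use * in auto)
    qed
    fix t2 assume t2: "?Qb t2"
    define t3 where "t3 = t2\<lparr>nats := (nats t2)(''zN'' := (nats t2 ''zN'')(0 := h))\<rparr>"
    have s12: "same (ijk \<union> znames) znames s t2"
      by (rule same_trans[OF conjunct1[OF t1] conjunct1[OF t2]]) auto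
    have s3: "same (ijk \<union> znames) znames s t3"
      by (rule same_trans[OF s12, of znames znames]) (auto simp: t3_def same_def)
    have A3: "reals t3 ''zA'' (i * h + k) = X i k" if "i < h" "k < h" for i k
    proof -
      have "reals t3 ''zA'' = reals t1 ''zA''" using same_reals[OF conjunct1[OF t2], of "''zA''"] by (simp add: t3_def)
      then show ?thesis using conjunct2[OF t1] that by simp
    qed
    have B3: "reals t3 ''zB'' (k * h + j) = Y k j" if "j < h" "k < h" for j k
      using t2 that by (simp add: t3_def)
    show "exec (Seq (nset ''zN'' (nv ''h'')) (Seq mulc (Map D hix (nv ''h'') (nv ''h'') (RGet ''zC'' hix)))) t2
      (4 * ?P + (Cm * ?P + 4 * map_cost hix (nv ''h'') (nv ''h'') (RGet ''zC'' hix) * ?P))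
     (\<lambda>t. same (ijk \<union> znames) ({D} \<union> znames) s t \<and> (\<forall>i<h. \<forall>j<h. reals t D (i * h + j) = (\<Sum>k<h. X i k * Y k j)))"
    proof (rule exec_Seq)
      have "nats t2 ''h'' 0 = h" using s12 h by (simp add: same_def)
      then show "exec (nset ''zN'' (nv ''h'')) t2 (4 * ?P) (\<lambda>t. t = t3)"
        by (intro exec_NSet) (use powr_ge_1[OF h(1)] in \<open>auto simp: t3_def\<close>)
      fix t assume "t = t3"
      show "exec (Seq mulc (Map D hix (nv ''h'') (nv ''h'') (RGet ''zC'' hix))) t
        (Cm * ?P + 4 * map_cost hix (nv ''h'') (nv ''h'') (RGet ''zC'' hix) * ?P)
        (\<lambda>t. same (ijk \<union> znames) ({D} \<union> znames) s t \<and> (\<forall>i<h. \<forall>j<h. reals t D (i * h + j) = (\<Sum>k<h. X i k * Y k j)))"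
        unfolding \<open>t = t3\<close>
      proof (rule exec_Seq)
        show "exec mulc t3 (Cm * ?P) (\<lambda>t. same znames znames t3 t \<and>
          (\<forall>i<h. \<forall>j<h. reals t ''zC'' (i * h + j) = (\<Sum>k<h. reals t3 ''zA'' (i * h + k) * reals t3 ''zB'' (k * h + j))))" (is "exec _ _ _ ?Posta")
          by (rule mulc) (use h in \<open>auto simp: t3_def\<close>)
        fix t4 assume t4: "?Posta t4"
        have s4: "same (ijk \<union> znames) znames s t4"
          by (rule same_trans[OF s3 conjunct1[OF t4]]) auto
        have h4: "nats t4 ''h'' 0 = h" using s4 h by (simp add: same_def)
        have "exec (Map D hix (nv ''h'') (nv ''h'') (RGet ''zC'' hix)) t4 (4 * map_cost hix (nv ''h'') (nv ''h'') (RGet ''zC'' hix) * ?P)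
          (\<lambda>t. same ijk {D} t4 t \<and> (\<forall>i<h. \<forall>j<h. reals t D (i * h + j) = reals t4 ''zC'' (i * h + j)))" (is "exec _ _ _ ?Postb")
        proof (rule exec_Map_hix[OF h(1) h4 \<tau>])
          fix s' i j assume *: "same ijk {D} t4 s'" "nats s' ''i'' 0 = i" "nats s' ''j'' 0 = j"
          have "''zC'' \<in> znames" by simp
          then have "''zC'' \<noteq> D" using D by metis
          then have "reals s' ''zC'' = reals t4 ''zC''" by (intro same_reals[OF *(1)]) simp
          moreover have "nats s' ''h'' = nats t4 ''h''" by (rule same_nats[OF *(1)]) simp
          ultimately show "rval (RGet ''zC'' hix) s' = reals t4 ''zC'' (i * h + j)" using * h4 by simp
        qed
        then show "exec (Map D hix (nv ''h'') (nv ''h'') (RGet ''zC'' hix)) t4 (4 * map_cost hix (nv ''h'') (nv ''h'') (RGet ''zC'' hix) * ?P)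
          (\<lambda>t. same (ijk \<union> znames) ({D} \<union> znames) s t \<and> (\<forall>i<h. \<forall>j<h. reals t D (i * h + j) = (\<Sum>k<h. X i k * Y k j)))"
        proof (rule exec_mono[OF _ order_refl], intro conjI allI impI)
          fix t assume t: "?Postb t"
          show "same (ijk \<union> znames) ({D} \<union> znames) s t"
            by (rule same_trans[OF s4 conjunct1[OF t]]) auto
          fix i j assume ij: "i < h" "j < h"
          have "reals t D (i * h + j) = (\<Sum>k<h. reals t3 ''zA'' (i * h + k) * reals t3 ''zB'' (k * h + j))"
            using conjunct2[OF t] conjunct2[OF t4] ij by simp
          also have "\<dots> = (\<Sum>k<h. X i k * Y k j)" using A3 B3 ij by (intro sum.cong) auto
          finally show "reals t D (i * h + j) = (\<Sum>k<h. X i k * Y k j)" .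
        qed
      qed
    qed
  qed
qed

definition gat :: "state \<Rightarrow> nat \<Rightarrow> nat \<Rightarrow> nat \<Rightarrow> real" where
  "gat s N i j = reals s ''G'' (i * N + j)"

text \<open>The bound c + h \<le> N keeps a row of the block from running into the next row of the
  array, so that addresses determine entries inside the block and outside of it.\<close>

lemma exec_Map_block:
  assumes h: "1 \<le> h" "nats s ''h'' 0 = h" and N: "nats s ''N'' 0 = N" "c + h \<le> N"
    and ix: "\<And>s' i j. same ijk {''G''} s s' \<Longrightarrow> nats s' ''i'' 0 = i \<Longrightarrow> nats s' ''j'' 0 = j \<Longrightarrow> nval er s' = r + i \<and> nval ec s' = c + j"
    and e: "\<And>s' i j. same ijk {''G''} s s' \<Longrightarrow> i < h \<Longrightarrow> j < h \<Longrightarrow> nats s' ''i'' 0 = i \<Longrightarrow> nats s' ''j'' 0 = j \<Longrightarrow>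
       reals s' ''G'' ((r + i) * N + (c + j)) = gat s N (r + i) (c + j) \<Longrightarrow> rval e s' = Z i j"
  shows "exec (Map ''G'' (Gat er ec) (nv ''h'') (nv ''h'') e) s (4 * map_cost (Gat er ec) (nv ''h'') (nv ''h'') e * mtime h)
    (\<lambda>t. same ijk {''G''} s t \<and> (\<forall>i<h. \<forall>j<h. gat t N (r + i) (c + j) = Z i j) \<and>
      (\<forall>a b. b < N \<longrightarrow> \<not> (r \<le> a \<and> a < r + h \<and> c \<le> b \<and> b < c + h) \<longrightarrow> gat t N a b = gat s N a b))"
proof -
  have "exec (Map ''G'' (Gat er ec) (nv ''h'') (nv ''h'') e) s (4 * map_cost (Gat er ec) (nv ''h'') (nv ''h'') e * mtime h)
    (\<lambda>t. same ijk {''G''} s t \<and> (\<forall>i<h. \<forall>j<h. reals t ''G'' ((r + i) * N + (c + j)) = Z i j) \<and>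
      (\<forall>x. (\<forall>i<h. \<forall>j<h. x \<noteq> (r + i) * N + (c + j)) \<longrightarrow> reals t ''G'' x = reals s ''G'' x))" (is "exec _ _ _ ?Postc")
  proof (rule exec_Map_square[OF h \<tau>, where X = "\<lambda>i j. (r + i) * N + (c + j)" and Z = Z])
    fix s' i j assume *: "same ijk {''G''} s s'" "nats s' ''i'' 0 = i" "nats s' ''j'' 0 = j"
    have "nats s' ''N'' 0 = N" using N by (simp add: same_nats[OF *(1)])
    then show "nval (Gat er ec) s' = (r + i) * N + (c + j)" using ix[OF *] by simp
  next
    fix i j i' j' assume "j < h" "j' < h" "(r + i) * N + (c + j) = (r + i') * N + (c + j')"
    then show "i = i' \<and> j = j'" using index_inj[of "c + j" N "c + j'" "r + i" "r + i'"] N(2) by simp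
  qed (rule e, auto simp: gat_def)
  then show ?thesis
  proof (rule exec_mono[OF _ order_refl])
    fix t assume t: "?Postc t"
    have "gat t N a b = gat s N a b" if "b < N" "\<not> (r \<le> a \<and> a < r + h \<and> c \<le> b \<and> b < c + h)" for a b
    proof -
      have "a * N + b \<noteq> (r + i) * N + (c + j)" if "i < h" "j < h" for i j
        using index_inj[of b N "c + j" a "r + i"] \<open>b < N\<close> that N(2) \<open>\<not> _\<close> by auto
      then show ?thesis using t by (simp add: gat_def)
    qed
    then show "same ijk {''G''} s t \<and> (\<forall>i<h. \<forall>j<h. gat t N (r + i) (c + j) = Z i j) \<and>
      (\<forall>a b. b < N \<longrightarrow> \<not> (r \<le> a \<and> a < r + h \<and> c \<le> b \<and> b < c + h) \<longrightarrow> gat t N a b = gat s N a b)"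
      using t by (auto simp: gat_def)
  qed
qed

text \<open>\<open>U\<close> of \<open>block_ginv\<close> in terms of the array: the leading block
  at \<open>p\<close> already holds the generalized inverse, and to the right of it the Gram entries
  are still in place.\<close>

definition Ublk :: "rmat \<Rightarrow> nat \<Rightarrow> nat \<Rightarrow> nat \<Rightarrow> nat \<Rightarrow> real" where
  "Ublk g p h i j = (\<Sum>k<h. g (p + i) (p + k) * g (p + k) (p + h + j))"

text \<open>\<open>V\<close> of \<open>block_ginv\<close>, to be read once the trailing block holds
  the second generalized inverse.\<close>

definition Vblk :: "rmat \<Rightarrow> nat \<Rightarrow> nat \<Rightarrow> nat \<Rightarrow> nat \<Rightarrow> real" where
  "Vblk g p h i j = (\<Sum>k<h. Ublk g p h i k * g (p + h + k) (p + h + j))"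

abbreviation "schur_post N p h s t \<equiv>
  (\<forall>i<h. \<forall>j<h. gat t N (p + h + i) (p + h + j) = gat s N (p + h + i) (p + h + j)
     - (\<Sum>k<h. gat s N (p + k) (p + h + i) * Ublk (gat s N) p h k j)) \<and>
   (\<forall>a b. b < N \<longrightarrow> \<not> (p + h \<le> a \<and> a < p + h + h \<and> p + h \<le> b \<and> b < p + h + h) \<longrightarrow> gat t N a b = gat s N a b)"

abbreviation "combine_post N p h s t \<equiv>
  (\<forall>i<h. \<forall>j<h. gat t N (p + i) (p + j) = gat s N (p + i) (p + j) + (\<Sum>k<h. Vblk (gat s N) p h i k * Ublk (gat s N) p h j k)) \<and>
   (\<forall>i<h. \<forall>j<h. gat t N (p + i) (p + h + j) = - Vblk (gat s N) p h i j) \<and>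
   (\<forall>i<h. \<forall>j<h. gat t N (p + h + i) (p + j) = - Vblk (gat s N) p h j i) \<and>
   (\<forall>i<h. \<forall>j<h. gat t N (p + h + i) (p + h + j) = gat s N (p + h + i) (p + h + j)) \<and>
   (\<forall>a b. b < N \<longrightarrow> \<not> (p \<le> a \<and> a < p + h + h \<and> p \<le> b \<and> b < p + h + h) \<longrightarrow> gat t N a b = gat s N a b)"

abbreviation "SchurG \<equiv> Map ''G'' (Gat qhi qhj) (nv ''h'') (nv ''h'') (ROp Minus (RGet ''G'' (Gat qhi qhj)) (RGet ''V'' hix))"

definition Schur :: "rop com" where
  "Schur = Seq (Prod ''U'' (RGet ''G'' (Gat qi qj)) (RGet ''G'' (Gat qi qhj)))
    (Seq (Prod ''V'' (RGet ''G'' (Gat qj qhi)) (RGet ''U'' hix))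
     SchurG)"

abbreviation "CombineUR \<equiv> Map ''G'' (Gat qi qhj) (nv ''h'') (nv ''h'') (ROp Minus rzero (RGet ''V'' hix))"

abbreviation "CombineLL \<equiv> Map ''G'' (Gat qhi qj) (nv ''h'') (nv ''h'') (ROp Minus rzero (RGet ''V'' hixT))"

abbreviation "CombineUL \<equiv> Map ''G'' (Gat qi qj) (nv ''h'') (nv ''h'') (ROp Plus (RGet ''G'' (Gat qi qj)) (RGet ''X'' hix))"

text \<open>\<open>U\<close> is formed again because the recursion on the trailing block reuses the
  scratch arrays. All three products are finished before the array \<open>G\<close> is changed; its
  trailing block already has the final value.\<close>

definition Combine :: "rop com" where
  "Combine = Seq (Prod ''U'' (RGet ''G'' (Gat qi qj)) (RGet ''G'' (Gat qi qhj)))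
    (Seq (Prod ''V'' (RGet ''U'' hix) (RGet ''G'' (Gat qhi qhj)))
    (Seq (Prod ''X'' (RGet ''V'' hix) (RGet ''U'' hixT))
    (Seq CombineUL
    (Seq CombineUR
     CombineLL))))"

lemma exec_U:
  assumes h: "1 \<le> h" "nats s ''h'' 0 = h" and q: "nats s ''q'' 0 = p" and N: "nats s ''N'' 0 = N"
  shows "exec (Prod ''U'' (RGet ''G'' (Gat qi qj)) (RGet ''G'' (Gat qi qhj))) s
     (prod_cost (RGet ''G'' (Gat qi qj)) (RGet ''G'' (Gat qi qhj)) * mtime h)
    (\<lambda>t. same ginv_nats ({''U''} \<union> znames) s t \<and> (\<forall>i<h. \<forall>j<h. reals t ''U'' (i * h + j) = Ublk (gat s N) p h i j))"
  unfolding Ublk_def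
proof (rule exec_Prod[OF h])
  fix s' i j assume *: "same ginv_nats znames s s'" "nats s' ''i'' 0 = i" "nats s' ''j'' 0 = j"
  show "rval (RGet ''G'' (Gat qi qj)) s' = gat s N (p + i) (p + j)" "rval (RGet ''G'' (Gat qi qhj)) s' = gat s N (p + i) (p + h + j)"
    using h q N by (simp_all add: *(2,3) same_eqs[OF *(1)] gat_def)
qed simp

lemma exec_Schur:
  "\<exists>C\<ge>0. \<forall>s h p N. 1 \<le> h \<and> nats s ''h'' 0 = h \<and> nats s ''q'' 0 = p \<and> nats s ''N'' 0 = N \<and> p + h + h \<le> N \<longrightarrow>
    exec Schur s (C * mtime h) (\<lambda>t. same ginv_nats ginv_reals s t \<and>
      schur_post N p h s t)"
proof -
  let ?ca = "prod_cost (RGet ''G'' (Gat qi qj)) (RGet ''G'' (Gat qi qhj))"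
  let ?cb = "prod_cost (RGet ''G'' (Gat qj qhi)) (RGet ''U'' hix)"
  let ?cc = "4 * map_cost (Gat qhi qhj) (nv ''h'') (nv ''h'') (ROp Minus (RGet ''G'' (Gat qhi qhj)) (RGet ''V'' hix))"
  show ?thesis
  proof (intro exI[of _ "?ca + (?cb + ?cc)"] conjI allI impI)
    fix s :: state and h p N assume asm: "1 \<le> h \<and> nats s ''h'' 0 = h \<and> nats s ''q'' 0 = p \<and> nats s ''N'' 0 = N \<and> p + h + h \<le> N"
    then have h: "1 \<le> h" "nats s ''h'' 0 = h" and q: "nats s ''q'' 0 = p" and N: "nats s ''N'' 0 = N" "p + h + h \<le> N" by auto
    define g where "g = gat s N"
    show "exec Schur s ((?ca + (?cb + ?cc)) * mtime h) (\<lambda>t. same ginv_nats ginv_reals s t \<and>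
      schur_post N p h s t)"
      (is "exec _ _ _ ?Q")
      unfolding Schur_def distrib_right
    proof (rule exec_Seq[OF exec_U[OF h q N(1)]])
      fix t1 assume t1: "same ginv_nats ({''U''} \<union> znames) s t1 \<and> (\<forall>i<h. \<forall>j<h. reals t1 ''U'' (i * h + j) = Ublk (gat s N) p h i j)"
      note s1 = conjunct1[OF t1]
      have h1: "nats t1 ''h'' 0 = h" using h by (simp add: same_nats[OF s1])
      have G1: "reals t1 ''G'' = reals s ''G''" by (simp add: same_reals[OF s1])
      have qN1: "nats t1 ''q'' 0 = p" "nats t1 ''N'' 0 = N" using q N by (simp_all add: same_nats[OF s1])
      show "exec (Seq (Prod ''V'' (RGet ''G'' (Gat qj qhi)) (RGet ''U'' hix))
     SchurG) t1
        (?cb * mtime h + ?cc * mtime h) ?Q"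
      proof (rule exec_Seq)
        show "exec (Prod ''V'' (RGet ''G'' (Gat qj qhi)) (RGet ''U'' hix)) t1 (?cb * mtime h)
          (\<lambda>t. same ginv_nats ({''V''} \<union> znames) t1 t \<and>
          (\<forall>i<h. \<forall>j<h. reals t ''V'' (i * h + j) = (\<Sum>k<h. g (p + k) (p + h + i) * Ublk g p h k j)))" (is "exec _ _ _ ?Postd")
        proof (rule exec_Prod[OF h(1) h1])
          fix s' i j assume *: "same ginv_nats znames t1 s'" "nats s' ''i'' 0 = i" "nats s' ''j'' 0 = j" "i < h" "j < h"
          show "rval (RGet ''G'' (Gat qj qhi)) s' = g (p + j) (p + h + i)"
            using h1 qN1 by (simp add: *(2,3) same_eqs[OF *(1)] g_def gat_def G1)
          show "rval (RGet ''U'' hix) s' = Ublk g p h i j"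
            using h1 conjunct2[OF t1] *(4,5) by (simp add: *(2,3) same_eqs[OF *(1)] g_def)
        qed simp
        fix t2 assume t2: "?Postd t2"
        note s2 = conjunct1[OF t2]
        have h2: "nats t2 ''h'' 0 = h" using h1 by (simp add: same_nats[OF s2])
        have G2: "gat t2 N = g" by (simp add: same_reals[OF s2] G1 gat_def g_def fun_eq_iff)
        have qN2: "nats t2 ''q'' 0 = p" "nats t2 ''N'' 0 = N" using qN1 by (simp_all add: same_nats[OF s2])
        have "exec SchurG t2 (?cc * mtime h)
          (\<lambda>t. same ijk {''G''} t2 t \<and> (\<forall>i<h. \<forall>j<h. gat t N (p + h + i) (p + h + j) =
              g (p + h + i) (p + h + j) - reals t2 ''V'' (i * h + j)) \<and>
            (\<forall>a b. b < N \<longrightarrow> \<not> (p + h \<le> a \<and> a < p + h + h \<and> p + h \<le> b \<and> b < p + h + h) \<longrightarrow> gat t N a b = gat t2 N a b))" (is "exec _ _ _ ?Poste")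
        proof (rule exec_Map_block[OF h(1) h2 qN2(2)])
          fix s' i j assume *: "same ijk {''G''} t2 s'" "nats s' ''i'' 0 = i" "nats s' ''j'' 0 = j"
          show "nval qhi s' = p + h + i \<and> nval qhj s' = p + h + j"
            using h2 qN2 by (simp add: *(2,3) same_nats[OF *(1)])
          assume e: "reals s' ''G'' ((p + h + i) * N + (p + h + j)) = gat t2 N (p + h + i) (p + h + j)"
          show "rval (ROp Minus (RGet ''G'' (Gat qhi qhj)) (RGet ''V'' hix)) s' = g (p + h + i) (p + h + j) - reals t2 ''V'' (i * h + j)"
            using h2 qN2 e by (simp add: *(2,3) same_eqs[OF *(1)] G2)
        qed (use N in simp)
        then show "exec SchurG t2 (?cc * mtime h) ?Q"
        proof (rule exec_mono[OF _ order_refl])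
          fix t assume t: "?Poste t"
          have "same ginv_nats ginv_reals s t2" by (rule same_trans[OF s1 s2]) auto
          then have "same ginv_nats ginv_reals s t" by (rule same_trans[OF _ conjunct1[OF t]]) auto
          then show "?Q t" using conjunct2[OF t] conjunct2[OF t2] by (simp add: G2 g_def)
        qed
      qed
    qed
  qed (simp add: prod_cost_nonneg map_cost_nonneg)
qed

lemma exec_Combine:
  "\<exists>C\<ge>0. \<forall>s h p N. 1 \<le> h \<and> nats s ''h'' 0 = h \<and> nats s ''q'' 0 = p \<and> nats s ''N'' 0 = N \<and> p + h + h \<le> N \<longrightarrow>
    exec Combine s (C * mtime h) (\<lambda>t. same ginv_nats ginv_reals s t \<and>
      combine_post N p h s t)"
proof -
  let ?ca = "prod_cost (RGet ''G'' (Gat qi qj)) (RGet ''G'' (Gat qi qhj))"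
  let ?cb = "prod_cost (RGet ''U'' hix) (RGet ''G'' (Gat qhi qhj))"
  let ?cc = "prod_cost (RGet ''V'' hix) (RGet ''U'' hixT)"
  let ?cd = "4 * map_cost (Gat qi qj) (nv ''h'') (nv ''h'') (ROp Plus (RGet ''G'' (Gat qi qj)) (RGet ''X'' hix))"
  let ?ce = "4 * map_cost (Gat qi qhj) (nv ''h'') (nv ''h'') (ROp Minus rzero (RGet ''V'' hix))"
  let ?cf = "4 * map_cost (Gat qhi qj) (nv ''h'') (nv ''h'') (ROp Minus rzero (RGet ''V'' hixT))"
  show ?thesis
  proof (intro exI[of _ "?ca + (?cb + (?cc + (?cd + (?ce + ?cf))))"] conjI allI impI)
    fix s :: state and h p N assume asm: "1 \<le> h \<and> nats s ''h'' 0 = h \<and> nats s ''q'' 0 = p \<and> nats s ''N'' 0 = N \<and> p + h + h \<le> N"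
    then have h: "1 \<le> h" "nats s ''h'' 0 = h" and q: "nats s ''q'' 0 = p" and N: "nats s ''N'' 0 = N" "p + h + h \<le> N" by auto
    define g where "g = gat s N"
    define U where "U = Ublk g p h"
    define V where "V = Vblk g p h"
    show "exec Combine s ((?ca + (?cb + (?cc + (?cd + (?ce + ?cf))))) * mtime h) (\<lambda>t. same ginv_nats ginv_reals s t \<and>
      combine_post N p h s t)"
      (is "exec _ _ _ ?Q")
      unfolding Combine_def distrib_right
    proof (rule exec_Seq[OF exec_U[OF h q N(1)]], rule exec_Seq)
      fix t1 assume t1: "same ginv_nats ({''U''} \<union> znames) s t1 \<and> (\<forall>i<h. \<forall>j<h. reals t1 ''U'' (i * h + j) = Ublk (gat s N) p h i j)"
      note s1 = conjunct1[OF t1]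
      have h1: "nats t1 ''h'' 0 = h" using h by (simp add: same_nats[OF s1])
      have G1: "reals t1 ''G'' = reals s ''G''" by (simp add: same_reals[OF s1])
      have qN1: "nats t1 ''q'' 0 = p" "nats t1 ''N'' 0 = N" using q N by (simp_all add: same_nats[OF s1])
      have U1: "reals t1 ''U'' (i * h + j) = U i j" if "i < h" "j < h" for i j
        using conjunct2[OF t1] that by (simp add: U_def g_def)
      show "exec (Prod ''V'' (RGet ''U'' hix) (RGet ''G'' (Gat qhi qhj))) t1 (?cb * mtime h)
        (\<lambda>t. same ginv_nats ({''V''} \<union> znames) t1 t \<and>
        (\<forall>i<h. \<forall>j<h. reals t ''V'' (i * h + j) = (\<Sum>k<h. U i k * g (p + h + k) (p + h + j))))" (is "exec _ _ _ ?Postf")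
      proof (rule exec_Prod[OF h(1) h1])
        fix s' i j assume *: "same ginv_nats znames t1 s'" "nats s' ''i'' 0 = i" "nats s' ''j'' 0 = j" "i < h" "j < h"
        show "rval (RGet ''U'' hix) s' = U i j"
          using h1 U1 *(4,5) by (simp add: *(2,3) same_eqs[OF *(1)])
        show "rval (RGet ''G'' (Gat qhi qhj)) s' = g (p + h + i) (p + h + j)"
          using h1 qN1 by (simp add: *(2,3) same_eqs[OF *(1)] g_def gat_def G1)
      qed simp
      fix t2 assume t2: "?Postf t2"
      note s2 = conjunct1[OF t2]
      have h2: "nats t2 ''h'' 0 = h" using h1 by (simp add: same_nats[OF s2])
      have G2: "reals t2 ''G'' = reals s ''G''" by (simp add: same_reals[OF s2] G1)
      have qN2: "nats t2 ''q'' 0 = p" "nats t2 ''N'' 0 = N" using qN1 by (simp_all add: same_nats[OF s2])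
      have U2: "reals t2 ''U'' (i * h + j) = U i j" if "i < h" "j < h" for i j
        using U1 that by (simp add: same_reals[OF s2])
      have V2: "reals t2 ''V'' (i * h + j) = V i j" if "i < h" "j < h" for i j
        using conjunct2[OF t2] that by (simp add: V_def Vblk_def U_def)
      show "exec (Seq (Prod ''X'' (RGet ''V'' hix) (RGet ''U'' hixT))
    (Seq CombineUL
    (Seq CombineUR
     CombineLL))) t2
       (?cc * mtime h + (?cd * mtime h + (?ce * mtime h + ?cf * mtime h))) ?Q"
      proof (rule exec_Seq)
        show "exec (Prod ''X'' (RGet ''V'' hix) (RGet ''U'' hixT)) t2 (?cc * mtime h)
          (\<lambda>t. same ginv_nats ({''X''} \<union> znames) t2 t \<and> (\<forall>i<h. \<forall>j<h. reals t ''X'' (i * h + j) = (\<Sum>k<h. V i k * U j k)))" (is "exec _ _ _ ?Postg")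
        proof (rule exec_Prod[OF h(1) h2])
          fix s' i j assume *: "same ginv_nats znames t2 s'" "nats s' ''i'' 0 = i" "nats s' ''j'' 0 = j" "i < h" "j < h"
          show "rval (RGet ''V'' hix) s' = V i j"
            using h2 V2 *(4,5) by (simp add: *(2,3) same_eqs[OF *(1)])
          show "rval (RGet ''U'' hixT) s' = U j i"
            using h2 U2 *(4,5) by (simp add: *(2,3) same_eqs[OF *(1)])
        qed simp
        fix t3 assume t3: "?Postg t3"
        note s3 = conjunct1[OF t3]
        have h3: "nats t3 ''h'' 0 = h" using h2 by (simp add: same_nats[OF s3])
        have G3: "gat t3 N = g" by (simp add: same_reals[OF s3] G2 gat_def g_def fun_eq_iff)
        have qN3: "nats t3 ''q'' 0 = p" "nats t3 ''N'' 0 = N" using qN2 by (simp_all add: same_nats[OF s3])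
        have V3: "reals t3 ''V'' (i * h + j) = V i j" if "i < h" "j < h" for i j
          using V2 that by (simp add: same_reals[OF s3])
        have X3: "reals t3 ''X'' (i * h + j) = (\<Sum>k<h. V i k * U j k)" if "i < h" "j < h" for i j
          using conjunct2[OF t3] that by simp
        show "exec (Seq CombineUL
    (Seq CombineUR
     CombineLL)) t3
          (?cd * mtime h + (?ce * mtime h + ?cf * mtime h)) ?Q"
        proof (rule exec_Seq[OF exec_Map_block[OF h(1) h3 qN3(2), where r = p and c = p and Z = "\<lambda>i j. g (p + i) (p + j) + (\<Sum>k<h. V i k * U j k)"]], goal_cases)
          case 1 then show ?case using N by simp
        next
          case (2 s' i j) then show ?case using h3 qN3 by (simp add: same_nats[OF 2(1)])
        next
          case (3 s' i j) then show ?case using h3 qN3 X3 by (simp add: same_eqs[OF 3(1)] G3)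
        next
          case (4 t4)
          note s4 = conjunct1[OF 4]
          have h4: "nats t4 ''h'' 0 = h" using h3 by (simp add: same_nats[OF s4])
          have qN4: "nats t4 ''q'' 0 = p" "nats t4 ''N'' 0 = N" using qN3 by (simp_all add: same_nats[OF s4])
          have V4: "reals t4 ''V'' (i * h + j) = V i j" if "i < h" "j < h" for i j
            using V3 that by (simp add: same_reals[OF s4])
          show ?case
          proof (rule exec_Seq[OF exec_Map_block[OF h(1) h4 qN4(2), where r = p and c = "p + h" and Z = "\<lambda>i j. - V i j"]], goal_cases)
            case 1 then show ?case using N by simp
          next
            case (2 s' i j) then show ?case using h4 qN4 by (simp add: same_nats[OF 2(1)])
          next
            case (3 s' i j) then show ?case using h4 qN4 V4 by (simp add: same_eqs[OF 3(1)])
          next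
            case (4 t5)
            note s5 = conjunct1[OF 4]
            have h5: "nats t5 ''h'' 0 = h" using h4 by (simp add: same_nats[OF s5])
            have qN5: "nats t5 ''q'' 0 = p" "nats t5 ''N'' 0 = N" using qN4 by (simp_all add: same_nats[OF s5])
            have V5: "reals t5 ''V'' (i * h + j) = V i j" if "i < h" "j < h" for i j
              using V4 that by (simp add: same_reals[OF s5])
            show ?case
            proof (rule exec_mono[OF exec_Map_block[OF h(1) h5 qN5(2), where r = "p + h" and c = p and Z = "\<lambda>i j. - V j i"] order_refl], goal_cases)
              case 1 then show ?case using N by simp
            next
              case (2 s' i j) then show ?case using h5 qN5 by (simp add: same_nats[OF 2(1)])
            next
              case (3 s' i j) then show ?case using h5 qN5 V5 by (simp add: same_eqs[OF 3(1)])
            next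
              case t6: (4 t6)
              note s6 = conjunct1[OF t6]
              have "same ginv_nats ginv_reals s t2" by (rule same_trans[OF s1 s2]) auto
              then have "same ginv_nats ginv_reals s t3" by (rule same_trans[OF _ s3]) auto
              then have "same ginv_nats ginv_reals s t4" by (rule same_trans[OF _ s4]) auto
              then have "same ginv_nats ginv_reals s t5" by (rule same_trans[OF _ s5]) auto
              then have s: "same ginv_nats ginv_reals s t6" by (rule same_trans[OF _ s6]) auto
              note d4 = conjunct2[OF \<open>same ijk {''G''} t3 t4 \<and> _\<close>] and d5 = conjunct2[OF 4] and d6 = conjunct2[OF t6]
              have ul: "gat t6 N (p + i) (p + j) = g (p + i) (p + j) + (\<Sum>k<h. V i k * U j k)" if "i < h" "j < h" for i j
                using d4 d5 d6 that N(2) by simp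
              have ur: "gat t6 N (p + i) (p + h + j) = - V i j" if "i < h" "j < h" for i j
                using d5 d6 that N(2) by simp
              have ll: "gat t6 N (p + h + i) (p + j) = - V j i" if "i < h" "j < h" for i j
                using d6 that N(2) by simp
              have lr: "gat t6 N (p + h + i) (p + h + j) = g (p + h + i) (p + h + j)" if "i < h" "j < h" for i j
                using d4 d5 d6 that N(2) by (simp add: G3)
              have off: "gat t6 N a b = g a b" if b: "b < N" and n: "\<not> (p \<le> a \<and> a < p + h + h \<and> p \<le> b \<and> b < p + h + h)" for a b
              proof -
                have "gat t6 N a b = gat t5 N a b" using d6 b n by auto
                also have "\<dots> = gat t4 N a b" using d5 b n by auto
                also have "\<dots> = gat t3 N a b" using d4 b n by auto
                finally show ?thesis by (simp add: G3)
              qed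
              show ?case using s ul ur ll lr off by (simp add: g_def U_def V_def)
            qed
          qed
        qed
      qed
    qed
  qed (simp add: prod_cost_nonneg map_cost_nonneg)
qed

end

text \<open>Some iterations of a loop, not necessarily all: whatever the loop does from the reached
  state on extends to a run from the start. A group of iterations can thus be composed like a
  procedure call.\<close>

definition reach :: "rop bexp \<Rightarrow> rop com \<Rightarrow> state \<Rightarrow> real \<Rightarrow> (state \<Rightarrow> bool) \<Rightarrow> bool" where
  "reach b c s B Q \<longleftrightarrow> (\<exists>T t. (\<forall>T' u. run (While b c) t T' u \<longrightarrow> run (While b c) s (T + T') u) \<and> real T \<le> B \<and> Q t)"

lemma reach_step:
  fixes B :: real
  shows "bval b s \<Longrightarrow> exec c s B Q \<Longrightarrow> reach b c s (bcost b + B) Q"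
proof -
  assume b: "bval b s" and "exec c s B Q"
  then obtain T t where t: "run c s T t" "real T \<le> B" "Q t" by (auto simp: exec_def)
  have "run (While b c) s ((bcost b + T) + T') u" if "run (While b c) t T' u" for T' u
    using run.WhileTrue[OF b t(1) that] .
  then show ?thesis unfolding reach_def using t by (intro exI[of _ "bcost b + T"] exI[of _ t]) auto
qed

lemma reach_trans:
  assumes "reach b c s B Q" "\<And>t. Q t \<Longrightarrow> reach b c t B' Q'"
  shows "reach b c s (B + B') Q'"
proof -
  obtain T t where 1: "\<And>T' u. run (While b c) t T' u \<Longrightarrow> run (While b c) s (T + T') u" "real T \<le> B" "Q t"
    using assms(1) by (auto simp: reach_def)
  obtain T2 u where 2: "\<And>T' v. run (While b c) u T' v \<Longrightarrow> run (While b c) t (T2 + T') v" "real T2 \<le> B'" "Q' u"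
    using assms(2)[OF 1(3)] by (auto simp: reach_def)
  have "run (While b c) s ((T + T2) + T') v" if "run (While b c) u T' v" for T' v
    using 1(1)[OF 2(1)[OF that]] by (simp add: add.assoc)
  then show ?thesis unfolding reach_def using 1 2 by (intro exI[of _ "T + T2"] exI[of _ u]) auto
qed

lemma reach_mono: "reach b c s B Q \<Longrightarrow> B \<le> B' \<Longrightarrow> (\<And>t. Q t \<Longrightarrow> Q' t) \<Longrightarrow> reach b c s B' Q'"
  unfolding reach_def by (meson order_trans)

lemma reach_While:
  assumes "reach b c s B Q" "\<And>t. Q t \<Longrightarrow> \<not> bval b t"
  shows "exec (While b c) s (B + bcost b) Q"
proof -
  obtain T t where 1: "\<And>T' u. run (While b c) t T' u \<Longrightarrow> run (While b c) s (T + T') u" "real T \<le> B" "Q t"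
    using assms(1) by (auto simp: reach_def)
  show ?thesis unfolding exec_def using 1 1(1)[OF run.WhileFalse[OF assms(2)[OF 1(3)]]]
    by (intro exI[of _ "T + bcost b"] exI[of _ t]) auto
qed

lemma sum_block: "(\<Sum>a\<in>{p..<p + h}. f a) = (\<Sum>k<h. f (p + k))" for f :: "nat \<Rightarrow> real"
  by (rule sum.reindex_bij_witness[of _ "\<lambda>k. p + k" "\<lambda>a. a - p"]) auto

section \<open>The block recursion as a state machine\<close>

abbreviation "mach_nats \<equiv> {''lev'', ''pos'', ''ph'', ''h'', ''q''} \<union> ginv_nats"

context multiplier begin

abbreviation "SchurStep \<equiv>
  Seq (nset ''q'' (NSub (nv ''pos'') (nv ''h''))) (Seq Schur (Seq (NSet ''ph'' (nv ''lev'') (NConst 2)) (Seq (nset ''lev'' (NSub (nv ''lev'') (NConst 1))) (NSet ''ph'' (nv ''lev'') (NConst 0)))))"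

abbreviation "CombineStep \<equiv>
  Seq (nset ''q'' (NSub (NSub (nv ''pos'') (nv ''h'')) (nv ''h''))) (Seq Combine (nset ''lev'' (NAdd (nv ''lev'') (NConst 1))))"

abbreviation "LeafStep \<equiv>
  Seq (RSet ''G'' (Gat (nv ''pos'') (nv ''pos'')) (ROp Divide (ROfNat (NConst 1)) (RGet ''G'' (Gat (nv ''pos'') (nv ''pos''))))) (Seq (nset ''pos'' (NAdd (nv ''pos'') (NConst 1))) (nset ''lev'' (NConst 1)))"

abbreviation "DescendStep \<equiv>
  Seq (NSet ''ph'' (nv ''lev'') (NConst 1)) (Seq (nset ''lev'' (NSub (nv ''lev'') (NConst 1))) (NSet ''ph'' (nv ''lev'') (NConst 0)))"

abbreviation "Branch \<equiv>
  If (NLess (NGet ''ph'' (nv ''lev'')) (NConst 2)) SchurStep CombineStep"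

text \<open>
  The language has no procedures, so the recursion on diagonal blocks is unrolled into one loop. At level
  \<open>l\<close>, for a block of size \<open>2\<^sup>l\<close>, \<open>ph[l]\<close> counts the finished recursive calls of the pending invocation: after the first
  one comes the Schur complement, after the second one the assembly. \<open>pos\<close> is the first row not yet processed.
\<close>

definition GBody :: "rop com" where
  "GBody = If (NLess (NGet ''ph'' (nv ''lev'')) (NConst 1))
    (If (NLess (nv ''lev'') (NConst 1))
      LeafStep
      DescendStep)
    (Seq (nset ''h'' (NGet ''sz'' (NSub (nv ''lev'') (NConst 1))))
      Branch)"

definition GTest :: "rop bexp" where
  "GTest = NLess (nv ''lev'') (NAdd (nv ''L'') (NConst 1))"

lemma exec_leaf:
  assumes "nats s ''ph'' 0 = 0" "nats s ''lev'' 0 = 0" "nats s ''pos'' 0 = p" "nats s ''N'' 0 = N" "p < N"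
  shows "exec GBody s 90 (\<lambda>t. same mach_nats ginv_reals s t \<and> nats t ''lev'' 0 = 1 \<and> nats t ''pos'' 0 = p + 1 \<and>
     nats t ''ph'' = nats s ''ph'' \<and> gat t N p p = 1 / gat s N p p \<and>
     (\<forall>a b. b < N \<longrightarrow> \<not> (a = p \<and> b = p) \<longrightarrow> gat t N a b = gat s N a b))"
    (is "exec _ _ _ ?Q")
proof -
  define s1 where "s1 = s\<lparr>reals := (reals s)(''G'' := (reals s ''G'')(p * N + p := 1 / gat s N p p))\<rparr>"
  define s2 where "s2 = s1\<lparr>nats := (nats s1)(''pos'' := (nats s1 ''pos'')(0 := p + 1))\<rparr>"
  define s3 where "s3 = s2\<lparr>nats := (nats s2)(''lev'' := (nats s2 ''lev'')(0 := 1))\<rparr>"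
  have "?Q s3"
  proof -
    have "a * N + b \<noteq> p * N + p" if "b < N" "\<not> (a = p \<and> b = p)" for a b
      using index_inj[of b N p a p] that assms(5) by auto
    then show ?thesis by (auto simp: s3_def s2_def s1_def same_def gat_def)
  qed
  have 1: "exec (RSet ''G'' (Gat (nv ''pos'') (nv ''pos'')) (ROp Divide (ROfNat (NConst 1)) (RGet ''G'' (Gat (nv ''pos'') (nv ''pos''))))) s 30 (\<lambda>t. t = s1)"
    by (rule exec_RSet) (use assms in \<open>simp_all add: s1_def gat_def\<close>)
  have 2: "exec (nset ''pos'' (NAdd (nv ''pos'') (NConst 1))) s1 10 (\<lambda>t. t = s2)"
    by (rule exec_NSet) (use assms in \<open>simp_all add: s1_def s2_def\<close>)
  have 3: "exec (nset ''lev'' (NConst 1)) s2 10 ?Q"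
    by (rule exec_NSet) (use \<open>?Q s3\<close> in \<open>simp_all add: s3_def\<close>)
  have 4: "exec LeafStep s (30 + (10 + 10)) ?Q"
    by (rule exec_Seq_eq[OF 1], rule exec_Seq_eq[OF 2], rule 3)
  show ?thesis unfolding GBody_def
    by (rule exec_mono[OF exec_If[OF exec_If[OF 4]]]) (use assms in auto)
qed

lemma exec_descend:
  assumes "nats s ''ph'' (Suc l) = 0" "nats s ''lev'' 0 = Suc l"
  shows "exec GBody s 90 (\<lambda>t. t = s\<lparr>nats := (nats s)(''ph'' := (nats s ''ph'')(Suc l := 1, l := 0), ''lev'' := (nats s ''lev'')(0 := l))\<rparr>)"
    (is "exec _ _ _ ?Q")
proof -
  define s1 where "s1 = s\<lparr>nats := (nats s)(''ph'' := (nats s ''ph'')(Suc l := 1))\<rparr>"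
  define s2 where "s2 = s1\<lparr>nats := (nats s1)(''lev'' := (nats s1 ''lev'')(0 := l))\<rparr>"
  have 1: "exec (NSet ''ph'' (nv ''lev'') (NConst 1)) s 10 (\<lambda>t. t = s1)"
    by (rule exec_NSet) (use assms in \<open>simp_all add: s1_def\<close>)
  have 2: "exec (nset ''lev'' (NSub (nv ''lev'') (NConst 1))) s1 10 (\<lambda>t. t = s2)"
    by (rule exec_NSet) (use assms in \<open>simp_all add: s1_def s2_def\<close>)
  have 3: "exec (NSet ''ph'' (nv ''lev'') (NConst 0)) s2 10 ?Q"
    by (rule exec_NSet) (use assms in \<open>simp_all add: s2_def s1_def fun_upd_twist\<close>)
  have 4: "exec DescendStep s (10 + (10 + 10)) ?Q"
    by (rule exec_Seq_eq[OF 1], rule exec_Seq_eq[OF 2], rule 3)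
  show ?thesis unfolding GBody_def
    by (rule exec_mono[OF exec_If[OF exec_If[OF _ 4]]]) (use assms in auto)
qed

text \<open>The start \<open>p\<close> of the block is not stored. It is recovered from
  \<open>pos\<close>, which has advanced past it by \<open>h\<close> rows after the first recursive
  call and by twice as many after the second.\<close>

lemma exec_schur_iteration:
  "\<exists>C\<ge>0. \<forall>s l p h N. nats s ''ph'' (Suc l) = 1 \<and> nats s ''lev'' 0 = Suc l \<and> nats s ''sz'' l = h \<and> 1 \<le> h \<and>
     nats s ''pos'' 0 = p + h \<and> nats s ''N'' 0 = N \<and> p + h + h \<le> N \<longrightarrow>
    exec GBody s (C * mtime h) (\<lambda>t. same mach_nats ginv_reals s t \<and> nats t ''lev'' 0 = l \<and> nats t ''pos'' 0 = p + h \<and>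
      nats t ''ph'' = (nats s ''ph'')(Suc l := 2, l := 0) \<and>
      schur_post N p h s t)"
proof -
  from exec_Schur obtain C where C: "0 \<le> C" and schur: "\<And>s h p N. 1 \<le> h \<Longrightarrow> nats s ''h'' 0 = h \<Longrightarrow> nats s ''q'' 0 = p \<Longrightarrow> nats s ''N'' 0 = N \<Longrightarrow> p + h + h \<le> N \<Longrightarrow>
    exec Schur s (C * mtime h) (\<lambda>t. same ginv_nats ginv_reals s t \<and>
      schur_post N p h s t)"
    by blast
  show ?thesis
  proof (intro exI[of _ "C + 90"] conjI allI impI)
    fix s :: state and l p h N
    assume "nats s ''ph'' (Suc l) = 1 \<and> nats s ''lev'' 0 = Suc l \<and> nats s ''sz'' l = h \<and> 1 \<le> h \<and>
     nats s ''pos'' 0 = p + h \<and> nats s ''N'' 0 = N \<and> p + h + h \<le> N"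
    then have a: "nats s ''ph'' (Suc l) = 1" "nats s ''lev'' 0 = Suc l" "nats s ''sz'' l = h" "1 \<le> h"
      "nats s ''pos'' 0 = p + h" "nats s ''N'' 0 = N" "p + h + h \<le> N" by auto
    let ?Q = "\<lambda>t. same mach_nats ginv_reals s t \<and> nats t ''lev'' 0 = l \<and> nats t ''pos'' 0 = p + h \<and>
      nats t ''ph'' = (nats s ''ph'')(Suc l := 2, l := 0) \<and>
      schur_post N p h s t"
    define s1 where "s1 = s\<lparr>nats := (nats s)(''h'' := (nats s ''h'')(0 := h))\<rparr>"
    define s2 where "s2 = s1\<lparr>nats := (nats s1)(''q'' := (nats s1 ''q'')(0 := p))\<rparr>"
    have g2: "gat s2 = gat s" by (simp add: fun_eq_iff gat_def s2_def s1_def)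
    have same2: "same mach_nats ginv_reals s s2" by (auto simp: same_def s2_def s1_def)
    have 1: "exec (nset ''h'' (NGet ''sz'' (NSub (nv ''lev'') (NConst 1)))) s 10 (\<lambda>t. t = s1)"
      by (rule exec_NSet) (use a in \<open>simp_all add: s1_def\<close>)
    have 2: "exec (nset ''q'' (NSub (nv ''pos'') (nv ''h''))) s1 10 (\<lambda>t. t = s2)"
      by (rule exec_NSet) (use a in \<open>simp_all add: s1_def s2_def\<close>)
    have 3: "exec (Seq (NSet ''ph'' (nv ''lev'') (NConst 2))
            (Seq (nset ''lev'' (NSub (nv ''lev'') (NConst 1))) (NSet ''ph'' (nv ''lev'') (NConst 0)))) t (10 + (10 + 10)) ?Q"
      if t: "same ginv_nats ginv_reals s2 t \<and>
      schur_post N p h s2 t" for t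
    proof -
      note st = conjunct1[OF t]
      define t1 where "t1 = t\<lparr>nats := (nats t)(''ph'' := (nats t ''ph'')(Suc l := 2))\<rparr>"
      define t2 where "t2 = t1\<lparr>nats := (nats t1)(''lev'' := (nats t1 ''lev'')(0 := l))\<rparr>"
      define t3 where "t3 = t2\<lparr>nats := (nats t2)(''ph'' := (nats t2 ''ph'')(l := 0))\<rparr>"
      have n: "nats t ''lev'' 0 = Suc l" "nats t ''ph'' = nats s ''ph''" "nats t ''pos'' 0 = p + h"
        using a by (simp_all add: same_nats[OF st] s2_def s1_def)
      have g3: "gat t3 = gat t" by (simp add: fun_eq_iff gat_def t3_def t2_def t1_def)
      have "same mach_nats ginv_reals s t" by (rule same_trans[OF same2 st]) auto
      then have st3: "same mach_nats ginv_reals s t3" by (auto simp: same_def t3_def t2_def t1_def)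
      have q1: "exec (NSet ''ph'' (nv ''lev'') (NConst 2)) t 10 (\<lambda>t. t = t1)"
        by (rule exec_NSet) (use n in \<open>simp_all add: t1_def\<close>)
      have q2: "exec (nset ''lev'' (NSub (nv ''lev'') (NConst 1))) t1 10 (\<lambda>t. t = t2)"
        by (rule exec_NSet) (use n in \<open>simp_all add: t1_def t2_def\<close>)
      have q3: "exec (NSet ''ph'' (nv ''lev'') (NConst 0)) t2 10 (\<lambda>t. t = t3)"
        by (rule exec_NSet) (use n in \<open>simp_all add: t3_def t2_def\<close>)
      have Q: "?Q t3"
      proof -
        have "nats t3 ''lev'' 0 = l" "nats t3 ''pos'' 0 = p + h" "nats t3 ''ph'' = (nats s ''ph'')(Suc l := 2, l := 0)"
          using n by (simp_all add: t3_def t2_def t1_def)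
        then show ?thesis using st3 conjunct2[OF t] unfolding g3 g2 by blast
      qed
      show ?thesis
        by (rule exec_Seq_eq[OF q1], rule exec_Seq_eq[OF q2], rule exec_eq[OF q3], rule Q)
    qed
    have 4: "exec SchurStep s1
        (10 + (C * mtime h + (10 + (10 + 10)))) ?Q"
    proof (rule exec_Seq[OF 2], rule exec_Seq)
      fix t assume "t = s2"
      then show "exec Schur t (C * mtime h) (\<lambda>t. same ginv_nats ginv_reals s2 t \<and>
      schur_post N p h s2 t)"
        unfolding \<open>t = s2\<close> by (intro schur) (use a in \<open>simp_all add: s2_def s1_def\<close>)
    qed (rule 3)
    have b: "bval (NLess (NGet ''ph'' (nv ''lev'')) (NConst 2)) s1" "\<not> bval (NLess (NGet ''ph'' (nv ''lev'')) (NConst 1)) s"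
      using a by (simp_all add: s1_def)
    have 5: "exec (Seq (nset ''h'' (NGet ''sz'' (NSub (nv ''lev'') (NConst 1))))
      Branch) s
       (10 + (5 + (10 + (C * mtime h + (10 + (10 + 10)))))) ?Q"
    proof (rule exec_Seq[OF 1])
      fix t assume "t = s1"
      show "exec Branch t
         (5 + (10 + (C * mtime h + (10 + (10 + 10))))) ?Q"
        unfolding \<open>t = s1\<close> by (rule exec_mono[OF exec_If[OF 4]]) (use b in simp_all)
    qed
    have "exec GBody s (5 + (10 + (5 + (10 + (C * mtime h + (10 + (10 + 10))))))) ?Q"
      unfolding GBody_def by (rule exec_mono[OF exec_If[OF _ 5]]) (use b in simp_all)
    then show "exec GBody s ((C + 90) * mtime h) ?Q"
      by (rule exec_mono) (use powr_ge_1[OF a(4)] in \<open>simp_all add: distrib_right\<close>)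
  qed (use C in simp)
qed

lemma exec_combine_iteration:
  "\<exists>C\<ge>0. \<forall>s l p h N. nats s ''ph'' (Suc l) = 2 \<and> nats s ''lev'' 0 = Suc l \<and> nats s ''sz'' l = h \<and> 1 \<le> h \<and>
     nats s ''pos'' 0 = p + h + h \<and> nats s ''N'' 0 = N \<and> p + h + h \<le> N \<longrightarrow>
    exec GBody s (C * mtime h) (\<lambda>t. same mach_nats ginv_reals s t \<and> nats t ''lev'' 0 = Suc (Suc l) \<and> nats t ''pos'' 0 = p + h + h \<and>
      nats t ''ph'' = nats s ''ph'' \<and>
      combine_post N p h s t)"
proof -
  from exec_Combine obtain C where C: "0 \<le> C" and comb: "\<And>s h p N. 1 \<le> h \<Longrightarrow> nats s ''h'' 0 = h \<Longrightarrow> nats s ''q'' 0 = p \<Longrightarrow> nats s ''N'' 0 = N \<Longrightarrow> p + h + h \<le> N \<Longrightarrow>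
    exec Combine s (C * mtime h) (\<lambda>t. same ginv_nats ginv_reals s t \<and> combine_post N p h s t)"
    by blast
  show ?thesis
  proof (intro exI[of _ "C + 90"] conjI allI impI)
    fix s :: state and l p h N
    assume "nats s ''ph'' (Suc l) = 2 \<and> nats s ''lev'' 0 = Suc l \<and> nats s ''sz'' l = h \<and> 1 \<le> h \<and>
     nats s ''pos'' 0 = p + h + h \<and> nats s ''N'' 0 = N \<and> p + h + h \<le> N"
    then have a: "nats s ''ph'' (Suc l) = 2" "nats s ''lev'' 0 = Suc l" "nats s ''sz'' l = h" "1 \<le> h"
      "nats s ''pos'' 0 = p + h + h" "nats s ''N'' 0 = N" "p + h + h \<le> N" by auto
    let ?Q = "\<lambda>t. same mach_nats ginv_reals s t \<and> nats t ''lev'' 0 = Suc (Suc l) \<and> nats t ''pos'' 0 = p + h + h \<and>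
      nats t ''ph'' = nats s ''ph'' \<and> combine_post N p h s t"
    define s1 where "s1 = s\<lparr>nats := (nats s)(''h'' := (nats s ''h'')(0 := h))\<rparr>"
    define s2 where "s2 = s1\<lparr>nats := (nats s1)(''q'' := (nats s1 ''q'')(0 := p))\<rparr>"
    have g2: "gat s2 = gat s" by (simp add: fun_eq_iff gat_def s2_def s1_def)
    have same2: "same mach_nats ginv_reals s s2" by (auto simp: same_def s2_def s1_def)
    have 1: "exec (nset ''h'' (NGet ''sz'' (NSub (nv ''lev'') (NConst 1)))) s 10 (\<lambda>t. t = s1)"
      by (rule exec_NSet) (use a in \<open>simp_all add: s1_def\<close>)
    have 2: "exec (nset ''q'' (NSub (NSub (nv ''pos'') (nv ''h'')) (nv ''h''))) s1 15 (\<lambda>t. t = s2)"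
      by (rule exec_NSet) (use a in \<open>simp_all add: s1_def s2_def\<close>)
    have 3: "exec (nset ''lev'' (NAdd (nv ''lev'') (NConst 1))) t 10 ?Q"
      if t: "same ginv_nats ginv_reals s2 t \<and> combine_post N p h s2 t" for t
    proof -
      note st = conjunct1[OF t]
      define t1 where "t1 = t\<lparr>nats := (nats t)(''lev'' := (nats t ''lev'')(0 := Suc (Suc l)))\<rparr>"
      have n: "nats t ''lev'' 0 = Suc l" "nats t ''ph'' = nats s ''ph''" "nats t ''pos'' 0 = p + h + h"
        using a by (simp_all add: same_nats[OF st] s2_def s1_def)
      have g3: "gat t1 = gat t" by (simp add: fun_eq_iff gat_def t1_def)
      have "same mach_nats ginv_reals s t" by (rule same_trans[OF same2 st]) auto
      then have st3: "same mach_nats ginv_reals s t1" by (auto simp: same_def t1_def)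
      have Q: "?Q t1"
      proof -
        have "nats t1 ''lev'' 0 = Suc (Suc l)" "nats t1 ''pos'' 0 = p + h + h" "nats t1 ''ph'' = nats s ''ph''"
          using n by (simp_all add: t1_def)
        then show ?thesis using st3 conjunct2[OF t] unfolding g3 g2 by blast
      qed
      have q1: "exec (nset ''lev'' (NAdd (nv ''lev'') (NConst 1))) t 10 (\<lambda>t. t = t1)"
        by (rule exec_NSet) (use n in \<open>simp_all add: t1_def\<close>)
      show ?thesis by (rule exec_eq[OF q1]) (rule Q)
    qed
    have 4: "exec CombineStep s1
        (15 + (C * mtime h + 10)) ?Q"
    proof (rule exec_Seq[OF 2], rule exec_Seq)
      fix t assume "t = s2"
      then show "exec Combine t (C * mtime h) (\<lambda>t. same ginv_nats ginv_reals s2 t \<and> combine_post N p h s2 t)"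
        unfolding \<open>t = s2\<close> by (intro comb) (use a in \<open>simp_all add: s2_def s1_def\<close>)
    qed (rule 3)
    have b: "\<not> bval (NLess (NGet ''ph'' (nv ''lev'')) (NConst 2)) s1" "\<not> bval (NLess (NGet ''ph'' (nv ''lev'')) (NConst 1)) s"
      using a by (simp_all add: s1_def)
    have "exec GBody s (5 + (10 + (5 + (15 + (C * mtime h + 10))))) ?Q"
      unfolding GBody_def
    proof (rule exec_mono[OF exec_If[where B = "10 + (5 + (15 + (C * mtime h + 10)))" and Q = ?Q]], goal_cases)
      case 2
      show ?case
      proof (rule exec_Seq[OF 1])
        fix t assume "t = s1"
        show "exec Branch t
           (5 + (15 + (C * mtime h + 10))) ?Q"
          unfolding \<open>t = s1\<close> by (rule exec_mono[OF exec_If[OF _ 4]]) (use b in simp_all)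
      qed
    qed (use b in simp_all)
    then show "exec GBody s ((C + 90) * mtime h) ?Q"
      by (rule exec_mono) (use powr_ge_1[OF a(4)] in \<open>simp_all add: distrib_right\<close>)
  qed (use C in simp)
qed

lemma block_split: "{p..<p + h + h} = {p..<p + h} \<union> {p + h..<p + h + h}" for p h :: nat
  by auto

text \<open>The array at two moments: \<open>g\<close> after the first recursive call and
  \<open>g'\<close> after the second. They differ in the trailing block only, so the entries that
  make up \<open>U\<close> may be read from either.\<close>

lemma ginv_combine_math:
  assumes s1: "solves N {p..<p + h} B g" and pN: "p + h + h \<le> N"
    and gQ: "\<And>i j. i \<in> {p..<p + h} \<Longrightarrow> j \<in> {p + h..<p + h + h} \<Longrightarrow> g i j = (\<Sum>k<N. B i k * B j k)"
    and s2: "solves N {p + h..<p + h + h} (schur_rows N {p..<p + h} B g {p + h..<p + h + h}) g'"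
    and g': "\<And>a b. b < N \<Longrightarrow> \<not> (p + h \<le> a \<and> a < p + h + h \<and> p + h \<le> b \<and> b < p + h + h) \<Longrightarrow> g' a b = g a b"
    and ul: "\<And>i j. i < h \<Longrightarrow> j < h \<Longrightarrow> f (p + i) (p + j) = g' (p + i) (p + j) + (\<Sum>k<h. Vblk g' p h i k * Ublk g' p h j k)"
    and ur: "\<And>i j. i < h \<Longrightarrow> j < h \<Longrightarrow> f (p + i) (p + h + j) = - Vblk g' p h i j"
    and ll: "\<And>i j. i < h \<Longrightarrow> j < h \<Longrightarrow> f (p + h + i) (p + j) = - Vblk g' p h j i"
    and lr: "\<And>i j. i < h \<Longrightarrow> j < h \<Longrightarrow> f (p + h + i) (p + h + j) = g' (p + h + i) (p + h + j)"
  shows "solves N {p..<p + h + h} B f"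
  unfolding block_split
proof (rule solves_combine[OF s1 s2])
  let ?I = "{p..<p + h}" and ?J = "{p + h..<p + h + h}"
  have I: "\<exists>i'<h. i = p + i'" if "i \<in> ?I" for i using that by (intro exI[of _ "i - p"]) auto
  have J: "\<exists>i'<h. i = p + h + i'" if "i \<in> ?J" for i using that by (intro exI[of _ "i - (p + h)"]) auto
  have g'I: "g' i j = g i j" if "i \<in> ?I" "j \<in> ?I \<union> ?J" for i j
    by (rule g') (use that pN in auto)
  define U where "U i j = Ublk g' p h (i - p) (j - (p + h))" for i j
  define V where "V i j = Vblk g' p h (i - p) (j - (p + h))" for i j
  show "?I \<subseteq> {..<N}" "?J \<subseteq> {..<N}" "?I \<inter> ?J = {}" using pN by auto
  show "g i j = (\<Sum>k<N. B i k * B j k)" if "i \<in> ?I" "j \<in> ?J" for i j using gQ that .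
  show "U i j = (\<Sum>b\<in>?I. g i b * g b j)" if i: "i \<in> ?I" and j: "j \<in> ?J" for i j
  proof -
    obtain i' j' where ij: "i' < h" "j' < h" "i = p + i'" "j = p + h + j'" using I J i j by meson
    have "U i j = (\<Sum>k<h. g' i (p + k) * g' (p + k) j)" by (simp add: U_def Ublk_def ij)
    also have "\<dots> = (\<Sum>b\<in>?I. g' i b * g' b j)" by (rule sum_block[symmetric])
    also have "\<dots> = (\<Sum>b\<in>?I. g i b * g b j)" by (intro sum.cong arg_cong2[of _ _ _ _ "(*)"] g'I) (use that in auto)
    finally show ?thesis .
  qed
  show "V i j = (\<Sum>c\<in>?J. U i c * g' c j)" if i: "i \<in> ?I" and j: "j \<in> ?J" for i j
  proof -
    obtain i' j' where ij: "i' < h" "j' < h" "i = p + i'" "j = p + h + j'" using I J i j by meson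
    have "V i j = (\<Sum>k<h. U i (p + h + k) * g' (p + h + k) j)" by (simp add: V_def Vblk_def U_def ij)
    also have "\<dots> = (\<Sum>c\<in>?J. U i c * g' c j)" by (rule sum_block[symmetric])
    finally show ?thesis .
  qed
  show "f i j = g i j + (\<Sum>c\<in>?J. V i c * U j c)" if i: "i \<in> ?I" and j: "j \<in> ?I" for i j
  proof -
    obtain i' j' where ij: "i' < h" "j' < h" "i = p + i'" "j = p + j'" using I i j by meson
    have "(\<Sum>c\<in>?J. V i c * U j c) = (\<Sum>k<h. V i (p + h + k) * U j (p + h + k))" by (rule sum_block)
    also have "\<dots> = (\<Sum>k<h. Vblk g' p h i' k * Ublk g' p h j' k)" by (simp add: ij U_def V_def)
    finally show ?thesis using ul[OF ij(1,2)] g'I[of i j] that by (simp add: ij)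
  qed
  show "f i j = - V i j" if "i \<in> ?I" "j \<in> ?J" for i j
    using I[OF that(1)] J[OF that(2)] ur by (auto simp: V_def)
  show "f i j = - V j i" if "i \<in> ?J" "j \<in> ?I" for i j
    using J[OF that(1)] I[OF that(2)] ll by (auto simp: V_def)
  show "f i j = g' i j" if "i \<in> ?J" "j \<in> ?J" for i j
    using J[OF that(1)] J[OF that(2)] lr by auto
qed

text \<open>\<open>B\<close> is a ghost: a call sees only the Gram matrix of the rows in its block.
  For the second recursive call the role of \<open>B\<close> is taken by
  \<open>schur_rows\<close>.\<close>

definition gpre :: "nat \<Rightarrow> nat \<Rightarrow> nat \<Rightarrow> rmat \<Rightarrow> state \<Rightarrow> bool" where
  "gpre l p N B s \<longleftrightarrow> nats s ''lev'' 0 = l \<and> l \<le> nats s ''L'' 0 \<and> nats s ''pos'' 0 = p \<and> nats s ''ph'' l = 0 \<and>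
     nats s ''N'' 0 = N \<and> p + 2 ^ l \<le> N \<and> (\<forall>j\<le>l. nats s ''sz'' j = 2 ^ j) \<and>
     (\<forall>i\<in>{p..<p + 2 ^ l}. \<forall>j\<in>{p..<p + 2 ^ l}. gat s N i j = (\<Sum>k<N. B i k * B j k))"

text \<open>The entries of \<open>ph\<close> above level \<open>l\<close> are the return stack of
  the pending invocations and must survive; raising \<open>lev\<close> by one is the return.\<close>

definition gpost :: "nat \<Rightarrow> nat \<Rightarrow> nat \<Rightarrow> rmat \<Rightarrow> state \<Rightarrow> state \<Rightarrow> bool" where
  "gpost l p N B s t \<longleftrightarrow> same mach_nats ginv_reals s t \<and> nats t ''lev'' 0 = Suc l \<and> nats t ''pos'' 0 = p + 2 ^ l \<and>
     (\<forall>j>l. nats t ''ph'' j = nats s ''ph'' j) \<and> solves N {p..<p + 2 ^ l} B (gat t N) \<and>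
     (\<forall>a b. b < N \<longrightarrow> \<not> (p \<le> a \<and> a < p + 2 ^ l \<and> p \<le> b \<and> b < p + 2 ^ l) \<longrightarrow> gat t N a b = gat s N a b)"

text \<open>Induction on the level. A call makes two calls of half the size and does O(h powr
  \<tau>) work of its own; the recurrence closes because 2 powr \<tau> \<ge> 4 exceeds 2 with room
  for that work.\<close>

lemma ginv_reach:
  "\<exists>K\<ge>0. \<forall>l p N B s. gpre l p N B s \<longrightarrow> reach GTest GBody s (K * real (2 ^ l) powr \<tau>) (gpost l p N B s)"
proof -
  from exec_schur_iteration obtain Ca where schur_spec: "0 \<le> Ca \<and> (\<forall>s l p h N. nats s ''ph'' (Suc l) = 1 \<and> nats s ''lev'' 0 = Suc l \<and> nats s ''sz'' l = h \<and> 1 \<le> h \<and>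
     nats s ''pos'' 0 = p + h \<and> nats s ''N'' 0 = N \<and> p + h + h \<le> N \<longrightarrow>
    exec GBody s (Ca * mtime h) (\<lambda>t. same mach_nats ginv_reals s t \<and> nats t ''lev'' 0 = l \<and> nats t ''pos'' 0 = p + h \<and>
      nats t ''ph'' = (nats s ''ph'')(Suc l := 2, l := 0) \<and>
      schur_post N p h s t))" by (rule exE)
  note Ca = conjunct1[OF schur_spec] and schur = conjunct2[OF schur_spec, rule_format]
  from exec_combine_iteration obtain Cb where comb_spec: "0 \<le> Cb \<and> (\<forall>s l p h N. nats s ''ph'' (Suc l) = 2 \<and> nats s ''lev'' 0 = Suc l \<and> nats s ''sz'' l = h \<and> 1 \<le> h \<and>
     nats s ''pos'' 0 = p + h + h \<and> nats s ''N'' 0 = N \<and> p + h + h \<le> N \<longrightarrow>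
    exec GBody s (Cb * mtime h) (\<lambda>t. same mach_nats ginv_reals s t \<and> nats t ''lev'' 0 = Suc (Suc l) \<and> nats t ''pos'' 0 = p + h + h \<and>
      nats t ''ph'' = nats s ''ph'' \<and>
      combine_post N p h s t))" by (rule exE)
  note Cb = conjunct1[OF comb_spec] and comb = conjunct2[OF comb_spec, rule_format]
  define K where "K = 400 + Ca + Cb"
  have test: "bcost GTest = 7" by (simp add: GTest_def)
  have main: "reach GTest GBody s (K * real (2 ^ l) powr \<tau>) (gpost l p N B s)" if "gpre l p N B s" for l p N B s
    using that
  proof (induction l arbitrary: p B s)
    case 0
    then have a: "nats s ''ph'' 0 = 0" "nats s ''lev'' 0 = 0" "nats s ''pos'' 0 = p" "nats s ''N'' 0 = N" "p < N"
      and g: "gat s N p p = (\<Sum>k<N. B p k * B p k)" by (auto simp: gpre_def)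
    have b: "bval GTest s" using a by (simp add: GTest_def)
    have "reach GTest GBody s (real (bcost GTest) + 90) (\<lambda>t. same mach_nats ginv_reals s t \<and> nats t ''lev'' 0 = 1 \<and> nats t ''pos'' 0 = p + 1 \<and>
     nats t ''ph'' = nats s ''ph'' \<and> gat t N p p = 1 / gat s N p p \<and>
     (\<forall>a b. b < N \<longrightarrow> \<not> (a = p \<and> b = p) \<longrightarrow> gat t N a b = gat s N a b))"
      by (rule reach_step[OF b exec_leaf[OF a]])
    then show ?case
    proof (rule reach_mono)
      show "real (bcost GTest) + 90 \<le> K * real (2 ^ 0) powr \<tau>" using Ca Cb by (simp add: test K_def)
    next
      fix t assume t: "same mach_nats ginv_reals s t \<and> nats t ''lev'' 0 = 1 \<and> nats t ''pos'' 0 = p + 1 \<and>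
       nats t ''ph'' = nats s ''ph'' \<and> gat t N p p = 1 / gat s N p p \<and>
       (\<forall>a b. b < N \<longrightarrow> \<not> (a = p \<and> b = p) \<longrightarrow> gat t N a b = gat s N a b)"
      have I: "{p..<p + 2 ^ 0} = {p}" by auto
      have "solves N {p..<p + 2 ^ 0} B (gat t N)" unfolding I
        by (rule solves_singleton[where G = "gat s N p p", OF a(5)]) (use t g in simp_all)
      moreover have "gat t N a b = gat s N a b" if "b < N" "\<not> (p \<le> a \<and> a < p + 2 ^ 0 \<and> p \<le> b \<and> b < p + 2 ^ 0)" for a b
      proof -
        have "\<not> (a = p \<and> b = p)" using that(2) by auto
        moreover have "\<forall>a b. b < N \<longrightarrow> \<not> (a = p \<and> b = p) \<longrightarrow> gat t N a b = gat s N a b" using t by (elim conjE)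
        ultimately show ?thesis using that(1) by simp
      qed
      ultimately show "gpost 0 p N B s t" using t unfolding gpost_def by simp
    qed
  next
    case (Suc l)
    define h where "h = (2::nat) ^ l"
    define P where "P = mtime h"
    have hh: "(2::nat) ^ Suc l = h + h" by (simp add: h_def)
    have h1: "1 \<le> h" by (simp add: h_def)
    have P1: "1 \<le> P" using powr_ge_1[OF h1] by (simp add: P_def)
    let ?I = "{p..<p + h}" and ?J = "{p + h..<p + h + h}"
    from Suc.prems have a: "nats s ''lev'' 0 = Suc l" "Suc l \<le> nats s ''L'' 0" "nats s ''pos'' 0 = p" "nats s ''ph'' (Suc l) = 0"
      "nats s ''N'' 0 = N" "p + h + h \<le> N" "\<And>j. j \<le> Suc l \<Longrightarrow> nats s ''sz'' j = 2 ^ j"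
      and gram: "\<And>i j. i \<in> {p..<p + h + h} \<Longrightarrow> j \<in> {p..<p + h + h} \<Longrightarrow> gat s N i j = (\<Sum>k<N. B i k * B j k)"
      by (auto simp: gpre_def hh add.assoc simp del: power_Suc)
    define s1 where "s1 = s\<lparr>nats := (nats s)(''ph'' := (nats s ''ph'')(Suc l := 1, l := 0), ''lev'' := (nats s ''lev'')(0 := l))\<rparr>"
    have st1: "same mach_nats ginv_reals s s1" by (auto simp: same_def s1_def)
    have g1: "gat s1 N = gat s N" by (simp add: s1_def gat_def fun_eq_iff)
    have pre1: "gpre l p N B s1"
    proof -
      have "nats s1 ''lev'' 0 = l" "nats s1 ''pos'' 0 = p" "nats s1 ''ph'' l = 0" "nats s1 ''L'' = nats s ''L''"
        "nats s1 ''N'' = nats s ''N''" "nats s1 ''sz'' = nats s ''sz''" using a(3) by (simp_all add: s1_def)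
      moreover have "\<forall>j\<le>l. nats s ''sz'' j = 2 ^ j" using a(7) by simp
      moreover have "\<forall>i\<in>?I. \<forall>j\<in>?I. gat s N i j = (\<Sum>k<N. B i k * B j k)" using gram by simp
      ultimately show ?thesis unfolding gpre_def g1 h_def[symmetric] using a(2,5,6) by simp
    qed
    have r1: "reach GTest GBody s (7 + 90) (\<lambda>t. t = s1)"
      using reach_step[of GTest s GBody 90, OF _ exec_descend[OF a(4,1)]] a by (simp add: test s1_def) (simp add: GTest_def)
    have r2: "reach GTest GBody s1 (K * P) (gpost l p N B s1)"
      using Suc.IH[OF pre1] by (simp add: P_def h_def)
    have r3: "reach GTest GBody s2 (7 + Ca * P + (K * P + (7 + Cb * P))) (gpost (Suc l) p N B s)" if "gpost l p N B s1 s2" for s2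
    proof -
      from that have p2: "same mach_nats ginv_reals s1 s2" "nats s2 ''lev'' 0 = Suc l" "nats s2 ''pos'' 0 = p + h"
        "\<And>j. j > l \<Longrightarrow> nats s2 ''ph'' j = nats s1 ''ph'' j" "solves N ?I B (gat s2 N)"
        "\<And>a b. b < N \<Longrightarrow> \<not> (p \<le> a \<and> a < p + h \<and> p \<le> b \<and> b < p + h) \<Longrightarrow> gat s2 N a b = gat s1 N a b"
        by (auto simp: gpost_def h_def)
      have st2: "same mach_nats ginv_reals s s2" by (rule same_trans[OF st1 p2(1)]) auto
      have c2: "nats s2 ''ph'' (Suc l) = 1" "nats s2 ''N'' 0 = N" "nats s2 ''sz'' l = h" "Suc l \<le> nats s2 ''L'' 0"
        using p2(4)[of "Suc l"] a by (simp_all add: same_nats[OF st2] h_def s1_def[THEN arg_cong[where f = nats]])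
      have Q2: "gat s2 N i j = (\<Sum>k<N. B i k * B j k)" if "i \<in> ?I" "j \<in> ?J" for i j
        using p2(6)[of j i] gram[of i j] that a(6) by (simp add: g1)
      have S2: "gat s2 N i j = (\<Sum>k<N. B i k * B j k)" if "i \<in> ?J" "j \<in> ?J" for i j
        using p2(6)[of j i] gram[of i j] that a(6) by (simp add: g1)
      have b2: "bval GTest s2" using p2(2) c2(4) by (simp add: GTest_def)
      have r: "reach GTest GBody s2 (7 + Ca * P) (\<lambda>t. same mach_nats ginv_reals s2 t \<and> nats t ''lev'' 0 = l \<and> nats t ''pos'' 0 = p + h \<and>
      nats t ''ph'' = (nats s2 ''ph'')(Suc l := 2, l := 0) \<and>
      schur_post N p h s2 t)"
      proof -
        have pre: "nats s2 ''ph'' (Suc l) = 1 \<and> nats s2 ''lev'' 0 = Suc l \<and> nats s2 ''sz'' l = h \<and> 1 \<le> h \<and>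
          nats s2 ''pos'' 0 = p + h \<and> nats s2 ''N'' 0 = N \<and> p + h + h \<le> N"
          using c2(1-3) p2(2,3) h1 a(6) by (intro conjI)
        show ?thesis using reach_step[OF b2 schur[OF pre]] unfolding test P_def[symmetric] of_nat_numeral .
      qed
      show ?thesis
      proof (rule reach_trans[OF r])
        fix s3 assume p3: "same mach_nats ginv_reals s2 s3 \<and> nats s3 ''lev'' 0 = l \<and> nats s3 ''pos'' 0 = p + h \<and>
      nats s3 ''ph'' = (nats s2 ''ph'')(Suc l := 2, l := 0) \<and>
      schur_post N p h s2 s3"
        note p3a = conjunct2[OF p3] note p3b = conjunct2[OF p3a] note p3c = conjunct2[OF p3b] note p3d = conjunct2[OF p3c]
        note lev3 = conjunct1[OF p3a] and pos3 = conjunct1[OF p3b] and ph3 = conjunct1[OF p3c]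
          and lr3 = conjunct1[OF p3d, rule_format] and off3 = conjunct2[OF p3d, rule_format]
        define B' where "B' = schur_rows N ?I B (gat s2 N) ?J"
        have st3: "same mach_nats ginv_reals s s3" by (rule same_trans[OF st2 conjunct1[OF p3]]) auto
        have gram3: "gat s3 N i j = (\<Sum>k<N. B' i k * B' j k)" if ij: "i \<in> ?J" "j \<in> ?J" for i j
        proof -
          define i' j' where "i' = i - (p + h)" and "j' = j - (p + h)"
          then have i': "i' < h" "i = p + h + i'" and j': "j' < h" "j = p + h + j'" using ij by auto
          have "gat s3 N i j = gat s2 N i j - (\<Sum>k<h. gat s2 N (p + k) i * (\<Sum>k'<h. gat s2 N (p + k) (p + k') * gat s2 N (p + k') j))"
            using lr3[OF i'(1) j'(1)] unfolding i'(2)[symmetric] j'(2)[symmetric] Ublk_def .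
          also have "\<dots> = gat s2 N i j - (\<Sum>a\<in>?I. gat s2 N a i * (\<Sum>b\<in>?I. gat s2 N a b * gat s2 N b j))"
            by (simp only: sum_block)
          also have "\<dots> = (\<Sum>k<N. B' i k * B' j k)"
            unfolding B'_def by (rule schur_rows_gram[OF p2(5) _ Q2 S2 ij]) (use a(6) in auto)
          finally show ?thesis .
        qed
        have "gpre l (p + h) N B' s3"
        proof -
          have "nats s3 ''lev'' 0 = l" "nats s3 ''pos'' 0 = p + h" "nats s3 ''ph'' l = 0" using lev3 pos3 ph3 by simp_all
          moreover have "nats s3 ''L'' = nats s ''L''" "nats s3 ''N'' = nats s ''N''" "nats s3 ''sz'' = nats s ''sz''"
            by (simp_all add: same_nats[OF st3])
          moreover have "\<forall>j\<le>l. nats s ''sz'' j = 2 ^ j" using a(7) by simp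
          ultimately show ?thesis
            unfolding gpre_def h_def[symmetric] using gram3 a(2,5,6) by simp
        qed
        from Suc.IH[OF this] have r4: "reach GTest GBody s3 (K * P) (gpost l (p + h) N B' s3)" by (simp add: P_def h_def)
        show "reach GTest GBody s3 (K * P + (7 + Cb * P)) (gpost (Suc l) p N B s)"
        proof (rule reach_trans[OF r4])
          fix s4 assume "gpost l (p + h) N B' s3 s4"
          then have p4: "same mach_nats ginv_reals s3 s4" "nats s4 ''lev'' 0 = Suc l" "nats s4 ''pos'' 0 = p + h + h"
            "\<And>j. j > l \<Longrightarrow> nats s4 ''ph'' j = nats s3 ''ph'' j" "solves N ?J B' (gat s4 N)"
            "\<And>a b. b < N \<Longrightarrow> \<not> (p + h \<le> a \<and> a < p + h + h \<and> p + h \<le> b \<and> b < p + h + h) \<Longrightarrow> gat s4 N a b = gat s3 N a b"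
            by (auto simp: gpost_def h_def)
          have st4: "same mach_nats ginv_reals s s4" by (rule same_trans[OF st3 p4(1)]) auto
          have c4: "nats s4 ''ph'' (Suc l) = 2" "nats s4 ''N'' 0 = N" "nats s4 ''sz'' l = h" "Suc l \<le> nats s4 ''L'' 0"
            using p4(4)[of "Suc l"] ph3 a(2,5) a(7)[of l] by (simp_all add: same_nats[OF st4] h_def)
          have b4: "bval GTest s4" using p4(2) c4(4) by (simp add: GTest_def)
          have r: "reach GTest GBody s4 (7 + Cb * P) (\<lambda>t. same mach_nats ginv_reals s4 t \<and> nats t ''lev'' 0 = Suc (Suc l) \<and> nats t ''pos'' 0 = p + h + h \<and>
      nats t ''ph'' = nats s4 ''ph'' \<and>
      combine_post N p h s4 t)"
          proof -
            have pre: "nats s4 ''ph'' (Suc l) = 2 \<and> nats s4 ''lev'' 0 = Suc l \<and> nats s4 ''sz'' l = h \<and> 1 \<le> h \<and>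
              nats s4 ''pos'' 0 = p + h + h \<and> nats s4 ''N'' 0 = N \<and> p + h + h \<le> N"
              using c4(1-3) p4(2,3) h1 a(6) by (intro conjI)
            show ?thesis using reach_step[OF b4 comb[OF pre]] unfolding test P_def[symmetric] of_nat_numeral .
          qed
          show "reach GTest GBody s4 (7 + Cb * P) (gpost (Suc l) p N B s)"
          proof (rule reach_mono[OF r order_refl])
            fix t assume t: "same mach_nats ginv_reals s4 t \<and> nats t ''lev'' 0 = Suc (Suc l) \<and> nats t ''pos'' 0 = p + h + h \<and>
      nats t ''ph'' = nats s4 ''ph'' \<and>
      combine_post N p h s4 t"
            note ta = conjunct2[OF t] note tb = conjunct2[OF ta] note tc = conjunct2[OF tb] note td = conjunct2[OF tc]
            note te = conjunct2[OF td] note tf = conjunct2[OF te] note tg = conjunct2[OF tf]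
            note lev = conjunct1[OF ta] and pos = conjunct1[OF tb] and ph = conjunct1[OF tc] and ul = conjunct1[OF td, rule_format]
              and ur = conjunct1[OF te, rule_format] and ll = conjunct1[OF tf, rule_format] and lr = conjunct1[OF tg, rule_format]
              and out = conjunct2[OF tg, rule_format]
            have off: "gat s4 N a b = gat s2 N a b" if "b < N" "\<not> (p + h \<le> a \<and> a < p + h + h \<and> p + h \<le> b \<and> b < p + h + h)" for a b
              using p4(6)[OF that] off3[OF that] by (rule trans)
            have "solves N {p..<p + h + h} B (gat t N)"
              by (rule ginv_combine_math[OF p2(5) a(6) Q2 p4(5)[unfolded B'_def] off ul ur ll lr])
            moreover have "gat t N a b = gat s N a b" if b: "b < N" "\<not> (p \<le> a \<and> a < p + h + h \<and> p \<le> b \<and> b < p + h + h)" for a b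
            proof -
              have "gat t N a b = gat s4 N a b" by (rule out[OF b])
              also have "\<dots> = gat s2 N a b" by (rule off) (use b in auto)
              also have "\<dots> = gat s1 N a b" by (rule p2(6)) (use b in auto)
              finally show ?thesis by (simp add: g1)
            qed
            moreover have "same mach_nats ginv_reals s t" by (rule same_trans[OF st4 conjunct1[OF t]]) auto
            moreover have "nats t ''ph'' j = nats s ''ph'' j" if "j > Suc l" for j
            proof -
              have "nats t ''ph'' j = nats s4 ''ph'' j" by (simp only: ph)
              also have "\<dots> = nats s3 ''ph'' j" by (rule p4(4)) (use that in simp)
              also have "\<dots> = ((nats s2 ''ph'')(Suc l := 2, l := 0)) j" by (simp only: ph3)
              also have "\<dots> = nats s2 ''ph'' j" using that by simp
              also have "\<dots> = nats s1 ''ph'' j" by (rule p2(4)) (use that in simp)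
              also have "\<dots> = nats s ''ph'' j" using that by (simp add: s1_def)
              finally show ?thesis .
            qed
            moreover note lev pos
            ultimately show "gpost (Suc l) p N B s t"
              unfolding gpost_def hh add.assoc[symmetric] by (intro conjI allI impI)
          qed
        qed
      qed
    qed
    have "reach GTest GBody s (7 + 90 + (K * P + (7 + Ca * P + (K * P + (7 + Cb * P))))) (gpost (Suc l) p N B s)"
      by (rule reach_trans[OF r1], simp only:, rule reach_trans[OF r2 r3])
    then show ?case
    proof (rule reach_mono)
      \<comment> \<open>Two calls cost 2 * K * P. The summand 400 in \<open>K\<close> covers tests
        and bookkeeping, so the work outside the calls is at most one further K * P.\<close>
      have "7 + 90 + (K * P + (7 + Ca * P + (K * P + (7 + Cb * P)))) \<le> 3 * K * P"
        using P1 by (simp add: K_def algebra_simps)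
      also have "\<dots> \<le> K * (4 * P)" using Ca Cb P1 by (simp add: K_def mult.assoc[symmetric])
      also have "\<dots> \<le> K * (2 powr \<tau> * P)"
      proof (intro mult_left_mono mult_right_mono)
        have "(2::real) powr 2 \<le> 2 powr \<tau>" using \<tau> by (intro powr_mono) auto
        then show "4 \<le> 2 powr \<tau>" by simp
      qed (use P1 Ca Cb in \<open>auto simp: K_def\<close>)
      also have "2 powr \<tau> * P = real (2 ^ Suc l) powr \<tau>" by (simp add: P_def h_def powr_mult)
      finally show "7 + 90 + (K * P + (7 + Ca * P + (K * P + (7 + Cb * P)))) \<le> K * real (2 ^ Suc l) powr \<tau>" .
    qed
  qed
  have "0 \<le> K" using Ca Cb by (simp add: K_def)
  then show ?thesis by (intro exI[of _ K] conjI allI impI main)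
qed

definition Ginv :: "rop com" where
  "Ginv = Seq (nset ''lev'' (nv ''L'')) (Seq (nset ''pos'' (NConst 0))
     (Seq (NSet ''ph'' (nv ''L'') (NConst 0)) (While GTest GBody)))"

lemma exec_Ginv:
  "\<exists>K\<ge>0. \<forall>s L N B. nats s ''L'' 0 = L \<and> nats s ''N'' 0 = N \<and> N = 2 ^ L \<and> (\<forall>j\<le>L. nats s ''sz'' j = 2 ^ j) \<and>
     (\<forall>i<N. \<forall>j<N. gat s N i j = (\<Sum>k<N. B i k * B j k)) \<longrightarrow>
    exec Ginv s (K * mtime N) (\<lambda>t. same mach_nats ginv_reals s t \<and> solves N {..<N} B (gat t N))"
proof -
  from ginv_reach obtain K where K: "0 \<le> K" and reach: "\<And>l p N B s. gpre l p N B s \<Longrightarrow> reach GTest GBody s (K * real (2 ^ l) powr \<tau>) (gpost l p N B s)"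
    by blast
  show ?thesis
  proof (intro exI[of _ "K + 37"] conjI allI impI)
    fix s :: state and L N B
    assume "nats s ''L'' 0 = L \<and> nats s ''N'' 0 = N \<and> N = 2 ^ L \<and> (\<forall>j\<le>L. nats s ''sz'' j = 2 ^ j) \<and>
     (\<forall>i<N. \<forall>j<N. gat s N i j = (\<Sum>k<N. B i k * B j k))"
    then have a: "nats s ''L'' 0 = L" "nats s ''N'' 0 = N" "N = 2 ^ L" "\<forall>j\<le>L. nats s ''sz'' j = 2 ^ j"
      and gram: "\<forall>i<N. \<forall>j<N. gat s N i j = (\<Sum>k<N. B i k * B j k)" by auto
    define s1 where "s1 = s\<lparr>nats := (nats s)(''lev'' := (nats s ''lev'')(0 := L))\<rparr>"
    define s2 where "s2 = s1\<lparr>nats := (nats s1)(''pos'' := (nats s1 ''pos'')(0 := 0))\<rparr>"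
    define s3 where "s3 = s2\<lparr>nats := (nats s2)(''ph'' := (nats s2 ''ph'')(L := 0))\<rparr>"
    have 1: "exec (nset ''lev'' (nv ''L'')) s 10 (\<lambda>t. t = s1)"
      by (rule exec_NSet) (use a in \<open>simp_all add: s1_def\<close>)
    have 2: "exec (nset ''pos'' (NConst 0)) s1 10 (\<lambda>t. t = s2)"
      by (rule exec_NSet) (use a in \<open>simp_all add: s2_def\<close>)
    have 3: "exec (NSet ''ph'' (nv ''L'') (NConst 0)) s2 10 (\<lambda>t. t = s3)"
      by (rule exec_NSet) (use a in \<open>simp_all add: s3_def s2_def s1_def\<close>)
    have g3: "gat s3 N = gat s N" by (simp add: gat_def s3_def s2_def s1_def fun_eq_iff)
    have st3: "same mach_nats ginv_reals s s3" by (auto simp: same_def s3_def s2_def s1_def)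
    have "gpre L 0 N B s3" unfolding gpre_def g3 using a gram
      by (auto simp: s3_def s2_def s1_def)
    from reach[OF this] have r: "reach GTest GBody s3 (K * mtime N) (gpost L 0 N B s3)" by (simp add: a(3))
    have 4: "exec (While GTest GBody) s3 (K * mtime N + bcost GTest) (gpost L 0 N B s3)"
    proof (rule reach_While[OF r])
      fix t assume t: "gpost L 0 N B s3 t"
      then have st: "same mach_nats ginv_reals s3 t" and lev: "nats t ''lev'' 0 = Suc L" by (auto simp: gpost_def)
      have "nats t ''L'' = nats s ''L''" unfolding same_nats[OF st, of "''L''", simplified] by (simp add: s3_def s2_def s1_def)
      then show "\<not> bval GTest t" using lev a by (simp add: GTest_def)
    qed
    have "exec Ginv s (10 + (10 + (10 + (K * mtime N + bcost GTest)))) (gpost L 0 N B s3)"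
      unfolding Ginv_def by (rule exec_Seq_eq[OF 1], rule exec_Seq_eq[OF 2], rule exec_Seq_eq[OF 3], rule 4)
    then show "exec Ginv s ((K + 37) * mtime N) (\<lambda>t. same mach_nats ginv_reals s t \<and> solves N {..<N} B (gat t N))"
    proof (rule exec_mono)
      have "1 \<le> mtime N" by (rule powr_ge_1) (simp add: a)
      then show "10 + (10 + (10 + (K * mtime N + bcost GTest))) \<le> (K + 37) * mtime N"
        by (simp add: GTest_def distrib_right)
    next
      fix t assume t: "gpost L 0 N B s3 t"
      then have "same mach_nats ginv_reals s3 t" by (simp add: gpost_def)
      then have "same mach_nats ginv_reals s t" by (rule same_trans[OF st3]) auto
      then show "same mach_nats ginv_reals s t \<and> solves N {..<N} B (gat t N)"
        using t by (simp add: gpost_def a(3) atLeast0LessThan)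
    qed
  qed (use K in simp)
qed

end

section \<open>Weighted least squares\<close>

definition VecSum :: "string \<Rightarrow> nexp \<Rightarrow> nexp \<Rightarrow> rop rexp \<Rightarrow> rop com" where
  "VecSum d R K e = Tensor d (nv ''i'') R (NConst 1) rzero K e"

definition vsum_cost :: "nexp \<Rightarrow> nexp \<Rightarrow> rop rexp \<Rightarrow> real" where
  "vsum_cost R K e = 8 * real (tensor_cost (nv ''i'') R (NConst 1) rzero K e)"

definition VecMap :: "string \<Rightarrow> nexp \<Rightarrow> rop rexp \<Rightarrow> rop com" where
  "VecMap d R e = Map d (nv ''i'') R (NConst 1) e"

definition vmap_cost :: "nexp \<Rightarrow> rop rexp \<Rightarrow> real" where
  "vmap_cost R e = 8 * map_cost (nv ''i'') R (NConst 1) e"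

lemma vsum_cost_nonneg: "0 \<le> vsum_cost R K e" and vmap_cost_nonneg: "0 \<le> vmap_cost R e"
  by (simp_all add: vsum_cost_def vmap_cost_def map_cost_nonneg)

abbreviation "rv a \<equiv> RGet a (NConst 0)"
abbreviation "ri a \<equiv> RGet a (nv ''i'')"
abbreviation "rk a \<equiv> RGet a (nv ''k'')"
abbreviation "dir_reals \<equiv> {''U'', ''V'', ''X'', ''G'', ''gv'', ''y'', ''ty'', ''dd''} \<union> znames"

context multiplier begin

lemma size_le: "r \<le> N \<Longrightarrow> q \<le> N \<Longrightarrow> 1 \<le> N \<Longrightarrow> (real r + 1) * (real q + 1) \<le> 4 * mtime N"
proof -
  assume a: "r \<le> N" "q \<le> N" "1 \<le> N"
  have "(real r + 1) * (real q + 1) \<le> (real N + 1) * (real N + 1)" using a by (intro mult_mono) auto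
  also have "\<dots> \<le> 4 * mtime N" by (rule Suc_sq_le[OF a(3) \<tau>])
  finally show ?thesis .
qed

lemma exec_VecSum:
  assumes R: "\<And>s'. same ijk {d} s s' \<Longrightarrow> nval R s' = r" and K: "\<And>s'. same ijk {d} s s' \<Longrightarrow> nval K s' = \<kappa>"
    and e: "\<And>s' i k. same ijk {d} s s' \<Longrightarrow> i < r \<Longrightarrow> k < \<kappa> \<Longrightarrow> nats s' ''i'' 0 = i \<Longrightarrow> nats s' ''k'' 0 = k \<Longrightarrow> rval e s' = F i k"
    and N: "r \<le> N" "\<kappa> \<le> N" "1 \<le> N"
  shows "exec (VecSum d R K e) s (vsum_cost R K e * mtime N)
    (\<lambda>t. same ijk {d} s t \<and> (\<forall>i<r. reals t d i = (\<Sum>k<\<kappa>. F i k)))"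
proof -
  let ?c = "real (tensor_cost (nv ''i'') R (NConst 1) rzero K e)"
  have "exec (VecSum d R K e) s (?c * (real r + 1) * (real 1 + 1) * (real \<kappa> + 1))
    (\<lambda>t. same ijk {d} s t \<and> (\<forall>i<r. \<forall>j<(1::nat). reals t d i = 0 + (\<Sum>k<\<kappa>. F i k)) \<and>
      (\<forall>c. (\<forall>i<r. \<forall>j<(1::nat). c \<noteq> i) \<longrightarrow> reals t d c = reals s d c))"
    unfolding VecSum_def
    by (rule exec_Tensor[where X = "\<lambda>i j. i" and Z = "\<lambda>i j. 0" and F = "\<lambda>i j k. F i k"])
      (erule R, simp, erule K, simp, simp, rule e, assumption+, simp)
  moreover have "?c * (real r + 1) * (real 1 + 1) * (real \<kappa> + 1) \<le> vsum_cost R K e * mtime N"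
  proof -
    have "?c * (real r + 1) * (real 1 + 1) * (real \<kappa> + 1) = 2 * ?c * ((real r + 1) * (real \<kappa> + 1))" by simp
    also have "\<dots> \<le> 2 * ?c * (4 * mtime N)" by (intro mult_left_mono size_le N) simp
    finally show ?thesis by (simp add: vsum_cost_def)
  qed
  ultimately show ?thesis by (rule exec_mono) auto
qed

lemma exec_VecMap:
  assumes R: "\<And>s'. same ijk {d} s s' \<Longrightarrow> nval R s' = r"
    and e: "\<And>s' i. same ijk {d} s s' \<Longrightarrow> i < r \<Longrightarrow> nats s' ''i'' 0 = i \<Longrightarrow> reals s' d i = reals s d i \<Longrightarrow> rval e s' = Z i"
    and N: "r \<le> N" "1 \<le> N"
  shows "exec (VecMap d R e) s (vmap_cost R e * mtime N)
    (\<lambda>t. same ijk {d} s t \<and> (\<forall>i<r. reals t d i = Z i))"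
proof -
  let ?c = "map_cost (nv ''i'') R (NConst 1) e"
  have "exec (VecMap d R e) s (?c * (real r + 1) * (real 1 + 1))
    (\<lambda>t. same ijk {d} s t \<and> (\<forall>i<r. \<forall>j<(1::nat). reals t d i = Z i) \<and>
      (\<forall>c. (\<forall>i<r. \<forall>j<(1::nat). c \<noteq> i) \<longrightarrow> reals t d c = reals s d c))"
    unfolding VecMap_def
    by (rule exec_Map[where X = "\<lambda>i j. i" and Z = "\<lambda>i j. Z i"])
      (erule R, simp, simp, rule e, assumption+, simp)
  moreover have "?c * (real r + 1) * (real 1 + 1) \<le> vmap_cost R e * mtime N"
  proof -
    have "?c * (real r + 1) * (real 1 + 1) \<le> 2 * ?c * ((real r + 1) * (real 0 + 1))" using map_cost_nonneg by simp
    also have "\<dots> \<le> 2 * ?c * (4 * mtime N)" by (intro mult_left_mono size_le N) (simp_all add: map_cost_nonneg)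
    finally show ?thesis by (simp add: vmap_cost_def)
  qed
  ultimately show ?thesis by (rule exec_mono) auto
qed

end

text \<open>\<open>P\<close> is \<open>A\<close> padded with zeros to a square whose side is a power
  of two, as halving requires. Zero rows make the Gram matrix singular, which generalized inverses
  tolerate, and N \<le> 2 * m keeps the cost within a constant factor of m powr \<tau>.\<close>

definition dat :: "nat \<Rightarrow> nat \<Rightarrow> nat \<Rightarrow> rmat \<Rightarrow> state \<Rightarrow> bool" where
  "dat n m N A s \<longleftrightarrow> nats s ''n'' 0 = n \<and> nats s ''m'' 0 = m \<and> nats s ''N'' 0 = N \<and> N = 2 ^ nats s ''L'' 0 \<and>
     (\<forall>j\<le>nats s ''L'' 0. nats s ''sz'' j = 2 ^ j) \<and> (\<forall>i<n. \<forall>j<m. reals s ''A'' (i * m + j) = A i j) \<and>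
     (\<forall>i<N. \<forall>j<N. reals s ''P'' (i * N + j) = (if i < n \<and> j < m then A i j else 0)) \<and>
     1 \<le> n \<and> n \<le> m \<and> m \<le> N \<and> N \<le> 2 * m"

lemma dat_same:
  assumes "dat n m N A s" "same X Y s t" "{''n'', ''m'', ''N'', ''L'', ''sz''} \<inter> X = {}" "{''A'', ''P''} \<inter> Y = {}"
  shows "dat n m N A t"
proof -
  have eqs: "nats t ''n'' = nats s ''n''" "nats t ''m'' = nats s ''m''" "nats t ''N'' = nats s ''N''" "nats t ''L'' = nats s ''L''"
    "nats t ''sz'' = nats s ''sz''" "reals t ''A'' = reals s ''A''" "reals t ''P'' = reals s ''P''"
    using assms(3,4) by (auto intro!: same_eqs[OF assms(2)])
  show ?thesis using assms(1) unfolding dat_def eqs .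
qed

context multiplier begin

definition GramInv :: "rop com" where
  "GramInv = Seq (nset ''h'' (nv ''N''))
    (Seq (Prod ''G'' (ROp Times (RGet ''P'' hix) (RGet ''W'' (nv ''j''))) (RGet ''P'' hixT)) Ginv)"

definition scaled_rows :: "nat \<Rightarrow> nat \<Rightarrow> rmat \<Rightarrow> rvec \<Rightarrow> nat \<Rightarrow> nat \<Rightarrow> real" where
  "scaled_rows n m A W = (\<lambda>i k. if i < n \<and> k < m then A i k * sqrt (W k) else 0)"

abbreviation "gram_post n m N A s t \<equiv> same mach_nats ginv_reals s t \<and>
      solves N {..<N} (scaled_rows n m A (reals s ''W'')) (gat t N)"

lemma exec_GramInv:
  "\<exists>C\<ge>0. \<forall>n m N A s. dat n m N A s \<and> (\<forall>k<m. 0 < reals s ''W'' k) \<longrightarrow>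
    exec GramInv s (C * mtime N) (\<lambda>t. gram_post n m N A s t)"
proof -
  from exec_Ginv obtain K where K_spec: "0 \<le> K \<and> (\<forall>s L N B. nats s ''L'' 0 = L \<and> nats s ''N'' 0 = N \<and> N = 2 ^ L \<and> (\<forall>j\<le>L. nats s ''sz'' j = 2 ^ j) \<and>
     (\<forall>i<N. \<forall>j<N. gat s N i j = (\<Sum>k<N. B i k * B j k)) \<longrightarrow>
    exec Ginv s (K * mtime N) (\<lambda>t. same mach_nats ginv_reals s t \<and> solves N {..<N} B (gat t N)))" by (rule exE)
  note K = conjunct1[OF K_spec] and ginv = conjunct2[OF K_spec, rule_format]
  let ?cp = "prod_cost (ROp Times (RGet ''P'' hix) (RGet ''W'' (nv ''j''))) (RGet ''P'' hixT)"
  show ?thesis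
  proof (intro exI[of _ "10 + (?cp + K)"] conjI allI impI)
    fix n m N A and s :: state
    assume "dat n m N A s \<and> (\<forall>k<m. 0 < reals s ''W'' k)"
    then have d: "dat n m N A s" and W: "\<And>k. k < m \<Longrightarrow> 0 < reals s ''W'' k" by auto
    have N: "nats s ''N'' 0 = N" "1 \<le> N" and P: "\<And>i j. i < N \<Longrightarrow> j < N \<Longrightarrow> reals s ''P'' (i * N + j) = (if i < n \<and> j < m then A i j else 0)"
      using d by (auto simp: dat_def)
    define B where "B = scaled_rows n m A (reals s ''W'')"
    define s1 where "s1 = s\<lparr>nats := (nats s)(''h'' := (nats s ''h'')(0 := N))\<rparr>"
    have st1: "same mach_nats ginv_reals s s1" by (auto simp: same_def s1_def)
    have 1: "exec (nset ''h'' (nv ''N'')) s (10 * mtime N) (\<lambda>t. t = s1)"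
      by (rule exec_NSet) (use N powr_ge_1[OF N(2)] in \<open>simp_all add: s1_def\<close>)
    have h1: "nats s1 ''h'' 0 = N" by (simp add: s1_def)
    have r1: "reals s1 = reals s" by (simp add: s1_def)
    have 2: "exec (Prod ''G'' (ROp Times (RGet ''P'' hix) (RGet ''W'' (nv ''j''))) (RGet ''P'' hixT)) s1 (?cp * mtime N)
      (\<lambda>t. same ginv_nats ({''G''} \<union> znames) s1 t \<and> (\<forall>i<N. \<forall>j<N. reals t ''G'' (i * N + j) =
         (\<Sum>k<N. (reals s ''P'' (i * N + k) * reals s ''W'' k) * reals s ''P'' (j * N + k))))"
    proof (rule exec_Prod[OF N(2) h1])
      fix s' i j assume *: "same ginv_nats znames s1 s'" "nats s' ''i'' 0 = i" "nats s' ''j'' 0 = j"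
      have "nats s' ''h'' 0 = N" "reals s' ''P'' = reals s ''P''" "reals s' ''W'' = reals s ''W''"
        by (simp_all add: same_eqs[OF *(1)] h1 r1)
      then show "rval (ROp Times (RGet ''P'' hix) (RGet ''W'' (nv ''j''))) s' = reals s ''P'' (i * N + j) * reals s ''W'' j"
        "rval (RGet ''P'' hixT) s' = reals s ''P'' (j * N + i)" using *(2,3) by simp_all
    qed simp
    have 3: "exec Ginv t (K * mtime N) (\<lambda>t. same mach_nats ginv_reals s t \<and> solves N {..<N} B (gat t N))"
      if t: "same ginv_nats ({''G''} \<union> znames) s1 t \<and> (\<forall>i<N. \<forall>j<N. reals t ''G'' (i * N + j) =
         (\<Sum>k<N. (reals s ''P'' (i * N + k) * reals s ''W'' k) * reals s ''P'' (j * N + k)))" for t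
    proof -
      note s1t = conjunct1[OF t] and G = conjunct2[OF t, rule_format]
      have st: "same mach_nats ginv_reals s t" by (rule same_trans[OF st1 s1t]) auto
      have dt: "dat n m N A t" by (rule dat_same[OF d st]) simp_all
      have "gat t N i j = (\<Sum>k<N. B i k * B j k)" if ij: "i < N" "j < N" for i j
      proof -
        have "gat t N i j = (\<Sum>k<N. (reals s ''P'' (i * N + k) * reals s ''W'' k) * reals s ''P'' (j * N + k))"
          unfolding gat_def by (rule G[OF ij])
        also have "\<dots> = (\<Sum>k<N. B i k * B j k)"
        proof (rule sum.cong[OF refl])
          fix k assume "k \<in> {..<N}"
          then have k: "k < N" by simp
          show "(reals s ''P'' (i * N + k) * reals s ''W'' k) * reals s ''P'' (j * N + k) = B i k * B j k"
          \<comment> \<open>Beyond column \<open>m\<close> the array \<open>W\<close> may hold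
            anything; there the zero padding of \<open>P\<close> removes the term.\<close>
          proof (cases "k < m")
            case True
            have "sqrt (reals s ''W'' k) * sqrt (reals s ''W'' k) = reals s ''W'' k" using W[OF True] by simp
            then have "A i k * reals s ''W'' k * A j k = (A i k * sqrt (reals s ''W'' k)) * (A j k * sqrt (reals s ''W'' k))"
              by (metis mult.assoc mult.commute)
            then show ?thesis using True W[OF True] by (simp add: P[OF ij(1) k] P[OF ij(2) k] B_def scaled_rows_def)
          qed (simp add: P[OF ij(1) k] P[OF ij(2) k] B_def scaled_rows_def)
        qed
        finally show ?thesis .
      qed
      then have "exec Ginv t (K * mtime N) (\<lambda>u. same mach_nats ginv_reals t u \<and> solves N {..<N} B (gat u N))"
        using dt by (intro ginv[of t "nats t ''L'' 0"]) (simp add: dat_def)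
      then show ?thesis
      proof (rule exec_mono[OF _ order_refl])
        fix u assume u: "same mach_nats ginv_reals t u \<and> solves N {..<N} B (gat u N)"
        have "same mach_nats ginv_reals s u" by (rule same_trans[OF st conjunct1[OF u]]) auto
        then show "same mach_nats ginv_reals s u \<and> solves N {..<N} B (gat u N)" using u by blast
      qed
    qed
    show "exec GramInv s ((10 + (?cp + K)) * mtime N) (\<lambda>t. gram_post n m N A s t)"
      unfolding GramInv_def distrib_right B_def[symmetric]
      by (rule exec_Seq_eq[OF 1], rule exec_Seq[OF 2 3])
  qed (use K prod_cost_nonneg in simp)
qed

text \<open>
  With \<open>H\<close> the computed generalized inverse, \<open>Back v\<close> leaves \<open>A\<^sup>T H v\<close> in the array \<open>ty\<close>.
\<close>

abbreviation "eGv v \<equiv> ROp Times (RGet ''G'' (NAdd (NMul (nv ''i'') (nv ''N'')) (nv ''k''))) (rk v)"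

abbreviation "eAty \<equiv> ROp Times (RGet ''A'' (NAdd (NMul (nv ''k'') (nv ''m'')) (nv ''i''))) (rk ''y'')"

definition Back :: "string \<Rightarrow> rop com" where
  "Back v = Seq (VecSum ''y'' (nv ''n'') (nv ''n'') (eGv v))
    (VecSum ''ty'' (nv ''m'') (nv ''n'') eAty)"

definition back_cost :: "string \<Rightarrow> real" where
  "back_cost v = vsum_cost (nv ''n'') (nv ''n'') (eGv v)
    + vsum_cost (nv ''m'') (nv ''n'') eAty"

lemma exec_Back:
  assumes d: "dat n m N A s" and v: "v \<notin> {''y'', ''ty''}"
  shows "exec (Back v) s (back_cost v * mtime N) (\<lambda>t. same ijk {''y'', ''ty''} s t \<and>
    (\<forall>l<m. reals t ''ty'' l = (\<Sum>j<n. A j l * (\<Sum>k<n. gat s N j k * reals s v k))))"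
  unfolding Back_def back_cost_def distrib_right
proof (rule exec_Seq)
  have nm: "nats s ''n'' 0 = n" "nats s ''m'' 0 = m" "nats s ''N'' 0 = N" "n \<le> N" "m \<le> N" "1 \<le> N"
    and Aat: "\<And>i j. i < n \<Longrightarrow> j < m \<Longrightarrow> reals s ''A'' (i * m + j) = A i j" using d by (auto simp: dat_def)
  let ?y = "\<lambda>j. \<Sum>k<n. gat s N j k * reals s v k"
  show "exec (VecSum ''y'' (nv ''n'') (nv ''n'') (eGv v)) s
    (vsum_cost (nv ''n'') (nv ''n'') (eGv v) * mtime N)
    (\<lambda>t. same ijk {''y''} s t \<and> (\<forall>i<n. reals t ''y'' i = ?y i))"
  proof (rule exec_VecSum)
    fix s' i k assume *: "same ijk {''y''} s s'" "nats s' ''i'' 0 = i" "nats s' ''k'' 0 = k"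
    have "reals s' v = reals s v" by (rule same_reals[OF *(1)]) (use v in simp)
    then show "rval (eGv v) s' = gat s N i k * reals s v k"
      using nm by (simp add: gat_def *(2,3) same_eqs[OF *(1)])
  qed (use nm in \<open>simp_all add: same_nats\<close>)
  fix t assume t: "same ijk {''y''} s t \<and> (\<forall>i<n. reals t ''y'' i = ?y i)"
  note st = conjunct1[OF t]
  have nmt: "nats t ''n'' 0 = n" "nats t ''m'' 0 = m" using nm by (simp_all add: same_nats[OF st])
  have "exec (VecSum ''ty'' (nv ''m'') (nv ''n'') eAty) t
    (vsum_cost (nv ''m'') (nv ''n'') eAty * mtime N)
    (\<lambda>u. same ijk {''ty''} t u \<and> (\<forall>l<m. reals u ''ty'' l = (\<Sum>j<n. A j l * ?y j)))" (is "exec _ _ _ ?Posta")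
  proof (rule exec_VecSum)
    fix s' i k assume *: "same ijk {''ty''} t s'" "i < m" "k < n" "nats s' ''i'' 0 = i" "nats s' ''k'' 0 = k"
    have "reals s' ''A'' = reals s ''A''" by (simp add: same_reals[OF *(1)] same_reals[OF st])
    moreover have "reals s' ''y'' k = ?y k" using conjunct2[OF t] *(3) by (simp add: same_reals[OF *(1)])
    ultimately show "rval eAty s' = A k i * ?y k"
      using nmt *(2,3) by (simp add: *(4,5) same_nats[OF *(1)] Aat)
  qed (use nm nmt in \<open>simp_all add: same_nats\<close>)
  then show "exec (VecSum ''ty'' (nv ''m'') (nv ''n'') eAty) t
    (vsum_cost (nv ''m'') (nv ''n'') eAty * mtime N)
    (\<lambda>u. same ijk {''y'', ''ty''} s u \<and> (\<forall>l<m. reals u ''ty'' l = (\<Sum>j<n. A j l * ?y j)))"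
  proof (rule exec_mono[OF _ order_refl])
    fix u assume u: "?Posta u"
    have "same ijk {''y'', ''ty''} s u" by (rule same_trans[OF st conjunct1[OF u]]) auto
    then show "same ijk {''y'', ''ty''} s u \<and> (\<forall>l<m. reals u ''ty'' l = (\<Sum>j<n. A j l * ?y j))" using u by blast
  qed
qed

definition Direction :: "rop com" where
  "Direction = Seq GramInv (Seq (VecSum ''gv'' (nv ''n'') (nv ''m'') (ROp Times (RGet ''A'' (NAdd (NMul (nv ''i'') (nv ''m'')) (nv ''k''))) (ROp Times (rk ''W'') (rk ''g''))))
    (Seq (Back ''gv'') (VecMap ''dd'' (nv ''m'') (ROp Times (ri ''W'') (ROp Minus (ri ''ty'') (ri ''g''))))))"

abbreviation "direction_post n m A s t \<equiv> same mach_nats dir_reals s t \<and>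
      (\<forall>i<n. (\<Sum>l<m. A i l * reals t ''dd'' l) = 0) \<and>
      (\<forall>d. (\<forall>i<n. (\<Sum>l<m. A i l * d l) = 0) \<longrightarrow>
         (\<Sum>l<m. 1 / reals s ''W'' l * reals t ''dd'' l * d l) = - (\<Sum>l<m. reals s ''g'' l * d l))"

text \<open>Lagrange multipliers: the result is W (A^T y - g), with \<open>W\<close> the reciprocal
  weights and \<open>y\<close> obtained from v = A W g. Since \<open>v\<close> is in the range of
  \<open>A\<close>, \<open>lsq_consistent\<close> puts the result in the kernel. Divided by
  \<open>W\<close> it differs from -g by a combination of rows of \<open>A\<close>, which every
  kernel vector annihilates.\<close>

lemma exec_Direction:
  "\<exists>C\<ge>0. \<forall>n m N A s. dat n m N A s \<and> (\<forall>k<m. 0 < reals s ''W'' k) \<longrightarrow>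
    exec Direction s (C * mtime N) (\<lambda>t. direction_post n m A s t)"
proof -
  from exec_GramInv obtain C where C_spec: "0 \<le> C \<and> (\<forall>n m N A s. dat n m N A s \<and> (\<forall>k<m. 0 < reals s ''W'' k) \<longrightarrow>
    exec GramInv s (C * mtime N) (\<lambda>t. gram_post n m N A s t))" by (rule exE)
  note C = conjunct1[OF C_spec] and gram = conjunct2[OF C_spec, rule_format]
  let ?ev = "ROp Times (RGet ''A'' (NAdd (NMul (nv ''i'') (nv ''m'')) (nv ''k''))) (ROp Times (rk ''W'') (rk ''g''))"
  let ?ed = "ROp Times (ri ''W'') (ROp Minus (ri ''ty'') (ri ''g''))"
  let ?cv = "vsum_cost (nv ''n'') (nv ''m'') ?ev"
  let ?cd = "vmap_cost (nv ''m'') ?ed"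
  show ?thesis
  proof (intro exI[of _ "C + (?cv + (back_cost ''gv'' + ?cd))"] conjI allI impI)
    fix n m N A and s :: state
    assume asm: "dat n m N A s \<and> (\<forall>k<m. 0 < reals s ''W'' k)"
    then have d: "dat n m N A s" and W: "\<And>k. k < m \<Longrightarrow> 0 < reals s ''W'' k" by auto
    have nm: "n \<le> N" "m \<le> N" "1 \<le> N" using d by (auto simp: dat_def)
    let ?W = "reals s ''W''" and ?g = "reals s ''g''"
    let ?Q = "\<lambda>t. same mach_nats dir_reals s t \<and>
      (\<forall>i<n. (\<Sum>l<m. A i l * reals t ''dd'' l) = 0) \<and>
      (\<forall>d. (\<forall>i<n. (\<Sum>l<m. A i l * d l) = 0) \<longrightarrow>
         (\<Sum>l<m. 1 / ?W l * reals t ''dd'' l * d l) = - (\<Sum>l<m. ?g l * d l))"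
    define v where "v i = (\<Sum>k<m. A i k * (?W k * ?g k))" for i
    show "exec Direction s ((C + (?cv + (back_cost ''gv'' + ?cd))) * mtime N) ?Q"
      unfolding Direction_def distrib_right
    proof (rule exec_Seq[OF gram[OF asm]])
      fix s1 assume p1: "gram_post n m N A s s1"
      note st1 = conjunct1[OF p1]
      have d1: "dat n m N A s1" by (rule dat_same[OF d st1]) simp_all
      have W1: "reals s1 ''W'' = ?W" and g1: "reals s1 ''g'' = ?g" by (simp_all add: same_reals[OF st1])
      have nm1: "nats s1 ''n'' 0 = n" "nats s1 ''m'' 0 = m" and A1: "\<And>i j. i < n \<Longrightarrow> j < m \<Longrightarrow> reals s1 ''A'' (i * m + j) = A i j"
        using d1 by (auto simp: dat_def)
      show "exec (Seq (VecSum ''gv'' (nv ''n'') (nv ''m'') ?ev) (Seq (Back ''gv'') (VecMap ''dd'' (nv ''m'') ?ed))) s1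
        (?cv * mtime N + (back_cost ''gv'' * mtime N + ?cd * mtime N)) ?Q"
      proof (rule exec_Seq)
        show "exec (VecSum ''gv'' (nv ''n'') (nv ''m'') ?ev) s1 (?cv * mtime N)
          (\<lambda>t. same ijk {''gv''} s1 t \<and> (\<forall>i<n. reals t ''gv'' i = (\<Sum>k<m. A i k * (?W k * ?g k))))" (is "exec _ _ _ ?Postb")
        proof (rule exec_VecSum)
          fix s' i k assume *: "same ijk {''gv''} s1 s'" "i < n" "k < m" "nats s' ''i'' 0 = i" "nats s' ''k'' 0 = k"
          show "rval ?ev s' = A i k * (?W k * ?g k)"
            using nm1 *(2,3) by (simp add: *(4,5) same_eqs[OF *(1)] A1 W1 g1)
        qed (use nm nm1 in \<open>simp_all add: same_nats\<close>)
        fix s2 assume p2: "?Postb s2"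
        note st2 = conjunct1[OF p2]
        have d2: "dat n m N A s2" by (rule dat_same[OF d1 st2]) simp_all
        have W2: "reals s2 ''W'' = ?W" and g2: "reals s2 ''g'' = ?g" by (simp_all add: same_reals[OF st2] W1 g1)
        have G2: "gat s2 N = gat s1 N" by (simp add: gat_def same_reals[OF st2] fun_eq_iff)
        have v2: "reals s2 ''gv'' i = v i" if "i < n" for i using p2 that by (simp add: v_def)
        show "exec (Seq (Back ''gv'') (VecMap ''dd'' (nv ''m'') ?ed)) s2 (back_cost ''gv'' * mtime N + ?cd * mtime N) ?Q"
        proof (rule exec_Seq[OF exec_Back[OF d2]])
          fix s3 assume p3: "same ijk {''y'', ''ty''} s2 s3 \<and>
            (\<forall>l<m. reals s3 ''ty'' l = (\<Sum>j<n. A j l * (\<Sum>k<n. gat s2 N j k * reals s2 ''gv'' k)))"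
          note st3 = conjunct1[OF p3] and ty3 = conjunct2[OF p3, rule_format]
          have nm3: "nats s3 ''m'' 0 = m" using nm1 by (simp add: same_nats[OF st2] same_nats[OF st3])
          have W3: "reals s3 ''W'' = ?W" and g3: "reals s3 ''g'' = ?g" by (simp_all add: same_reals[OF st3] W2 g2)
          have "exec (VecMap ''dd'' (nv ''m'') ?ed) s3 (?cd * mtime N)
            (\<lambda>t. same ijk {''dd''} s3 t \<and> (\<forall>l<m. reals t ''dd'' l = ?W l * (reals s3 ''ty'' l - ?g l)))" (is "exec _ _ _ ?Postc")
          proof (rule exec_VecMap)
            fix s' i assume *: "same ijk {''dd''} s3 s'" "nats s' ''i'' 0 = i"
            show "rval ?ed s' = ?W i * (reals s3 ''ty'' i - ?g i)"
              by (simp add: *(2) same_reals[OF *(1)] W3 g3)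
          qed (use nm nm3 in \<open>simp_all add: same_nats\<close>)
          then show "exec (VecMap ''dd'' (nv ''m'') ?ed) s3 (?cd * mtime N) ?Q"
          proof (rule exec_mono[OF _ order_refl])
            fix t assume t: "?Postc t"
            note dd = conjunct2[OF t, rule_format]
            define y where "y j = (\<Sum>k<n. gat s1 N j k * v k)" for j
            have ty: "reals s3 ''ty'' l = (\<Sum>j<n. A j l * y j)" if "l < m" for l
              using ty3[OF that] by (simp add: G2 v2 y_def)
            have "same mach_nats dir_reals s s2" by (rule same_trans[OF st1 st2]) auto
            then have "same mach_nats dir_reals s s3" by (rule same_trans[OF _ st3]) auto
            then have st: "same mach_nats dir_reals s t" by (rule same_trans[OF _ conjunct1[OF t]]) auto
            have feas: "(\<Sum>l<m. A i l * reals t ''dd'' l) = 0" if i: "i < n" for i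
            proof -
              have "(\<Sum>l<m. A i l * (?W l * (\<Sum>j<n. A j l * y j))) = v i"
                by (rule lsq_consistent[where N = N and H = "gat s1 N" and z = "\<lambda>k. ?W k * ?g k"])
                  (use p1 nm W i in \<open>auto simp: scaled_rows_def v_def y_def\<close>)
              then have "(\<Sum>l<m. A i l * (?W l * reals s3 ''ty'' l)) = v i" by (simp add: ty)
              then show ?thesis by (simp add: dd v_def right_diff_distrib sum_subtractf)
            qed
            have orth: "(\<Sum>l<m. 1 / ?W l * reals t ''dd'' l * d l) = - (\<Sum>l<m. ?g l * d l)"
              if d: "\<forall>i<n. (\<Sum>l<m. A i l * d l) = 0" for d
            proof -
              have "(\<Sum>l<m. 1 / ?W l * reals t ''dd'' l * d l) = (\<Sum>l<m. reals s3 ''ty'' l * d l - ?g l * d l)"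
              proof (rule sum.cong[OF refl])
                fix l assume "l \<in> {..<m}"
                then have l: "l < m" by simp
                show "1 / ?W l * reals t ''dd'' l * d l = reals s3 ''ty'' l * d l - ?g l * d l"
                  using W[OF l] by (simp add: dd[OF l] left_diff_distrib)
              qed
              also have "\<dots> = (\<Sum>l<m. reals s3 ''ty'' l * d l) - (\<Sum>l<m. ?g l * d l)" by (simp add: sum_subtractf)
              also have "(\<Sum>l<m. reals s3 ''ty'' l * d l) = (\<Sum>l<m. \<Sum>j<n. y j * (A j l * d l))"
              proof (rule sum.cong[OF refl])
                fix l assume "l \<in> {..<m}"
                then have "reals s3 ''ty'' l * d l = (\<Sum>j<n. A j l * y j) * d l" by (simp add: ty)
                also have "\<dots> = (\<Sum>j<n. y j * (A j l * d l))"
                  unfolding sum_distrib_right by (intro sum.cong) (auto simp: mult_ac)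
                finally show "reals s3 ''ty'' l * d l = (\<Sum>j<n. y j * (A j l * d l))" .
              qed
              also have "\<dots> = (\<Sum>j<n. y j * (\<Sum>l<m. A j l * d l))"
                by (subst sum.swap) (simp add: sum_distrib_left)
              also have "\<dots> = 0" using d by simp
              finally show ?thesis by simp
            qed
            show "?Q t" using st feas orth by blast
          qed
        qed simp
      qed
    qed
  qed (use C in \<open>simp add: vsum_cost_nonneg vmap_cost_nonneg back_cost_def\<close>)
qed

end

section \<open>The inner loop\<close>

abbreviation "num k \<equiv> ROfNat (NConst k) :: rop rexp"
abbreviation "radd a b \<equiv> ROp Plus a b"
abbreviation "rsub a b \<equiv> ROp Minus a b"
abbreviation "rmul a b \<equiv> ROp Times a b"
abbreviation "rdiv a b \<equiv> ROp Divide a b"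
abbreviation "rpow a b \<equiv> ROp Power a b"

text \<open>
  The value of \<open>positive z\<close> is 1 if \<open>z > 0\<close> and 0 otherwise, because \<open>0 powr 0 = 0\<close>.
\<close>

definition positive :: "rop rexp \<Rightarrow> rop rexp" where
  "positive z = rpow (rdiv (radd z (rpow z (num 1))) (num 2)) (num 0)"

lemma rval_positive [simp]: "rval (positive z) s = of_bool (0 < rval z s)"
  by (cases "0 < rval z s") (auto simp: positive_def)

definition ePhi :: "rop rexp" where "ePhi = rpow (rk ''w'') (rv ''pp'')"

definition eW :: "rop rexp" where
  "eW = rdiv (num 1) (radd (rdiv (rpow (ri ''x'') (rsub (rv ''pp'') (num 2))) (rmul (rv ''nu'') (rpow (num 2) (rv ''pp''))))
     (rdiv (rpow (ri ''w'') (rsub (rv ''pp'') (num 2))) (rmul (rv ''sc'') (rv ''sc''))))"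

definition eE :: "rop rexp" where "eE = rmul (rdiv (num 1) (rk ''W'')) (rmul (rk ''dd'') (rk ''dd''))"

definition eu :: "rop rexp" where
  "eu = rdiv (rpow (rmul (rdiv (rv ''nu'') (rv ''E'')) (ri ''dd'')) (num 1)) (rv ''sc'')"

definition eEH :: "rop rexp" where
  "eEH = rmul (positive (rsub (rk ''u'') (rmul (rv ''rho'') (rk ''w''))))
     (rmul (rpow (rk ''w'') (rsub (rv ''pp'') (num 2))) (rmul (rk ''u'') (rk ''u'')))"

definition eac :: "rop rexp" where
  "eac = radd (ri ''ac'') (rdiv (rmul (rdiv (rv ''nu'') (rv ''E'')) (ri ''dd'')) (ROfNat (nv ''T'')))"

definition ewf :: "rop rexp" where "ewf = radd (ri ''w'') (rdiv (ri ''u'') (ROfNat (nv ''T'')))"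

definition eww :: "rop rexp" where
  "eww = rmul (ri ''w'') (radd (num 1) (positive (rsub (ri ''u'') (rmul (rv ''rho'') (ri ''w'')))))"

abbreviation "inner_nats \<equiv> mach_nats \<union> {''cnt'', ''fl''}"
abbreviation "inner_reals \<equiv> dir_reals \<union> {''Phi'', ''W'', ''E'', ''u'', ''EH'', ''ac'', ''w''}"

definition ker :: "nat \<Rightarrow> nat \<Rightarrow> rmat \<Rightarrow> rvec set" where
  "ker n m A = {d. \<forall>i<n. (\<Sum>l<m. A i l * d l) = 0}"

definition dirs :: "nat \<Rightarrow> nat \<Rightarrow> rmat \<Rightarrow> real \<Rightarrow> rvec \<Rightarrow> real \<Rightarrow> rvec set" where
  "dirs n m A p x \<nu> = {d \<in> ker n m A. (\<Sum>i<m. grad p x i * d i) = - \<nu>}"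

definition ipre :: "nat \<Rightarrow> nat \<Rightarrow> nat \<Rightarrow> rmat \<Rightarrow> real \<Rightarrow> real \<Rightarrow> nat \<Rightarrow> rvec \<Rightarrow> state \<Rightarrow> bool" where
  "ipre n m N A p \<nu> T x s \<longleftrightarrow> dat n m N A s \<and> reals s ''pp'' 0 = p \<and> reals s ''nu'' 0 = \<nu> \<and> reals s ''sc'' 0 = scale p \<nu> \<and>
     reals s ''rho'' 0 = rho p \<and> nats s ''T'' 0 = T \<and> reals s ''x'' = x \<and> (\<forall>i<m. reals s ''g'' i = grad p x i) \<and>
     2 < p \<and> 0 < \<nu> \<and> 1 \<le> T"

lemma ipre_same:
  assumes "ipre n m N A p \<nu> T x s" "same X Y s t" "{''n'', ''m'', ''N'', ''L'', ''sz'', ''T''} \<inter> X = {}"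
    "{''A'', ''P'', ''pp'', ''nu'', ''sc'', ''rho'', ''x'', ''g''} \<inter> Y = {}"
  shows "ipre n m N A p \<nu> T x t"
proof -
  have eqs: "nats t ''T'' = nats s ''T''" "reals t ''pp'' = reals s ''pp''" "reals t ''nu'' = reals s ''nu''"
    "reals t ''sc'' = reals s ''sc''" "reals t ''rho'' = reals s ''rho''" "reals t ''x'' = reals s ''x''" "reals t ''g'' = reals s ''g''"
    using assms(3,4) by (auto intro!: same_eqs[OF assms(2)])
  have "dat n m N A t" by (rule dat_same[OF _ assms(2)]) (use assms in \<open>auto simp: ipre_def\<close>)
  then show ?thesis using assms(1) unfolding ipre_def eqs by blast
qed

definition flow_result :: "nat \<Rightarrow> nat \<Rightarrow> rvec \<Rightarrow> rvec \<Rightarrow> state \<Rightarrow> state \<Rightarrow> bool" where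
  "flow_result m T u \<Delta> s t \<longleftrightarrow> (\<forall>i<m. reals t ''w'' i = reals s ''w'' i + u i / T) \<and>
     (\<forall>i<m. reals t ''ac'' i = reals s ''ac'' i + \<Delta> i / T) \<and> nats t ''cnt'' 0 = Suc (nats s ''cnt'' 0) \<and> nats t ''fl'' = nats s ''fl''"

definition width_result :: "real \<Rightarrow> nat \<Rightarrow> rvec \<Rightarrow> state \<Rightarrow> state \<Rightarrow> bool" where
  "width_result p m u s t \<longleftrightarrow> (\<forall>i<m. reals t ''w'' i = reals s ''w'' i * (1 + of_bool (rho p * reals s ''w'' i < u i))) \<and>
     reals t ''ac'' = reals s ''ac'' \<and> nats t ''cnt'' = nats s ''cnt'' \<and> nats t ''fl'' = nats s ''fl''"

text \<open>The direction \<open>D\<close> is known only through kernel membership and its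
  orthogonality relation. The energy test is multiplied out, so that it covers E = 0 and sends this
  case to the failure branch.\<close>

definition istep :: "nat \<Rightarrow> nat \<Rightarrow> nat \<Rightarrow> rmat \<Rightarrow> real \<Rightarrow> real \<Rightarrow> nat \<Rightarrow> rvec \<Rightarrow> state \<Rightarrow> state \<Rightarrow> bool" where
  "istep n m N A p \<nu> T x s t \<longleftrightarrow> (\<exists>D E. D \<in> ker n m A \<and>
     (\<forall>d\<in>ker n m A. (\<Sum>i<m. weight p \<nu> x (reals s ''w'') i * D i * d i) = - (\<Sum>i<m. grad p x i * d i)) \<and>
     E = (\<Sum>i<m. weight p \<nu> x (reals s ''w'') i * (D i)\<^sup>2) \<and>
     (if 3 * psum p m (reals s ''w'') * E < \<nu>\<^sup>2 then nats t ''fl'' 0 = 1 \<and> nats t ''cnt'' 0 = T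
      else (let \<Delta> = (\<lambda>i. \<nu> / E * D i); u = (\<lambda>i. \<bar>\<Delta> i\<bar> / scale p \<nu>)
        in (if heavy_energy p m (reals s ''w'') u < 1 / T then flow_result m T u \<Delta> s t else width_result p m u s t))))"

context multiplier begin

text \<open>Moving the counter to \<open>T\<close> ends the loop; \<open>fl\<close> tells the outer
  loop that no sufficient improvement exists.\<close>

definition Fail :: "rop com" where
  "Fail = Seq (nset ''fl'' (NConst 1)) (nset ''cnt'' (nv ''T''))"

definition Flow :: "rop com" where
  "Flow = Seq (VecMap ''ac'' (nv ''m'') eac) (Seq (VecMap ''w'' (nv ''m'') ewf) (nset ''cnt'' (NAdd (nv ''cnt'') (NConst 1))))"

abbreviation "Advance \<equiv> If (RLess (rv ''EH'') (rdiv (num 1) (ROfNat (nv ''T'')))) Flow (VecMap ''w'' (nv ''m'') eww)"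

definition Progress :: "rop com" where
  "Progress = Seq (VecMap ''u'' (nv ''m'') eu) (Seq (VecSum ''EH'' (NConst 1) (nv ''m'') eEH)
     Advance)"

abbreviation "Decide \<equiv> If (RLess (rmul (rmul (num 3) (rv ''Phi'')) (rv ''E'')) (rmul (rv ''nu'') (rv ''nu''))) Fail Progress"

definition IBody :: "rop com" where
  "IBody = Seq (VecSum ''Phi'' (NConst 1) (nv ''m'') ePhi) (Seq (VecMap ''W'' (nv ''m'') eW) (Seq Direction
     (Seq (VecSum ''E'' (NConst 1) (nv ''m'') eE)
       Decide)))"

lemma exec_Flow:
  assumes pre: "ipre n m N A p \<nu> T x s" and u: "\<And>i. i < m \<Longrightarrow> reals s ''u'' i = u i"
    and \<Delta>: "\<And>i. i < m \<Longrightarrow> \<nu> / reals s ''E'' 0 * reals s ''dd'' i = \<Delta> i"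
  shows "exec Flow s ((vmap_cost (nv ''m'') eac + (vmap_cost (nv ''m'') ewf + 10)) * mtime N)
    (\<lambda>t. same inner_nats inner_reals s t \<and> flow_result m T u \<Delta> s t)"
  unfolding Flow_def distrib_right
proof (rule exec_Seq)
  have nm: "nats s ''m'' 0 = m" "m \<le> N" "1 \<le> N" "nats s ''T'' 0 = T" "reals s ''nu'' 0 = \<nu>" using pre by (auto simp: ipre_def dat_def)
  show "exec (VecMap ''ac'' (nv ''m'') eac) s (vmap_cost (nv ''m'') eac * mtime N)
    (\<lambda>t. same ijk {''ac''} s t \<and> (\<forall>i<m. reals t ''ac'' i = reals s ''ac'' i + \<Delta> i / T))" (is "exec _ _ _ ?Posta")
  proof (rule exec_VecMap)
    fix s' i assume *: "same ijk {''ac''} s s'" "i < m" "nats s' ''i'' 0 = i" "reals s' ''ac'' i = reals s ''ac'' i"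
    show "rval eac s' = reals s ''ac'' i + \<Delta> i / T"
      using nm \<Delta>[OF *(2)] *(4) by (simp add: eac_def *(3) same_eqs[OF *(1)])
  qed (use nm in \<open>simp_all add: same_nats\<close>)
  fix s1 assume p1: "?Posta s1"
  note st1 = conjunct1[OF p1]
  have nm1: "nats s1 ''m'' 0 = m" "nats s1 ''T'' 0 = T" using nm by (simp_all add: same_nats[OF st1])
  show "exec (Seq (VecMap ''w'' (nv ''m'') ewf) (nset ''cnt'' (NAdd (nv ''cnt'') (NConst 1)))) s1
    (vmap_cost (nv ''m'') ewf * mtime N + 10 * mtime N)
    (\<lambda>t. same inner_nats inner_reals s t \<and> flow_result m T u \<Delta> s t)"
  proof (rule exec_Seq)
    show "exec (VecMap ''w'' (nv ''m'') ewf) s1 (vmap_cost (nv ''m'') ewf * mtime N)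
      (\<lambda>t. same ijk {''w''} s1 t \<and> (\<forall>i<m. reals t ''w'' i = reals s ''w'' i + u i / T))" (is "exec _ _ _ ?Postb")
    proof (rule exec_VecMap)
      fix s' i assume *: "same ijk {''w''} s1 s'" "i < m" "nats s' ''i'' 0 = i" "reals s' ''w'' i = reals s1 ''w'' i"
      show "rval ewf s' = reals s ''w'' i + u i / T"
        using nm1 u[OF *(2)] *(4) by (simp add: ewf_def *(3) same_eqs[OF *(1)] same_reals[OF st1])
    qed (use nm nm1 in \<open>simp_all add: same_nats\<close>)
    fix s2 assume p2: "?Postb s2"
    note st2 = conjunct1[OF p2]
    define s3 where "s3 = s2\<lparr>nats := (nats s2)(''cnt'' := (nats s2 ''cnt'')(0 := Suc (nats s ''cnt'' 0)))\<rparr>"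
    have c2: "nats s2 ''cnt'' = nats s ''cnt''" "nats s2 ''fl'' = nats s ''fl''" by (simp_all add: same_nats[OF st2] same_nats[OF st1])
    have "exec (nset ''cnt'' (NAdd (nv ''cnt'') (NConst 1))) s2 (10 * mtime N) (\<lambda>t. t = s3)"
      by (rule exec_NSet) (use c2 powr_ge_1[OF nm(3)] in \<open>simp_all add: s3_def\<close>)
    moreover have "same inner_nats inner_reals s s3 \<and> flow_result m T u \<Delta> s s3"
    proof -
      have "same inner_nats inner_reals s s2" by (rule same_trans[OF st1 st2]) auto
      then have "same inner_nats inner_reals s s3" by (auto simp: same_def s3_def)
      moreover have "reals s2 ''ac'' = reals s1 ''ac''" by (simp add: same_reals[OF st2])
      ultimately show ?thesis using p1 p2 c2 by (simp add: flow_result_def s3_def)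
    qed
    ultimately show "exec (nset ''cnt'' (NAdd (nv ''cnt'') (NConst 1))) s2 (10 * mtime N)
      (\<lambda>t. same inner_nats inner_reals s t \<and> flow_result m T u \<Delta> s t)" by (rule exec_eq)
  qed
qed

definition progress_cost :: real where
  "progress_cost = vmap_cost (nv ''m'') eu + (vsum_cost (NConst 1) (nv ''m'') eEH + (20 +
     (vmap_cost (nv ''m'') eac + (vmap_cost (nv ''m'') ewf + 10) + vmap_cost (nv ''m'') eww)))"

lemma progress_cost_nonneg: "0 \<le> progress_cost"
  by (simp add: progress_cost_def vmap_cost_nonneg vsum_cost_nonneg add_nonneg_nonneg)

lemma exec_Progress:
  assumes pre: "ipre n m N A p \<nu> T x s"
    and \<Delta>: "\<Delta> = (\<lambda>i. \<nu> / reals s ''E'' 0 * reals s ''dd'' i)" and u: "u = (\<lambda>i. \<bar>\<Delta> i\<bar> / scale p \<nu>)"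
    and w: "\<And>i. i < m \<Longrightarrow> 0 < reals s ''w'' i"
  shows "exec Progress s (progress_cost * mtime N)
    (\<lambda>t. same inner_nats inner_reals s t \<and>
      (if heavy_energy p m (reals s ''w'') u < 1 / T then flow_result m T u \<Delta> s t else width_result p m u s t))"
    (is "exec _ _ _ ?Q")
  unfolding Progress_def progress_cost_def distrib_right[of "vmap_cost (nv ''m'') eu"]
proof (rule exec_Seq)
  have nm: "nats s ''m'' 0 = m" "m \<le> N" "1 \<le> N" "nats s ''T'' 0 = T" "reals s ''nu'' 0 = \<nu>" "reals s ''sc'' 0 = scale p \<nu>"
    "reals s ''rho'' 0 = rho p" "reals s ''pp'' 0 = p" using pre by (auto simp: ipre_def dat_def)
  let ?cf = "vmap_cost (nv ''m'') eac + (vmap_cost (nv ''m'') ewf + 10)" and ?cw = "vmap_cost (nv ''m'') eww"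
  let ?P = "mtime N"
  show "exec (VecMap ''u'' (nv ''m'') eu) s (vmap_cost (nv ''m'') eu * ?P)
    (\<lambda>t. same ijk {''u''} s t \<and> (\<forall>i<m. reals t ''u'' i = u i))"
  proof (rule exec_VecMap)
    fix s' i assume *: "same ijk {''u''} s s'" "i < m" "nats s' ''i'' 0 = i"
    show "rval eu s' = u i"
      using nm by (simp add: eu_def u \<Delta> *(3) same_eqs[OF *(1)])
  qed (use nm in \<open>simp_all add: same_nats\<close>)
  fix s1 assume p1: "same ijk {''u''} s s1 \<and> (\<forall>i<m. reals s1 ''u'' i = u i)"
  note st1 = conjunct1[OF p1] and u1 = conjunct2[OF p1, rule_format]
  have w1: "reals s1 ''w'' = reals s ''w''" by (simp add: same_reals[OF st1])
  have nm1: "nats s1 ''m'' 0 = m" "nats s1 ''T'' 0 = T" "reals s1 ''rho'' 0 = rho p" "reals s1 ''pp'' 0 = p"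
    using nm by (simp_all add: same_eqs[OF st1])
  show "exec (Seq (VecSum ''EH'' (NConst 1) (nv ''m'') eEH) Advance) s1
    ((vsum_cost (NConst 1) (nv ''m'') eEH + (20 + (?cf + ?cw))) * ?P) ?Q"
    unfolding distrib_right[of "vsum_cost (NConst 1) (nv ''m'') eEH"]
  proof (rule exec_Seq)
    show "exec (VecSum ''EH'' (NConst 1) (nv ''m'') eEH) s1 (vsum_cost (NConst 1) (nv ''m'') eEH * ?P)
      (\<lambda>t. same ijk {''EH''} s1 t \<and> (\<forall>i<1. reals t ''EH'' i = (\<Sum>k<m. of_bool (rho p * reals s ''w'' k < u k) * (reals s ''w'' k powr (p - 2) * (u k)\<^sup>2))))" (is "exec _ _ _ ?Postc")
    proof (rule exec_VecSum)
      fix s' i k assume *: "same ijk {''EH''} s1 s'" "k < m" "nats s' ''k'' 0 = k"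
      show "rval eEH s' = of_bool (rho p * reals s ''w'' k < u k) * (reals s ''w'' k powr (p - 2) * (u k)\<^sup>2)"
        using nm1 w[OF *(2)] u1[OF *(2)] by (simp add: eEH_def *(3) same_eqs[OF *(1)] w1 power2_eq_square)
    qed (use nm nm1 in \<open>simp_all add: same_nats\<close>)
    fix s2 assume p2: "?Postc s2"
    note st2 = conjunct1[OF p2]
    have EH: "reals s2 ''EH'' 0 = heavy_energy p m (reals s ''w'') u" using conjunct2[OF p2, rule_format, of 0] by (simp add: heavy_energy_def)
    have st: "same inner_nats inner_reals s s2" by (rule same_trans[OF st1 st2]) auto
    have pre2: "ipre n m N A p \<nu> T x s2" by (rule ipre_same[OF pre st]) simp_all
    have E2: "reals s2 ''w'' = reals s ''w''" "reals s2 ''dd'' = reals s ''dd''" "reals s2 ''E'' = reals s ''E''" "reals s2 ''ac'' = reals s ''ac''"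
      "reals s2 ''u'' = reals s1 ''u''" "nats s2 ''cnt'' = nats s ''cnt''" "nats s2 ''fl'' = nats s ''fl''"
      by (simp_all add: same_reals[OF st2] same_reals[OF st1] same_nats[OF st2] same_nats[OF st1])
    have nm2: "nats s2 ''m'' 0 = m" "nats s2 ''T'' 0 = T" "reals s2 ''rho'' 0 = rho p"
      using nm1 by (simp_all add: same_eqs[OF st2])
    let ?b = "RLess (rv ''EH'') (rdiv (num 1) (ROfNat (nv ''T'')))"
    have b: "bval ?b s2 \<longleftrightarrow> heavy_energy p m (reals s ''w'') u < 1 / T" by (simp add: EH nm2)
    have "exec (If ?b Flow (VecMap ''w'' (nv ''m'') eww)) s2 (bcost ?b + (?cf + ?cw) * ?P) ?Q"
    proof (rule exec_If)
      assume "bval ?b s2"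
      then have h: "heavy_energy p m (reals s ''w'') u < 1 / T" using b by simp
      have "exec Flow s2 (?cf * ?P) (\<lambda>t. same inner_nats inner_reals s2 t \<and> flow_result m T u \<Delta> s2 t)" (is "exec _ _ _ ?Postd")
        by (rule exec_Flow[OF pre2]) (simp_all add: E2 u1 \<Delta>)
      then show "exec Flow s2 ((?cf + ?cw) * ?P) ?Q"
      proof (rule exec_mono)
        show "?cf * ?P \<le> (?cf + ?cw) * ?P" by (intro mult_right_mono) (simp_all add: vmap_cost_nonneg)
        fix t assume t: "?Postd t"
        have "same inner_nats inner_reals s t" by (rule same_trans[OF st conjunct1[OF t]]) auto
        then show "?Q t" using t h by (simp add: flow_result_def E2)
      qed
    next
      assume "\<not> bval ?b s2"
      then have h: "\<not> heavy_energy p m (reals s ''w'') u < 1 / T" using b by simp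
      have "exec (VecMap ''w'' (nv ''m'') eww) s2 (?cw * ?P)
        (\<lambda>t. same ijk {''w''} s2 t \<and> (\<forall>i<m. reals t ''w'' i = reals s ''w'' i * (1 + of_bool (rho p * reals s ''w'' i < u i))))" (is "exec _ _ _ ?Poste")
      proof (rule exec_VecMap)
        fix s' i assume *: "same ijk {''w''} s2 s'" "i < m" "nats s' ''i'' 0 = i" "reals s' ''w'' i = reals s2 ''w'' i"
        show "rval eww s' = reals s ''w'' i * (1 + of_bool (rho p * reals s ''w'' i < u i))"
          using nm2 u1[OF *(2)] *(4) by (simp add: eww_def *(3) same_eqs[OF *(1)] E2)
      qed (use nm nm2 in \<open>simp_all add: same_nats\<close>)
      then show "exec (VecMap ''w'' (nv ''m'') eww) s2 ((?cf + ?cw) * ?P) ?Q"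
      proof (rule exec_mono)
        show "?cw * ?P \<le> (?cf + ?cw) * ?P" by (intro mult_right_mono) (simp_all add: vmap_cost_nonneg add_nonneg_nonneg)
        fix t assume t: "?Poste t"
        note stt = conjunct1[OF t]
        have "same inner_nats inner_reals s t" by (rule same_trans[OF st stt]) auto
        moreover have "reals t ''ac'' = reals s2 ''ac''" "nats t ''cnt'' = nats s2 ''cnt''" "nats t ''fl'' = nats s2 ''fl''"
          by (simp_all add: same_eqs[OF stt])
        ultimately show "?Q t" using conjunct2[OF t] h by (simp add: width_result_def E2)
      qed
    qed
    then show "exec (If ?b Flow (VecMap ''w'' (nv ''m'') eww)) s2 ((20 + (?cf + ?cw)) * ?P) ?Q"
      by (rule exec_mono) (use powr_ge_1[OF nm(3)] in \<open>simp_all add: distrib_right\<close>)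
  qed
qed

lemma exec_IBody:
  "\<exists>C\<ge>0. \<forall>n m N A p \<nu> T x s. ipre n m N A p \<nu> T x s \<and> (\<forall>i<m. 0 < reals s ''w'' i) \<longrightarrow>
    exec IBody s (C * mtime N) (\<lambda>t. same inner_nats inner_reals s t \<and> istep n m N A p \<nu> T x s t)"
proof -
  from exec_Direction obtain Cd where Cd_spec: "0 \<le> Cd \<and> (\<forall>n m N A s. dat n m N A s \<and> (\<forall>k<m. 0 < reals s ''W'' k) \<longrightarrow>
    exec Direction s (Cd * mtime N) (\<lambda>t. direction_post n m A s t))" by (rule exE)
  note Cd = conjunct1[OF Cd_spec] and direction = conjunct2[OF Cd_spec, rule_format]
  let ?cPhi = "vsum_cost (NConst 1) (nv ''m'') ePhi" and ?cW = "vmap_cost (nv ''m'') eW" and ?cE = "vsum_cost (NConst 1) (nv ''m'') eE"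
  show ?thesis
  proof (intro exI[of _ "?cPhi + (?cW + (Cd + (?cE + (50 + progress_cost))))"] conjI allI impI)
    fix n m N A p \<nu> T x and s :: state
    assume asm: "ipre n m N A p \<nu> T x s \<and> (\<forall>i<m. 0 < reals s ''w'' i)"
    then have pre: "ipre n m N A p \<nu> T x s" and w: "\<And>i. i < m \<Longrightarrow> 0 < reals s ''w'' i" by auto
    let ?w = "reals s ''w''" and ?P = "mtime N"
    let ?Q = "\<lambda>t. same inner_nats inner_reals s t \<and> istep n m N A p \<nu> T x s t"
    have p: "2 < p" "0 < \<nu>" using pre by (auto simp: ipre_def)
    have nm: "nats s ''m'' 0 = m" "m \<le> N" "1 \<le> N" "reals s ''nu'' 0 = \<nu>" "reals s ''sc'' 0 = scale p \<nu>"
      "reals s ''pp'' 0 = p" "reals s ''x'' = x" "\<And>i. i < m \<Longrightarrow> reals s ''g'' i = grad p x i" using pre by (auto simp: ipre_def dat_def)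
    define wt where "wt = weight p \<nu> x ?w"
    have wt: "0 < wt i" if "i < m" for i
      using w[OF that] p scale_pos[OF p(2), of p] unfolding wt_def weight_def by (intro add_nonneg_pos) auto
    show "exec IBody s ((?cPhi + (?cW + (Cd + (?cE + (50 + progress_cost))))) * ?P) ?Q"
      unfolding IBody_def distrib_right[of ?cPhi]
    proof (rule exec_Seq)
      show "exec (VecSum ''Phi'' (NConst 1) (nv ''m'') ePhi) s (?cPhi * ?P)
        (\<lambda>t. same ijk {''Phi''} s t \<and> (\<forall>i<1. reals t ''Phi'' i = (\<Sum>k<m. \<bar>?w k\<bar> powr p)))" (is "exec _ _ _ ?Postf")
      proof (rule exec_VecSum)
        fix s' i k assume *: "same ijk {''Phi''} s s'" "nats s' ''k'' 0 = k"
        show "rval ePhi s' = \<bar>?w k\<bar> powr p"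
          using nm by (simp add: ePhi_def *(2) same_eqs[OF *(1)])
      qed (use nm in \<open>simp_all add: same_nats\<close>)
      fix s1 assume p1: "?Postf s1"
      note st1 = conjunct1[OF p1]
      have Phi1: "reals s1 ''Phi'' 0 = psum p m ?w" using conjunct2[OF p1, rule_format, of 0] by (simp add: psum_def)
      have nm1: "nats s1 ''m'' 0 = m" "reals s1 ''nu'' 0 = \<nu>" "reals s1 ''sc'' 0 = scale p \<nu>" "reals s1 ''pp'' 0 = p" "reals s1 ''x'' = x" "reals s1 ''w'' = ?w"
        using nm by (simp_all add: same_eqs[OF st1])
      show "exec (Seq (VecMap ''W'' (nv ''m'') eW) (Seq Direction (Seq (VecSum ''E'' (NConst 1) (nv ''m'') eE)
          Decide))) s1
        ((?cW + (Cd + (?cE + (50 + progress_cost)))) * ?P) ?Q"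
        unfolding distrib_right[of ?cW]
      proof (rule exec_Seq)
        show "exec (VecMap ''W'' (nv ''m'') eW) s1 (?cW * ?P)
          (\<lambda>t. same ijk {''W''} s1 t \<and> (\<forall>i<m. reals t ''W'' i = 1 / wt i))" (is "exec _ _ _ ?Postg")
        proof (rule exec_VecMap)
          fix s' i assume *: "same ijk {''W''} s1 s'" "i < m" "nats s' ''i'' 0 = i"
          show "rval eW s' = 1 / wt i"
            using nm1 w[OF *(2)] by (simp add: eW_def wt_def weight_def *(3) same_eqs[OF *(1)] power2_eq_square)
        qed (use nm nm1 in \<open>simp_all add: same_nats\<close>)
        fix s2 assume p2: "?Postg s2"
        note st2 = conjunct1[OF p2] and W2 = conjunct2[OF p2, rule_format]
        have st02: "same inner_nats inner_reals s s2" by (rule same_trans[OF st1 st2]) auto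
        have pre2: "ipre n m N A p \<nu> T x s2" by (rule ipre_same[OF pre st02]) simp_all
        have dat2: "dat n m N A s2 \<and> (\<forall>k<m. 0 < reals s2 ''W'' k)" using pre2 W2 wt by (auto simp: ipre_def)
        have e2: "reals s2 ''w'' = ?w" "reals s2 ''Phi'' 0 = psum p m ?w" "reals s2 ''g'' = reals s ''g''" "reals s2 ''ac'' = reals s ''ac''"
          "nats s2 ''cnt'' = nats s ''cnt''" "nats s2 ''fl'' = nats s ''fl''"
          using Phi1 by (simp_all add: same_reals[OF st2] same_reals[OF st1] same_nats[OF st2] same_nats[OF st1])
        show "exec (Seq Direction (Seq (VecSum ''E'' (NConst 1) (nv ''m'') eE)
          Decide)) s2
          ((Cd + (?cE + (50 + progress_cost))) * ?P) ?Q"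
          unfolding distrib_right[of Cd]
        proof (rule exec_Seq[OF direction[OF dat2]])
          fix s3 assume p3: "direction_post n m A s2 s3"
          note st3 = conjunct1[OF p3] note p3' = conjunct2[OF p3]
          define D where "D = reals s3 ''dd''"
          have Dker: "D \<in> ker n m A" using conjunct1[OF p3'] by (simp add: ker_def D_def)
          have orth: "(\<Sum>i<m. wt i * D i * d i) = - (\<Sum>i<m. grad p x i * d i)" if "d \<in> ker n m A" for d
          proof -
            have "(\<Sum>l<m. 1 / reals s2 ''W'' l * D l * d l) = - (\<Sum>l<m. reals s2 ''g'' l * d l)"
              using conjunct2[OF p3', rule_format, of d] that by (simp add: ker_def D_def)
            moreover have "(\<Sum>l<m. 1 / reals s2 ''W'' l * D l * d l) = (\<Sum>i<m. wt i * D i * d i)"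
              by (intro sum.cong) (auto simp: W2)
            moreover have "(\<Sum>l<m. reals s2 ''g'' l * d l) = (\<Sum>i<m. grad p x i * d i)"
              by (intro sum.cong) (auto simp: e2 nm)
            ultimately show ?thesis by simp
          qed
          have st03: "same inner_nats inner_reals s s3" by (rule same_trans[OF st02 st3]) auto
          have pre3: "ipre n m N A p \<nu> T x s3" by (rule ipre_same[OF pre st03]) simp_all
          have e3: "reals s3 ''w'' = ?w" "reals s3 ''Phi'' 0 = psum p m ?w" "reals s3 ''ac'' = reals s ''ac''" "reals s3 ''W'' = reals s2 ''W''"
            "nats s3 ''cnt'' = nats s ''cnt''" "nats s3 ''fl'' = nats s ''fl''" "nats s3 ''m'' 0 = m"
            using e2 nm by (simp_all add: same_eqs[OF st3] same_nats[OF st02])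
          define E where "E = (\<Sum>i<m. wt i * (D i)\<^sup>2)"
          show "exec (Seq (VecSum ''E'' (NConst 1) (nv ''m'') eE)
            Decide) s3
            ((?cE + (50 + progress_cost)) * ?P) ?Q"
            unfolding distrib_right[of ?cE]
          proof (rule exec_Seq)
            show "exec (VecSum ''E'' (NConst 1) (nv ''m'') eE) s3 (?cE * ?P)
              (\<lambda>t. same ijk {''E''} s3 t \<and> (\<forall>i<1. reals t ''E'' i = (\<Sum>k<m. wt k * (D k)\<^sup>2)))" (is "exec _ _ _ ?Posth")
            proof (rule exec_VecSum)
              fix s' i k assume *: "same ijk {''E''} s3 s'" "k < m" "nats s' ''k'' 0 = k"
              show "rval eE s' = wt k * (D k)\<^sup>2"
                using W2[OF *(2)] by (simp add: eE_def *(3) same_eqs[OF *(1)] e3(4) D_def power2_eq_square)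
            qed (use nm e3 in \<open>simp_all add: same_nats\<close>)
            fix s4 assume p4: "?Posth s4"
            note st4 = conjunct1[OF p4]
            have st04: "same inner_nats inner_reals s s4" by (rule same_trans[OF st03 st4]) auto
            have pre4: "ipre n m N A p \<nu> T x s4" by (rule ipre_same[OF pre st04]) simp_all
            have e4: "reals s4 ''w'' = ?w" "reals s4 ''Phi'' 0 = psum p m ?w" "reals s4 ''ac'' = reals s ''ac''" "reals s4 ''dd'' = D"
              "nats s4 ''cnt'' = nats s ''cnt''" "nats s4 ''fl'' = nats s ''fl''"
              using e3 by (simp_all add: same_eqs[OF st4] D_def)
            have E4: "reals s4 ''E'' 0 = E" using conjunct2[OF p4, rule_format, of 0] by (simp add: E_def)
            have nu4: "reals s4 ''nu'' 0 = \<nu>" "nats s4 ''T'' 0 = T" using pre4 by (auto simp: ipre_def)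
            let ?b = "RLess (rmul (rmul (num 3) (rv ''Phi'')) (rv ''E'')) (rmul (rv ''nu'') (rv ''nu''))"
            have b: "bval ?b s4 \<longleftrightarrow> 3 * psum p m ?w * E < \<nu>\<^sup>2" by (simp add: e4 E4 nu4 power2_eq_square)
            let ?R = "\<lambda>t. if 3 * psum p m ?w * E < \<nu>\<^sup>2 then nats t ''fl'' 0 = 1 \<and> nats t ''cnt'' 0 = T
              else (let \<Delta> = (\<lambda>i. \<nu> / E * D i); u = (\<lambda>i. \<bar>\<Delta> i\<bar> / scale p \<nu>)
                in (if heavy_energy p m ?w u < 1 / T then flow_result m T u \<Delta> s t else width_result p m u s t))"
            have istep: "istep n m N A p \<nu> T x s t" if "?R t" for t
              unfolding istep_def using Dker orth that unfolding wt_def[symmetric]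
              by (intro exI[of _ D] exI[of _ E]) (simp add: E_def)
            have "exec (If ?b Fail Progress) s4 (bcost ?b + (20 + progress_cost) * ?P) ?Q"
            proof (rule exec_If)
              assume "bval ?b s4"
              then have h: "3 * psum p m ?w * E < \<nu>\<^sup>2" using b by simp
              define s5 where "s5 = s4\<lparr>nats := (nats s4)(''fl'' := (nats s4 ''fl'')(0 := 1))\<rparr>"
              define s6 where "s6 = s5\<lparr>nats := (nats s5)(''cnt'' := (nats s5 ''cnt'')(0 := T))\<rparr>"
              have "exec (nset ''fl'' (NConst 1)) s4 10 (\<lambda>t. t = s5)"
                by (rule exec_NSet) (simp_all add: s5_def)
              moreover have "exec (nset ''cnt'' (nv ''T'')) s5 10 (\<lambda>t. t = s6)"
                by (rule exec_NSet) (use nu4 in \<open>simp_all add: s6_def s5_def\<close>)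
              ultimately have "exec Fail s4 (10 + 10) (\<lambda>t. t = s6)" unfolding Fail_def by (rule exec_Seq_eq)
              moreover have "?Q s6"
              proof -
                have "same inner_nats inner_reals s s6" using st04 by (auto simp: same_def s6_def s5_def)
                moreover have "?R s6" using h by (simp add: s6_def s5_def)
                ultimately show ?thesis using istep by blast
              qed
              ultimately have "exec Fail s4 (10 + 10) ?Q" by (rule exec_eq)
              then show "exec Fail s4 ((20 + progress_cost) * ?P) ?Q"
              proof (rule exec_mono)
                have "20 * 1 \<le> (20 + progress_cost) * ?P" using progress_cost_nonneg powr_ge_1[OF nm(3)] by (intro mult_mono) auto
                then show "10 + 10 \<le> (20 + progress_cost) * ?P" by simp
              qed
            next
              assume "\<not> bval ?b s4"
              then have h: "\<not> 3 * psum p m ?w * E < \<nu>\<^sup>2" using b by simp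
              define \<Delta> where "\<Delta> = (\<lambda>i. \<nu> / E * D i)"
              define u where "u = (\<lambda>i. \<bar>\<Delta> i\<bar> / scale p \<nu>)"
              have "exec Progress s4 (progress_cost * ?P) (\<lambda>t. same inner_nats inner_reals s4 t \<and>
                (if heavy_energy p m (reals s4 ''w'') u < 1 / T then flow_result m T u \<Delta> s4 t else width_result p m u s4 t))" (is "exec _ _ _ ?Posti")
                by (rule exec_Progress[OF pre4 _ u_def]) (simp_all add: \<Delta>_def E4 e4 w)
              then show "exec Progress s4 ((20 + progress_cost) * ?P) ?Q"
              proof (rule exec_mono)
                show "progress_cost * ?P \<le> (20 + progress_cost) * ?P" by (intro mult_right_mono) auto
                fix t assume t: "?Posti t"
                have "same inner_nats inner_reals s t" by (rule same_trans[OF st04 conjunct1[OF t]]) auto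
                moreover have "?R t"
                proof -
                  have "flow_result m T u \<Delta> s4 t = flow_result m T u \<Delta> s t" "width_result p m u s4 t = width_result p m u s t"
                    by (simp_all add: flow_result_def width_result_def e4)
                  then show ?thesis
                    using h conjunct2[OF t] unfolding Let_def \<Delta>_def[symmetric] u_def[symmetric] e4(1) by (simp split: if_splits)
                qed
                ultimately show "?Q t" using istep by blast
              qed
            qed
            then show "exec (If ?b Fail Progress) s4 ((50 + progress_cost) * ?P) ?Q"
              by (rule exec_mono) (use powr_ge_1[OF nm(3)] in \<open>simp_all add: distrib_right\<close>)
          qed
        qed
      qed
    qed
  qed (use Cd progress_cost_nonneg in \<open>simp add: vsum_cost_nonneg vmap_cost_nonneg\<close>)
qed

end

section \<open>Correctness and number of rounds of the inner loop\<close>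

context width_reduction begin

lemma psum_cong: "(\<And>i. i < m \<Longrightarrow> w i = w' i) \<Longrightarrow> psum p m w = psum p m w'"
  by (simp add: psum_def)

lemma en_cong: "(\<And>i. i < m \<Longrightarrow> w i = w' i) \<Longrightarrow> en w d = en w' d"
  by (simp add: en_def weight_def)

lemma inv_cong:
  assumes "\<And>i. i < m \<Longrightarrow> w i = w' i" shows "invar w k e \<longleftrightarrow> invar w' k e"
proof -
  have "psum p m w = psum p m w'" by (rule psum_cong) (rule assms)
  moreover have "en w d = en w' d" for d by (rule en_cong) (rule assms)
  ultimately show ?thesis unfolding invar_def using assms by simp
qed

lemma routed_cong:
  assumes "\<And>i. i < m \<Longrightarrow> w i = w' i" "\<And>i. i < m \<Longrightarrow> a i = a' i" shows "routed w k a \<longleftrightarrow> routed w' k a'"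
proof -
  have "psum p m w = psum p m w'" by (rule psum_cong) (rule assms)
  then show ?thesis unfolding routed_def using assms by simp
qed

end

definition improvable :: "nat \<Rightarrow> nat \<Rightarrow> rmat \<Rightarrow> real \<Rightarrow> rvec \<Rightarrow> real \<Rightarrow> bool" where
  "improvable n m A p x \<nu> \<longleftrightarrow>
     (\<exists>y. (\<forall>i<n. (\<Sum>l<m. A i l * y l) = (\<Sum>l<m. A i l * x l)) \<and> \<nu> \<le> psum p m x - psum p m y)"

definition theta :: "real \<Rightarrow> real" where "theta p = 1 - 2 powr (2 - p)"

text \<open>Six times the bound of \<open>inv_psum_le\<close>, by the conjunct e \<le> 6 * psum p m
  w of \<open>invar\<close>.\<close>

definition energy_max :: "real \<Rightarrow> real" where "energy_max p = 12 * exp (2 * growth p)"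

text \<open>Rounds per unit of \<open>T\<close>: at most \<open>T\<close> flow steps, at most
  energy_max p * T / theta p width steps, and a summand 1 for the exit, which is bounded by
  \<open>T\<close> as well.\<close>

definition inner_const :: "real \<Rightarrow> real" where "inner_const p = 2 + energy_max p / theta p"

text \<open>After \<open>k\<close> flow steps the accumulated step has slope -\<nu> * k / T; the
  required slope -\<nu> is reached exactly at k = T.\<close>

definition found :: "nat \<Rightarrow> nat \<Rightarrow> rmat \<Rightarrow> real \<Rightarrow> real \<Rightarrow> nat \<Rightarrow> rvec \<Rightarrow> nat \<Rightarrow> real \<Rightarrow> state \<Rightarrow> bool" where
  "found n m A p \<nu> T x k e s \<longleftrightarrow> width_reduction.invar p \<nu> m x (dirs n m A p x \<nu>) T (reals s ''w'') k e \<and>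
     width_reduction.routed p \<nu> m x T (reals s ''w'') k (reals s ''ac'') \<and> reals s ''ac'' \<in> ker n m A \<and>
     (\<Sum>i<m. grad p x i * reals s ''ac'' i) = - \<nu> * k / T"

lemma theta_pos: "2 < p \<Longrightarrow> 0 < theta p"
proof -
  assume "2 < p"
  then have "2 powr (2 - p) < 2 powr (0::real)" by (intro powr_less_mono) auto
  then show ?thesis by (simp add: theta_def)
qed

lemma ker_scale: "d \<in> ker n m A \<Longrightarrow> (\<lambda>i. t * d i) \<in> ker n m A"
  by (simp add: ker_def mult.left_commute[of _ t] sum_distrib_left[symmetric])

text \<open>A solution better by \<nu> would yield, through \<open>gap_witness\<close>, a kernel
  direction of slope -\<nu> and energy at most 3 * psum p m w, which the failed test
  excludes.\<close>

lemma istep_fail: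
  assumes wr: "width_reduction p \<nu> m T" and st: "istep n m N A p \<nu> T x s t"
    and invar: "width_reduction.invar p \<nu> m x (dirs n m A p x \<nu>) T (reals s ''w'') k e"
    and D: "D \<in> ker n m A" "\<forall>d\<in>ker n m A. (\<Sum>i<m. weight p \<nu> x (reals s ''w'') i * D i * d i) = - (\<Sum>i<m. grad p x i * d i)"
    and E: "E = (\<Sum>i<m. weight p \<nu> x (reals s ''w'') i * (D i)\<^sup>2)" and bad: "3 * psum p m (reals s ''w'') * E < \<nu>\<^sup>2"
  shows "\<not> improvable n m A p x \<nu>"
proof
  assume "improvable n m A p x \<nu>"
  then obtain y where y: "\<And>i. i < n \<Longrightarrow> (\<Sum>l<m. A i l * y l) = (\<Sum>l<m. A i l * x l)" "\<nu> \<le> psum p m x - psum p m y"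
    by (auto simp: improvable_def)
  interpret width_reduction p \<nu> m x "dirs n m A p x \<nu>" T by (rule wr)
  have w: "\<And>i. i < m \<Longrightarrow> 0 < reals s ''w'' i" using inv_pos[OF invar] .
  from gap_witness[OF p \<nu> y(2) w inv_psum_ge_1[OF invar]] obtain t where
    t: "(\<Sum>i<m. grad p x i * (t * (y i - x i))) = - \<nu>" "en (reals s ''w'') (\<lambda>i. t * (y i - x i)) \<le> 3 * psum p m (reals s ''w'')"
    by (auto simp: en_def)
  have "(\<lambda>i. y i - x i) \<in> ker n m A" using y(1) by (simp add: ker_def right_diff_distrib sum_subtractf)
  then have "(\<lambda>i. t * (y i - x i)) \<in> dirs n m A p x \<nu>" using ker_scale[of "\<lambda>i. y i - x i"] t(1) by (simp add: dirs_def)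
  then have "3 * psum p m (reals s ''w'') < en (reals s ''w'') (\<lambda>i. t * (y i - x i))"
    by (intro lsq_infeasible[OF dirs_def D(2)[rule_format] E bad _ w])
  then show False using t(2) by simp
qed

text \<open>The two outcomes feed two counters: a flow step increases \<open>k\<close>, and a width
  step, taken when the heavy energy is at least 1 / T, raises the certified energy by at least theta
  p / T.\<close>

lemma found_step:
  assumes wr: "width_reduction p \<nu> m T" and f: "found n m A p \<nu> T x k e s" and k: "k < T"
    and D: "D \<in> ker n m A" "\<forall>d\<in>ker n m A. (\<Sum>i<m. weight p \<nu> x (reals s ''w'') i * D i * d i) = - (\<Sum>i<m. grad p x i * d i)"
    and E: "E = (\<Sum>i<m. weight p \<nu> x (reals s ''w'') i * (D i)\<^sup>2)" and ok: "\<not> 3 * psum p m (reals s ''w'') * E < \<nu>\<^sup>2"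
    and \<Delta>: "\<Delta> = (\<lambda>i. \<nu> / E * D i)" and u: "u = (\<lambda>i. \<bar>\<Delta> i\<bar> / scale p \<nu>)"
  shows "heavy_energy p m (reals s ''w'') u < 1 / T \<Longrightarrow> flow_result m T u \<Delta> s t \<Longrightarrow> \<exists>e'\<ge>e. found n m A p \<nu> T x (Suc k) e' t"
    and "\<not> heavy_energy p m (reals s ''w'') u < 1 / T \<Longrightarrow> width_result p m u s t \<Longrightarrow> \<exists>e'\<ge>e + theta p / T. found n m A p \<nu> T x k e' t"
proof -
  interpret width_reduction p \<nu> m x "dirs n m A p x \<nu>" T by (rule wr)
  let ?w = "reals s ''w''" and ?w' = "reals t ''w''" and ?F = "dirs n m A p x \<nu>"
  from f have invar: "invar ?w k e" and routed: "routed ?w k (reals s ''ac'')" and ac: "reals s ''ac'' \<in> ker n m A"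
    and lin: "(\<Sum>i<m. grad p x i * reals s ''ac'' i) = - \<nu> * k / T" by (auto simp: found_def)
  have w: "\<And>i. i < m \<Longrightarrow> 0 < ?w i" using inv_pos[OF invar] .
  have E0: "0 \<le> E" unfolding E using wt_pos w by (intro sum_nonneg) (auto simp: less_imp_le)
  have ok': "\<nu>\<^sup>2 \<le> 3 * psum p m ?w * E" using ok by simp
  note min = lsq_minimizer[OF dirs_def ker_scale D(1) D(2)[rule_format] E ok' E0, folded \<Delta>]
  have \<Delta>F: "\<Delta> \<in> ?F" using min(1) by (simp add: minimizer_def)
  have e_le: "e \<le> en ?w \<Delta>" using invar \<Delta>F by (simp add: invar_def)
  have \<theta>: "0 < theta p" by (rule theta_pos[OF p])
  {
    assume h: "heavy_energy p m ?w u < 1 / T" and r: "flow_result m T u \<Delta> s t"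
    from r have w': "\<And>i. i < m \<Longrightarrow> ?w' i = ?w i + u i / T" and a': "\<And>i. i < m \<Longrightarrow> reals t ''ac'' i = reals s ''ac'' i + \<Delta> i / T"
      by (auto simp: flow_result_def)
    note fl = flow_step[OF invar min u h w']
    have "routed ?w' (Suc k) (reals t ''ac'')" by (rule routed_flow[OF invar routed min(2) u w' fl(2) a'])
    moreover have "reals t ''ac'' \<in> ker n m A"
    proof -
      have "(\<Sum>l<m. A i l * reals t ''ac'' l) = 0" if i: "i < n" for i
      proof -
        have "(\<Sum>l<m. A i l * reals t ''ac'' l) = (\<Sum>l<m. A i l * reals s ''ac'' l) + (\<Sum>l<m. A i l * \<Delta> l) / T"
          unfolding sum_divide_distrib sum.distrib[symmetric] by (intro sum.cong) (auto simp: a' distrib_left)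
        then show ?thesis using ac \<Delta>F i by (simp add: ker_def dirs_def)
      qed
      then show ?thesis by (simp add: ker_def)
    qed
    moreover have "(\<Sum>i<m. grad p x i * reals t ''ac'' i) = - \<nu> * Suc k / T"
    proof -
      have "(\<Sum>i<m. grad p x i * reals t ''ac'' i) = (\<Sum>i<m. grad p x i * reals s ''ac'' i) + (\<Sum>i<m. grad p x i * \<Delta> i) / T"
        unfolding sum_divide_distrib sum.distrib[symmetric] by (intro sum.cong) (auto simp: a' distrib_left)
      also have "\<dots> = - \<nu> * k / T + - \<nu> / T" using lin \<Delta>F by (simp add: dirs_def)
      also have "\<dots> = - \<nu> * Suc k / T" by (simp add: add_divide_distrib diff_divide_distrib algebra_simps)
      finally show ?thesis .
    qed
    ultimately have "found n m A p \<nu> T x (Suc k) (en ?w \<Delta>) t" using fl(1) by (simp add: found_def)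
    then show "\<exists>e'\<ge>e. found n m A p \<nu> T x (Suc k) e' t" using e_le by blast
  next
    assume h: "\<not> heavy_energy p m ?w u < 1 / T" and r: "width_result p m u s t"
    from r have w': "\<And>i. i < m \<Longrightarrow> ?w' i = ?w i * (1 + of_bool (rho p * ?w i < u i))" and a': "reals t ''ac'' = reals s ''ac''"
      by (auto simp: width_result_def)
    have "invar ?w' k (en ?w \<Delta> + theta p * heavy_energy p m ?w u)"
      unfolding theta_def by (rule width_step[OF invar min u w'])
    moreover have "routed ?w' k (reals t ''ac'')"
      unfolding a' by (rule routed_width[OF routed w]) (use w' w in \<open>auto simp: less_imp_le\<close>)
    ultimately have "found n m A p \<nu> T x k (en ?w \<Delta> + theta p * heavy_energy p m ?w u) t"
      using ac lin by (simp add: found_def a')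
    moreover have "e + theta p / T \<le> en ?w \<Delta> + theta p * heavy_energy p m ?w u"
    proof -
      have "theta p * (1 / T) \<le> theta p * heavy_energy p m ?w u" using h \<theta> by (intro mult_left_mono) auto
      then show ?thesis using e_le by simp
    qed
    ultimately show "\<exists>e'\<ge>e + theta p / T. found n m A p \<nu> T x k e' t" by blast
  }
qed

lemma found_init:
  assumes wr: "width_reduction p \<nu> m T" and w: "\<And>i. i < m \<Longrightarrow> reals s ''w'' i = start p m"
    and ac: "\<And>i. i < m \<Longrightarrow> reals s ''ac'' i = 0"
  shows "found n m A p \<nu> T x 0 0 s"
proof -
  interpret width_reduction p \<nu> m x "dirs n m A p x \<nu>" T by (rule wr)
  have "invar (reals s ''w'') 0 0" using inv_cong[of "reals s ''w''" "\<lambda>_. start p m"] w inv_init by simp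
  moreover have "routed (reals s ''w'') 0 (reals s ''ac'')"
    using routed_cong[of "reals s ''w''" "\<lambda>_. start p m" "reals s ''ac''" "\<lambda>_. 0"] w ac routed_init by simp
  ultimately show ?thesis using ac by (simp add: found_def ker_def)
qed

lemma found_energy:
  assumes wr: "width_reduction p \<nu> m T" and f: "found n m A p \<nu> T x k e s" and k: "k \<le> T"
  shows "0 \<le> e" "e \<le> energy_max p"
proof -
  interpret width_reduction p \<nu> m x "dirs n m A p x \<nu>" T by (rule wr)
  have invar: "invar (reals s ''w'') k e" using f by (simp add: found_def)
  then show "0 \<le> e" by (simp add: invar_def)
  have "e \<le> 6 * psum p m (reals s ''w'')" using invar by (simp add: invar_def)
  then show "e \<le> energy_max p" using inv_psum_le[OF invar k] by (simp add: energy_max_def)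
qed

context multiplier begin

definition ILoop :: "rop com" where
  "ILoop = While (NLess (nv ''cnt'') (nv ''T'')) IBody"

abbreviation "loop_pre n m N A p \<nu> T x s \<equiv> ipre n m N A p \<nu> T x s \<and> real m powr width_exp p \<le> real T \<and>
     (\<forall>i<m. reals s ''w'' i = start p m) \<and> (\<forall>i<m. reals s ''ac'' i = 0) \<and> nats s ''cnt'' 0 = 0 \<and> nats s ''fl'' 0 = 0"

abbreviation "loop_post n m A p \<nu> T x s t \<equiv> same inner_nats inner_reals s t \<and>
      (if nats t ''fl'' 0 = 0 then \<exists>e. found n m A p \<nu> T x T e t else \<not> improvable n m A p x \<nu>)"

lemma exec_ILoop:
  "\<exists>C\<ge>0. \<forall>n m N A p \<nu> T x s. loop_pre n m N A p \<nu> T x s \<longrightarrow>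
    exec ILoop s (C * inner_const p * T * mtime N) (\<lambda>t. loop_post n m A p \<nu> T x s t)"
proof -
  from exec_IBody obtain C where C_spec: "0 \<le> C \<and> (\<forall>n m N A p \<nu> T x s. ipre n m N A p \<nu> T x s \<and> (\<forall>i<m. 0 < reals s ''w'' i) \<longrightarrow>
    exec IBody s (C * mtime N) (\<lambda>t. same inner_nats inner_reals s t \<and> istep n m N A p \<nu> T x s t))" by (rule exE)
  note C = conjunct1[OF C_spec] and body = conjunct2[OF C_spec, rule_format]
  show ?thesis
  proof (intro exI[of _ "C + 10"] conjI allI impI)
    fix n m N A p \<nu> T x and s :: state
    assume asm: "loop_pre n m N A p \<nu> T x s"
    then have pre: "ipre n m N A p \<nu> T x s" by blast
    have p: "2 < p" "0 < \<nu>" "1 \<le> T" "1 \<le> m" "1 \<le> N" using pre by (auto simp: ipre_def dat_def)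
    have wr: "width_reduction p \<nu> m T" using p asm by unfold_locales auto
    have \<theta>: "0 < theta p" by (rule theta_pos[OF p(1)])
    let ?P = "mtime N" and ?M = "energy_max p"
    \<comment> \<open>The measure adds the flow steps still to come and the width steps that the
      remaining energy budget \<open>?M - e\<close> allows at theta p / T each. A failure sets it to
      0.\<close>
    define I where "I \<mu> t \<longleftrightarrow> same inner_nats inner_reals s t \<and>
      ((nats t ''fl'' 0 = 1 \<and> nats t ''cnt'' 0 = T \<and> \<not> improvable n m A p x \<nu> \<and> \<mu> = 0) \<or>
       (nats t ''fl'' 0 = 0 \<and> nats t ''cnt'' 0 \<le> T \<and> (\<exists>e. found n m A p \<nu> T x (nats t ''cnt'' 0) e t \<and>
          \<mu> = real (T - nats t ''cnt'' 0) + (?M - e) * T / theta p)))" for \<mu> :: real and t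
    let ?b = "NLess (nv ''cnt'') (nv ''T'') :: rop bexp"
    have "exec ILoop s ((C * ?P + bcost ?b) * ((real T + ?M * T / theta p) + 1)) (\<lambda>t. (\<exists>\<mu>. I \<mu> t) \<and> \<not> bval ?b t)"
      unfolding ILoop_def
    proof (rule exec_While)
      show "I (real T + ?M * T / theta p) s"
        using asm found_init[OF wr, of s n A x] by (auto simp: I_def same_refl)
      show "0 \<le> C * ?P" using C by simp
      show "0 \<le> \<mu>" if "I \<mu> t" for \<mu> t
        using that found_energy[OF wr] \<theta> unfolding I_def by (auto intro!: add_nonneg_nonneg divide_nonneg_pos mult_nonneg_nonneg)
      fix t \<mu> assume I: "I \<mu> t" and b: "bval ?b t"
      have st: "same inner_nats inner_reals s t" using I by (simp add: I_def)
      have pret: "ipre n m N A p \<nu> T x t" by (rule ipre_same[OF pre st]) simp_all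
      have T: "nats t ''T'' 0 = T" using pret by (simp add: ipre_def)
      define k where "k = nats t ''cnt'' 0"
      have k: "k < T" using b T by (simp add: k_def)
      obtain e where fl: "nats t ''fl'' 0 = 0" and f: "found n m A p \<nu> T x k e t" and \<mu>: "\<mu> = real (T - k) + (?M - e) * T / theta p"
        using I k unfolding I_def k_def by auto
      have invar: "width_reduction.invar p \<nu> m x (dirs n m A p x \<nu>) T (reals t ''w'') k e" using f by (simp add: found_def)
      have w: "\<forall>i<m. 0 < reals t ''w'' i" using width_reduction.inv_pos[OF wr invar] by blast
      show "exec IBody t (C * ?P) (\<lambda>t. \<exists>\<mu>'\<le>\<mu> - 1. I \<mu>' t)"
      proof (rule exec_mono[OF body[OF conjI[OF pret w]] order_refl])
        fix t' assume t': "same inner_nats inner_reals t t' \<and> istep n m N A p \<nu> T x t t'"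
        have st': "same inner_nats inner_reals s t'" by (rule same_trans[OF st conjunct1[OF t']]) auto
        note step = conjunct2[OF t']
        from step obtain D E where D: "D \<in> ker n m A"
          "\<forall>d\<in>ker n m A. (\<Sum>i<m. weight p \<nu> x (reals t ''w'') i * D i * d i) = - (\<Sum>i<m. grad p x i * d i)"
          and E: "E = (\<Sum>i<m. weight p \<nu> x (reals t ''w'') i * (D i)\<^sup>2)"
          and r: "if 3 * psum p m (reals t ''w'') * E < \<nu>\<^sup>2 then nats t' ''fl'' 0 = 1 \<and> nats t' ''cnt'' 0 = T
           else (let \<Delta> = (\<lambda>i. \<nu> / E * D i); u = (\<lambda>i. \<bar>\<Delta> i\<bar> / scale p \<nu>)
            in (if heavy_energy p m (reals t ''w'') u < 1 / T then flow_result m T u \<Delta> t t' else width_result p m u t t'))"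
          unfolding istep_def by (elim exE conjE) (rule that)
        show "\<exists>\<mu>'\<le>\<mu> - 1. I \<mu>' t'"
        proof (cases "3 * psum p m (reals t ''w'') * E < \<nu>\<^sup>2")
          case True
          have "\<not> improvable n m A p x \<nu>" by (rule istep_fail[OF wr step invar D E True])
          then have "I 0 t'" using r True st' by (simp add: I_def)
          moreover have "1 \<le> \<mu>"
          proof -
            have "1 \<le> real (T - k)" using k by simp
            moreover have "0 \<le> (?M - e) * T / theta p"
              using found_energy[OF wr f] k \<theta> by (intro divide_nonneg_pos mult_nonneg_nonneg) auto
            ultimately show ?thesis using \<mu> by linarith
          qed
          ultimately show ?thesis by (intro exI[of _ 0]) auto
        next
          case False
          define \<Delta> where "\<Delta> = (\<lambda>i. \<nu> / E * D i)"
          define u where "u = (\<lambda>i. \<bar>\<Delta> i\<bar> / scale p \<nu>)"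
          have r': "if heavy_energy p m (reals t ''w'') u < 1 / T then flow_result m T u \<Delta> t t' else width_result p m u t t'"
            using r False unfolding Let_def \<Delta>_def[symmetric] u_def[symmetric] by simp
          show ?thesis
          proof (cases "heavy_energy p m (reals t ''w'') u < 1 / T")
            case True
            then have fr: "flow_result m T u \<Delta> t t'" using r' by simp
            from found_step(1)[OF wr f k D E False \<Delta>_def u_def True fr] obtain e' where e': "e \<le> e'" "found n m A p \<nu> T x (Suc k) e' t'" by blast
            have cf: "nats t' ''cnt'' 0 = Suc k" "nats t' ''fl'' 0 = 0" using fr fl by (auto simp: flow_result_def k_def)
            have "I (real (T - Suc k) + (?M - e') * T / theta p) t'"
              using st' e' cf k unfolding I_def by auto
            moreover have "real (T - Suc k) + (?M - e') * T / theta p \<le> \<mu> - 1"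
            proof -
              have "(?M - e') * T / theta p \<le> (?M - e) * T / theta p"
                using e' \<theta> by (intro divide_right_mono mult_right_mono) auto
              moreover have "real (T - Suc k) = real (T - k) - 1" using k by simp
              ultimately show ?thesis using \<mu> by linarith
            qed
            ultimately show ?thesis by blast
          next
            case h: False
            then have wrr: "width_result p m u t t'" using r' by simp
            from found_step(2)[OF wr f k D E False \<Delta>_def u_def h wrr] obtain e' where e': "e + theta p / T \<le> e'" "found n m A p \<nu> T x k e' t'" by blast
            have cf: "nats t' ''cnt'' 0 = k" "nats t' ''fl'' 0 = 0" using wrr fl by (auto simp: width_result_def k_def)
            have "I (real (T - k) + (?M - e') * T / theta p) t'"
              using st' e' cf k unfolding I_def by auto
            moreover have "real (T - k) + (?M - e') * T / theta p \<le> \<mu> - 1"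
            proof -
              have "(?M - e') * T / theta p \<le> (?M - e - theta p / T) * T / theta p"
                using e' \<theta> by (intro divide_right_mono mult_right_mono) auto
              also have "\<dots> = (?M - e) * T / theta p - 1"
                using \<theta> p(3) by (simp add: left_diff_distrib diff_divide_distrib)
              finally show ?thesis using \<mu> by linarith
            qed
            ultimately show ?thesis by blast
          qed
        qed
      qed
    qed
    then show "exec ILoop s ((C + 10) * inner_const p * T * ?P) (\<lambda>t. loop_post n m A p \<nu> T x s t)"
    proof (rule exec_mono)
      have P1: "1 \<le> ?P" using powr_ge_1[OF p(5)] .
      have M0: "0 \<le> ?M" by (simp add: energy_max_def)
      have "C * ?P + bcost ?b \<le> (C + 10) * ?P" using P1 by (simp add: distrib_right)
      moreover have "(real T + ?M * T / theta p) + 1 \<le> inner_const p * T"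
        using p(3) by (simp add: inner_const_def distrib_right)
      ultimately have "(C * ?P + bcost ?b) * ((real T + ?M * T / theta p) + 1) \<le> ((C + 10) * ?P) * (inner_const p * T)"
        using C P1 M0 \<theta> by (intro mult_mono) (auto intro!: add_nonneg_nonneg)
      then show "(C * ?P + bcost ?b) * ((real T + ?M * T / theta p) + 1) \<le> (C + 10) * inner_const p * T * ?P"
        by (simp add: mult_ac)
    next
      fix t assume "(\<exists>\<mu>. I \<mu> t) \<and> \<not> bval ?b t"
      then obtain \<mu> where I: "I \<mu> t" and b: "\<not> bval ?b t" by blast
      have st: "same inner_nats inner_reals s t" using I by (simp add: I_def)
      have pret: "ipre n m N A p \<nu> T x t" by (rule ipre_same[OF pre st]) simp_all
      have "T \<le> nats t ''cnt'' 0" using b pret by (simp add: ipre_def)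
      then show "loop_post n m A p \<nu> T x s t"
        using I unfolding I_def by auto
    qed
  qed (use C in simp)
qed

end

section \<open>The outer loop\<close>

text \<open>With \<nu> = U / 2 the descent gains at least the step size times \<nu> / 2, that is,
  times U / 4. The step size is taken at the largest sum of p-th powers that
  \<open>inv_psum_le\<close> allows.\<close>

definition rate :: "real \<Rightarrow> real" where "rate p = step_size p (2 * exp (2 * growth p)) / 4"

text \<open>Bounds the rounds left until \<open>U\<close> falls to \<open>th\<close> when each round
  removes the fraction \<kappa>; the summand 1 is for the round that crosses the threshold.\<close>

definition potential :: "real \<Rightarrow> real \<Rightarrow> real \<Rightarrow> real" where
  "potential \<kappa> th U = (if th < U then ln (U / th) / \<kappa> + 1 else 0)"

definition sol :: "nat \<Rightarrow> nat \<Rightarrow> rmat \<Rightarrow> rvec \<Rightarrow> rvec set" where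
  "sol n m A b = {y. \<forall>i<n. (\<Sum>l<m. A i l * y l) = b i}"

definition good :: "nat \<Rightarrow> nat \<Rightarrow> rmat \<Rightarrow> rvec \<Rightarrow> real \<Rightarrow> rvec \<Rightarrow> real \<Rightarrow> bool" where
  "good n m A b p x U \<longleftrightarrow> x \<in> sol n m A b \<and> (\<forall>y\<in>sol n m A b. psum p m x - psum p m y \<le> U)"

lemma growth_nonneg: "2 < p \<Longrightarrow> 0 \<le> growth p"
  by (simp add: growth_def)

lemma step_size_pos: "2 < p \<Longrightarrow> 1 \<le> \<Phi> \<Longrightarrow> 0 < step_size p \<Phi>"
  using upper_const_ge_1[of p] by (simp add: step_size_def)

lemma step_size_antimono: "2 < p \<Longrightarrow> 1 \<le> \<Phi> \<Longrightarrow> \<Phi> \<le> \<Phi>' \<Longrightarrow> step_size p \<Phi>' \<le> step_size p \<Phi>"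
  using upper_const_ge_1[of p] unfolding step_size_def by (intro divide_left_mono mult_left_mono mult_pos_pos) auto

lemma rate_pos: "2 < p \<Longrightarrow> 0 < rate p"
proof -
  assume p: "2 < p"
  have "1 \<le> exp (2 * growth p)" using growth_nonneg[OF p] by simp
  then have "1 \<le> 2 * exp (2 * growth p)" by linarith
  from step_size_pos[OF p this] show ?thesis by (simp add: rate_def)
qed

lemma rate_le: "2 < p \<Longrightarrow> rate p \<le> 1 / 2"
proof -
  assume p: "2 < p"
  have "1 \<le> exp (2 * growth p)" using growth_nonneg[OF p] by simp
  then have "1 \<le> 2 * exp (2 * growth p)" by linarith
  then have "1 * 1 * 1 \<le> 8 * upper_const p * 2 powr p * (2 * exp (2 * growth p))"
    using upper_const_ge_1[OF p] p by (intro mult_mono) (simp_all add: ge_one_powr_ge_zero)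
  then have "step_size p (2 * exp (2 * growth p)) \<le> 1" unfolding step_size_def by simp
  then show ?thesis by (simp add: rate_def)
qed

lemma potential_nonneg: "0 < \<kappa> \<Longrightarrow> 0 < th \<or> U \<le> th \<Longrightarrow> 0 \<le> potential \<kappa> th U"
  by (auto simp: potential_def intro!: add_nonneg_nonneg divide_nonneg_pos)

text \<open>While the threshold is not crossed, ln (1 - \<kappa>) \<le> -\<kappa> gives the drop by
  1; when it is crossed, the potential falls from at least 1 to 0.\<close>

lemma potential_step:
  assumes \<kappa>: "0 < \<kappa>" "\<kappa> \<le> 1 / 2" and th: "0 < th" "th < U" and U': "U' \<le> U - \<kappa> * U"
  shows "potential \<kappa> th U' \<le> potential \<kappa> th U - 1"
proof (cases "th < U'")
  case True
  have "ln (U' / th) \<le> ln ((1 - \<kappa>) * (U / th))"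
    using th True \<kappa> U' by (intro ln_mono divide_pos_pos mult_pos_pos) (auto simp: field_simps)
  also have "\<dots> = ln (1 - \<kappa>) + ln (U / th)" using \<kappa> th by (intro ln_mult_pos) auto
  also have "\<dots> \<le> ln (U / th) - \<kappa>" using ln_add_one_self_le_self2[of "- \<kappa>"] \<kappa> by simp
  finally have "ln (U' / th) / \<kappa> \<le> (ln (U / th) - \<kappa>) / \<kappa>" using \<kappa> by (intro divide_right_mono) auto
  also have "\<dots> = ln (U / th) / \<kappa> - 1" using \<kappa> by (simp add: diff_divide_distrib)
  finally show ?thesis using True th by (simp add: potential_def)
next
  case False
  then show ?thesis using th \<kappa> by (simp add: potential_def)
qed

lemma good_shrink:
  assumes "good n m A b p x U" "\<not> improvable n m A p x (U / 2)" shows "good n m A b p x (U / 2)"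
  unfolding good_def
proof (intro conjI ballI)
  show x: "x \<in> sol n m A b" using assms(1) by (simp add: good_def)
  fix y assume "y \<in> sol n m A b"
  then have "\<forall>i<n. (\<Sum>l<m. A i l * y l) = (\<Sum>l<m. A i l * x l)" using x by (simp add: sol_def)
  then have "\<not> U / 2 \<le> psum p m x - psum p m y" using assms(2) unfolding improvable_def by blast
  then show "psum p m x - psum p m y \<le> U / 2" by simp
qed

text \<open>The certified gap moves along with the value: whatever the step takes off psum p m x is
  taken off \<open>U\<close>. The program evaluates both sums exactly, so nothing is lost to
  estimates.\<close>

lemma good_descend:
  assumes wr: "width_reduction p (U / 2) m T" and f: "found n m A p (U / 2) T x T e s" and g: "good n m A b p x U"
    and x': "\<And>i. i < m \<Longrightarrow> x' i = x i + step_size p (psum p m (reals s ''w'')) * reals s ''ac'' i"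
  shows "good n m A b p x' (U - psum p m x + psum p m x')" "U - psum p m x + psum p m x' \<le> U - rate p * U"
proof -
  interpret width_reduction p "U / 2" m x "dirs n m A p x (U / 2)" T by (rule wr)
  let ?w = "reals s ''w''" and ?a = "reals s ''ac''"
  let ?l = "step_size p (psum p m ?w)"
  from f have inv: "invar ?w T e" and r: "routed ?w T ?a" and a: "?a \<in> ker n m A"
    and lin: "(\<Sum>i<m. grad p x i * ?a i) = - (U / 2) * T / T" by (auto simp: found_def)
  have T: "0 < real T" using T_pos by simp
  have \<Phi>: "1 \<le> psum p m ?w" "psum p m ?w \<le> 2 * exp (2 * growth p)"
    using inv_psum_ge_1[OF inv] inv_psum_le[OF inv] by auto
  have eq: "psum p m x' = psum p m (\<lambda>i. x i + ?l * ?a i)" by (rule psum_cong) (rule x')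
  have "psum p m x' \<le> psum p m x - ?l * (U / 2) / 2" unfolding eq
    by (rule routed_descent[OF r \<Phi>(1)]) (use inv_pos[OF inv] lin T in auto)
  moreover have "4 * rate p * (U / 2) \<le> ?l * (U / 2)"
    using step_size_antimono[OF p \<Phi>] \<nu> by (intro mult_right_mono) (auto simp: rate_def)
  then have "rate p * U \<le> ?l * (U / 2) / 2" by (simp add: mult_ac)
  ultimately show "U - psum p m x + psum p m x' \<le> U - rate p * U" by simp
  have "(\<Sum>l<m. A i l * x' l) = b i" if i: "i < n" for i
  proof -
    have "(\<Sum>l<m. A i l * x' l) = (\<Sum>l<m. A i l * x l + ?l * (A i l * ?a l))"
      by (intro sum.cong) (auto simp: x' algebra_simps)
    also have "\<dots> = (\<Sum>l<m. A i l * x l) + ?l * (\<Sum>l<m. A i l * ?a l)"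
      by (simp add: sum.distrib sum_distrib_left)
    finally show ?thesis using g a i by (simp add: good_def sol_def ker_def)
  qed
  then show "good n m A b p x' (U - psum p m x + psum p m x')"
    using g unfolding good_def sol_def by (auto simp: algebra_simps)
qed

definition opre :: "nat \<Rightarrow> nat \<Rightarrow> nat \<Rightarrow> rmat \<Rightarrow> real \<Rightarrow> nat \<Rightarrow> state \<Rightarrow> bool" where
  "opre n m N A p T s \<longleftrightarrow> dat n m N A s \<and> reals s ''pp'' 0 = p \<and> reals s ''rho'' 0 = rho p \<and> nats s ''T'' 0 = T \<and>
     1 \<le> T \<and> real m powr width_exp p \<le> real T"

lemma opre_same:
  assumes "opre n m N A p T s" "same X Y s t" "{''n'', ''m'', ''N'', ''L'', ''sz'', ''T''} \<inter> X = {}"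
    "{''A'', ''P'', ''pp'', ''rho''} \<inter> Y = {}"
  shows "opre n m N A p T t"
proof -
  have eqs: "nats t ''T'' = nats s ''T''" "reals t ''pp'' = reals s ''pp''" "reals t ''rho'' = reals s ''rho''"
    using assms(3,4) by (auto intro!: same_eqs[OF assms(2)])
  have "dat n m N A t" by (rule dat_same[OF _ assms(2)]) (use assms in \<open>auto simp: opre_def\<close>)
  then show ?thesis using assms(1) unfolding opre_def eqs by blast
qed

abbreviation "outer_reals \<equiv> inner_reals \<union> {''nu'', ''sc'', ''g'', ''gap'', ''lam'', ''xn'', ''fx'', ''fn'', ''x''}"

definition eg :: "rop rexp" where
  "eg = rmul (rmul (rv ''pp'') (rpow (ri ''x'') (rsub (rv ''pp'') (num 2)))) (ri ''x'')"

definition estart :: "rop rexp" where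
  "estart = rpow (ROfNat (nv ''m'')) (rdiv (rsub (num 0) (num 1)) (rv ''pp''))"

definition enu :: "rop rexp" where "enu = rdiv (rv ''gap'') (num 2)"

definition esc :: "rop rexp" where "esc = rmul (num 2) (rpow (rv ''nu'') (rdiv (num 1) (rv ''pp'')))"

definition elam :: "rop rexp" where
  "elam = rdiv (num 1) (rmul (rmul (rmul (num 8) (rmul (rmul (rv ''pp'') (rv ''pp'')) (rpow (num 4) (rv ''pp''))))
     (rpow (num 2) (rv ''pp''))) (rv ''Phi''))"

definition exn :: "rop rexp" where "exn = radd (ri ''x'') (rmul (rv ''lam'') (ri ''ac''))"

definition efx :: "rop rexp" where "efx = rpow (rk ''x'') (rv ''pp'')"

definition efn :: "rop rexp" where "efn = rpow (rk ''xn'') (rv ''pp'')"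

definition egap :: "rop rexp" where "egap = radd (rsub (rv ''gap'') (rv ''fx'')) (rv ''fn'')"

context multiplier begin

lemma exec_RSet0:
  assumes "1 \<le> N" "rval e s = v"
  shows "exec (rset a e) s (real (2 + rcost e) * mtime N) (\<lambda>t. same {} {a} s t \<and> reals t a 0 = v)"
proof (rule exec_RSet)
  have "real (2 + rcost e) * 1 \<le> real (2 + rcost e) * mtime N"
    by (intro mult_left_mono powr_ge_1 assms) simp
  then show "real (1 + ncost (NConst 0) + rcost e) \<le> real (2 + rcost e) * mtime N" by simp
qed (use assms in \<open>auto simp: same_def\<close>)

lemma exec_NSet0:
  assumes "1 \<le> N" "nval e s = v"
  shows "exec (nset a e) s (real (2 + ncost e) * mtime N) (\<lambda>t. same {a} {} s t \<and> nats t a 0 = v)"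
proof (rule exec_NSet)
  have "real (2 + ncost e) * 1 \<le> real (2 + ncost e) * mtime N"
    by (intro mult_left_mono powr_ge_1 assms) simp
  then show "real (1 + ncost (NConst 0) + ncost e) \<le> real (2 + ncost e) * mtime N" by simp
qed (use assms in \<open>auto simp: same_def\<close>)

definition Prelude :: "rop com" where
  "Prelude = Seq (rset ''nu'' enu) (Seq (rset ''sc'' esc) (Seq (VecMap ''g'' (nv ''m'') eg)
     (Seq (VecMap ''w'' (nv ''m'') estart) (Seq (VecMap ''ac'' (nv ''m'') rzero)
       (Seq (nset ''cnt'' (NConst 0)) (nset ''fl'' (NConst 0)))))))"

definition prelude_cost :: real where
  "prelude_cost = real (2 + rcost enu) + (real (2 + rcost esc) + (vmap_cost (nv ''m'') eg + (vmap_cost (nv ''m'') estart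
     + (vmap_cost (nv ''m'') rzero + (real (2 + ncost (NConst 0)) + real (2 + ncost (NConst 0)))))))"

lemma exec_Prelude:
  assumes pre: "opre n m N A p T s" and p: "2 < p" and U: "reals s ''gap'' 0 = U" "0 < U"
  shows "exec Prelude s (prelude_cost * mtime N) (\<lambda>t. same inner_nats outer_reals s t \<and> reals t ''gap'' 0 = U \<and>
    ipre n m N A p (U / 2) T (reals s ''x'') t \<and>
    (\<forall>i<m. reals t ''w'' i = start p m) \<and> (\<forall>i<m. reals t ''ac'' i = 0) \<and> nats t ''cnt'' 0 = 0 \<and> nats t ''fl'' 0 = 0)" (is "exec _ _ _ ?Q")
  unfolding Prelude_def prelude_cost_def distrib_right
proof (rule exec_Seq)
  let ?pf = "Seq (nset ''cnt'' (NConst 0)) (nset ''fl'' (NConst 0))"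
  let ?pe = "Seq (VecMap ''ac'' (nv ''m'') rzero) ?pf"
  let ?pd = "Seq (VecMap ''w'' (nv ''m'') estart) ?pe"
  let ?pc = "Seq (VecMap ''g'' (nv ''m'') eg) ?pd"
  let ?pb = "Seq (rset ''sc'' esc) ?pc"
  let ?cf = "real (2 + ncost (NConst 0)) * mtime N + real (2 + ncost (NConst 0)) * mtime N"
  let ?ce = "vmap_cost (nv ''m'') rzero * mtime N + ?cf"
  let ?cd = "vmap_cost (nv ''m'') estart * mtime N + ?ce"
  let ?cc = "vmap_cost (nv ''m'') eg * mtime N + ?cd"
  let ?cb = "real (2 + rcost esc) * mtime N + ?cc"
  have d: "dat n m N A s" and pp: "reals s ''pp'' 0 = p" "reals s ''rho'' 0 = rho p" "nats s ''T'' 0 = T" "1 \<le> T"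
    using pre by (auto simp: opre_def)
  have nm: "nats s ''m'' 0 = m" "m \<le> N" "1 \<le> N" using d by (auto simp: dat_def)
  show "exec (rset ''nu'' enu) s (real (2 + rcost enu) * mtime N) (\<lambda>t. same {} {''nu''} s t \<and> reals t ''nu'' 0 = U / 2)"
    by (rule exec_RSet0) (use nm U in \<open>simp_all add: enu_def\<close>)
  fix s1 assume p1: "same {} {''nu''} s s1 \<and> reals s1 ''nu'' 0 = U / 2"
  note st1 = conjunct1[OF p1]
  show "exec ?pb s1
    ?cb
    ?Q"
  proof (rule exec_Seq)
    show "exec (rset ''sc'' esc) s1 (real (2 + rcost esc) * mtime N) (\<lambda>t. same {} {''sc''} s1 t \<and> reals t ''sc'' 0 = scale p (U / 2))"
      by (rule exec_RSet0) (use nm U pp in \<open>simp_all add: conjunct2[OF p1] esc_def scale_def same_reals[OF st1]\<close>)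
    fix s2 assume p2: "same {} {''sc''} s1 s2 \<and> reals s2 ''sc'' 0 = scale p (U / 2)"
    note st2 = conjunct1[OF p2]
    have nm2: "nats s2 ''m'' 0 = m" using nm by (simp add: same_nats[OF st2] same_nats[OF st1])
    show "exec ?pc s2
    ?cc
    ?Q"
    proof (rule exec_Seq)
      show "exec (VecMap ''g'' (nv ''m'') eg) s2 (vmap_cost (nv ''m'') eg * mtime N)
        (\<lambda>t. same ijk {''g''} s2 t \<and> (\<forall>i<m. reals t ''g'' i = grad p (reals s ''x'') i))" (is "exec _ _ _ ?Posta")
      proof (rule exec_VecMap)
        fix s' i assume *: "same ijk {''g''} s2 s'" "nats s' ''i'' 0 = i"
        show "rval eg s' = grad p (reals s ''x'') i"
          using pp by (simp add: eg_def grad_def *(2) same_reals[OF *(1)] same_reals[OF st1] same_reals[OF st2])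
      qed (use nm nm2 in \<open>simp_all add: same_nats\<close>)
      fix s3 assume p3: "?Posta s3"
      note st3 = conjunct1[OF p3]
      have nm3: "nats s3 ''m'' 0 = m" using nm2 by (simp add: same_nats[OF st3])
      show "exec ?pd s3
        ?cd
        ?Q"
      proof (rule exec_Seq)
        show "exec (VecMap ''w'' (nv ''m'') estart) s3 (vmap_cost (nv ''m'') estart * mtime N)
          (\<lambda>t. same ijk {''w''} s3 t \<and> (\<forall>i<m. reals t ''w'' i = start p m))" (is "exec _ _ _ ?Postb")
        proof (rule exec_VecMap)
          fix s' i assume *: "same ijk {''w''} s3 s'" "nats s' ''i'' 0 = i"
          show "rval estart s' = start p m"
            using pp nm by (simp add: estart_def start_def same_nats[OF *(1)] same_nats[OF st1] same_nats[OF st2] same_nats[OF st3]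
               same_reals[OF *(1)] same_reals[OF st1] same_reals[OF st2] same_reals[OF st3])
        qed (use nm nm3 in \<open>simp_all add: same_nats\<close>)
        fix s4 assume p4: "?Postb s4"
        note st4 = conjunct1[OF p4]
        have nm4: "nats s4 ''m'' 0 = m" using nm3 by (simp add: same_nats[OF st4])
        show "exec ?pe s4
          ?ce
          ?Q"
        proof (rule exec_Seq)
          show "exec (VecMap ''ac'' (nv ''m'') rzero) s4 (vmap_cost (nv ''m'') rzero * mtime N)
            (\<lambda>t. same ijk {''ac''} s4 t \<and> (\<forall>i<m. reals t ''ac'' i = 0))"
            by (rule exec_VecMap) (use nm nm4 in \<open>simp_all add: same_nats\<close>)
          fix s5 assume p5: "same ijk {''ac''} s4 s5 \<and> (\<forall>i<m. reals s5 ''ac'' i = 0)"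
          note st5 = conjunct1[OF p5]
          show "exec ?pf s5
            ?cf
            ?Q"
          proof (rule exec_Seq[OF exec_NSet0[OF nm(3)]])
            show "nval (NConst 0) s5 = 0" by simp
            fix s6 assume p6: "same {''cnt''} {} s5 s6 \<and> nats s6 ''cnt'' 0 = 0"
            note st6 = conjunct1[OF p6]
            show "exec (nset ''fl'' (NConst 0)) s6 (real (2 + ncost (NConst 0)) * mtime N)
              ?Q"
            proof (rule exec_mono[OF exec_NSet0[OF nm(3)] order_refl])
              show "nval (NConst 0) s6 = 0" by simp
              fix t assume p7: "same {''fl''} {} s6 t \<and> nats t ''fl'' 0 = 0"
              note st7 = conjunct1[OF p7]
              have "same {} {''nu'', ''sc''} s s2" by (rule same_trans[OF st1 st2]) auto
              then have "same ijk {''nu'', ''sc'', ''g''} s s3" by (rule same_trans[OF _ st3]) auto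
              then have "same ijk {''nu'', ''sc'', ''g'', ''w''} s s4" by (rule same_trans[OF _ st4]) auto
              then have "same ijk {''nu'', ''sc'', ''g'', ''w'', ''ac''} s s5" by (rule same_trans[OF _ st5]) auto
              then have "same (ijk \<union> {''cnt''}) {''nu'', ''sc'', ''g'', ''w'', ''ac''} s s6" by (rule same_trans[OF _ st6]) auto
              then have st: "same (ijk \<union> {''cnt'', ''fl''}) {''nu'', ''sc'', ''g'', ''w'', ''ac''} s t" by (rule same_trans[OF _ st7]) auto
              have dt: "dat n m N A t" by (rule dat_same[OF d st]) simp_all
              have r: "reals t ''nu'' 0 = U / 2" "reals t ''sc'' 0 = scale p (U / 2)"
                "\<forall>i<m. reals t ''g'' i = grad p (reals s ''x'') i" "\<forall>i<m. reals t ''w'' i = start p m" "\<forall>i<m. reals t ''ac'' i = 0"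
                using p1 p2 p3 p4 p5
                by (simp_all add: same_reals[OF st2] same_reals[OF st3] same_reals[OF st4] same_reals[OF st5] same_reals[OF st6] same_reals[OF st7])
              have c: "nats t ''cnt'' 0 = 0" "nats t ''fl'' 0 = 0" using p6 p7 by (simp_all add: same_nats[OF st7])
              have q: "reals t ''pp'' 0 = p" "reals t ''rho'' 0 = rho p" "nats t ''T'' 0 = T" "reals t ''x'' = reals s ''x''" "reals t ''gap'' 0 = U"
                using pp U by (simp_all add: same_eqs[OF st])
              have "ipre n m N A p (U / 2) T (reals s ''x'') t"
                unfolding ipre_def using dt r(1,2,3) q pp(4) p U by simp
              moreover have "same inner_nats outer_reals s t" by (rule same_mono[OF st]) auto
              ultimately show "?Q t"
                using r(4,5) c q(5) by blast
            qed
          qed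
        qed
      qed
    qed
  qed
qed

end

context multiplier begin

definition Update :: "rop com" where
  "Update = Seq (VecSum ''Phi'' (NConst 1) (nv ''m'') ePhi) (Seq (rset ''lam'' elam) (Seq (VecMap ''xn'' (nv ''m'') exn)
     (Seq (VecSum ''fx'' (NConst 1) (nv ''m'') efx) (Seq (VecSum ''fn'' (NConst 1) (nv ''m'') efn)
       (Seq (rset ''gap'' egap) (VecMap ''x'' (nv ''m'') (ri ''xn'')))))))"

definition update_cost :: real where
  "update_cost = vsum_cost (NConst 1) (nv ''m'') ePhi + (real (2 + rcost elam) + (vmap_cost (nv ''m'') exn
     + (vsum_cost (NConst 1) (nv ''m'') efx + (vsum_cost (NConst 1) (nv ''m'') efn
       + (real (2 + rcost egap) + vmap_cost (nv ''m'') (ri ''xn''))))))"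

lemma exec_Update:
  assumes pre: "opre n m N A p T s" and U: "reals s ''gap'' 0 = U"
  shows "exec Update s (update_cost * mtime N) (\<lambda>t. same inner_nats outer_reals s t \<and>
    (\<forall>i<m. reals t ''x'' i = reals s ''x'' i + step_size p (psum p m (reals s ''w'')) * reals s ''ac'' i) \<and>
    reals t ''gap'' 0 = U - psum p m (reals s ''x'') + psum p m (reals t ''x''))" (is "exec _ _ _ ?Q")
  unfolding Update_def update_cost_def distrib_right
proof (rule exec_Seq)
  let ?P = "mtime N"
  let ?ce = "real (2 + rcost egap) * ?P + vmap_cost (nv ''m'') (ri ''xn'') * ?P"
  let ?cd = "vsum_cost (NConst 1) (nv ''m'') efn * ?P + ?ce"
  let ?cc = "vsum_cost (NConst 1) (nv ''m'') efx * ?P + ?cd"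
  let ?cb = "vmap_cost (nv ''m'') exn * ?P + ?cc"
  let ?ca = "real (2 + rcost elam) * ?P + ?cb"
  let ?pe = "Seq (rset ''gap'' egap) (VecMap ''x'' (nv ''m'') (ri ''xn''))"
  let ?pd = "Seq (VecSum ''fn'' (NConst 1) (nv ''m'') efn) ?pe"
  let ?pc = "Seq (VecSum ''fx'' (NConst 1) (nv ''m'') efx) ?pd"
  let ?pb = "Seq (VecMap ''xn'' (nv ''m'') exn) ?pc"
  let ?pa = "Seq (rset ''lam'' elam) ?pb"
  have pp: "reals s ''pp'' 0 = p" and d: "dat n m N A s" using pre by (auto simp: opre_def)
  have nm: "nats s ''m'' 0 = m" "m \<le> N" "1 \<le> N" using d by (auto simp: dat_def)
  let ?w = "reals s ''w''" and ?x = "reals s ''x''"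
  let ?l = "step_size p (psum p m ?w)"
  define x' where "x' i = ?x i + ?l * reals s ''ac'' i" for i
  show "exec (VecSum ''Phi'' (NConst 1) (nv ''m'') ePhi) s (vsum_cost (NConst 1) (nv ''m'') ePhi * ?P)
    (\<lambda>t. same ijk {''Phi''} s t \<and> (\<forall>i<1. reals t ''Phi'' i = (\<Sum>k<m. \<bar>?w k\<bar> powr p)))" (is "exec _ _ _ ?Posta")
  proof (rule exec_VecSum)
    fix s' i k assume *: "same ijk {''Phi''} s s'" "nats s' ''k'' 0 = k"
    show "rval ePhi s' = \<bar>?w k\<bar> powr p" using pp by (simp add: ePhi_def *(2) same_reals[OF *(1)])
  qed (use nm in \<open>simp_all add: same_nats\<close>)
  fix s1 assume p1: "?Posta s1"
  note st1 = conjunct1[OF p1]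
  have Phi: "reals s1 ''Phi'' 0 = psum p m ?w" using conjunct2[OF p1] by (simp add: psum_def)
  show "exec ?pa s1 ?ca ?Q"
  proof (rule exec_Seq[OF exec_RSet0[OF nm(3)]])
    show "rval elam s1 = ?l"
      using pp Phi by (simp add: elam_def step_size_def upper_const_def power2_eq_square same_reals[OF st1])
    fix s2 assume p2: "same {} {''lam''} s1 s2 \<and> reals s2 ''lam'' 0 = ?l"
    have st2: "same ijk {''Phi'', ''lam''} s s2" by (rule same_trans[OF st1 conjunct1[OF p2]]) auto
    have nm2: "nats s2 ''m'' 0 = m" using nm by (simp add: same_nats[OF st2])
    show "exec ?pb s2 ?cb ?Q"
    proof (rule exec_Seq)
      show "exec (VecMap ''xn'' (nv ''m'') exn) s2 (vmap_cost (nv ''m'') exn * ?P)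
        (\<lambda>t. same ijk {''xn''} s2 t \<and> (\<forall>i<m. reals t ''xn'' i = x' i))" (is "exec _ _ _ ?Postb")
      proof (rule exec_VecMap)
        fix s' i assume *: "same ijk {''xn''} s2 s'" "nats s' ''i'' 0 = i"
        show "rval exn s' = x' i"
          by (simp add: exn_def x'_def *(2) same_reals[OF *(1)] conjunct2[OF p2] same_reals[OF st2])
      qed (use nm nm2 in \<open>simp_all add: same_nats\<close>)
      fix s3 assume p3: "?Postb s3"
      have st3: "same ijk {''Phi'', ''lam'', ''xn''} s s3" by (rule same_trans[OF st2 conjunct1[OF p3]]) auto
      have nm3: "nats s3 ''m'' 0 = m" using nm by (simp add: same_nats[OF st3])
      have pp3: "reals s3 ''pp'' 0 = p" using pp by (simp add: same_reals[OF st3])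
      show "exec ?pc s3 ?cc ?Q"
      proof (rule exec_Seq)
        show "exec (VecSum ''fx'' (NConst 1) (nv ''m'') efx) s3 (vsum_cost (NConst 1) (nv ''m'') efx * ?P)
          (\<lambda>t. same ijk {''fx''} s3 t \<and> (\<forall>i<1. reals t ''fx'' i = (\<Sum>k<m. \<bar>?x k\<bar> powr p)))" (is "exec _ _ _ ?Postc")
        proof (rule exec_VecSum)
          fix s' i k assume *: "same ijk {''fx''} s3 s'" "nats s' ''k'' 0 = k"
          show "rval efx s' = \<bar>?x k\<bar> powr p" using pp3 by (simp add: efx_def *(2) same_reals[OF *(1)] same_reals[OF st3])
        qed (use nm nm3 in \<open>simp_all add: same_nats\<close>)
        fix s4 assume p4: "?Postc s4"
        have st4: "same ijk {''Phi'', ''lam'', ''xn'', ''fx''} s s4" by (rule same_trans[OF st3 conjunct1[OF p4]]) auto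
        have nm4: "nats s4 ''m'' 0 = m" using nm by (simp add: same_nats[OF st4])
        have pp4: "reals s4 ''pp'' 0 = p" using pp by (simp add: same_reals[OF st4])
        have xn4: "\<forall>i<m. reals s4 ''xn'' i = x' i" using conjunct2[OF p3] by (simp add: same_reals[OF conjunct1[OF p4]])
        show "exec ?pd s4 ?cd ?Q"
        proof (rule exec_Seq)
          show "exec (VecSum ''fn'' (NConst 1) (nv ''m'') efn) s4 (vsum_cost (NConst 1) (nv ''m'') efn * ?P)
            (\<lambda>t. same ijk {''fn''} s4 t \<and> (\<forall>i<1. reals t ''fn'' i = (\<Sum>k<m. \<bar>x' k\<bar> powr p)))" (is "exec _ _ _ ?Postd")
          proof (rule exec_VecSum)
            fix s' i k assume *: "same ijk {''fn''} s4 s'" "k < m" "nats s' ''k'' 0 = k"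
            show "rval efn s' = \<bar>x' k\<bar> powr p" using pp4 xn4 *(2) by (simp add: efn_def *(3) same_reals[OF *(1)])
          qed (use nm nm4 in \<open>simp_all add: same_nats\<close>)
          fix s5 assume p5: "?Postd s5"
          have st5: "same ijk {''Phi'', ''lam'', ''xn'', ''fx'', ''fn''} s s5" by (rule same_trans[OF st4 conjunct1[OF p5]]) auto
          have f5: "reals s5 ''fx'' 0 = psum p m ?x" "reals s5 ''fn'' 0 = psum p m x'"
            using conjunct2[OF p4] conjunct2[OF p5] by (simp_all add: psum_def same_reals[OF conjunct1[OF p5]])
          have xn5: "\<forall>i<m. reals s5 ''xn'' i = x' i" using xn4 by (simp add: same_reals[OF conjunct1[OF p5]])
          show "exec ?pe s5 ?ce ?Q"
          proof (rule exec_Seq[OF exec_RSet0[OF nm(3)]])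
            show "rval egap s5 = U - psum p m ?x + psum p m x'"
              using U by (simp add: egap_def f5 same_reals[OF st5])
            fix s6 assume p6: "same {} {''gap''} s5 s6 \<and> reals s6 ''gap'' 0 = U - psum p m ?x + psum p m x'"
            have st6: "same ijk {''Phi'', ''lam'', ''xn'', ''fx'', ''fn'', ''gap''} s s6"
              by (rule same_trans[OF st5 conjunct1[OF p6]]) auto
            have nm6: "nats s6 ''m'' 0 = m" using nm by (simp add: same_nats[OF st6])
            have xn6: "\<forall>i<m. reals s6 ''xn'' i = x' i" using xn5 by (simp add: same_reals[OF conjunct1[OF p6]])
            have "exec (VecMap ''x'' (nv ''m'') (ri ''xn'')) s6 (vmap_cost (nv ''m'') (ri ''xn'') * ?P)
              (\<lambda>t. same ijk {''x''} s6 t \<and> (\<forall>i<m. reals t ''x'' i = x' i))"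
            proof (rule exec_VecMap)
              fix s' i assume *: "same ijk {''x''} s6 s'" "i < m" "nats s' ''i'' 0 = i"
              show "rval (ri ''xn'') s' = x' i" using xn6 *(2) by (simp add: *(3) same_reals[OF *(1)])
            qed (use nm nm6 in \<open>simp_all add: same_nats\<close>)
            then show "exec (VecMap ''x'' (nv ''m'') (ri ''xn'')) s6 (vmap_cost (nv ''m'') (ri ''xn'') * ?P) ?Q"
            proof (rule exec_mono[OF _ order_refl])
              fix t assume p7: "same ijk {''x''} s6 t \<and> (\<forall>i<m. reals t ''x'' i = x' i)"
              have "same inner_nats outer_reals s t" by (rule same_trans[OF st6 conjunct1[OF p7]]) auto
              moreover have "psum p m (reals t ''x'') = psum p m x'" using conjunct2[OF p7] by (simp add: psum_def)
              ultimately show "?Q t"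
                using conjunct2[OF p7] conjunct2[OF p6] by (simp add: x'_def same_reals[OF conjunct1[OF p7]])
            qed
          qed
        qed
      qed
    qed
  qed
qed

definition OBody :: "rop com" where
  "OBody = Seq Prelude (Seq ILoop (If (NLess (NConst 0) (nv ''fl'')) (rset ''gap'' enu) Update))"

text \<open>The right-hand side \<open>b\<close> is quantified inside: the body moves
  \<open>x\<close> within the kernel of \<open>A\<close> and never reads \<open>b\<close>, so it
  preserves the solutions of every system with matrix \<open>A\<close>.\<close>

abbreviation "step_post n m A p s t \<equiv> same inner_nats outer_reals s t \<and>
      (\<forall>b. good n m A b p (reals s ''x'') (reals s ''gap'' 0) \<longrightarrow> good n m A b p (reals t ''x'') (reals t ''gap'' 0) \<and>
         reals t ''gap'' 0 \<le> reals s ''gap'' 0 - rate p * reals s ''gap'' 0)"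

text \<open>Both outcomes of the inner loop guarantee the same shrinkage of the gap: a failure
  halves it, which suffices as rate p \<le> 1 / 2, and a completed step lowers it by
  \<open>good_descend\<close>.\<close>

lemma exec_OBody:
  "\<exists>C\<ge>0. \<forall>n m N A p T s. opre n m N A p T s \<and> 2 < p \<and> 0 < reals s ''gap'' 0 \<longrightarrow>
    exec OBody s (C * inner_const p * T * mtime N) (\<lambda>t. step_post n m A p s t)"
proof -
  from exec_ILoop obtain C where C_spec: "0 \<le> C \<and> (\<forall>n m N A p \<nu> T x s. loop_pre n m N A p \<nu> T x s \<longrightarrow>
    exec ILoop s (C * inner_const p * T * mtime N) (\<lambda>t. loop_post n m A p \<nu> T x s t))" by (rule exE)
  note C = conjunct1[OF C_spec] and loop = conjunct2[OF C_spec, rule_format]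
  define K where "K = real (2 + rcost enu) + update_cost"
  have K0: "0 \<le> update_cost" by (simp add: update_cost_def vsum_cost_nonneg vmap_cost_nonneg)
  have K1: "0 \<le> prelude_cost" by (simp add: prelude_cost_def vmap_cost_nonneg)
  show ?thesis
  proof (intro exI[of _ "prelude_cost + (C + (10 + K))"] conjI allI impI)
    show "0 \<le> prelude_cost + (C + (10 + K))" using C K0 K1 by (simp add: K_def)
    fix n m N A p T and s :: state
    assume asm: "opre n m N A p T s \<and> 2 < p \<and> 0 < reals s ''gap'' 0"
    then have pre: "opre n m N A p T s" and p: "2 < p" and U: "0 < reals s ''gap'' 0" by auto
    define U0 where "U0 = reals s ''gap'' 0"
    let ?P = "mtime N" and ?x = "reals s ''x''"
    let ?b = "NLess (NConst 0) (nv ''fl'') :: rop bexp"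
    have N: "1 \<le> N" "1 \<le> m" and T: "1 \<le> T" "real m powr width_exp p \<le> real T" using pre by (auto simp: opre_def dat_def)
    have wr: "width_reduction p (U0 / 2) m T" using p U T N by unfold_locales (auto simp: U0_def)
    let ?Q = "\<lambda>t. same inner_nats outer_reals s t \<and>
      (\<forall>b. good n m A b p ?x U0 \<longrightarrow> good n m A b p (reals t ''x'') (reals t ''gap'' 0) \<and>
         reals t ''gap'' 0 \<le> U0 - rate p * U0)"
    have "exec OBody s (prelude_cost * ?P + (C * inner_const p * T * ?P + (bcost ?b + K * ?P))) ?Q"
      unfolding OBody_def
    proof (rule exec_Seq[OF exec_Prelude[OF pre p refl U]], fold U0_def)
      fix s1 assume p1: "same inner_nats outer_reals s s1 \<and> reals s1 ''gap'' 0 = U0 \<and> ipre n m N A p (U0 / 2) T ?x s1 \<and>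
        (\<forall>i<m. reals s1 ''w'' i = start p m) \<and> (\<forall>i<m. reals s1 ''ac'' i = 0) \<and> nats s1 ''cnt'' 0 = 0 \<and> nats s1 ''fl'' 0 = 0"
      note st1 = conjunct1[OF p1]
      have g1: "reals s1 ''gap'' 0 = U0" and pre1: "ipre n m N A p (U0 / 2) T ?x s1"
        using p1 by (blast, blast)
      have ex: "exec ILoop s1 (C * inner_const p * T * ?P) (\<lambda>t. same inner_nats inner_reals s1 t \<and>
        (if nats t ''fl'' 0 = 0 then \<exists>e. found n m A p (U0 / 2) T ?x T e t else \<not> improvable n m A p ?x (U0 / 2)))" (is "exec _ _ _ ?Poste")
        by (rule loop) (use p1 T in blast)
      show "exec (Seq ILoop (If ?b (rset ''gap'' enu) Update)) s1 (C * inner_const p * T * ?P + (bcost ?b + K * ?P)) ?Q"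
      proof (rule exec_Seq[OF ex])
        fix s2 assume p2: "?Poste s2"
        note st2 = conjunct1[OF p2]
        have st: "same inner_nats outer_reals s s2" by (rule same_trans[OF st1 st2]) auto
        have g2: "reals s2 ''gap'' 0 = U0" using g1 by (simp add: same_reals[OF st2])
        have x2: "reals s2 ''x'' = ?x" using pre1 by (simp add: ipre_def same_reals[OF st2])
        have pre2: "opre n m N A p T s2" by (rule opre_same[OF pre st]) simp_all
        show "exec (If ?b (rset ''gap'' enu) Update) s2 (bcost ?b + K * ?P) ?Q"
        proof (rule exec_If)
          assume "bval ?b s2"
          then have ni: "\<not> improvable n m A p ?x (U0 / 2)" using p2 by (auto split: if_splits)
          have "exec (rset ''gap'' enu) s2 (real (2 + rcost enu) * ?P)
            (\<lambda>t. same {} {''gap''} s2 t \<and> reals t ''gap'' 0 = U0 / 2)"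
            by (rule exec_RSet0[OF N(1)]) (simp add: enu_def g2)
          then show "exec (rset ''gap'' enu) s2 (K * ?P) ?Q"
          proof (rule exec_mono)
            show "real (2 + rcost enu) * ?P \<le> K * ?P" using K0 by (intro mult_right_mono) (auto simp: K_def)
            fix t assume t: "same {} {''gap''} s2 t \<and> reals t ''gap'' 0 = U0 / 2"
            have st3: "same inner_nats outer_reals s t" by (rule same_trans[OF st conjunct1[OF t]]) auto
            have x3: "reals t ''x'' = ?x" using x2 by (simp add: same_reals[OF conjunct1[OF t]])
            have "rate p * U0 \<le> 1 / 2 * U0" using rate_le[OF p] U by (intro mult_right_mono) (auto simp: U0_def)
            then show "?Q t" using st3 good_shrink[OF _ ni] by (simp add: x3 conjunct2[OF t])
          qed
        next
          assume "\<not> bval ?b s2"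
          then obtain e where f: "found n m A p (U0 / 2) T ?x T e s2" using p2 by (auto split: if_splits)
          show "exec Update s2 (K * ?P) ?Q"
          proof (rule exec_mono[OF exec_Update[OF pre2 g2]])
            show "update_cost * ?P \<le> K * ?P" by (intro mult_right_mono) (auto simp: K_def)
            fix t assume t: "same inner_nats outer_reals s2 t \<and>
              (\<forall>i<m. reals t ''x'' i = reals s2 ''x'' i + step_size p (psum p m (reals s2 ''w'')) * reals s2 ''ac'' i) \<and>
              reals t ''gap'' 0 = U0 - psum p m (reals s2 ''x'') + psum p m (reals t ''x'')"
            have st3: "same inner_nats outer_reals s t" by (rule same_trans[OF st conjunct1[OF t]]) auto
            have x': "\<And>i. i < m \<Longrightarrow> reals t ''x'' i = ?x i + step_size p (psum p m (reals s2 ''w'')) * reals s2 ''ac'' i"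
              and g': "reals t ''gap'' 0 = U0 - psum p m ?x + psum p m (reals t ''x'')" using t x2 by simp_all
            note gd = good_descend[OF wr f _ x']
            show "?Q t" unfolding g' using st3 gd by blast
          qed
        qed
      qed
    qed
    then show "exec OBody s ((prelude_cost + (C + (10 + K))) * inner_const p * T * ?P) (\<lambda>t. step_post n m A p s t)"
      unfolding U0_def
    proof (rule exec_mono)
      have i1: "1 \<le> inner_const p" using theta_pos[OF p] by (simp add: inner_const_def energy_max_def)
      have P1: "1 \<le> ?P" using powr_ge_1[OF N(1)] .
      have "1 * 1 \<le> inner_const p * real T" using i1 T by (intro mult_mono) auto
      then have iT: "1 * ?P \<le> inner_const p * real T * ?P" by (intro mult_right_mono) auto
      define X where "X = inner_const p * real T * ?P"
      have eq: "C * inner_const p * T * ?P = C * X"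
        "(prelude_cost + (C + (10 + K))) * inner_const p * T * ?P = (prelude_cost + (C + (10 + K))) * X"
        by (simp_all only: X_def mult.assoc)
      have "prelude_cost * ?P \<le> prelude_cost * X" "K * ?P \<le> K * X"
        using iT K1 K0 by (auto simp: X_def K_def intro!: mult_left_mono)
      moreover have "real (bcost ?b) \<le> 10" by simp
      moreover have "1 \<le> X" using iT P1 unfolding X_def by linarith
      ultimately show "prelude_cost * ?P + (C * inner_const p * T * ?P + (bcost ?b + K * ?P))
          \<le> (prelude_cost + (C + (10 + K))) * inner_const p * T * ?P"
        unfolding eq unfolding distrib_right by linarith
    qed
  qed
qed

end

text \<open>Pythagoras: \<open>x\<close> is a combination of rows of \<open>A\<close> and hence
  orthogonal to the difference of any two solutions.\<close>

lemma min_norm: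
  fixes A :: "nat \<Rightarrow> nat \<Rightarrow> real"
  assumes x: "\<And>l. l < m \<Longrightarrow> x l = (\<Sum>j<n. A j l * h j)" and sol: "x \<in> sol n m A b" "y \<in> sol n m A b"
  shows "(\<Sum>l<m. (x l)\<^sup>2) \<le> (\<Sum>l<m. (y l)\<^sup>2)"
proof -
  have "(\<Sum>l<m. x l * (y l - x l)) = (\<Sum>l<m. \<Sum>j<n. h j * (A j l * (y l - x l)))"
    by (intro sum.cong) (auto simp: x sum_distrib_right sum_distrib_left mult_ac)
  also have "\<dots> = (\<Sum>j<n. \<Sum>l<m. h j * (A j l * (y l - x l)))" by (rule sum.swap)
  also have "\<dots> = (\<Sum>j<n. h j * ((\<Sum>l<m. A j l * y l) - (\<Sum>l<m. A j l * x l)))"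
    by (simp add: sum_distrib_left right_diff_distrib sum_subtractf)
  also have "\<dots> = 0" using sol by (simp add: sol_def)
  finally have 0: "(\<Sum>l<m. x l * (y l - x l)) = 0" .
  have "(\<Sum>l<m. (x l)\<^sup>2) + 2 * (\<Sum>l<m. x l * (y l - x l)) \<le> (\<Sum>l<m. (y l)\<^sup>2)"
    unfolding sum_distrib_left sum.distrib[symmetric]
  proof (rule sum_mono)
    fix l
    have "0 \<le> (y l - x l)\<^sup>2" by simp
    then show "(x l)\<^sup>2 + 2 * (x l * (y l - x l)) \<le> (y l)\<^sup>2" by (simp add: power2_eq_square algebra_simps)
  qed
  then show ?thesis using 0 by simp
qed

section \<open>Initialization and the solver for a fixed exponent\<close>

lemma width_exp_bounds: "2 \<le> p \<Longrightarrow> 0 \<le> width_exp p" "2 \<le> p \<Longrightarrow> width_exp p \<le> 1"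
  by (auto simp: width_exp_def)

definition ecc :: "rop rexp" where
  "ecc = rpow (ROfNat (nv ''m'')) (rdiv (rsub (num 2) (rv ''pp'')) (num 2))"

text \<open>The value at the least-norm solution times m powr ((2 - p) / 2) is a lower bound for the
  optimum, by \<open>psum_lsq_le\<close>; what remains of the value is the first certified gap. For
  p = 2 it is zero.\<close>

definition einit :: "rop rexp" where "einit = rsub (rv ''fx'') (rmul (rv ''cc'') (rv ''fx''))"

text \<open>The accuracy times the same lower bound: a gap below this computable threshold is at
  most the accuracy times the unknown optimum.\<close>

definition eth :: "rop rexp" where "eth = rmul (rmul (rv ''ee'') (rv ''cc'')) (rv ''fx'')"

definition erho :: "rop rexp" where
  "erho = rpow (rdiv (rmul (num 12) (rpow (num 2) (rv ''pp''))) (rsub (num 1) (rpow (num 2) (rsub (num 2) (rv ''pp''))))) (rdiv (num 1) (num 2))"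

definition ewidth :: "rop rexp" where
  "ewidth = rpow (ROfNat (nv ''m'')) (rdiv (rsub (rv ''pp'') (num 2)) (rsub (rmul (num 3) (rv ''pp'')) (num 2)))"

text \<open>Reals cannot be rounded to naturals, so \<open>T\<close> is found by counting up to m
  powr width_exp p. Since width_exp p \<le> 1, this takes at most linear time in
  \<open>m\<close>.\<close>

definition Horizon :: "rop com" where
  "Horizon = Seq (nset ''T'' (NConst 1))
     (While (RLess (ROfNat (nv ''T'')) ewidth) (nset ''T'' (NAdd (nv ''T'') (NConst 1))))"

abbreviation "solve_nats \<equiv> inner_nats \<union> {''T''}"
abbreviation "solve_reals \<equiv> outer_reals \<union> {''cc'', ''th'', ''rho''}"

context multiplier begin

lemma exec_Horizon:
  assumes m: "nats s ''m'' 0 = m" "1 \<le> m" "m \<le> N" and p: "reals s ''pp'' 0 = p" "2 \<le> p"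
  shows "exec Horizon s (200 * mtime N) (\<lambda>t. same {''T''} {} s t \<and> 1 \<le> nats t ''T'' 0 \<and>
    real m powr width_exp p \<le> real (nats t ''T'' 0) \<and> real (nats t ''T'' 0) \<le> 2 * real m powr width_exp p)"
proof -
  let ?M = "real m powr width_exp p" and ?P = "mtime N"
  let ?b = "RLess (ROfNat (nv ''T'')) ewidth"
  define I where "I \<mu> t \<longleftrightarrow> same {''T''} {} s t \<and> 1 \<le> nats t ''T'' 0 \<and> real (nats t ''T'' 0) \<le> ?M + 1 \<and>
    \<mu> = ?M + 1 - real (nats t ''T'' 0)" for \<mu> t
  have M1: "1 \<le> ?M" using m width_exp_bounds(1)[OF p(2)] by (intro ge_one_powr_ge_zero) auto
  have "real N powr 1 \<le> ?P" using m \<tau> by (intro powr_mono) auto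
  then have NP: "real N \<le> ?P" using m by simp
  have "?M \<le> real m powr 1" using m width_exp_bounds(2)[OF p(2)] by (intro powr_mono) auto
  then have MN: "?M \<le> ?P" using NP m by simp
  have width: "rval ewidth t = ?M" if "same {''T''} {} s t" for t
    using m p by (simp add: ewidth_def width_exp_def same_eqs[OF that])
  have "exec Horizon s (3 + ((6 + real (bcost ?b)) * (?M + 1))) (\<lambda>t. (\<exists>\<mu>. I \<mu> t) \<and> \<not> bval ?b t)"
    unfolding Horizon_def
  proof (rule exec_Seq)
    show "exec (nset ''T'' (NConst 1)) s 3 (\<lambda>t. I ?M t)"
      by (rule exec_NSet) (use M1 in \<open>auto simp: I_def same_def\<close>)
    fix t assume "I ?M t"
    then show "exec (While ?b (nset ''T'' (NAdd (nv ''T'') (NConst 1)))) t ((6 + real (bcost ?b)) * (?M + 1))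
        (\<lambda>t. (\<exists>\<mu>. I \<mu> t) \<and> \<not> bval ?b t)"
    proof (rule exec_While[rotated 3])
      fix t \<mu> assume I: "I \<mu> t" and b: "bval ?b t"
      have st: "same {''T''} {} s t" and T: "1 \<le> nats t ''T'' 0" "\<mu> = ?M + 1 - real (nats t ''T'' 0)" using I by (simp_all add: I_def)
      have lt: "real (nats t ''T'' 0) < ?M" using b width[OF st] by simp
      show "exec (nset ''T'' (NAdd (nv ''T'') (NConst 1))) t 6 (\<lambda>t. \<exists>\<mu>'\<le>\<mu> - 1. I \<mu>' t)"
        by (rule exec_NSet) (use st T lt in \<open>auto simp: I_def same_def\<close>)
    qed (auto simp: I_def)
  qed
  then show ?thesis
  proof (rule exec_mono)
    have "real (bcost ?b) \<le> 50" by (simp add: ewidth_def)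
    then have "(6 + real (bcost ?b)) * (?M + 1) \<le> 56 * (2 * ?P)" using M1 MN by (intro mult_mono) auto
    then show "3 + ((6 + real (bcost ?b)) * (?M + 1)) \<le> 200 * ?P" using M1 MN by linarith
    fix t assume "(\<exists>\<mu>. I \<mu> t) \<and> \<not> bval ?b t"
    then obtain \<mu> where I: "I \<mu> t" and b: "\<not> bval ?b t" by blast
    have st: "same {''T''} {} s t" using I by (simp add: I_def)
    then show "same {''T''} {} s t \<and> 1 \<le> nats t ''T'' 0 \<and>
      ?M \<le> real (nats t ''T'' 0) \<and> real (nats t ''T'' 0) \<le> 2 * ?M"
      using I b width[OF st] M1 by (auto simp: I_def)
  qed
qed

text \<open>With all weights equal to 1 the result is A^T H b, a combination of rows of
  \<open>A\<close>. It solves the system as soon as the system is solvable, and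
  \<open>min_norm\<close> applies.\<close>

definition LeastNorm :: "rop com" where
  "LeastNorm = Seq (VecMap ''W'' (nv ''m'') (num 1)) (Seq GramInv (Seq (Back ''b'') (VecMap ''x'' (nv ''m'') (ri ''ty''))))"

abbreviation "solvable n m N A b s \<equiv> dat n m N A s \<and> (\<forall>i<n. reals s ''b'' i = b i) \<and> sol n m A b \<noteq> {}"

abbreviation "least_post n m A b s t \<equiv> same inner_nats outer_reals s t \<and> reals t ''x'' \<in> sol n m A b \<and>
      (\<forall>y\<in>sol n m A b. (\<Sum>l<m. (reals t ''x'' l)\<^sup>2) \<le> (\<Sum>l<m. (y l)\<^sup>2))"

lemma exec_LeastNorm:
  "\<exists>C\<ge>0. \<forall>n m N A b s. solvable n m N A b s \<longrightarrow>
    exec LeastNorm s (C * mtime N) (\<lambda>t. least_post n m A b s t)"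
proof -
  from exec_GramInv obtain C where C_spec: "0 \<le> C \<and> (\<forall>n m N A s. dat n m N A s \<and> (\<forall>k<m. 0 < reals s ''W'' k) \<longrightarrow>
    exec GramInv s (C * mtime N) (\<lambda>t. gram_post n m N A s t))" by (rule exE)
  note C = conjunct1[OF C_spec] and gram = conjunct2[OF C_spec, rule_format]
  let ?vm = "vmap_cost (nv ''m'') (num 1)" and ?vx = "vmap_cost (nv ''m'') (ri ''ty'')"
  show ?thesis
  proof (intro exI[of _ "?vm + (C + (back_cost ''b'' + ?vx))"] conjI allI impI)
    show "0 \<le> ?vm + (C + (back_cost ''b'' + ?vx))" using C by (simp add: back_cost_def vmap_cost_nonneg vsum_cost_nonneg)
    fix n m N A b and s :: state
    assume asm: "solvable n m N A b s"
    then have d: "dat n m N A s" and b: "\<And>i. i < n \<Longrightarrow> reals s ''b'' i = b i" by auto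
    from asm obtain z where "z \<in> sol n m A b" by blast
    then have z: "\<And>i. i < n \<Longrightarrow> b i = (\<Sum>l<m. A i l * z l)" by (simp add: sol_def)
    have nm: "nats s ''m'' 0 = m" "m \<le> N" "1 \<le> N" "n \<le> N" using d by (auto simp: dat_def)
    let ?P = "mtime N"
    let ?Q = "\<lambda>t. least_post n m A b s t"
    show "exec LeastNorm s ((?vm + (C + (back_cost ''b'' + ?vx))) * ?P) ?Q"
      unfolding LeastNorm_def distrib_right
    proof (rule exec_Seq)
      show "exec (VecMap ''W'' (nv ''m'') (num 1)) s (?vm * ?P) (\<lambda>t. same ijk {''W''} s t \<and> (\<forall>i<m. reals t ''W'' i = 1))"
        by (rule exec_VecMap) (use nm in \<open>simp_all add: same_nats\<close>)
      fix s1 assume p1: "same ijk {''W''} s s1 \<and> (\<forall>i<m. reals s1 ''W'' i = 1)"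
      note st1 = conjunct1[OF p1]
      have d1: "dat n m N A s1" by (rule dat_same[OF d st1]) simp_all
      have W1: "\<forall>k<m. 0 < reals s1 ''W'' k" using conjunct2[OF p1] by simp
      show "exec (Seq GramInv (Seq (Back ''b'') (VecMap ''x'' (nv ''m'') (ri ''ty'')))) s1 (C * ?P + (back_cost ''b'' * ?P + ?vx * ?P)) ?Q"
      proof (rule exec_Seq[OF gram[OF conjI[OF d1 W1]]])
        fix s2 assume p2: "gram_post n m N A s1 s2"
        note st2 = conjunct1[OF p2]
        have d2: "dat n m N A s2" by (rule dat_same[OF d1 st2]) simp_all
        have b2: "reals s2 ''b'' = reals s ''b''" by (simp add: same_reals[OF st2] same_reals[OF st1])
        show "exec (Seq (Back ''b'') (VecMap ''x'' (nv ''m'') (ri ''ty''))) s2 (back_cost ''b'' * ?P + ?vx * ?P) ?Q"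
        proof (rule exec_Seq[OF exec_Back[OF d2]])
          fix s3 assume p3: "same ijk {''y'', ''ty''} s2 s3 \<and>
            (\<forall>l<m. reals s3 ''ty'' l = (\<Sum>j<n. A j l * (\<Sum>k<n. gat s2 N j k * reals s2 ''b'' k)))"
          note st3 = conjunct1[OF p3]
          have nm3: "nats s3 ''m'' 0 = m" using nm by (simp add: same_nats[OF st3] same_nats[OF st2] same_nats[OF st1])
          have "exec (VecMap ''x'' (nv ''m'') (ri ''ty'')) s3 (?vx * ?P)
            (\<lambda>t. same ijk {''x''} s3 t \<and> (\<forall>i<m. reals t ''x'' i = reals s3 ''ty'' i))" (is "exec _ _ _ ?Posta")
            by (rule exec_VecMap) (use nm nm3 in \<open>simp_all add: same_nats same_reals\<close>)
          then show "exec (VecMap ''x'' (nv ''m'') (ri ''ty'')) s3 (?vx * ?P) ?Q"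
          proof (rule exec_mono[OF _ order_refl])
            fix t assume t: "?Posta t"
            define h where "h j = (\<Sum>k<n. gat s2 N j k * b k)" for j
            have x: "reals t ''x'' l = (\<Sum>j<n. A j l * h j)" if "l < m" for l
              using conjunct2[OF t] conjunct2[OF p3] that b by (simp add: h_def b2)
            have "(\<Sum>l<m. A i l * (reals s1 ''W'' l * (\<Sum>j<n. A j l * h j))) = b i" if i: "i < n" for i
              by (rule lsq_consistent[where N = N and H = "gat s2 N" and z = z])
                (use p2 nm W1 i z in \<open>auto simp: scaled_rows_def h_def\<close>)
            then have sol: "reals t ''x'' \<in> sol n m A b" using conjunct2[OF p1] by (simp add: sol_def x)
            have "same inner_nats outer_reals s s2" by (rule same_trans[OF st1 st2]) auto
            then have "same inner_nats outer_reals s s3" by (rule same_trans[OF _ st3]) auto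
            then have "same inner_nats outer_reals s t" by (rule same_trans[OF _ conjunct1[OF t]]) auto
            then show "?Q t" using sol min_norm[OF x sol] by blast
          qed
        qed simp
      qed
    qed
  qed
qed

definition Init :: "rop com" where
  "Init = Seq LeastNorm (Seq (VecSum ''fx'' (NConst 1) (nv ''m'') efx) (Seq (rset ''cc'' ecc) (Seq (rset ''gap'' einit)
     (Seq (rset ''th'' eth) (Seq (rset ''rho'' erho) Horizon)))))"

abbreviation "init_post n m N A b p \<epsilon> s t \<equiv> same solve_nats solve_reals s t \<and>
      (\<exists>T. opre n m N A p T t \<and> real T \<le> 2 * real m powr width_exp p) \<and> reals t ''x'' \<in> sol n m A b \<and>
      (let f = psum p m (reals t ''x''); c = real m powr ((2 - p) / 2)
       in reals t ''gap'' 0 = f - c * f \<and> reals t ''th'' 0 = \<epsilon> * c * f \<and> (\<forall>y\<in>sol n m A b. c * f \<le> psum p m y))"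

abbreviation "approx n m A b p \<epsilon> t \<equiv> reals t ''x'' \<in> sol n m A b \<and> (\<forall>y\<in>sol n m A b. psum p m (reals t ''x'') \<le> (1 + \<epsilon>) * psum p m y)"

lemma exec_Init:
  "\<exists>C\<ge>0. \<forall>n m N A b p \<epsilon> s. solvable n m N A b s \<and>
      reals s ''pp'' 0 = p \<and> reals s ''ee'' 0 = \<epsilon> \<and> 2 \<le> p \<longrightarrow>
    exec Init s (C * mtime N) (\<lambda>t. init_post n m N A b p \<epsilon> s t)"
proof -
  from exec_LeastNorm obtain C where C_spec: "0 \<le> C \<and> (\<forall>n m N A b s. solvable n m N A b s \<longrightarrow>
    exec LeastNorm s (C * mtime N) (\<lambda>t. least_post n m A b s t))" by (rule exE)
  note C = conjunct1[OF C_spec] and least = conjunct2[OF C_spec, rule_format]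
  let ?vf = "vsum_cost (NConst 1) (nv ''m'') efx"
  let ?r = "\<lambda>e. real (2 + rcost e)"
  show ?thesis
  proof (intro exI[of _ "C + (?vf + (?r ecc + (?r einit + (?r eth + (?r erho + 200)))))"] conjI allI impI)
    show "0 \<le> C + (?vf + (?r ecc + (?r einit + (?r eth + (?r erho + 200)))))" using C by (simp add: vsum_cost_nonneg)
    fix n m N A b p \<epsilon> and s :: state
    assume asm: "solvable n m N A b s \<and>
      reals s ''pp'' 0 = p \<and> reals s ''ee'' 0 = \<epsilon> \<and> 2 \<le> p"
    then have d: "dat n m N A s" and pp: "reals s ''pp'' 0 = p" and ee: "reals s ''ee'' 0 = \<epsilon>" and p: "2 \<le> p" by auto
    have asm': "solvable n m N A b s" using asm by blast
    have nm: "nats s ''m'' 0 = m" "m \<le> N" "1 \<le> N" "1 \<le> m" using d by (auto simp: dat_def)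
    let ?P = "mtime N"
    let ?c = "real m powr ((2 - p) / 2)"
    let ?Q = "\<lambda>t. same solve_nats solve_reals s t \<and>
      (\<exists>T. opre n m N A p T t \<and> real T \<le> 2 * real m powr width_exp p) \<and> reals t ''x'' \<in> sol n m A b \<and>
      (let f = psum p m (reals t ''x''); c = ?c
       in reals t ''gap'' 0 = f - c * f \<and> reals t ''th'' 0 = \<epsilon> * c * f \<and> (\<forall>y\<in>sol n m A b. c * f \<le> psum p m y))"
    let ?ce = "?r erho * ?P + 200 * ?P"
    let ?cd = "?r eth * ?P + ?ce"
    let ?cc = "?r einit * ?P + ?cd"
    let ?cb = "?r ecc * ?P + ?cc"
    let ?ca = "?vf * ?P + ?cb"
    let ?pe = "Seq (rset ''rho'' erho) Horizon"
    let ?pd = "Seq (rset ''th'' eth) ?pe"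
    let ?pc = "Seq (rset ''gap'' einit) ?pd"
    let ?pb = "Seq (rset ''cc'' ecc) ?pc"
    let ?pa = "Seq (VecSum ''fx'' (NConst 1) (nv ''m'') efx) ?pb"
    show "exec Init s ((C + (?vf + (?r ecc + (?r einit + (?r eth + (?r erho + 200)))))) * ?P) ?Q"
      unfolding Init_def distrib_right
    proof (rule exec_Seq[OF least[OF asm']])
      fix s1 assume p1: "least_post n m A b s s1"
      note st1 = conjunct1[OF p1]
      define x where "x = reals s1 ''x''"
      have x: "x \<in> sol n m A b" "\<And>y. y \<in> sol n m A b \<Longrightarrow> (\<Sum>l<m. (x l)\<^sup>2) \<le> (\<Sum>l<m. (y l)\<^sup>2)" using p1 by (auto simp: x_def)
      define f where "f = psum p m x"
      have nm1: "nats s1 ''m'' 0 = m" using nm by (simp add: same_nats[OF st1])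
      have pp1: "reals s1 ''pp'' 0 = p" using pp by (simp add: same_reals[OF st1])
      show "exec ?pa s1 ?ca ?Q"
      proof (rule exec_Seq)
        show "exec (VecSum ''fx'' (NConst 1) (nv ''m'') efx) s1 (?vf * ?P)
          (\<lambda>t. same ijk {''fx''} s1 t \<and> (\<forall>i<1. reals t ''fx'' i = (\<Sum>k<m. \<bar>x k\<bar> powr p)))" (is "exec _ _ _ ?Postb")
        proof (rule exec_VecSum)
          fix s' i k assume *: "same ijk {''fx''} s1 s'" "nats s' ''k'' 0 = k"
          show "rval efx s' = \<bar>x k\<bar> powr p" using pp1 by (simp add: efx_def *(2) same_reals[OF *(1)] x_def)
        qed (use nm nm1 in \<open>simp_all add: same_nats\<close>)
        fix s2 assume p2: "?Postb s2"
        have st2: "same inner_nats solve_reals s s2" by (rule same_trans[OF st1 conjunct1[OF p2]]) auto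
        have f2: "reals s2 ''fx'' 0 = f" using conjunct2[OF p2] by (simp add: f_def psum_def)
        have x2: "reals s2 ''x'' = x" by (simp add: same_reals[OF conjunct1[OF p2]] x_def)
        show "exec ?pb s2 ?cb ?Q"
        proof (rule exec_Seq[OF exec_RSet0[OF nm(3)]])
          show "rval ecc s2 = ?c" using nm pp by (simp add: ecc_def same_eqs[OF st2])
          fix s3 assume p3: "same {} {''cc''} s2 s3 \<and> reals s3 ''cc'' 0 = ?c"
          have st3: "same inner_nats solve_reals s s3" by (rule same_trans[OF st2 conjunct1[OF p3]]) auto
          have f3: "reals s3 ''fx'' 0 = f" "reals s3 ''x'' = x" using f2 x2 by (simp_all add: same_reals[OF conjunct1[OF p3]])
          show "exec ?pc s3 ?cc ?Q"
          proof (rule exec_Seq[OF exec_RSet0[OF nm(3)]])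
            show "rval einit s3 = f - ?c * f" by (simp add: einit_def f3 conjunct2[OF p3])
            fix s4 assume p4: "same {} {''gap''} s3 s4 \<and> reals s4 ''gap'' 0 = f - ?c * f"
            have st4: "same inner_nats solve_reals s s4" by (rule same_trans[OF st3 conjunct1[OF p4]]) auto
            have f4: "reals s4 ''fx'' 0 = f" "reals s4 ''x'' = x" "reals s4 ''cc'' 0 = ?c"
              using f3 conjunct2[OF p3] by (simp_all add: same_reals[OF conjunct1[OF p4]])
            show "exec ?pd s4 ?cd ?Q"
            proof (rule exec_Seq[OF exec_RSet0[OF nm(3)]])
              show "rval eth s4 = \<epsilon> * ?c * f" using ee by (simp add: eth_def f4 same_reals[OF st4])
              fix s5 assume p5: "same {} {''th''} s4 s5 \<and> reals s5 ''th'' 0 = \<epsilon> * ?c * f"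
              have st5: "same inner_nats solve_reals s s5" by (rule same_trans[OF st4 conjunct1[OF p5]]) auto
              show "exec ?pe s5 ?ce ?Q"
              proof (rule exec_Seq[OF exec_RSet0[OF nm(3)]])
                show "rval erho s5 = rho p"
                proof -
                  \<comment> \<open>The power operation of the machine takes the absolute value of
                    its base, so the base has to be nonnegative. This includes p = 2, where the
                    denominator is 0.\<close>
                  have "0 \<le> 1 - 2 powr (2 - p)" using powr_mono[of "2 - p" 0 2] p by simp
                  then show ?thesis using pp by (simp add: erho_def rho_def same_reals[OF st5])
                qed
                fix s6 assume p6: "same {} {''rho''} s5 s6 \<and> reals s6 ''rho'' 0 = rho p"
                have st6: "same inner_nats solve_reals s s6" by (rule same_trans[OF st5 conjunct1[OF p6]]) auto
                have nm6: "nats s6 ''m'' 0 = m" using nm by (simp add: same_nats[OF st6])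
                have pp6: "reals s6 ''pp'' 0 = p" using pp by (simp add: same_reals[OF st6])
                have v6: "reals s6 ''x'' = x" "reals s6 ''gap'' 0 = f - ?c * f" "reals s6 ''th'' 0 = \<epsilon> * ?c * f"
                  using f4 conjunct2[OF p4] conjunct2[OF p5]
                  by (simp_all add: same_reals[OF conjunct1[OF p5]] same_reals[OF conjunct1[OF p6]])
                show "exec Horizon s6 (200 * ?P) ?Q"
                proof (rule exec_mono[OF exec_Horizon[OF nm6 nm(4,2) pp6 p] order_refl])
                  fix t assume p7: "same {''T''} {} s6 t \<and> 1 \<le> nats t ''T'' 0 \<and>
                    real m powr width_exp p \<le> real (nats t ''T'' 0) \<and> real (nats t ''T'' 0) \<le> 2 * real m powr width_exp p"
                  note st7 = conjunct1[OF p7]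
                  have st: "same solve_nats solve_reals s t" by (rule same_trans[OF st6 st7]) auto
                  have dt: "dat n m N A t" by (rule dat_same[OF d st]) simp_all
                  have r: "reals t = reals s6" using st7 by (auto simp: same_def)
                  have "opre n m N A p (nats t ''T'' 0) t" using dt p7 pp6 conjunct2[OF p6] by (simp add: opre_def r)
                  moreover have "?c * f \<le> psum p m y" if y: "y \<in> sol n m A b" for y
                  proof -
                    have "?c * f \<le> ?c * (real m powr ((p - 2) / 2) * psum p m y)"
                      unfolding f_def by (intro mult_left_mono psum_lsq_le p nm x y) simp
                    also have "\<dots> = (real m powr ((2 - p) / 2 + (p - 2) / 2)) * psum p m y"
                      by (simp add: powr_add)
                    also have "(2 - p) / 2 + (p - 2) / 2 = 0" by (simp add: add_divide_distrib[symmetric])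
                    finally show ?thesis using nm by simp
                  qed
                  ultimately show "?Q t" using st x p7 unfolding Let_def r v6 f_def[symmetric] by blast
                qed
              qed
            qed
          qed
        qed
      qed
    qed
  qed
qed

definition Solve :: "rop com" where
  "Solve = Seq Init (While (RLess (rv ''th'') (rv ''gap'')) OBody)"

text \<open>The logarithmic term counts outer rounds and is switched off for p = 2, where the
  least-norm solution is already optimal. The constant absorbs \<open>rate\<close> and
  \<open>inner_const\<close>, which depend on \<open>p\<close> alone.\<close>

lemma exec_Solve:
  assumes p: "2 \<le> p"
  shows "\<exists>C\<ge>0. \<forall>n m N A b \<epsilon> s. solvable n m N A b s \<and>
      reals s ''pp'' 0 = p \<and> reals s ''ee'' 0 = \<epsilon> \<and> 0 < \<epsilon> \<longrightarrow>
    exec Solve s (C * (real m powr width_exp p * (1 + of_bool (2 < p) * (ln m + \<bar>ln \<epsilon>\<bar>))) * mtime N)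
      (\<lambda>t. approx n m A b p \<epsilon> t)"
proof -
  from exec_Init obtain C where C_spec: "0 \<le> C \<and> (\<forall>n m N A b p \<epsilon> s. solvable n m N A b s \<and>
      reals s ''pp'' 0 = p \<and> reals s ''ee'' 0 = \<epsilon> \<and> 2 \<le> p \<longrightarrow>
    exec Init s (C * mtime N) (\<lambda>t. init_post n m N A b p \<epsilon> s t))" by (rule exE)
  note C = conjunct1[OF C_spec] and init = conjunct2[OF C_spec, rule_format]
  from exec_OBody obtain D where D_spec: "0 \<le> D \<and> (\<forall>n m N A p T s. opre n m N A p T s \<and> 2 < p \<and> 0 < reals s ''gap'' 0 \<longrightarrow>
    exec OBody s (D * inner_const p * T * mtime N) (\<lambda>t. step_post n m A p s t))" by (rule exE)
  note D = conjunct1[OF D_spec] and body = conjunct2[OF D_spec, rule_format]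
  let ?b = "RLess (rv ''th'') (rv ''gap'') :: rop bexp"
  define R where "R = 2 * D * \<bar>inner_const p\<bar> + bcost ?b"
  define K where "K = 2 + (1 + (p - 2) / 2) / \<bar>rate p\<bar>"
  have R0: "0 \<le> R" using D by (simp add: R_def)
  have K2: "2 \<le> K" using p by (simp add: K_def)
  show ?thesis
  proof (intro exI[of _ "C + R * K"] conjI allI impI)
    show "0 \<le> C + R * K" using C R0 K2 by simp
    fix n m N A b \<epsilon> and s :: state
    assume asm: "solvable n m N A b s \<and>
      reals s ''pp'' 0 = p \<and> reals s ''ee'' 0 = \<epsilon> \<and> 0 < \<epsilon>"
    have asm': "solvable n m N A b s \<and>
      reals s ''pp'' 0 = p \<and> reals s ''ee'' 0 = \<epsilon> \<and> 2 \<le> p" using asm p by blast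
    have \<epsilon>: "0 < \<epsilon>" using asm by blast
    have "dat n m N A s" using asm by blast
    then have m: "1 \<le> m" "1 \<le> N" by (auto simp: dat_def)
    let ?P = "mtime N" and ?M = "real m powr width_exp p"
    let ?L = "1 + of_bool (2 < p) * (ln m + \<bar>ln \<epsilon>\<bar>)"
    have P1: "1 \<le> ?P" using powr_ge_1[OF m(2)] .
    have M1: "1 \<le> ?M" using m width_exp_bounds(1)[OF p] by (intro ge_one_powr_ge_zero) auto
    have L1: "1 \<le> ?L" using m by simp
    let ?Q = "\<lambda>t. approx n m A b p \<epsilon> t"
    have "exec Solve s (C * ?P + R * ?M * ?P * (K * ?L)) ?Q"
      unfolding Solve_def
    proof (rule exec_Seq[OF init[OF asm']])
      fix s1 assume p1: "same solve_nats solve_reals s s1 \<and>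
        (\<exists>T. opre n m N A p T s1 \<and> real T \<le> 2 * ?M) \<and> reals s1 ''x'' \<in> sol n m A b \<and>
        (let f = psum p m (reals s1 ''x''); c = real m powr ((2 - p) / 2)
         in reals s1 ''gap'' 0 = f - c * f \<and> reals s1 ''th'' 0 = \<epsilon> * c * f \<and> (\<forall>y\<in>sol n m A b. c * f \<le> psum p m y))"
      define f where "f = psum p m (reals s1 ''x'')"
      define c where "c = real m powr ((2 - p) / 2)"
      from p1 obtain T where T: "opre n m N A p T s1" "real T \<le> 2 * ?M" by blast
      from p1 have x1: "reals s1 ''x'' \<in> sol n m A b" and gap1: "reals s1 ''gap'' 0 = f - c * f" and th1: "reals s1 ''th'' 0 = \<epsilon> * c * f"
        and low: "\<And>y. y \<in> sol n m A b \<Longrightarrow> c * f \<le> psum p m y" unfolding Let_def f_def[symmetric] c_def[symmetric] by blast+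
      have f0: "0 \<le> f" by (simp add: f_def psum_nonneg)
      have c0: "0 < c" using m by (simp add: c_def)
      define th where "th = \<epsilon> * c * f"
      \<comment> \<open>If the loop is entered at all, then f > 0 and m powr ((2 - p) / 2) differs
        from 1, hence p > 2. The threshold is then positive, as the potential requires.\<close>
      have start: "2 < p \<and> 0 < f" if "th < f - c * f"
      proof -
        have "0 \<le> th" using \<epsilon> c0 f0 by (simp add: th_def)
        then have "f \<noteq> 0" "c \<noteq> 1" using that by auto
        moreover have "p \<noteq> 2" using \<open>c \<noteq> 1\<close> m by (auto simp: c_def)
        ultimately show ?thesis using f0 p by simp
      qed
      define I where "I \<mu> t \<longleftrightarrow> opre n m N A p T t \<and> good n m A b p (reals t ''x'') (reals t ''gap'' 0) \<and> reals t ''th'' 0 = th \<and>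
        (2 < p \<and> 0 < th \<or> reals t ''gap'' 0 \<le> th) \<and> \<mu> = potential (rate p) th (reals t ''gap'' 0)" for \<mu> t
      define \<mu>0 where "\<mu>0 = potential (rate p) th (f - c * f)"
      have \<mu>0: "\<mu>0 + 1 \<le> K * ?L"
      proof (cases "th < f - c * f")
        case True
        then have p2: "2 < p" and f: "0 < f" using start by auto
        have th: "0 < th" using \<epsilon> c0 f by (simp add: th_def)
        have \<kappa>: "0 < rate p" by (rule rate_pos[OF p2])
        \<comment> \<open>The initial ratio of gap and threshold is at most 1 / (\<epsilon> * c),
          whose logarithm is -ln \<epsilon> + (p - 2) / 2 * ln m.\<close>
        have "(f - c * f) / th \<le> f / (\<epsilon> * c * f)" unfolding th_def using \<epsilon> c0 f by (intro divide_right_mono) auto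
        also have "\<dots> = 1 / (\<epsilon> * c)" using f by simp
        finally have "ln ((f - c * f) / th) \<le> ln (1 / (\<epsilon> * c))" using th True \<epsilon> c0 by (intro ln_mono) auto
        also have "\<dots> = - ln \<epsilon> - ln c" using \<epsilon> c0 by (simp add: ln_div ln_mult)
        also have "ln c = (2 - p) / 2 * ln m" using m by (simp add: c_def ln_powr)
        also have "- ln \<epsilon> - (2 - p) / 2 * ln m \<le> (1 + (p - 2) / 2) * (ln m + \<bar>ln \<epsilon>\<bar>)"
        proof -
          have "- e + q * a \<le> (1 + q) * (a + d)" if "0 \<le> a" "0 \<le> d" "0 \<le> q" "- e \<le> d" for q a d e :: real
          proof -
            have "0 \<le> q * d" using that by simp
            moreover have "(1 + q) * (a + d) = a + d + q * a + q * d" by (simp add: algebra_simps)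
            ultimately show ?thesis using that by linarith
          qed
          from this[of "ln m" "\<bar>ln \<epsilon>\<bar>" "(p - 2) / 2" "ln \<epsilon>"] show ?thesis using m p by (simp add: field_simps)
        qed
        also have "\<dots> \<le> (1 + (p - 2) / 2) * ?L" using p p2 by (intro mult_left_mono) auto
        finally have "ln ((f - c * f) / th) / rate p \<le> (1 + (p - 2) / 2) * ?L / rate p" using \<kappa> by (intro divide_right_mono) auto
        then have "\<mu>0 + 1 \<le> (1 + (p - 2) / 2) / \<bar>rate p\<bar> * ?L + 2 * 1" using True \<kappa> by (simp add: \<mu>0_def potential_def)
        also have "\<dots> \<le> K * ?L" using L1 by (simp add: K_def distrib_right)
        finally show ?thesis .
      next
        case False
        have "1 * 1 \<le> K * ?L" using K2 L1 by (intro mult_mono) auto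
        then show ?thesis using False by (simp add: \<mu>0_def potential_def)
      qed
      have "exec (While ?b OBody) s1 ((D * inner_const p * T * ?P + bcost ?b) * (\<mu>0 + 1)) (\<lambda>t. (\<exists>\<mu>. I \<mu> t) \<and> \<not> bval ?b t)"
      proof (cases "2 < p")
        case p2: True
        have i1: "1 \<le> inner_const p" using theta_pos[OF p2] by (simp add: inner_const_def energy_max_def)
        show ?thesis
        proof (rule exec_While)
          have "good n m A b p (reals s1 ''x'') (f - c * f)" using x1 low by (auto simp: good_def f_def)
          moreover have "0 < th \<or> f - c * f \<le> th" using start \<epsilon> c0 by (auto simp: th_def)
          ultimately show "I \<mu>0 s1" using T(1) p2 th1 gap1 by (auto simp: I_def \<mu>0_def th_def)
          show "0 \<le> D * inner_const p * T * ?P" using D i1 by simp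
          fix t \<mu> assume I: "I \<mu> t"
          then show "0 \<le> \<mu>" using potential_nonneg[OF rate_pos[OF p2]] by (auto simp: I_def)
          assume "bval ?b t"
          then have lt: "th < reals t ''gap'' 0" and th: "0 < th" using I by (auto simp: I_def)
          then have pre: "opre n m N A p T t \<and> 2 < p \<and> 0 < reals t ''gap'' 0" using I p2 by (auto simp: I_def)
          show "exec OBody t (D * inner_const p * T * ?P) (\<lambda>t'. \<exists>\<mu>'\<le>\<mu> - 1. I \<mu>' t')"
          proof (rule exec_mono[OF body[OF pre] order_refl])
            fix t' assume t': "step_post n m A p t t'"
            note st = conjunct1[OF t']
            have g: "good n m A b p (reals t' ''x'') (reals t' ''gap'' 0)"
              and le: "reals t' ''gap'' 0 \<le> reals t ''gap'' 0 - rate p * reals t ''gap'' 0"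
              using conjunct2[OF t'] I by (auto simp: I_def)
            have "opre n m N A p T t'" by (rule opre_same[OF conjunct1[OF pre] st]) simp_all
            moreover have "reals t' ''th'' 0 = th" using I by (simp add: I_def same_reals[OF st])
            ultimately have "I (potential (rate p) th (reals t' ''gap'' 0)) t'" using g p2 th by (simp add: I_def)
            moreover have "potential (rate p) th (reals t' ''gap'' 0) \<le> \<mu> - 1"
              using potential_step[OF rate_pos[OF p2] rate_le[OF p2] th lt le] I by (simp add: I_def)
            ultimately show "\<exists>\<mu>'\<le>\<mu> - 1. I \<mu>' t'" by blast
          qed
        qed
      next
        case p2: False
        \<comment> \<open>For p = 2 the test fails at once, so the loop costs a single test.\<close>
        have le: "f - c * f \<le> th" using start p2 by force
        have "good n m A b p (reals s1 ''x'') (f - c * f)" using x1 low by (auto simp: good_def f_def)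
        then have I: "I \<mu>0 s1" using T(1) th1 gap1 le by (auto simp: I_def \<mu>0_def th_def)
        have nb: "\<not> bval ?b s1" using le by (simp add: gap1 th1 th_def)
        have z: "\<mu>0 = 0" using le by (simp add: \<mu>0_def potential_def)
        have i0: "0 \<le> inner_const p" using p p2 by (simp add: inner_const_def energy_max_def theta_def)
        show ?thesis unfolding exec_def z
          by (intro exI[of _ "bcost ?b"] exI[of _ s1]) (use run.WhileFalse[OF nb] I nb D i0 in auto)
      qed
      then show "exec (While ?b OBody) s1 (R * ?M * ?P * (K * ?L)) ?Q"
      proof (rule exec_mono)
        have "D * inner_const p * T * ?P + bcost ?b \<le> R * ?M * ?P"
        proof -
          have "D * inner_const p * T * ?P \<le> D * \<bar>inner_const p\<bar> * (2 * ?M) * ?P"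
            using D T(2) by (intro mult_right_mono mult_mono mult_left_mono) auto
          moreover have "real (bcost ?b) * (1 * 1) \<le> real (bcost ?b) * (?M * ?P)" using M1 P1 by (intro mult_left_mono mult_mono) auto
          ultimately show ?thesis by (simp add: R_def algebra_simps)
        qed
        moreover have "0 \<le> \<mu>0 + 1"
        proof (cases "th < f - c * f")
          case True
          then have "2 < p" "0 < th" using start \<epsilon> c0 by (auto simp: th_def)
          then show ?thesis using potential_nonneg[OF rate_pos, of p th] by (simp add: \<mu>0_def)
        qed (simp add: \<mu>0_def potential_def)
        ultimately show "(D * inner_const p * T * ?P + bcost ?b) * (\<mu>0 + 1) \<le> R * ?M * ?P * (K * ?L)"
          using \<mu>0 R0 by (intro mult_mono) auto
        fix t assume "(\<exists>\<mu>. I \<mu> t) \<and> \<not> bval ?b t"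
        then obtain \<mu> where I: "I \<mu> t" and nb: "\<not> bval ?b t" by blast
        have g: "good n m A b p (reals t ''x'') (reals t ''gap'' 0)" and le: "reals t ''gap'' 0 \<le> th" using I nb by (auto simp: I_def)
        show "?Q t"
        proof (intro conjI ballI)
          show "reals t ''x'' \<in> sol n m A b" using g by (simp add: good_def)
          fix y assume y: "y \<in> sol n m A b"
          have "psum p m (reals t ''x'') - psum p m y \<le> th" using g le y by (force simp: good_def)
          also have "th \<le> \<epsilon> * psum p m y" using low[OF y] \<epsilon> by (simp add: th_def mult.assoc)
          finally show "psum p m (reals t ''x'') \<le> (1 + \<epsilon>) * psum p m y" by (simp add: distrib_right)
        qed
      qed
    qed
    then show "exec Solve s ((C + R * K) * (?M * ?L) * ?P) ?Q"
    proof (rule exec_mono)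
      have "C * ?P + R * ?M * ?P * (K * l) \<le> (C + R * K) * (?M * l) * ?P" if "1 \<le> l" for l
      proof -
        have "C * ?P * (1 * 1) \<le> C * ?P * (?M * l)" using C M1 that by (intro mult_left_mono mult_mono) auto
        then show ?thesis by (simp add: algebra_simps)
      qed
      from this[OF L1] show "C * ?P + R * ?M * ?P * (K * ?L) \<le> (C + R * K) * (?M * ?L) * ?P" .
    qed
  qed
qed

end

section \<open>The regression program\<close>

abbreviation "Doubling \<equiv> Seq (NSet ''sz'' (NAdd (nv ''L'') (NConst 1)) (NAdd (NGet ''sz'' (nv ''L'')) (NGet ''sz'' (nv ''L'')))) (nset ''L'' (NAdd (nv ''L'') (NConst 1)))"

text \<open>Naturals offer neither division nor powers, so the block sizes of all levels are
  tabulated by doubling until \<open>m\<close> is reached. The last doubling starts below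
  \<open>m\<close>, which gives N \<le> 2 * m.\<close>

definition Sizes :: "rop com" where
  "Sizes = Seq (nset ''sz'' (NConst 1)) (Seq (nset ''L'' (NConst 0))
     (Seq (While (NLess (NGet ''sz'' (nv ''L'')) (nv ''m''))
        Doubling)
       (nset ''N'' (NGet ''sz'' (nv ''L'')))))"

lemma exec_Sizes:
  assumes m: "nats s ''m'' 0 = m" "1 \<le> m"
  shows "exec Sizes s (200 * real m) (\<lambda>t. same {''sz'', ''L'', ''N''} {} s t \<and> nats t ''N'' 0 = 2 ^ nats t ''L'' 0 \<and>
    (\<forall>j\<le>nats t ''L'' 0. nats t ''sz'' j = 2 ^ j) \<and> m \<le> nats t ''N'' 0 \<and> nats t ''N'' 0 \<le> 2 * m)"
proof -
  let ?b = "NLess (NGet ''sz'' (nv ''L'')) (nv ''m'') :: rop bexp"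
  let ?X = "{''sz'', ''L'', ''N''}"
  define I where "I \<mu> t \<longleftrightarrow> same ?X {} s t \<and> (\<forall>j\<le>nats t ''L'' 0. nats t ''sz'' j = 2 ^ j) \<and>
    2 ^ nats t ''L'' 0 < 2 * m \<and> \<mu> = real (2 * m) - real (nats t ''L'' 0)" for \<mu> t
  have "exec Sizes s (3 + (3 + ((30 + real (bcost ?b)) * (real (2 * m) + 1) + 6))) (\<lambda>t. same ?X {} s t \<and> nats t ''N'' 0 = 2 ^ nats t ''L'' 0 \<and>
    (\<forall>j\<le>nats t ''L'' 0. nats t ''sz'' j = 2 ^ j) \<and> m \<le> nats t ''N'' 0 \<and> nats t ''N'' 0 \<le> 2 * m)" (is "exec _ _ _ ?Q")
    unfolding Sizes_def
  proof (rule exec_Seq)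
    show "exec (nset ''sz'' (NConst 1)) s 3 (\<lambda>t. same ?X {} s t \<and> nats t ''sz'' 0 = 1)"
      by (rule exec_NSet) (auto simp: same_def)
    fix s1 assume p1: "same ?X {} s s1 \<and> nats s1 ''sz'' 0 = 1"
    show "exec (Seq (nset ''L'' (NConst 0))
     (Seq (While ?b
        Doubling)
       (nset ''N'' (NGet ''sz'' (nv ''L''))))) s1 (3 + ((30 + real (bcost ?b)) * (real (2 * m) + 1) + 6)) ?Q"
    proof (rule exec_Seq)
      show "exec (nset ''L'' (NConst 0)) s1 3 (\<lambda>t. I (real (2 * m)) t)"
        by (rule exec_NSet) (use p1 m in \<open>auto simp: I_def same_def\<close>)
      fix s2 assume I2: "I (real (2 * m)) s2"
      show "exec (Seq (While ?b
          Doubling)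
          (nset ''N'' (NGet ''sz'' (nv ''L'')))) s2 ((30 + real (bcost ?b)) * (real (2 * m) + 1) + 6) ?Q"
      proof (rule exec_Seq)
        show "exec (While ?b
          Doubling) s2 ((30 + real (bcost ?b)) * (real (2 * m) + 1))
          (\<lambda>t. (\<exists>\<mu>. I \<mu> t) \<and> \<not> bval ?b t)"
        proof (rule exec_While)
          show "I (real (2 * m)) s2" by (rule I2)
          fix t \<mu> assume I: "I \<mu> t"
          \<comment> \<open>A crude measure suffices: the level stays below 2 * m, and a linear
            number of rounds disappears in m powr \<tau>.\<close>
          have "nats t ''L'' 0 < 2 ^ nats t ''L'' 0" by (rule less_exp)
          also have "\<dots> < 2 * m" using I by (simp add: I_def)
          finally show "0 \<le> \<mu>" using I by (simp add: I_def)
          assume b: "bval ?b t"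
          let ?l = "nats t ''L'' 0"
          have st: "same ?X {} s t" and sz: "\<forall>j\<le>?l. nats t ''sz'' j = 2 ^ j" using I by (simp_all add: I_def)
          have tm: "nats t ''m'' 0 = m" using m by (simp add: same_nats[OF st])
          have lt: "2 ^ ?l < m" using b sz tm by simp
          show "exec Doubling t 30 (\<lambda>t. \<exists>\<mu>'\<le>\<mu> - 1. I \<mu>' t)"
          proof (rule exec_mono)
            show "exec Doubling t (20 + 6) (\<lambda>t. I (\<mu> - 1) t)"
            proof (rule exec_Seq)
              show "exec (NSet ''sz'' (NAdd (nv ''L'') (NConst 1)) (NAdd (NGet ''sz'' (nv ''L'')) (NGet ''sz'' (nv ''L'')))) t 20
                (\<lambda>u. same ?X {} s u \<and> nats u ''L'' = nats t ''L'' \<and> nats u ''sz'' = (nats t ''sz'')(Suc ?l := 2 ^ Suc ?l))" (is "exec _ _ _ ?Posta")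
              proof (rule exec_NSet)
                have l: "nats t ''sz'' ?l = 2 ^ ?l" using sz by simp
                let ?t = "t\<lparr>nats := (nats t)(''sz'' := (nats t ''sz'')(Suc ?l := 2 ^ Suc ?l))\<rparr>"
                have "same ?X {} s ?t" using st by (simp add: same_def)
                then show "(\<lambda>u. same ?X {} s u \<and> nats u ''L'' = nats t ''L'' \<and> nats u ''sz'' = (nats t ''sz'')(Suc ?l := 2 ^ Suc ?l))
                  (t\<lparr>nats := (nats t)(''sz'' := (nats t ''sz'')(nval (NAdd (nv ''L'') (NConst 1)) t := nval (NAdd (NGet ''sz'' (nv ''L'')) (NGet ''sz'' (nv ''L''))) t))\<rparr>)"
                  by (simp add: l mult_2[symmetric])
              qed simp
              fix u assume u: "?Posta u"
              have v: "same ?X {} s u" "nats u ''L'' = nats t ''L''" "nats u ''sz'' = (nats t ''sz'')(Suc ?l := 2 ^ Suc ?l)"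
                using u by blast+
              define t2 where "t2 = u\<lparr>nats := (nats u)(''L'' := (nats u ''L'')(0 := Suc ?l))\<rparr>"
              have "same ?X {} s t2" using v(1) by (auto simp: same_def t2_def)
              moreover have "\<forall>j\<le>Suc ?l. nats t2 ''sz'' j = 2 ^ j" using sz by (auto simp: t2_def v(3) le_Suc_eq)
              moreover have "2 ^ Suc ?l < 2 * m" using lt by simp
              moreover have "\<mu> - 1 = real (2 * m) - real (Suc ?l)" using I by (simp add: I_def)
              moreover have "nats t2 ''L'' 0 = Suc ?l" by (simp add: t2_def)
              ultimately have "I (\<mu> - 1) t2" unfolding I_def by simp
              moreover have "exec (nset ''L'' (NAdd (nv ''L'') (NConst 1))) u 6 (\<lambda>t. t = t2)"
                by (rule exec_NSet) (simp_all add: t2_def v(2))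
              ultimately show "exec (nset ''L'' (NAdd (nv ''L'') (NConst 1))) u 6 (\<lambda>t. I (\<mu> - 1) t)"
                by (rule exec_eq[rotated])
            qed
          qed auto
        qed simp
        fix t assume "(\<exists>\<mu>. I \<mu> t) \<and> \<not> bval ?b t"
        then obtain \<mu> where I: "I \<mu> t" and nb: "\<not> bval ?b t" by blast
        have st: "same ?X {} s t" using I by (simp add: I_def)
        have tm: "nats t ''m'' 0 = m" using m by (simp add: same_nats[OF st])
        show "exec (nset ''N'' (NGet ''sz'' (nv ''L''))) t 6 ?Q"
          by (rule exec_NSet) (use I nb tm in \<open>auto simp: I_def same_def\<close>)
      qed
    qed
  qed
  then show ?thesis
  proof (rule exec_mono)
    have "30 + real (bcost ?b) = 36" by simp
    then show "3 + (3 + ((30 + real (bcost ?b)) * (real (2 * m) + 1) + 6)) \<le> 200 * real m" using m(2) by simp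
  qed
qed

context multiplier begin

abbreviation "nix \<equiv> NAdd (NMul (nv ''i'') (nv ''N'')) (nv ''j'')"
abbreviation "eA \<equiv> RGet ''A'' (NAdd (NMul (nv ''i'') (nv ''m'')) (nv ''j'')) :: rop rexp"

definition Prepare :: "rop com" where
  "Prepare = Seq Sizes (Seq (nset ''h'' (nv ''N'')) (Seq (Map ''P'' hix (nv ''h'') (nv ''h'') rzero)
     (Map ''P'' nix (nv ''n'') (nv ''m'') eA)))"

lemma exec_Prepare:
  "\<exists>C\<ge>0. \<forall>n m A s. nats s ''n'' 0 = n \<and> nats s ''m'' 0 = m \<and> 1 \<le> n \<and> n \<le> m \<and> (\<forall>i<n. \<forall>j<m. reals s ''A'' (i * m + j) = A i j) \<longrightarrow>
    exec Prepare s (C * (2 * real m) powr \<tau>) (\<lambda>t. same ({''sz'', ''L'', ''N'', ''h''} \<union> ijk) {''P''} s t \<and> (\<exists>N. dat n m N A t))"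
proof -
  let ?cz = "4 * map_cost hix (nv ''h'') (nv ''h'') rzero" and ?ca = "4 * map_cost nix (nv ''n'') (nv ''m'') eA"
  show ?thesis
  proof (intro exI[of _ "200 + (10 + (?cz + ?ca))"] conjI allI impI)
    show "0 \<le> 200 + (10 + (?cz + ?ca))" by (simp add: map_cost_nonneg)
    fix n m A and s :: state
    assume asm: "nats s ''n'' 0 = n \<and> nats s ''m'' 0 = m \<and> 1 \<le> n \<and> n \<le> m \<and> (\<forall>i<n. \<forall>j<m. reals s ''A'' (i * m + j) = A i j)"
    then have nm: "nats s ''n'' 0 = n" "nats s ''m'' 0 = m" "1 \<le> n" "n \<le> m" "1 \<le> m"
      and A: "\<And>i j. i < n \<Longrightarrow> j < m \<Longrightarrow> reals s ''A'' (i * m + j) = A i j" by auto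
    let ?P = "(2 * real m) powr \<tau>"
    let ?Q = "\<lambda>t. same ({''sz'', ''L'', ''N'', ''h''} \<union> ijk) {''P''} s t \<and> (\<exists>N. dat n m N A t)"
    have "(2 * real m) powr 1 \<le> ?P" using nm(5) \<tau> by (intro powr_mono) auto
    then have mP: "2 * real m \<le> ?P" using nm(5) by simp
    have NP: "mtime N \<le> ?P" if "N \<le> 2 * m" for N using that \<tau> by (intro powr_mono2) (auto simp flip: of_nat_mult)
    show "exec Prepare s ((200 + (10 + (?cz + ?ca))) * ?P) ?Q"
      unfolding Prepare_def distrib_right
    proof (rule exec_Seq)
      show "exec Sizes s (200 * ?P) (\<lambda>t. same {''sz'', ''L'', ''N''} {} s t \<and> nats t ''N'' 0 = 2 ^ nats t ''L'' 0 \<and>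
        (\<forall>j\<le>nats t ''L'' 0. nats t ''sz'' j = 2 ^ j) \<and> m \<le> nats t ''N'' 0 \<and> nats t ''N'' 0 \<le> 2 * m)" (is "exec _ _ _ ?Postb")
        by (rule exec_mono[OF exec_Sizes[OF nm(2,5)]]) (use mP in auto)
      fix s1 assume p1: "?Postb s1"
      note st1 = conjunct1[OF p1]
      define N where "N = nats s1 ''N'' 0"
      have N: "m \<le> N" "N \<le> 2 * m" "1 \<le> N" "n \<le> N" using p1 nm by (auto simp: N_def)
      show "exec (Seq (nset ''h'' (nv ''N'')) (Seq (Map ''P'' hix (nv ''h'') (nv ''h'') rzero) (Map ''P'' nix (nv ''n'') (nv ''m'') eA))) s1
        (10 * ?P + (?cz * ?P + ?ca * ?P)) ?Q"
      proof (rule exec_Seq)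
        show "exec (nset ''h'' (nv ''N'')) s1 (10 * ?P) (\<lambda>t. same {''h''} {} s1 t \<and> nats t ''h'' 0 = N)"
          by (rule exec_NSet) (use mP nm in \<open>auto simp: N_def same_def\<close>)
        fix s2 assume p2: "same {''h''} {} s1 s2 \<and> nats s2 ''h'' 0 = N"
        note st2 = conjunct1[OF p2]
        show "exec (Seq (Map ''P'' hix (nv ''h'') (nv ''h'') rzero) (Map ''P'' nix (nv ''n'') (nv ''m'') eA)) s2 (?cz * ?P + ?ca * ?P) ?Q"
        proof (rule exec_Seq)
          have "exec (Map ''P'' hix (nv ''h'') (nv ''h'') rzero) s2 (?cz * mtime N)
            (\<lambda>t. same ijk {''P''} s2 t \<and> (\<forall>i<N. \<forall>j<N. reals t ''P'' (i * N + j) = 0))"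
            by (rule exec_Map_hix[OF N(3) conjunct2[OF p2] \<tau>]) simp
          then show "exec (Map ''P'' hix (nv ''h'') (nv ''h'') rzero) s2 (?cz * ?P)
            (\<lambda>t. same ijk {''P''} s2 t \<and> (\<forall>i<N. \<forall>j<N. reals t ''P'' (i * N + j) = 0))" (is "exec _ _ _ ?Postc")
            by (rule exec_mono) (use NP[OF N(2)] in \<open>auto intro!: mult_left_mono simp: map_cost_nonneg\<close>)
          fix s3 assume p3: "?Postc s3"
          note st3 = conjunct1[OF p3] and zero = conjunct2[OF p3, rule_format]
          have nm3: "nats s3 ''n'' 0 = n" "nats s3 ''m'' 0 = m" "nats s3 ''N'' 0 = N"
            using nm by (simp_all add: N_def same_nats[OF st1] same_nats[OF st2] same_nats[OF st3])
          have A3: "reals s3 ''A'' = reals s ''A''" by (simp add: same_reals[OF st1] same_reals[OF st2] same_reals[OF st3])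
          have "exec (Map ''P'' nix (nv ''n'') (nv ''m'') eA) s3 (map_cost nix (nv ''n'') (nv ''m'') eA * (real n + 1) * (real m + 1))
            (\<lambda>t. same ijk {''P''} s3 t \<and> (\<forall>i<n. \<forall>j<m. reals t ''P'' (i * N + j) = A i j) \<and>
              (\<forall>c. (\<forall>i<n. \<forall>j<m. c \<noteq> i * N + j) \<longrightarrow> reals t ''P'' c = reals s3 ''P'' c))" (is "exec _ _ _ ?Postd")
          proof (rule exec_Map)
            fix s' i j assume *: "same ijk {''P''} s3 s'" "i < n" "j < m" "nats s' ''i'' 0 = i" "nats s' ''j'' 0 = j"
            show "nval nix s' = i * N + j" using nm3 by (simp add: *(4,5) same_nats[OF *(1)])
            show "rval eA s' = A i j" using nm3 A[OF *(2,3)] by (simp add: *(4,5) same_eqs[OF *(1)] A3)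
          next
            fix i j i' j' assume "j < m" "j' < m" "i * N + j = i' * N + j'"
            then show "i = i' \<and> j = j'" using N(1) by (intro index_inj[of j N j']) auto
          qed (use nm3 in \<open>simp_all add: same_nats\<close>)
          then show "exec (Map ''P'' nix (nv ''n'') (nv ''m'') eA) s3 (?ca * ?P) ?Q"
          proof (rule exec_mono)
            have "(real n + 1) * (real m + 1) \<le> 4 * ?P" using size_le[OF N(4,1,3)] NP[OF N(2)] by linarith
            from mult_left_mono[OF this map_cost_nonneg[of nix "nv ''n''" "nv ''m''" eA]]
            show "map_cost nix (nv ''n'') (nv ''m'') eA * (real n + 1) * (real m + 1) \<le> ?ca * ?P" by (simp add: mult_ac)
            fix t assume t: "?Postd t"
            note st4 = conjunct1[OF t]
            have "same {''sz'', ''L'', ''N'', ''h''} {} s s2" by (rule same_trans[OF st1 st2]) auto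
            then have "same ({''sz'', ''L'', ''N'', ''h''} \<union> ijk) {''P''} s s3" by (rule same_trans[OF _ st3]) auto
            then have st: "same ({''sz'', ''L'', ''N'', ''h''} \<union> ijk) {''P''} s t" by (rule same_trans[OF _ st4]) auto
            have sz: "nats t ''L'' = nats s1 ''L''" "nats t ''sz'' = nats s1 ''sz''" "nats t ''N'' 0 = N"
              by (simp_all add: N_def same_nats[OF st2] same_nats[OF st3] same_nats[OF st4])
            have P: "reals t ''P'' (i * N + j) = (if i < n \<and> j < m then A i j else 0)" if ij: "i < N" "j < N" for i j
            proof (cases "i < n \<and> j < m")
              case False
              have "\<forall>i'<n. \<forall>j'<m. i * N + j \<noteq> i' * N + j'"
              proof (intro allI impI notI)
                fix i' j' assume "i' < n" "j' < m" "i * N + j = i' * N + j'"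
                then show False using index_inj[of j N j' i i'] ij N(1) False by auto
              qed
              then show ?thesis using conjunct2[OF conjunct2[OF t]] zero[OF ij] False by auto
            qed (use conjunct1[OF conjunct2[OF t]] in auto)
            have "N = 2 ^ nats s1 ''L'' 0 \<and> (\<forall>j\<le>nats s1 ''L'' 0. nats s1 ''sz'' j = 2 ^ j)" using p1 by (simp add: N_def)
            moreover have "nats t ''n'' 0 = n" "nats t ''m'' 0 = m" "reals t ''A'' = reals s ''A''"
              using nm by (simp_all add: same_eqs[OF st])
            ultimately have "dat n m N A t" unfolding dat_def sz using A P nm N by simp
            then show "?Q t" using st by blast
          qed
        qed
      qed
    qed
  qed
qed

end

text \<open>The factor 4/5 keeps the ratio of the two exponents at most 5/4, the range of
  \<open>psum_approx_transfer\<close>; the maximum keeps the new exponent at least 2.\<close>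

definition exponent :: "real \<Rightarrow> nat \<Rightarrow> real \<Rightarrow> real" where
  "exponent p m \<epsilon> = (if \<epsilon> < real m powr (1 / 2) then p else max 2 (4 * p / 5))"

text \<open>The value 1/2 corresponds to the factor 3/2 in
  \<open>psum_approx_transfer\<close>.\<close>

definition accuracy :: "nat \<Rightarrow> real \<Rightarrow> real" where
  "accuracy m \<epsilon> = (if \<epsilon> < real m powr (1 / 2) then \<epsilon> else 1 / 2)"

definition Params :: "rop com" where
  "Params = If (RLess (rv ''eps'') (rpow (ROfNat (nv ''m'')) (rdiv (num 1) (num 2))))
     (Seq (rset ''pp'' (rv ''p'')) (rset ''ee'' (rv ''eps'')))
     (Seq (If (RLess (rdiv (rmul (num 4) (rv ''p'')) (num 5)) (num 2)) (rset ''pp'' (num 2))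
         (rset ''pp'' (rdiv (rmul (num 4) (rv ''p'')) (num 5))))
       (rset ''ee'' (rdiv (num 1) (num 2))))"

lemma exec_Params:
  assumes "nats s ''m'' 0 = m" "reals s ''p'' 0 = p" "reals s ''eps'' 0 = \<epsilon>"
  shows "exec Params s 100 (\<lambda>t. same {} {''pp'', ''ee''} s t \<and> reals t ''pp'' 0 = exponent p m \<epsilon> \<and> reals t ''ee'' 0 = accuracy m \<epsilon>)" (is "exec _ _ _ ?Q")
proof -
  let ?b = "RLess (rv ''eps'') (rpow (ROfNat (nv ''m'')) (rdiv (num 1) (num 2)))"
  let ?e = "rdiv (rmul (num 4) (rv ''p'')) (num 5)"
  have "exec Params s (real (bcost ?b) + 80) ?Q"
    unfolding Params_def
  proof (rule exec_If)
    assume b: "bval ?b s"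
    show "exec (Seq (rset ''pp'' (rv ''p'')) (rset ''ee'' (rv ''eps''))) s 80 ?Q"
    proof (rule exec_mono)
      show "exec (Seq (rset ''pp'' (rv ''p'')) (rset ''ee'' (rv ''eps''))) s (10 + 10) ?Q"
      proof (rule exec_Seq)
        show "exec (rset ''pp'' (rv ''p'')) s 10 (\<lambda>t. same {} {''pp''} s t \<and> reals t ''pp'' 0 = p)"
          by (rule exec_RSet) (use assms in \<open>auto simp: same_def\<close>)
        fix t assume t: "same {} {''pp''} s t \<and> reals t ''pp'' 0 = p"
        show "exec (rset ''ee'' (rv ''eps'')) t 10 ?Q"
          by (rule exec_RSet) (use t b assms in \<open>auto simp: same_def exponent_def accuracy_def\<close>)
      qed
    qed auto
  next
    assume b: "\<not> bval ?b s"
    show "exec (Seq (If (RLess ?e (num 2)) (rset ''pp'' (num 2)) (rset ''pp'' ?e)) (rset ''ee'' (rdiv (num 1) (num 2)))) s 80 ?Q"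
    proof (rule exec_mono)
      let ?c = "RLess ?e (num 2)"
      show "exec (Seq (If ?c (rset ''pp'' (num 2)) (rset ''pp'' ?e)) (rset ''ee'' (rdiv (num 1) (num 2)))) s ((real (bcost ?c) + 20) + 20) ?Q"
      proof (rule exec_Seq)
        show "exec (If ?c (rset ''pp'' (num 2)) (rset ''pp'' ?e)) s (real (bcost ?c) + 20)
          (\<lambda>t. same {} {''pp''} s t \<and> reals t ''pp'' 0 = max 2 (4 * p / 5))"
          by (rule exec_If; rule exec_RSet) (use assms in \<open>auto simp: same_def\<close>)
        fix t assume t: "same {} {''pp''} s t \<and> reals t ''pp'' 0 = max 2 (4 * p / 5)"
        show "exec (rset ''ee'' (rdiv (num 1) (num 2))) t 20 ?Q"
          by (rule exec_RSet) (use t b assms in \<open>auto simp: same_def exponent_def accuracy_def\<close>)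
      qed
    qed auto
  qed
  then show ?thesis by (rule exec_mono) auto
qed

lemma lg_ge_1: "1 \<le> lg x" and lg_ge_ln: "1 \<le> x \<Longrightarrow> ln x \<le> lg x"
proof -
  show "1 \<le> lg x" by (simp add: lg_def)
  assume "1 \<le> x"
  then have "ln x * ln 2 \<le> ln x * 1" using ln_2_less_1 by (intro mult_left_mono) auto
  then have "ln x \<le> log 2 x" by (simp add: log_def field_simps)
  then show "ln x \<le> lg x" by (simp add: lg_def)
qed

lemma width_exp_mono: "2 \<le> q \<Longrightarrow> q < p \<Longrightarrow> width_exp q < width_exp p"
  by (simp add: width_exp_def field_simps)

text \<open>
  For \<open>\<epsilon> \<ge> \<surd>m\<close> the accuracy no longer controls \<open>ln m\<close>; there the problem is solved to constant accuracy
  for a smaller exponent, whose smaller power of \<open>m\<close> absorbs \<open>ln m\<close>.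
\<close>

lemma iteration_bound:
  assumes p: "2 \<le> p"
  shows "\<exists>K\<ge>0. \<forall>n m \<epsilon>. 1 \<le> n \<and> n \<le> m \<and> 0 < \<epsilon> \<longrightarrow>
    real m powr width_exp (exponent p m \<epsilon>) * (1 + of_bool (2 < exponent p m \<epsilon>) * (ln m + \<bar>ln (accuracy m \<epsilon>)\<bar>))
      \<le> K * (real m powr width_exp p * lg (real (m * n) / \<epsilon>))"
proof -
  define q where "q = max 2 (4 * p / 5)"
  define \<delta> where "\<delta> = width_exp p - width_exp q"
  let ?K = "4 + 1 / \<bar>\<delta>\<bar>"
  show ?thesis
  proof (intro exI[of _ ?K] conjI allI impI)
    fix n m :: nat and \<epsilon> :: real assume asm: "1 \<le> n \<and> n \<le> m \<and> 0 < \<epsilon>"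
    then have m: "1 \<le> n" "1 \<le> m" "0 < \<epsilon>" by auto
    let ?M = "real m powr width_exp p" and ?l = "lg (real (m * n) / \<epsilon>)"
    have l1: "1 \<le> ?l" by (rule lg_ge_1)
    show "real m powr width_exp (exponent p m \<epsilon>) * (1 + of_bool (2 < exponent p m \<epsilon>) * (ln m + \<bar>ln (accuracy m \<epsilon>)\<bar>)) \<le> ?K * (?M * ?l)"
    proof (cases "\<epsilon> < real m powr (1 / 2)")
      case True
      have "ln \<epsilon> \<le> ln (real m powr (1 / 2))" using True m by (intro ln_mono) auto
      then have e: "ln \<epsilon> \<le> ln m / 2" using m by (simp add: ln_powr)
      define y where "y = ln (real m / \<epsilon>)"
      have y: "y = ln m - ln \<epsilon>" using m by (simp add: y_def ln_div)
      have lm: "0 \<le> ln (real m)" using m by simp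
      then have y0: "0 \<le> y" using e y by linarith
      then have "1 \<le> real m / \<epsilon>" using m by (simp add: y_def ln_ge_zero_iff)
      moreover have "real m / \<epsilon> \<le> real (m * n) / \<epsilon>" using m by (intro divide_right_mono) auto
      ultimately have "y \<le> ln (real (m * n) / \<epsilon>)" "1 \<le> real (m * n) / \<epsilon>" unfolding y_def by (auto intro!: ln_mono)
      then have yl: "y \<le> ?l" using lg_ge_ln by force
      \<comment> \<open>If \<epsilon> \<ge> 1, then ln \<epsilon> \<le> ln m / 2 makes y at least
        half of ln m; if \<epsilon> < 1, the left side is y itself.\<close>
      have "ln m + \<bar>ln \<epsilon>\<bar> \<le> 3 * y" using e y lm by linarith
      then have "1 + of_bool (2 < p) * (ln m + \<bar>ln \<epsilon>\<bar>) \<le> 4 * ?l" using yl l1 by simp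
      also have "\<dots> \<le> ?K * ?l" using l1 by (intro mult_right_mono) auto
      finally have "?M * (1 + of_bool (2 < p) * (ln m + \<bar>ln \<epsilon>\<bar>)) \<le> ?M * (?K * ?l)" by (intro mult_left_mono) auto
      then show ?thesis using True by (simp add: exponent_def accuracy_def mult_ac)
    next
      case False
      have "real m powr width_exp q * (1 + of_bool (2 < q) * (ln m + \<bar>ln (1 / 2)\<bar>)) \<le> ?K * ?M"
      proof (cases "2 < q")
        case True
        have "0 < \<delta>" using True p unfolding \<delta>_def by (simp add: width_exp_mono q_def)
        \<comment> \<open>A logarithm is dominated by any positive power, and \<delta> is the power
          of \<open>m\<close> saved by the smaller exponent.\<close>
        have "ln (real m) \<le> real m powr \<delta> / \<delta>" using m \<open>0 < \<delta>\<close> by (intro ln_powr_bound) auto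
        moreover have "\<bar>ln (1 / 2 :: real)\<bar> \<le> 1" using ln_2_less_1 by (simp add: ln_div)
        moreover have "1 \<le> real m powr \<delta>" using m \<open>0 < \<delta>\<close> by (intro ge_one_powr_ge_zero) auto
        ultimately have "1 + of_bool (2 < q) * (ln m + \<bar>ln (1 / 2)\<bar>) \<le> ?K * real m powr \<delta>"
          using True \<open>0 < \<delta>\<close> by (simp add: distrib_right)
        then have "real m powr width_exp q * (1 + of_bool (2 < q) * (ln m + \<bar>ln (1 / 2)\<bar>)) \<le> real m powr width_exp q * (?K * real m powr \<delta>)"
          by (intro mult_left_mono) auto
        also have "\<dots> = ?K * real m powr (width_exp q + \<delta>)" by (simp add: powr_add mult_ac)
        finally show ?thesis by (simp add: \<delta>_def)
      next
        case False
        \<comment> \<open>For q = 2 there is no logarithm to absorb; \<delta> may vanish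
          here.\<close>
        have "real m powr width_exp q \<le> 1 * ?M" using False m p width_exp_bounds(1)[OF p]
          by (simp add: q_def width_exp_def ge_one_powr_ge_zero)
        also have "\<dots> \<le> ?K * ?M" by (intro mult_right_mono) auto
        finally show ?thesis using False by simp
      qed
      also have "?K * ?M * 1 \<le> ?K * ?M * ?l" using l1 by (intro mult_left_mono) auto
      finally show ?thesis using False by (simp add: exponent_def accuracy_def q_def mult_ac)
    qed
  qed simp
qed

lemma accuracy_pos: "0 < \<epsilon> \<Longrightarrow> 0 < accuracy m \<epsilon>"
  by (simp add: accuracy_def)

lemma approx_exponent:
  assumes p: "2 \<le> p" and m: "1 \<le> m"
    and le: "psum (exponent p m \<epsilon>) m x \<le> (1 + accuracy m \<epsilon>) * psum (exponent p m \<epsilon>) m y"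
  shows "psum p m x \<le> (1 + \<epsilon>) * psum p m y"
proof (cases "\<epsilon> < real m powr (1 / 2)")
  case False
  define q where "q = max 2 (4 * p / 5)"
  have q: "2 \<le> q" "q \<le> p" "4 * p / 5 \<le> q" using p by (auto simp: q_def)
  then have "p / q \<le> 5 / 4" by (simp add: field_simps)
  moreover have "psum q m x \<le> 3 / 2 * psum q m y" using le False by (simp add: exponent_def accuracy_def q_def)
  ultimately show ?thesis using psum_approx_transfer[OF q(1,2) _ m] False by simp
qed (use le in \<open>simp add: exponent_def accuracy_def\<close>)

context multiplier begin

definition Regression :: "rop com" where "Regression = Seq Params (Seq Prepare Solve)"

abbreviation "input n m A b p \<epsilon> s \<equiv> nats s ''n'' 0 = n \<and> nats s ''m'' 0 = m \<and> 1 \<le> n \<and> n \<le> m \<and>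
      (\<forall>i<n. \<forall>j<m. reals s ''A'' (i * m + j) = A i j) \<and> (\<forall>i<n. reals s ''b'' i = b i) \<and> sol n m A b \<noteq> {} \<and>
      reals s ''p'' 0 = p \<and> reals s ''eps'' 0 = \<epsilon> \<and> 0 < \<epsilon>"

text \<open>Depending on \<epsilon> the solver runs with exponent \<open>p\<close> or with max 2 (4
  * p / 5). Both are determined by \<open>p\<close>, so two instances of the solver bound are taken
  and their constants added.\<close>

lemma exec_Regression:
  assumes p: "2 \<le> p"
  shows "\<exists>C\<ge>0. \<forall>n m A b \<epsilon> s. input n m A b p \<epsilon> s \<longrightarrow>
    exec Regression s (C * ((2 * real m) powr \<tau> * (real m powr width_exp p * lg (real (m * n) / \<epsilon>))))
      (\<lambda>t. approx n m A b p \<epsilon> t)"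
proof -
  let ?pre = "\<lambda>n m N A b q e s. solvable n m N A b s \<and>
      reals s ''pp'' 0 = q \<and> reals s ''ee'' 0 = e \<and> 0 < (e::real)"
  let ?post = "\<lambda>n m A b q e t. reals t ''x'' \<in> sol n m A b \<and> (\<forall>y\<in>sol n m A b. psum q m (reals t ''x'') \<le> (1 + e) * psum q m y)"
  let ?cost = "\<lambda>m q e. real m powr width_exp q * (1 + of_bool (2 < q) * (ln (real m) + \<bar>ln e\<bar>))"
  from exec_Prepare obtain C where C_spec: "0 \<le> C \<and> (\<forall>n m A s. nats s ''n'' 0 = n \<and> nats s ''m'' 0 = m \<and> 1 \<le> n \<and> n \<le> m \<and>
      (\<forall>i<n. \<forall>j<m. reals s ''A'' (i * m + j) = A i j) \<longrightarrow>
    exec Prepare s (C * (2 * real m) powr \<tau>) (\<lambda>t. same ({''sz'', ''L'', ''N'', ''h''} \<union> ijk) {''P''} s t \<and> (\<exists>N. dat n m N A t)))"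
    by (rule exE)
  note C = conjunct1[OF C_spec] and prep = conjunct2[OF C_spec, rule_format]
  from iteration_bound[OF p] obtain K where K_spec: "0 \<le> K \<and> (\<forall>n m \<epsilon>. 1 \<le> n \<and> n \<le> m \<and> 0 < \<epsilon> \<longrightarrow>
    ?cost m (exponent p m \<epsilon>) (accuracy m \<epsilon>) \<le> K * (real m powr width_exp p * lg (real (m * n) / \<epsilon>)))" by (rule exE)
  note K = conjunct1[OF K_spec] and bound = conjunct2[OF K_spec, rule_format]
  from exec_Solve[OF p] obtain D where D_spec: "0 \<le> D \<and> (\<forall>n m N A b e s. ?pre n m N A b p e s \<longrightarrow>
    exec Solve s (D * ?cost m p e * mtime N) (?post n m A b p e))" by (rule exE)
  note D = conjunct1[OF D_spec] and solve1 = conjunct2[OF D_spec, rule_format]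
  let ?q = "max 2 (4 * p / 5)"
  have "2 \<le> ?q" by simp
  from exec_Solve[OF this] obtain E where E_spec: "0 \<le> E \<and> (\<forall>n m N A b e s. ?pre n m N A b ?q e s \<longrightarrow>
    exec Solve s (E * ?cost m ?q e * mtime N) (?post n m A b ?q e))" by (rule exE)
  note E = conjunct1[OF E_spec] and solve2 = conjunct2[OF E_spec, rule_format]
  show ?thesis
  proof (intro exI[of _ "100 + (C + (D + E) * K)"] conjI allI impI)
    show "0 \<le> 100 + (C + (D + E) * K)" using C D E K by simp
    fix n m A b \<epsilon> and s :: state
    assume asm: "input n m A b p \<epsilon> s"
    then have nm: "nats s ''n'' 0 = n" "nats s ''m'' 0 = m" "1 \<le> n" "n \<le> m" "1 \<le> m" "0 < \<epsilon>"
      and v: "reals s ''p'' 0 = p" "reals s ''eps'' 0 = \<epsilon>" by auto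
    have A: "\<forall>i<n. \<forall>j<m. reals s ''A'' (i * m + j) = A i j" and b: "\<forall>i<n. reals s ''b'' i = b i" and ne: "sol n m A b \<noteq> {}"
      using asm by (blast, blast, blast)
    let ?P = "(2 * real m) powr \<tau>" and ?W = "real m powr width_exp p * lg (real (m * n) / \<epsilon>)"
    let ?e = "accuracy m \<epsilon>" and ?r = "exponent p m \<epsilon>"
    let ?Q = "?post n m A b p \<epsilon>"
    have P1: "1 \<le> ?P" using nm \<tau> by (intro ge_one_powr_ge_zero) auto
    have "1 * 1 \<le> ?W" using nm width_exp_bounds(1)[OF p] lg_ge_1 by (intro mult_mono ge_one_powr_ge_zero) auto
    then have W1: "1 \<le> ?W" by simp
    have "exec Regression s (100 + (C * ?P + (D + E) * (K * ?W) * ?P)) ?Q"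
      unfolding Regression_def
    proof (rule exec_Seq[OF exec_Params[OF nm(2) v]])
      fix s1 assume p1: "same {} {''pp'', ''ee''} s s1 \<and> reals s1 ''pp'' 0 = ?r \<and> reals s1 ''ee'' 0 = ?e"
      note st1 = conjunct1[OF p1]
      have A1: "nats s1 ''n'' 0 = n \<and> nats s1 ''m'' 0 = m \<and> 1 \<le> n \<and> n \<le> m \<and> (\<forall>i<n. \<forall>j<m. reals s1 ''A'' (i * m + j) = A i j)"
        using nm A by (simp add: same_eqs[OF st1])
      show "exec (Seq Prepare Solve) s1 (C * ?P + (D + E) * (K * ?W) * ?P) ?Q"
      proof (rule exec_Seq[OF prep[OF A1]])
        fix s2 assume p2: "same ({''sz'', ''L'', ''N'', ''h''} \<union> ijk) {''P''} s1 s2 \<and> (\<exists>N. dat n m N A s2)"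
        note st2 = conjunct1[OF p2]
        from conjunct2[OF p2] obtain N where N: "dat n m N A s2" by blast
        have N2: "N \<le> 2 * m" using N by (simp add: dat_def)
        have pre: "?pre n m N A b ?r ?e s2"
          using N b ne p1 accuracy_pos[OF nm(6)] by (simp add: same_reals[OF st2] same_reals[OF st1])
        have "exec Solve s2 ((D + E) * ?cost m ?r ?e * mtime N) (?post n m A b ?r ?e)"
        proof (cases "\<epsilon> < real m powr (1 / 2)")
          case True
          then have r: "?r = p" by (simp add: exponent_def)
          show ?thesis unfolding r
            by (rule exec_mono[OF solve1[OF pre[unfolded r]]])
              (use E nm in \<open>auto intro!: mult_right_mono mult_nonneg_nonneg add_nonneg_nonneg\<close>)
        next
          case False
          then have r: "?r = ?q" by (simp add: exponent_def)
          show ?thesis unfolding r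
            by (rule exec_mono[OF solve2[OF pre[unfolded r]]])
              (use D nm in \<open>auto intro!: mult_right_mono mult_nonneg_nonneg add_nonneg_nonneg\<close>)
        qed
        then show "exec Solve s2 ((D + E) * (K * ?W) * ?P) ?Q"
        proof (rule exec_mono)
          have "mtime N \<le> ?P" using N2 \<tau> by (intro powr_mono2) (auto simp flip: of_nat_mult)
          moreover have "?cost m ?r ?e \<le> K * ?W" using nm by (intro bound) simp
          ultimately show "(D + E) * ?cost m ?r ?e * mtime N \<le> (D + E) * (K * ?W) * ?P"
            using D E K lg_ge_1[of "real (m * n) / \<epsilon>"] by (intro mult_mono[of "(D + E) * a" "(D + E) * b" for a b] mult_left_mono[of _ _ "D + E"] mult_nonneg_nonneg) simp_all
          fix t assume "?post n m A b ?r ?e t"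
          then show "?Q t" using approx_exponent[OF p nm(5)] by blast
        qed
      qed
    qed
    then show "exec Regression s ((100 + (C + (D + E) * K)) * (?P * ?W)) ?Q"
    proof (rule exec_mono)
      have "100 + (C * P + (D + E) * (K * W) * P) \<le> (100 + (C + (D + E) * K)) * (P * W)" if "1 \<le> P" "1 \<le> W" for P W :: real
      proof -
        have PW: "1 * 1 \<le> P * W" using that by (intro mult_mono) auto
        have "C * P * 1 \<le> C * P * W" using that C by (intro mult_left_mono) auto
        then show ?thesis using PW by (simp add: algebra_simps)
      qed
      from this[OF P1 W1] show "100 + (C * ?P + (D + E) * (K * ?W) * ?P) \<le> (100 + (C + (D + E) * K)) * (?P * ?W)" .
    qed blast
  qed
qed

end

section \<open>Translation to vectors and matrices, and the final bound\<close>

lemma p_norm_powr: "0 < p \<Longrightarrow> x \<in> carrier_vec m \<Longrightarrow> p_norm p x powr p = psum p m (($) x)"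
  by (simp add: p_norm_def psum_def powr_powr sum_nonneg)

lemma solutions_sol:
  assumes "A \<in> carrier_mat n m" "b \<in> carrier_vec n"
  shows "x \<in> solutions A b \<longleftrightarrow> x \<in> carrier_vec m \<and> ($) x \<in> sol n m (\<lambda>i j. A $$ (i, j)) (($) b)"
  using assms by (auto simp: solutions_def sol_def vec_eq_iff scalar_prod_def atLeast0LessThan)

theorem theorem5p1:
  fixes \<tau> :: real
  assumes "\<tau> > matmul_omega \<or> (\<tau> = matmul_omega \<and> matmul_exponent_admissible matmul_omega)"
  shows "\<exists>c :: rop com. \<forall>p :: real. p \<ge> 2 \<longrightarrow> (\<exists>(C :: real) (k :: nat).
    \<forall>(n :: nat) (m :: nat) (A :: real mat) (b :: real vec) (\<epsilon> :: real) (s :: state).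
      1 \<le> n \<and> n \<le> m \<and> A \<in> carrier_mat n m \<and> b \<in> carrier_vec n \<and> 0 < \<epsilon> \<and> solutions A b \<noteq> {} \<and>
      nats s ''n'' 0 = n \<and> nats s ''m'' 0 = m \<and> reals s ''p'' 0 = p \<and> reals s ''eps'' 0 = \<epsilon> \<and>
      holds_mat s ''A'' A \<and> holds_vec s ''b'' b \<longrightarrow>
      (\<exists>T t x. run c s T t \<and> x \<in> carrier_vec m \<and> holds_vec t ''x'' x \<and> approx_solution p \<epsilon> A b x \<and>
        real T \<le> C * real (m + n) powr (\<tau> + (p - 2) / (3 * p - 2)) * (lg (1 / \<epsilon>))\<^sup>2
                 * (lg (real (m * n) / \<epsilon>)) ^ k))"
proof -
  \<comment> \<open>The infimum may be unattained, so the program is built around a multiplication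
    program for some admissible \<tau>' \<le> \<tau>. It is fixed before \<open>p\<close>
    is.\<close>
  obtain \<tau>' where \<tau>': "\<tau>' \<le> \<tau>" and adm: "matmul_exponent_admissible \<tau>'" using admissible_below[OF assms] by blast
  obtain mulc Cm where mc: "0 \<le> Cm" "\<forall>N\<ge>1. \<forall>s. nats s ''zN'' 0 = N \<longrightarrow>
    exec mulc s (Cm * real N powr \<tau>') (\<lambda>t. same znames znames s t \<and>
      product_in N s t)"
    using admissible_multiplier[OF adm] by blast
  interpret multiplier mulc \<tau>' Cm
    using admissible_ge_2[OF adm] mc by unfold_locales blast+
  show ?thesis
  proof (intro exI[of _ Regression] allI impI)
    fix p :: real assume p: "2 \<le> p"
    from exec_Regression[OF p] obtain C where C_spec: "0 \<le> C \<and> (\<forall>n m A b \<epsilon> s. input n m A b p \<epsilon> s \<longrightarrow>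
      exec Regression s (C * ((2 * real m) powr \<tau>' * (real m powr width_exp p * lg (real (m * n) / \<epsilon>))))
      (\<lambda>t. approx n m A b p \<epsilon> t))" by (rule exE)
    note C = conjunct1[OF C_spec] and regr = conjunct2[OF C_spec, rule_format]
    show "\<exists>C k. \<forall>n m A b \<epsilon> s.
      1 \<le> n \<and> n \<le> m \<and> A \<in> carrier_mat n m \<and> b \<in> carrier_vec n \<and> 0 < \<epsilon> \<and> solutions A b \<noteq> {} \<and>
      nats s ''n'' 0 = n \<and> nats s ''m'' 0 = m \<and> reals s ''p'' 0 = p \<and> reals s ''eps'' 0 = \<epsilon> \<and>
      holds_mat s ''A'' A \<and> holds_vec s ''b'' b \<longrightarrow>
      (\<exists>T t x. run Regression s T t \<and> x \<in> carrier_vec m \<and> holds_vec t ''x'' x \<and> approx_solution p \<epsilon> A b x \<and>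
        real T \<le> C * real (m + n) powr (\<tau> + (p - 2) / (3 * p - 2)) * (lg (1 / \<epsilon>))\<^sup>2
                 * (lg (real (m * n) / \<epsilon>)) ^ k)"
    \<comment> \<open>The factor 2 powr \<tau>' pays for padding to a side of at most 2 * m; a
      single power of the logarithm of m * n / \<epsilon> covers the outer rounds.\<close>
    proof (rule exI[of _ "C * 2 powr \<tau>'"], rule exI[of _ "1 :: nat"], intro allI impI)
      fix n m :: nat and A :: "real mat" and b :: "real vec" and \<epsilon> :: real and s :: state
      assume asm: "1 \<le> n \<and> n \<le> m \<and> A \<in> carrier_mat n m \<and> b \<in> carrier_vec n \<and> 0 < \<epsilon> \<and> solutions A b \<noteq> {} \<and>
        nats s ''n'' 0 = n \<and> nats s ''m'' 0 = m \<and> reals s ''p'' 0 = p \<and> reals s ''eps'' 0 = \<epsilon> \<and>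
        holds_mat s ''A'' A \<and> holds_vec s ''b'' b"
      then have nm: "1 \<le> n" "n \<le> m" "0 < \<epsilon>" and Ab: "A \<in> carrier_mat n m" "b \<in> carrier_vec n" and ne: "solutions A b \<noteq> {}" by auto
      let ?A = "\<lambda>i j. A $$ (i, j)" and ?b = "($) b" and ?L = "lg (real (m * n) / \<epsilon>)" and ?M = "real (m + n)"
      note sols = solutions_sol[OF Ab]
      have "nats s ''n'' 0 = n \<and> nats s ''m'' 0 = m \<and> 1 \<le> n \<and> n \<le> m \<and>
        (\<forall>i<n. \<forall>j<m. reals s ''A'' (i * m + j) = ?A i j) \<and> (\<forall>i<n. reals s ''b'' i = ?b i) \<and> sol n m ?A ?b \<noteq> {} \<and>
        reals s ''p'' 0 = p \<and> reals s ''eps'' 0 = \<epsilon> \<and> 0 < \<epsilon>"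
        using asm sols by (auto simp: holds_mat_def holds_vec_def)
      from regr[OF this] obtain T t where run: "run Regression s T t"
        and T: "real T \<le> C * ((2 * real m) powr \<tau>' * (real m powr width_exp p * ?L))"
        and sol: "reals t ''x'' \<in> sol n m ?A ?b" and opt: "\<And>y. y \<in> sol n m ?A ?b \<Longrightarrow> psum p m (reals t ''x'') \<le> (1 + \<epsilon>) * psum p m y"
        unfolding exec_def by blast
      define x where "x = vec m (reals t ''x'')"
      have x: "x \<in> carrier_vec m" "holds_vec t ''x'' x" by (auto simp: x_def holds_vec_def)
      have xs: "x \<in> solutions A b" using sol x unfolding sols by (simp add: sol_def x_def)
      have px: "p_norm p x powr p = psum p m (reals t ''x'')" using p_norm_powr[OF _ x(1), of p] p by (simp add: psum_def x_def)
      \<comment> \<open>Divided by 1 + \<epsilon>, the value reached is a lower bound for all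
        solutions and hence for the infimum, which is thus handled without a minimizer.\<close>
      have "psum p m (reals t ''x'') / (1 + \<epsilon>) \<le> (INF y \<in> solutions A b. p_norm p y powr p)"
      proof (rule cINF_greatest[OF ne])
        fix y assume "y \<in> solutions A b"
        then have y: "y \<in> carrier_vec m" "($) y \<in> sol n m ?A ?b" unfolding sols by auto
        show "psum p m (reals t ''x'') / (1 + \<epsilon>) \<le> p_norm p y powr p"
          using opt[OF y(2)] p_norm_powr[OF _ y(1), of p] p nm by (simp add: divide_le_eq mult.commute)
      qed
      then have approx: "approx_solution p \<epsilon> A b x" unfolding approx_solution_def px using xs nm by (simp add: divide_le_eq mult.commute)
      have "real T \<le> C * 2 powr \<tau>' * ?M powr (\<tau> + (p - 2) / (3 * p - 2)) * (lg (1 / \<epsilon>))\<^sup>2 * ?L ^ 1"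
      proof -
        \<comment> \<open>Truncating \<open>lg\<close> at 1 makes both logarithmic factors at least
          1.\<close>
        have l1: "1 \<le> ?L" "1 \<le> (lg (1 / \<epsilon>))\<^sup>2" using lg_ge_1 by (auto simp: one_le_power)
        have "real m powr \<tau>' \<le> ?M powr \<tau>'" using \<tau> by (intro powr_mono2) auto
        also have "\<dots> \<le> ?M powr \<tau>" using nm \<tau>' by (intro powr_mono) auto
        finally have 1: "real m powr \<tau>' \<le> ?M powr \<tau>" .
        have 2: "real m powr width_exp p \<le> ?M powr width_exp p" using width_exp_bounds(1)[OF p] by (intro powr_mono2) auto
        have "(2 * real m) powr \<tau>' * (real m powr width_exp p * ?L) = 2 powr \<tau>' * (real m powr \<tau>' * real m powr width_exp p) * ?L * 1"
          by (simp add: powr_mult mult_ac)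
        also have "\<dots> \<le> 2 powr \<tau>' * (?M powr \<tau> * ?M powr width_exp p) * ?L * (lg (1 / \<epsilon>))\<^sup>2"
          using 1 2 l1 by (intro mult_mono mult_left_mono mult_right_mono) auto
        also have "\<dots> = 2 powr \<tau>' * ?M powr (\<tau> + (p - 2) / (3 * p - 2)) * (lg (1 / \<epsilon>))\<^sup>2 * ?L"
          by (simp add: powr_add width_exp_def mult_ac)
        finally have "C * ((2 * real m) powr \<tau>' * (real m powr width_exp p * ?L))
          \<le> C * (2 powr \<tau>' * ?M powr (\<tau> + (p - 2) / (3 * p - 2)) * (lg (1 / \<epsilon>))\<^sup>2 * ?L)" by (rule mult_left_mono[OF _ C])
        then show ?thesis using T by (simp add: mult_ac)
      qed
      then show "\<exists>T t x. run Regression s T t \<and> x \<in> carrier_vec m \<and> holds_vec t ''x'' x \<and> approx_solution p \<epsilon> A b x \<and>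
        real T \<le> C * 2 powr \<tau>' * ?M powr (\<tau> + (p - 2) / (3 * p - 2)) * (lg (1 / \<epsilon>))\<^sup>2 * ?L ^ 1"
        using run x approx by blast
    qed
  qed
qed

end
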